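(* Assume the basic hypotheses, the convexity hypothesis, and either the measure–modulus hypothesis or the compact-range hypothesis (all stated in the context). Then the value function $V$ is lower semicontinuous on $[0,T]\times L^2$ and $$V(s,\varphi)=\min\Big\{\int_\Omega g(x(T,\omega),\omega)\,d\mu(\omega): x\in S_{[s,T]}(\varphi)\Big\}\qquad\text{for all }(s,\varphi)\in[0,T]\times L^2.$$ Furthermore, for all $\bar\varphi\in L^2$, $$\int_\Omega g(\bar\varphi(\omega),\omega)\,d\mu(\omega)=\liminf_{s\to T^-,\ \varphi\to\bar\varphi}V(s,\varphi),\qquad V(0,\bar\varphi)=\liminf_{s\to0^+,\ \varphi\to\bar\varphi}V(s,\varphi),$$ where $\varphi\to\bar\varphi$ in the norm of $L^2$.
   Context: Setup. $T>0$; $(\Omega,d_\Omega,\mu)$ is a metric measure space; $L^2:=L^2(\mu,\Omega;\mathbb{R}^n)$; $U$ is a set-valued map on $[0,T]$ with values in $\mathbb{R}^m$; $f:[0,T]\times\mathbb{R}^n\times\mathbb{R}^m\times\Omega\to\mathbb{R}^n$; $g:\mathbb{R}^n\times\Omega\to\mathbb{R}$. Basic hypotheses. (i) $(\Omega,d_\Omega)$ is compact and $\mu$ is a finite Radon measure. (ii) $U$ is upper semicontinuous with nonempty compact values contained in a fixed compact set $\mathbf{U}\subset\mathbb{R}^m$ (upper semicontinuous: $\{t: U(t)\cap C\ne\emptyset\}$ is closed for every closed $C$). (iii) $f$ is measurable in $t$ and continuous in the other variables, and there are constants $c,k>0$ with $|f(t,x,u,\omega)|\le c(1+|x|)$ and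 $|f(t,x,u,\omega)-f(t,x',u,\omega)|\le k|x-x'|$ for all $x,x'\in\mathbb{R}^n$, $u\in\mathbb{R}^m$, $\omega\in\Omega$, a.e. $t\in(0,T)$. (iv) $g$ is $\mathcal{L}\otimes\mu$-measurable ($\mathcal{L}$ Lebesgue measure), $g(\cdot,\omega)$ is lower semicontinuous for every $\omega$, and $g(x,\omega)\ge a(\omega)-b|x|^2$ for all $(x,\omega)$, for some $a\in L^1(\mu,\Omega)$ and $b\ge0$. Controls and value function. $\mathcal{U}_{\rm ad}[s,T]=\{u\in L^\infty(s,T;\mathbb{R}^m):u(t)\in U(t)\text{ a.e. }t\in[s,T]\}$. For $s\in[0,T]$, $\varphi\in L^2$, $u\in\mathcal{U}_{\rm ad}[s,T]$, $x_{\varphi,u}\in C([s,T];L^2)$ is the unique solution of $x(t,\cdot)=\varphi(\cdot)+\int_s^t f(\sigma,x(\sigma,\cdot),u(\sigma),\cdot)\,d\sigma$. The value function is $V(s,\varphi)=\inf_{u\in\mathcal{U}_{\rm ad}[s,T]}\int_\Omega g(x_{\varphi,u}(T,\omega),\omega)\,d\mu(\omega)$. Set-valued dynamics. $F(t,\varphi)=\{f(t,\varphi(\cdot),u,\cdot):u\in U(t)\}\subset L^2$ for $(t,\varphi)\in[0,T]\times L^2$. $S_{[s,T]}(\varphi)$ is the set of all (absolutely continuous) $x\in C([s,T];L^2)$ with $x(s,\cdot)=\varphi(\cdot)$ and $\dot x(t,\cdot)\in F(t,x(t,\cdot))$ for a.e. $t\in[s,T]$. Additional hypotheses. Measure–modulus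 hypothesis: for every $r>0$, $\inf\{\mu(\mathcal{B}_r(\omega)):\omega\in\Omega\}>0$ ($\mathcal{B}_r(\omega)$ the open ball), and there is a modulus of continuity $\theta_f$ (nondecreasing, $\theta_f(r)\to0$ as $r\to0^+$) with $\int_0^T\sup_{u\in U(t),\,x,y\in\mathbb{R}^n}|f(t,x,u,\omega_1)-f(t,y,u,\omega_2)|\,dt\le\theta_f(d_\Omega(\omega_1,\omega_2))$ for all $\omega_1,\omega_2\in\Omega$. Compact-range hypothesis: there is a compact set $K\subset L^2$ with $F(t,\varphi)\subset K$ for every $(t,\varphi)\in[0,T]\times L^2$. Convexity hypothesis: $F(t,\varphi)$ is convex for every $(t,\varphi)\in[0,T]\times L^2$. *)

theory Defs
  imports "HOL-Analysis.Analysis"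
begin

section \<open>Semicontinuity, Radon measures\<close>

definition lower_semicontinuous :: "'a topology \<Rightarrow> ('a \<Rightarrow> 'b::linorder) \<Rightarrow> bool" where
  "lower_semicontinuous X h \<longleftrightarrow> (\<forall>c. openin X {z \<in> topspace X. c < h z})"

definition upper_semicontinuous_setmap ::
    "real set \<Rightarrow> (real \<Rightarrow> 'b::topological_space set) \<Rightarrow> bool" where
  "upper_semicontinuous_setmap I U \<longleftrightarrow>
     (\<forall>C. closed C \<longrightarrow> closedin (top_of_set I) {t \<in> I. U t \<inter> C \<noteq> {}})"

definition finite_radon_measure :: "'w::topological_space measure \<Rightarrow> bool" where
  "finite_radon_measure \<mu> \<longleftrightarrow> sets \<mu> = sets borel \<and> finite_measure \<mu> \<and>
     (\<forall>A\<in>sets borel. emeasure \<mu> A = (SUP C\<in>{C. compact C \<and> C \<subseteq> A}. emeasure \<mu> C))"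

text \<open>Nonnegativity is part of being a modulus; only the values on the half line matter.\<close>

definition modulus_of_continuity :: "(real \<Rightarrow> real) \<Rightarrow> bool" where
  "modulus_of_continuity \<theta> \<longleftrightarrow>
     (\<forall>r\<ge>0. 0 \<le> \<theta> r) \<and> mono_on {0..} \<theta> \<and> (\<theta> \<longlongrightarrow> 0) (at_right 0)"

section \<open>The space of square-integrable maps\<close>

text \<open>
  Elements of the Lebesgue space are represented by Borel functions, and two functions that agree
  almost everywhere are at distance 0. The topology below is therefore the (non-Hausdorff)
  pseudometric one. Its quotient by almost-everywhere equality is the usual norm topology, and
  openness, compactness, continuity, neighbourhood filters and semicontinuity all pass to and
  from that quotient.
\<close>

definition L2 :: "'w measure \<Rightarrow> ('w \<Rightarrow> 'b::euclidean_space) set" where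
  "L2 \<mu> = {\<phi> \<in> borel_measurable \<mu>. integrable \<mu> (\<lambda>\<omega>. (norm (\<phi> \<omega>))\<^sup>2)}"

definition L2norm :: "'w measure \<Rightarrow> ('w \<Rightarrow> 'b::euclidean_space) \<Rightarrow> real" where
  "L2norm \<mu> \<phi> = sqrt (\<integral>\<omega>. (norm (\<phi> \<omega>))\<^sup>2 \<partial>\<mu>)"

definition L2_topology :: "'w measure \<Rightarrow> ('w \<Rightarrow> 'b::euclidean_space) topology" where
  "L2_topology \<mu> = topology (\<lambda>W. W \<subseteq> L2 \<mu> \<and>
     (\<forall>\<phi>\<in>W. \<exists>r>0. \<forall>\<psi>\<in>L2 \<mu>. L2norm \<mu> (\<lambda>\<omega>. \<psi> \<omega> - \<phi> \<omega>) < r \<longrightarrow> \<psi> \<in> W))"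

lemma openin_L2_topology:
  fixes W :: "('a \<Rightarrow> 'b::euclidean_space) set"
  shows "openin (L2_topology \<mu>) W \<longleftrightarrow> W \<subseteq> L2 \<mu> \<and>
     (\<forall>\<phi>\<in>W. \<exists>r>0. \<forall>\<psi>\<in>L2 \<mu>. L2norm \<mu> (\<lambda>\<omega>. \<psi> \<omega> - \<phi> \<omega>) < r \<longrightarrow> \<psi> \<in> W)"
proof -
  let ?P = "\<lambda>W :: ('a \<Rightarrow> 'b) set. W \<subseteq> L2 \<mu> \<and>
     (\<forall>\<phi>\<in>W. \<exists>r>0. \<forall>\<psi>\<in>L2 \<mu>. L2norm \<mu> (\<lambda>\<omega>. \<psi> \<omega> - \<phi> \<omega>) < r \<longrightarrow> \<psi> \<in> W)"
  have "istopology ?P"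
    unfolding istopology_def
  proof (intro conjI allI impI)
    fix S T :: "('a \<Rightarrow> 'b) set" assume S: "?P S" and T: "?P T"
    show "S \<inter> T \<subseteq> L2 \<mu>" using S by blast
    show "\<forall>\<phi>\<in>S \<inter> T. \<exists>r>0. \<forall>\<psi>\<in>L2 \<mu>. L2norm \<mu> (\<lambda>\<omega>. \<psi> \<omega> - \<phi> \<omega>) < r \<longrightarrow> \<psi> \<in> S \<inter> T"
    proof
      fix \<phi> assume "\<phi> \<in> S \<inter> T"
      then obtain r1 r2 where "r1 > 0" "r2 > 0"
        "\<forall>\<psi>\<in>L2 \<mu>. L2norm \<mu> (\<lambda>\<omega>. \<psi> \<omega> - \<phi> \<omega>) < r1 \<longrightarrow> \<psi> \<in> S"
        "\<forall>\<psi>\<in>L2 \<mu>. L2norm \<mu> (\<lambda>\<omega>. \<psi> \<omega> - \<phi> \<omega>) < r2 \<longrightarrow> \<psi> \<in> T"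
        using S T by blast
      then show "\<exists>r>0. \<forall>\<psi>\<in>L2 \<mu>. L2norm \<mu> (\<lambda>\<omega>. \<psi> \<omega> - \<phi> \<omega>) < r \<longrightarrow> \<psi> \<in> S \<inter> T"
        by (intro exI[of _ "min r1 r2"]) auto
    qed
  next
    fix \<K> :: "('a \<Rightarrow> 'b) set set" assume "\<forall>S\<in>\<K>. ?P S"
    then show "\<Union>\<K> \<subseteq> L2 \<mu>"
      and "\<forall>\<phi>\<in>\<Union>\<K>. \<exists>r>0. \<forall>\<psi>\<in>L2 \<mu>. L2norm \<mu> (\<lambda>\<omega>. \<psi> \<omega> - \<phi> \<omega>) < r \<longrightarrow> \<psi> \<in> \<Union>\<K>"
      by (blast, meson UnionE UnionI)
  qed
  then show ?thesis
    unfolding L2_topology_def by (simp add: topology_inverse')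
qed

lemma topspace_L2_topology [simp]: "topspace (L2_topology \<mu>) = L2 \<mu>"
proof
  show "topspace (L2_topology \<mu>) \<subseteq> L2 \<mu>"
    using openin_L2_topology openin_topspace by blast
  have "openin (L2_topology \<mu>) (L2 \<mu>)"
    unfolding openin_L2_topology by (auto intro: exI[of _ 1])
  then show "L2 \<mu> \<subseteq> topspace (L2_topology \<mu>)"
    by (rule openin_subset)
qed

section \<open>Calculus for curves of square-integrable maps\<close>

text \<open>
  Bochner integral over a set \<open>I\<close> of times, for Lebesgue measure: \<open>L2_simple \<mu> I h Y\<close> says that
  \<open>h\<close> is a simple function with integral \<open>Y\<close>; an integrable function is the limit of simple
  functions almost everywhere (strong measurability) and in mean.
\<close>

definition L2_simple ::
    "'w measure \<Rightarrow> real set \<Rightarrow> (real \<Rightarrow> 'w \<Rightarrow> 'b::euclidean_space) \<Rightarrow> ('w \<Rightarrow> 'b) \<Rightarrow> bool" where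
  "L2_simple \<mu> I h Y \<longleftrightarrow> (\<exists>(N::nat) A p.
     (\<forall>i<N. A i \<in> lmeasurable \<and> A i \<subseteq> I \<and> p i \<in> L2 \<mu>) \<and>
     h = (\<lambda>\<sigma> \<omega>. \<Sum>i<N. indicator (A i) \<sigma> *\<^sub>R p i \<omega>) \<and>
     Y = (\<lambda>\<omega>. \<Sum>i<N. measure lebesgue (A i) *\<^sub>R p i \<omega>))"

definition has_L2_integral ::
    "'w measure \<Rightarrow> (real \<Rightarrow> 'w \<Rightarrow> 'b::euclidean_space) \<Rightarrow> real set \<Rightarrow> ('w \<Rightarrow> 'b) \<Rightarrow> bool" where
  "has_L2_integral \<mu> h I y \<longleftrightarrow>
     y \<in> L2 \<mu> \<and> (AE \<sigma> in lebesgue_on I. h \<sigma> \<in> L2 \<mu>) \<and>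
     (\<exists>H Y. (\<forall>k::nat. L2_simple \<mu> I (H k) (Y k)) \<and>
        (AE \<sigma> in lebesgue_on I. (\<lambda>k. L2norm \<mu> (\<lambda>\<omega>. h \<sigma> \<omega> - H k \<sigma> \<omega>)) \<longlonglongrightarrow> 0) \<and>
        (\<lambda>k. \<integral>\<^sup>+\<sigma>. ennreal (L2norm \<mu> (\<lambda>\<omega>. h \<sigma> \<omega> - H k \<sigma> \<omega>)) \<partial>lebesgue_on I) \<longlonglongrightarrow> 0 \<and>
        (\<lambda>k. L2norm \<mu> (\<lambda>\<omega>. Y k \<omega> - y \<omega>)) \<longlonglongrightarrow> 0)"

definition has_L2_derivative ::
    "'w measure \<Rightarrow> (real \<Rightarrow> 'w \<Rightarrow> 'b::euclidean_space) \<Rightarrow> ('w \<Rightarrow> 'b) \<Rightarrow> real \<Rightarrow> real set \<Rightarrow> bool" where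
  "has_L2_derivative \<mu> x \<psi> t I \<longleftrightarrow>
     ((\<lambda>r. L2norm \<mu> (\<lambda>\<omega>. (x r \<omega> - x t \<omega>) /\<^sub>R (r - t) - \<psi> \<omega>)) \<longlongrightarrow> 0) (at t within I)"

definition L2_absolutely_continuous_on ::
    "'w measure \<Rightarrow> real \<Rightarrow> real \<Rightarrow> (real \<Rightarrow> 'w \<Rightarrow> 'b::euclidean_space) \<Rightarrow> bool" where
  "L2_absolutely_continuous_on \<mu> s t x \<longleftrightarrow>
     (\<forall>\<epsilon>>0. \<exists>\<delta>>0. \<forall>(N::nat) a b.
        (\<forall>i<N. s \<le> a i \<and> a i \<le> b i \<and> b i \<le> t) \<and>
        disjoint_family_on (\<lambda>i. {a i<..<b i}) {..<N} \<and> (\<Sum>i<N. b i - a i) < \<delta>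
        \<longrightarrow> (\<Sum>i<N. L2norm \<mu> (\<lambda>\<omega>. x (b i) \<omega> - x (a i) \<omega>)) < \<epsilon>)"

definition continuous_L2_curve ::
    "'w measure \<Rightarrow> real \<Rightarrow> real \<Rightarrow> (real \<Rightarrow> 'w \<Rightarrow> 'b::euclidean_space) \<Rightarrow> bool" where
  "continuous_L2_curve \<mu> s t x \<longleftrightarrow> continuous_map (top_of_set {s..t}) (L2_topology \<mu>) x"

section \<open>The cost functional\<close>

definition ext_integral :: "'w measure \<Rightarrow> ('w \<Rightarrow> real) \<Rightarrow> ereal" where
  "ext_integral \<mu> v =
     enn2ereal (\<integral>\<^sup>+\<omega>. ennreal (v \<omega>) \<partial>\<mu>) - enn2ereal (\<integral>\<^sup>+\<omega>. ennreal (- v \<omega>) \<partial>\<mu>)"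

text \<open>
  If \<open>g\<close> is measurable for the product of the Lebesgue sigma-algebra and the
  \<open>\<mu>\<close>-measurable sets, and lower semicontinuous in the first variable, the function
  \<open>\<omega> \<mapsto> g (\<phi> \<omega>) \<omega>\<close> may still fail to be \<open>\<mu>\<close>-measurable, because preimages of Lebesgue null sets
  under \<open>\<phi>\<close> need not be \<open>\<mu>\<close>-measurable. The integral is therefore read as an upper
  integral, which is the ordinary (extended real valued) integral for every \<open>\<mu>\<close>-measurable
  integrand, see the two lemmas below.
\<close>

definition upper_integral :: "'w measure \<Rightarrow> ('w \<Rightarrow> real) \<Rightarrow> ereal" where
  "upper_integral \<mu> h =
     (INF v \<in> {v \<in> borel_measurable \<mu>. AE \<omega> in \<mu>. h \<omega> \<le> v \<omega>}. ext_integral \<mu> v)"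

lemma upper_integral_eq_ext_integral:
  assumes "h \<in> borel_measurable (completion \<mu>)"
  shows "upper_integral \<mu> h = ext_integral \<mu> h"
proof (rule antisym)
  obtain h' where h': "h' \<in> borel_measurable \<mu>" "AE \<omega> in \<mu>. h \<omega> = h' \<omega>"
    using completion_ex_borel_measurable_real[OF assms] by blast
  have "ext_integral \<mu> h' = ext_integral \<mu> h"
    unfolding ext_integral_def
    by (intro arg_cong2[of _ _ _ _ "(-)"] arg_cong[of _ _ enn2ereal] nn_integral_cong_AE)
       (use h' in auto)
  then show "upper_integral \<mu> h \<le> ext_integral \<mu> h"
    unfolding upper_integral_def using h' by (intro INF_lower2[of h']) auto
  show "ext_integral \<mu> h \<le> upper_integral \<mu> h"
    unfolding upper_integral_def
  proof (rule INF_greatest)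
    fix v assume "v \<in> {v \<in> borel_measurable \<mu>. AE \<omega> in \<mu>. h \<omega> \<le> v \<omega>}"
    then have v: "AE \<omega> in \<mu>. h \<omega> \<le> v \<omega>" by simp
    show "ext_integral \<mu> h \<le> ext_integral \<mu> v"
      unfolding ext_integral_def
      by (intro ereal_minus_mono less_eq_ennreal.rep_eq[THEN iffD1] nn_integral_mono_AE)
         (use v in \<open>auto elim!: eventually_mono intro: ennreal_leI\<close>)
  qed
qed

lemma upper_integral_eq_lebesgue_integral:
  assumes "integrable \<mu> h"
  shows "upper_integral \<mu> h = ereal (\<integral>\<omega>. h \<omega> \<partial>\<mu>)"
proof -
  obtain r q where "r \<ge> 0" "q \<ge> 0"
    "(\<integral>\<^sup>+\<omega>. ennreal (h \<omega>) \<partial>\<mu>) = ennreal r" "(\<integral>\<^sup>+\<omega>. ennreal (- h \<omega>) \<partial>\<mu>) = ennreal q"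
    "(\<integral>\<omega>. h \<omega> \<partial>\<mu>) = r - q"
    using assms by (rule integrableE)
  moreover have "h \<in> borel_measurable (completion \<mu>)"
    using assms by (simp add: measurable_completion)
  ultimately show ?thesis
    by (simp add: upper_integral_eq_ext_integral ext_integral_def enn2ereal_ennreal)
qed

definition cost :: "'w measure \<Rightarrow> ('b::euclidean_space \<Rightarrow> 'w \<Rightarrow> real) \<Rightarrow> ('w \<Rightarrow> 'b) \<Rightarrow> ereal" where
  "cost \<mu> g \<phi> = upper_integral \<mu> (\<lambda>\<omega>. g (\<phi> \<omega>) \<omega>)"

section \<open>Controls, value function, set-valued dynamics\<close>

definition admissible_controls ::
    "(real \<Rightarrow> (real^'m) set) \<Rightarrow> real \<Rightarrow> real \<Rightarrow> (real \<Rightarrow> real^'m) set" where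
  "admissible_controls U s T = {u \<in> borel_measurable (lebesgue_on {s..T}).
     (\<exists>B. AE t in lebesgue_on {s..T}. norm (u t) \<le> B) \<and> (AE t in lebesgue_on {s..T}. u t \<in> U t)}"

definition state_solution ::
    "'w measure \<Rightarrow> (real \<Rightarrow> real^'n \<Rightarrow> real^'m \<Rightarrow> 'w \<Rightarrow> real^'n) \<Rightarrow> real \<Rightarrow> real \<Rightarrow> ('w \<Rightarrow> real^'n)
      \<Rightarrow> (real \<Rightarrow> real^'m) \<Rightarrow> (real \<Rightarrow> 'w \<Rightarrow> real^'n) \<Rightarrow> bool" where
  "state_solution \<mu> f s T \<phi> u x \<longleftrightarrow> continuous_L2_curve \<mu> s T x \<and>
     (\<forall>t\<in>{s..T}. has_L2_integral \<mu> (\<lambda>\<sigma> \<omega>. f \<sigma> (x \<sigma> \<omega>) (u \<sigma>) \<omega>) {s..t} (\<lambda>\<omega>. x t \<omega> - \<phi> \<omega>))"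

text \<open>The solution is unique up to almost-everywhere equality; the choice is of a representative.\<close>

definition state ::
    "'w measure \<Rightarrow> (real \<Rightarrow> real^'n \<Rightarrow> real^'m \<Rightarrow> 'w \<Rightarrow> real^'n) \<Rightarrow> real \<Rightarrow> real \<Rightarrow> ('w \<Rightarrow> real^'n)
      \<Rightarrow> (real \<Rightarrow> real^'m) \<Rightarrow> (real \<Rightarrow> 'w \<Rightarrow> real^'n)" where
  "state \<mu> f s T \<phi> u = (SOME x. state_solution \<mu> f s T \<phi> u x)"

definition value_function ::
    "'w measure \<Rightarrow> real \<Rightarrow> (real \<Rightarrow> (real^'m) set) \<Rightarrow> (real \<Rightarrow> real^'n \<Rightarrow> real^'m \<Rightarrow> 'w \<Rightarrow> real^'n)
      \<Rightarrow> (real^'n \<Rightarrow> 'w \<Rightarrow> real) \<Rightarrow> real \<Rightarrow> ('w \<Rightarrow> real^'n) \<Rightarrow> ereal" where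
  "value_function \<mu> T U f g s \<phi> =
     (INF u \<in> admissible_controls U s T. cost \<mu> g (state \<mu> f s T \<phi> u T))"

text \<open>The set \<open>F (t, \<phi>)\<close>, closed under almost-everywhere equality so that it represents a set of classes.\<close>

definition setF ::
    "'w measure \<Rightarrow> (real \<Rightarrow> (real^'m) set) \<Rightarrow> (real \<Rightarrow> real^'n \<Rightarrow> real^'m \<Rightarrow> 'w \<Rightarrow> real^'n)
      \<Rightarrow> real \<Rightarrow> ('w \<Rightarrow> real^'n) \<Rightarrow> ('w \<Rightarrow> real^'n) set" where
  "setF \<mu> U f t \<phi> = {\<psi> \<in> L2 \<mu>. \<exists>u\<in>U t. AE \<omega> in \<mu>. \<psi> \<omega> = f t (\<phi> \<omega>) u \<omega>}"

definition inclusion_solutions ::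
    "'w measure \<Rightarrow> (real \<Rightarrow> (real^'m) set) \<Rightarrow> (real \<Rightarrow> real^'n \<Rightarrow> real^'m \<Rightarrow> 'w \<Rightarrow> real^'n)
      \<Rightarrow> real \<Rightarrow> real \<Rightarrow> ('w \<Rightarrow> real^'n) \<Rightarrow> (real \<Rightarrow> 'w \<Rightarrow> real^'n) set" where
  "inclusion_solutions \<mu> U f s T \<phi> = {x.
     continuous_L2_curve \<mu> s T x \<and> L2_absolutely_continuous_on \<mu> s T x \<and>
     (AE \<omega> in \<mu>. x s \<omega> = \<phi> \<omega>) \<and>
     (AE t in lebesgue_on {s..T}.
        \<exists>\<psi>\<in>setF \<mu> U f t (x t). has_L2_derivative \<mu> x \<psi> t {s..T})}"

section \<open>The hypotheses on the data\<close>

definition control_map_hyp :: "real \<Rightarrow> (real \<Rightarrow> (real^'m) set) \<Rightarrow> bool" where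
  "control_map_hyp T U \<longleftrightarrow> upper_semicontinuous_setmap {0..T} U \<and>
     (\<forall>t\<in>{0..T}. U t \<noteq> {} \<and> compact (U t)) \<and> (\<exists>UU. compact UU \<and> (\<forall>t\<in>{0..T}. U t \<subseteq> UU))"

definition dynamics_hyp ::
    "real \<Rightarrow> (real \<Rightarrow> real^'n \<Rightarrow> real^'m \<Rightarrow> 'w::topological_space \<Rightarrow> real^'n) \<Rightarrow> bool" where
  "dynamics_hyp T f \<longleftrightarrow>
     (\<forall>x u \<omega>. (\<lambda>t. f t x u \<omega>) \<in> borel_measurable (lebesgue_on {0..T})) \<and>
     (\<forall>t\<in>{0..T}. continuous_on UNIV (\<lambda>(x, u, \<omega>). f t x u \<omega>)) \<and>
     (\<exists>c>0. \<exists>k>0. \<forall>x x' u \<omega>. AE t in lebesgue_on {0<..<T}.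
        norm (f t x u \<omega>) \<le> c * (1 + norm x) \<and>
        norm (f t x u \<omega> - f t x' u \<omega>) \<le> k * norm (x - x'))"

definition cost_hyp :: "'w measure \<Rightarrow> (real^'n \<Rightarrow> 'w \<Rightarrow> real) \<Rightarrow> bool" where
  "cost_hyp \<mu> g \<longleftrightarrow>
     (\<lambda>(x, \<omega>). g x \<omega>) \<in> borel_measurable (lebesgue \<Otimes>\<^sub>M completion \<mu>) \<and>
     (\<forall>\<omega>. lower_semicontinuous euclidean (\<lambda>x. g x \<omega>)) \<and>
     (\<exists>a b. integrable (completion \<mu>) a \<and> 0 \<le> b \<and> (\<forall>x \<omega>. a \<omega> - b * (norm x)\<^sup>2 \<le> g x \<omega>))"

definition measure_modulus_hyp ::
    "'w::metric_space measure \<Rightarrow> real \<Rightarrow> (real \<Rightarrow> (real^'m) set)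
      \<Rightarrow> (real \<Rightarrow> real^'n \<Rightarrow> real^'m \<Rightarrow> 'w \<Rightarrow> real^'n) \<Rightarrow> bool" where
  "measure_modulus_hyp \<mu> T U f \<longleftrightarrow>
     (\<forall>r>0. 0 < (INF \<omega>. emeasure \<mu> (ball \<omega> r))) \<and>
     (\<exists>\<theta>. modulus_of_continuity \<theta> \<and> (\<forall>\<omega>1 \<omega>2.
        (\<integral>\<^sup>+t. (SUP (u, x, y) \<in> U t \<times> UNIV \<times> UNIV. ennreal (norm (f t x u \<omega>1 - f t y u \<omega>2)))
           \<partial>lebesgue_on {0..T}) \<le> ennreal (\<theta> (dist \<omega>1 \<omega>2))))"

definition compact_range_hyp ::
    "'w measure \<Rightarrow> real \<Rightarrow> (real \<Rightarrow> (real^'m) set)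
      \<Rightarrow> (real \<Rightarrow> real^'n \<Rightarrow> real^'m \<Rightarrow> 'w \<Rightarrow> real^'n) \<Rightarrow> bool" where
  "compact_range_hyp \<mu> T U f \<longleftrightarrow>
     (\<exists>K. compactin (L2_topology \<mu>) K \<and> (\<forall>t\<in>{0..T}. \<forall>\<phi>\<in>L2 \<mu>. setF \<mu> U f t \<phi> \<subseteq> K))"

text \<open>Convexity is spelled out because the function type is not a real vector space instance.\<close>

definition convexity_hyp ::
    "'w measure \<Rightarrow> real \<Rightarrow> (real \<Rightarrow> (real^'m) set)
      \<Rightarrow> (real \<Rightarrow> real^'n \<Rightarrow> real^'m \<Rightarrow> 'w \<Rightarrow> real^'n) \<Rightarrow> bool" where
  "convexity_hyp \<mu> T U f \<longleftrightarrow> (\<forall>t\<in>{0..T}. \<forall>\<phi>\<in>L2 \<mu>.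
     \<forall>\<psi>1\<in>setF \<mu> U f t \<phi>. \<forall>\<psi>2\<in>setF \<mu> U f t \<phi>. \<forall>l\<in>{0..1}.
       (\<lambda>\<omega>. (1 - l) *\<^sub>R \<psi>1 \<omega> + l *\<^sub>R \<psi>2 \<omega>) \<in> setF \<mu> U f t \<phi>)"

end

theory Submission
  imports Defs "HOL-Library.Diagonal_Subsequence"
begin

text \<open>
  The value is an infimum over trajectories \<open>x\<close> of a functional of \<open>x (T)\<close> alone that is lower semicontinuous
  in \<open>L\<^sup>2\<close>, by Fatou's lemma and the quadratic lower bound on \<open>g\<close>. All assertions therefore rest on one closure
  property: if trajectories \<open>X n\<close> start at \<open>(s n, \<phi> n) \<rightarrow> (s, \<phi>)\<close>, then a subsequence converges, uniformly in time
  in the norm of \<open>L\<^sup>2\<close>, to a solution of the differential inclusion starting at \<open>(s, \<phi>)\<close>.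

  Each \<open>X n\<close> is its initial value plus a primitive of its velocity. The primitives are equi-Lipschitz in time, and each of
  the two alternative hypotheses makes their values totally bounded: a compact range can be discretized by finitely many
  values, while the modulus condition, applied with two different states at the same point, shows that the
  primitives do not feel the state and are equicontinuous on the compact space. Arzela--Ascoli then applies. The
  velocities converge only weakly, but one may choose convex combinations of velocities taken along the limit curve that
  converge strongly; as the sets \<open>F (t, \<phi>)\<close> are closed and convex, the limit is an admissible velocity. Measurable selection
  of a control identifies solutions of the inclusion with controlled states, so that the infimum is attained.

  For the two limits, lower semicontinuity gives one inequality. The other follows from the dynamic programming
  inequality \<open>V (s, x (s)) \<le> cost (x (T))\<close> along a trajectory ending at the given point, respectively along an
  optimal solution starting there.
\<close>

section \<open>Square-integrable maps\<close>

text \<open>The obstacle that shapes the proof is that elements of L2 are functions up to null sets,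
  and along a curve the exceptional set of parameters may vary with time. Curves are therefore
  handled through jointly measurable representatives: L2 of the product of time and parameter space
  serves as the space of velocities, and the Bochner integral becomes integration in time at fixed
  parameter. Controlled trajectories come from an ordinary differential equation solved for every
  parameter, on all of \<open>{0..T}\<close> and in both time directions from \<open>s\<close>, so
  that trajectories with different initial times live on one interval and can also be run backward
  from \<open>T\<close>. The growth and Lipschitz estimates, given almost everywhere for each choice
  of arguments, are moved to one common null set of times, on which the vector field is replaced by
  0. In the closure argument the controls of \<open>X n\<close> are inserted into the limit curve
  rather than into \<open>X n\<close>: all velocities then lie in one family of convex sets
  independent of \<open>n\<close>, and the Lipschitz constant pays for the exchange.\<close>

abbreviation L2dist :: "'w measure \<Rightarrow> ('w \<Rightarrow> 'b::euclidean_space) \<Rightarrow> ('w \<Rightarrow> 'b) \<Rightarrow> real" where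
  "L2dist M \<phi> \<psi> \<equiv> L2norm M (\<lambda>w. \<phi> w - \<psi> w)"

lemma L2_measurable: "\<phi> \<in> L2 M \<Longrightarrow> \<phi> \<in> borel_measurable M"
  by (simp add: L2_def)

lemma L2_integrable_square: "\<phi> \<in> L2 M \<Longrightarrow> integrable M (\<lambda>w. (norm (\<phi> w))\<^sup>2)"
  by (simp add: L2_def)

lemma L2_bound:
  assumes "\<psi> \<in> L2 M" "\<phi> \<in> borel_measurable M" "AE w in M. norm (\<phi> w) \<le> norm (\<psi> w)"
  shows "\<phi> \<in> L2 M"
proof -
  note [measurable] = assms(2)
  have "integrable M (\<lambda>w. (norm (\<phi> w))\<^sup>2)"
    by (rule Bochner_Integration.integrable_bound[OF L2_integrable_square[OF assms(1)]])
      (use assms(3) in \<open>auto elim!: eventually_mono intro: power_mono\<close>)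
  then show ?thesis using assms(2) by (simp add: L2_def)
qed

lemma L2_norm_real: "\<phi> \<in> L2 M \<Longrightarrow> (\<lambda>w. norm (\<phi> w)) \<in> L2 M"
  by (auto simp: L2_def)

lemma L2_scaleR: "\<phi> \<in> L2 M \<Longrightarrow> (\<lambda>w. c *\<^sub>R \<phi> w) \<in> L2 M"
  by (auto simp: L2_def power_mult_distrib)

lemma L2_add:
  assumes "\<phi> \<in> L2 M" "\<psi> \<in> L2 M"
  shows "(\<lambda>w. \<phi> w + \<psi> w) \<in> L2 M"
proof -
  note [measurable] = assms[THEN L2_measurable]
  have "(norm (\<phi> w + \<psi> w))\<^sup>2 \<le> 2 * (norm (\<phi> w))\<^sup>2 + 2 * (norm (\<psi> w))\<^sup>2" for w
  proof -
    have "(norm (\<phi> w + \<psi> w))\<^sup>2 \<le> (norm (\<phi> w) + norm (\<psi> w))\<^sup>2"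
      by (intro power_mono norm_triangle_ineq) auto
    also have "\<dots> \<le> 2 * (norm (\<phi> w))\<^sup>2 + 2 * (norm (\<psi> w))\<^sup>2"
      using sum_squares_bound[of "norm (\<phi> w)" "norm (\<psi> w)"] by (simp add: power2_sum)
    finally show ?thesis by simp
  qed
  then have "norm ((norm (\<phi> w + \<psi> w))\<^sup>2) \<le> norm (2 * (norm (\<phi> w))\<^sup>2 + 2 * (norm (\<psi> w))\<^sup>2)" for w
    by simp
  then have "integrable M (\<lambda>w. (norm (\<phi> w + \<psi> w))\<^sup>2)"
    by (rule Bochner_Integration.integrable_bound[where
          f = "\<lambda>w. 2 * (norm (\<phi> w))\<^sup>2 + 2 * (norm (\<psi> w))\<^sup>2", rotated 2, OF AE_I2])
      (auto intro!: Bochner_Integration.integrable_add integrable_mult_right L2_integrable_square assms)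
  then show ?thesis by (simp add: L2_def)
qed

lemma L2_diff:
  assumes "\<phi> \<in> L2 M" "\<psi> \<in> L2 M"
  shows "(\<lambda>w. \<phi> w - \<psi> w) \<in> L2 M"
  using L2_add[OF assms(1) L2_scaleR[OF assms(2), of "-1"]] by simp

lemma L2_zero: "(\<lambda>w. 0) \<in> L2 M"
  by (simp add: L2_def)

lemma L2_sum: "(\<And>i. i \<in> I \<Longrightarrow> \<phi> i \<in> L2 M) \<Longrightarrow> (\<lambda>w. \<Sum>i\<in>I. \<phi> i w) \<in> L2 M"
  by (induction I rule: infinite_finite_induct) (auto intro: L2_zero L2_add)

lemma L2_const: "finite_measure M \<Longrightarrow> (\<lambda>w. c) \<in> L2 M"
  by (simp add: L2_def finite_measure.emeasure_finite finite_measure.integrable_const)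

lemma L2_indicator:
  assumes "\<phi> \<in> L2 M" "A \<in> sets M" shows "(\<lambda>w. indicator A w *\<^sub>R \<phi> w) \<in> L2 M"
proof -
  note [measurable] = L2_measurable[OF assms(1)] assms(2)
  show ?thesis
  proof (rule L2_bound[OF assms(1)])
    show "AE w in M. norm (indicator A w *\<^sub>R \<phi> w) \<le> norm (\<phi> w)"
      by (auto simp: indicator_def)
  qed measurable
qed

lemma L2_inner_integrable:
  assumes "\<phi> \<in> L2 M" "\<psi> \<in> L2 M"
  shows "integrable M (\<lambda>w. \<phi> w \<bullet> \<psi> w)"
proof -
  note [measurable] = assms[THEN L2_measurable]
  have "norm (\<phi> w \<bullet> \<psi> w) \<le> (norm (\<phi> w))\<^sup>2 + (norm (\<psi> w))\<^sup>2" for w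
    using Cauchy_Schwarz_ineq2[of "\<phi> w" "\<psi> w"] sum_squares_bound[of "norm (\<phi> w)" "norm (\<psi> w)"]
      mult_nonneg_nonneg[OF norm_ge_zero[of "\<phi> w"] norm_ge_zero[of "\<psi> w"]]
    unfolding real_norm_def by linarith
  then have "norm (\<phi> w \<bullet> \<psi> w) \<le> norm ((norm (\<phi> w))\<^sup>2 + (norm (\<psi> w))\<^sup>2)" for w
    by simp
  then show ?thesis
    by (rule Bochner_Integration.integrable_bound[where
          f = "\<lambda>w. (norm (\<phi> w))\<^sup>2 + (norm (\<psi> w))\<^sup>2", rotated 2, OF AE_I2])
      (auto intro!: Bochner_Integration.integrable_add L2_integrable_square assms)
qed

lemma L2norm_nonneg [simp]: "0 \<le> L2norm M \<phi>"
  by (simp add: L2norm_def)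

lemma L2norm_power2: "(L2norm M \<phi>)\<^sup>2 = (\<integral>w. (norm (\<phi> w))\<^sup>2 \<partial>M)"
  by (simp add: L2norm_def)

lemma L2norm_zero [simp]: "L2norm M (\<lambda>w. 0) = 0"
  by (simp add: L2norm_def)

lemma L2norm_cong_AE:
  assumes "\<phi> \<in> borel_measurable M" "\<psi> \<in> borel_measurable M" "AE w in M. norm (\<phi> w) = norm (\<psi> w)"
  shows "L2norm M \<phi> = L2norm M \<psi>"
proof -
  note [measurable] = assms(1,2)
  show ?thesis unfolding L2norm_def
    by (intro arg_cong[of _ _ sqrt] integral_cong_AE) (use assms(3) in auto)
qed

lemma L2norm_mono:
  assumes "\<psi> \<in> L2 M" "\<phi> \<in> borel_measurable M" "AE w in M. norm (\<phi> w) \<le> norm (\<psi> w)"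
  shows "L2norm M \<phi> \<le> L2norm M \<psi>"
  unfolding L2norm_def
  by (intro real_sqrt_le_mono integral_mono_AE L2_integrable_square L2_bound[OF assms] assms(1))
    (use assms(3) in \<open>auto elim!: eventually_mono intro: power_mono\<close>)

lemma L2norm_scaleR: "L2norm M (\<lambda>w. c *\<^sub>R \<phi> w) = \<bar>c\<bar> * L2norm M \<phi>"
  by (simp add: L2norm_def power_mult_distrib real_sqrt_mult)

lemma L2norm_minus_commute: "L2dist M \<phi> \<psi> = L2dist M \<psi> \<phi>"
  by (simp add: L2norm_def norm_minus_commute)

lemma L2norm_norm: "L2norm M (\<lambda>w. norm (\<phi> w)) = L2norm M \<phi>"
  by (simp add: L2norm_def)

text \<open>The free coefficient \<open>c\<close> lets one expansion serve three purposes: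
  optimizing over \<open>c\<close> gives Cauchy-Schwarz, \<open>c = 1\<close> the triangle
  inequality, and \<open>c = 1\<close> together with \<open>c = -1\<close> the parallelogram law of
  the minimal-norm argument.\<close>

lemma L2norm_add_power2:
  assumes "\<phi> \<in> L2 M" "\<psi> \<in> L2 M"
  shows "(L2norm M (\<lambda>w. \<phi> w + c *\<^sub>R \<psi> w))\<^sup>2 =
    (L2norm M \<phi>)\<^sup>2 + 2 * c * (\<integral>w. \<phi> w \<bullet> \<psi> w \<partial>M) + c\<^sup>2 * (L2norm M \<psi>)\<^sup>2"
proof -
  have "(norm (\<phi> w + c *\<^sub>R \<psi> w))\<^sup>2 =
      (norm (\<phi> w))\<^sup>2 + (2 * c) * (\<phi> w \<bullet> \<psi> w) + c\<^sup>2 * (norm (\<psi> w))\<^sup>2" for w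
    using dot_norm[of "\<phi> w" "c *\<^sub>R \<psi> w"] by (simp add: power_mult_distrib)
  then have "(\<integral>w. (norm (\<phi> w + c *\<^sub>R \<psi> w))\<^sup>2 \<partial>M) =
    (\<integral>w. (norm (\<phi> w))\<^sup>2 + (2 * c) * (\<phi> w \<bullet> \<psi> w) + c\<^sup>2 * (norm (\<psi> w))\<^sup>2 \<partial>M)"
    by simp
  also have "\<dots> = (\<integral>w. (norm (\<phi> w))\<^sup>2 \<partial>M) + (2 * c) * (\<integral>w. \<phi> w \<bullet> \<psi> w \<partial>M) + c\<^sup>2 * (\<integral>w. (norm (\<psi> w))\<^sup>2 \<partial>M)"
    using L2_integrable_square[OF assms(1)] L2_integrable_square[OF assms(2)] L2_inner_integrable[OF assms]
    by simp
  finally show ?thesis by (simp add: L2norm_power2)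
qed

text \<open>The expansion above is a nonnegative quadratic in \<open>c\<close>; its value at the
  minimizer \<open>- I / b\<^sup>2\<close> is the claim.\<close>

lemma L2_Cauchy_Schwarz:
  assumes "\<phi> \<in> L2 M" "\<psi> \<in> L2 M"
  shows "\<bar>\<integral>w. \<phi> w \<bullet> \<psi> w \<partial>M\<bar> \<le> L2norm M \<phi> * L2norm M \<psi>"
proof -
  define I where "I = (\<integral>w. \<phi> w \<bullet> \<psi> w \<partial>M)"
  define a where "a = L2norm M \<phi>"
  define b where "b = L2norm M \<psi>"
  have *: "0 \<le> a\<^sup>2 + 2 * c * I + c\<^sup>2 * b\<^sup>2" for c
    using L2norm_add_power2[OF assms, of c] unfolding I_def a_def b_def by (metis zero_le_power2)
  have "I\<^sup>2 \<le> (a * b)\<^sup>2"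
  proof (cases "b = 0")
    case True
    have "I = 0"
    proof (rule ccontr)
      assume "I \<noteq> 0"
      \<comment> \<open>For \<open>b = 0\<close> the quadratic is affine in \<open>c\<close> with
        slope \<open>2 * I\<close>; at this \<open>c\<close> its value would be -1.\<close>
      then show False using *[of "- (a\<^sup>2 + 1) / (2 * I)"] True by (simp add: field_simps)
    qed
    then show ?thesis by simp
  next
    case False
    then have "0 \<le> a\<^sup>2 - I\<^sup>2 / b\<^sup>2"
      using *[of "- I / b\<^sup>2"] by (simp add: field_simps power2_eq_square power4_eq_xxxx)
    then show ?thesis using False by (simp add: field_simps power_mult_distrib)
  qed
  then have "\<bar>I\<bar> \<le> \<bar>a * b\<bar>" by (rule abs_le_square_iff[THEN iffD2])
  then show ?thesis by (simp add: I_def a_def b_def abs_mult)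
qed

lemma L2norm_triangle:
  assumes "\<phi> \<in> L2 M" "\<psi> \<in> L2 M"
  shows "L2norm M (\<lambda>w. \<phi> w + \<psi> w) \<le> L2norm M \<phi> + L2norm M \<psi>"
proof (rule power2_le_imp_le)
  have "(L2norm M (\<lambda>w. \<phi> w + \<psi> w))\<^sup>2 = (L2norm M \<phi>)\<^sup>2 + 2 * (\<integral>w. \<phi> w \<bullet> \<psi> w \<partial>M) + (L2norm M \<psi>)\<^sup>2"
    using L2norm_add_power2[OF assms, of 1] by simp
  also have "\<dots> \<le> (L2norm M \<phi> + L2norm M \<psi>)\<^sup>2"
    using L2_Cauchy_Schwarz[OF assms] by (simp add: power2_sum)
  finally show "(L2norm M (\<lambda>w. \<phi> w + \<psi> w))\<^sup>2 \<le> (L2norm M \<phi> + L2norm M \<psi>)\<^sup>2" .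
qed simp

lemma L2norm_triangle_diff:
  assumes "\<phi> \<in> L2 M" "\<psi> \<in> L2 M" "\<zeta> \<in> L2 M"
  shows "L2dist M \<phi> \<zeta> \<le> L2dist M \<phi> \<psi> + L2dist M \<psi> \<zeta>"
  using L2norm_triangle[OF L2_diff[OF assms(1,2)] L2_diff[OF assms(2,3)]] by simp

lemma L2norm_triangle_diff':
  assumes "\<phi> \<in> L2 M" "\<psi> \<in> L2 M"
  shows "L2dist M \<phi> \<psi> \<le> L2norm M \<phi> + L2norm M \<psi>"
  using L2norm_triangle[OF assms(1) L2_scaleR[OF assms(2), of "-1"]] L2norm_scaleR[of M "-1" \<psi>] by simp

lemma L2norm_triangle_reverse:
  assumes "\<phi> \<in> L2 M" "\<psi> \<in> L2 M"
  shows "\<bar>L2norm M \<phi> - L2norm M \<psi>\<bar> \<le> L2dist M \<phi> \<psi>"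
  using L2norm_triangle[OF L2_diff[OF assms] assms(2)] L2norm_triangle[OF L2_diff[OF assms(2,1)] assms(1)]
    L2norm_minus_commute[of M \<phi> \<psi>] by simp

lemma L2norm_sum_le: "(\<And>i. i \<in> I \<Longrightarrow> \<phi> i \<in> L2 M) \<Longrightarrow> L2norm M (\<lambda>w. \<Sum>i\<in>I. \<phi> i w) \<le> (\<Sum>i\<in>I. L2norm M (\<phi> i))"
proof (induction I rule: infinite_finite_induct)
  case (insert i I)
  then have "L2norm M (\<lambda>w. \<phi> i w + (\<Sum>i\<in>I. \<phi> i w)) \<le> L2norm M (\<phi> i) + L2norm M (\<lambda>w. \<Sum>i\<in>I. \<phi> i w)"
    by (intro L2norm_triangle L2_sum) auto
  then show ?case using insert by force
qed auto

lemma L2norm_eq_0: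
  assumes "\<phi> \<in> L2 M"
  shows "L2norm M \<phi> = 0 \<longleftrightarrow> (AE w in M. \<phi> w = 0)"
  unfolding L2norm_def
  using integral_nonneg_eq_0_iff_AE[OF L2_integrable_square[OF assms]] by simp

lemma nn_integral_norm_square:
  assumes "\<phi> \<in> L2 M"
  shows "(\<integral>\<^sup>+w. ennreal ((norm (\<phi> w))\<^sup>2) \<partial>M) = ennreal ((L2norm M \<phi>)\<^sup>2)"
  using nn_integral_eq_integral[OF L2_integrable_square[OF assms]] by (simp add: L2norm_power2)

text \<open>Riesz-Fischer with a majorant. Increments of size \<open>(1/4)^n\<close> leave room for
  the weight \<open>4 ^ n\<close>: the sum of \<open>4 ^ n * (a n w)\<^sup>2\<close> is still
  integrable, and its square root \<open>R\<close> bounds all increments pointwise by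
  \<open>R w * (1/2)^n\<close>. Almost everywhere convergence, a common majorant in L2 and
  convergence in norm all follow from this one bound.\<close>

lemma L2_fast_Cauchy:
  fixes F :: "nat \<Rightarrow> 'w \<Rightarrow> 'b::euclidean_space"
  assumes F: "\<And>n. F n \<in> L2 M" and fast: "\<And>n. L2dist M (F (Suc n)) (F n) \<le> (1/4) ^ n"
  shows "\<exists>G\<in>L2 M. \<exists>m\<in>L2 M. (AE w in M. (\<lambda>n. F n w) \<longlonglongrightarrow> G w) \<and>
    (AE w in M. \<forall>n. norm (F n w) \<le> (m w :: real)) \<and> (\<lambda>n. L2dist M (F n) G) \<longlonglongrightarrow> 0"
proof -
  note [measurable] = F[THEN L2_measurable]
  define a where "a n w = norm (F (Suc n) w - F n w)" for n w
  have [measurable]: "a n \<in> borel_measurable M" for n unfolding a_def by measurable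
  define S where "S w = (\<Sum>n. ennreal (4 ^ n * (a n w)\<^sup>2))" for w
  have [measurable]: "S \<in> borel_measurable M" unfolding S_def by measurable
  have "(\<integral>\<^sup>+w. S w \<partial>M) = (\<Sum>n. \<integral>\<^sup>+w. ennreal (4 ^ n * (a n w)\<^sup>2) \<partial>M)"
    unfolding S_def by (intro nn_integral_suminf) measurable
  also have "\<dots> = (\<Sum>n. ennreal (4 ^ n * (L2dist M (F (Suc n)) (F n))\<^sup>2))"
    using nn_integral_norm_square[OF L2_diff[OF F F]]
    by (simp add: ennreal_mult nn_integral_cmult a_def)
  also have "\<dots> \<le> (\<Sum>n. ennreal ((1/4)^n))"
  proof (intro suminf_le allI)
    fix n
    have "4 ^ n * (L2dist M (F (Suc n)) (F n))\<^sup>2 \<le> 4 ^ n * ((1/4)^n)\<^sup>2"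
      by (intro mult_left_mono power_mono fast) auto
    also have "\<dots> = (1/4)^n" by (simp add: power2_eq_square power_divide)
    finally show "ennreal (4 ^ n * (L2dist M (F (Suc n)) (F n))\<^sup>2) \<le> ennreal ((1/4)^n)"
      by (rule ennreal_leI)
  qed auto
  also have "\<dots> = ennreal (\<Sum>n. (1/4)^n)"
    by (intro suminf_ennreal2) (auto intro: summable_geometric)
  finally have int_S: "(\<integral>\<^sup>+w. S w \<partial>M) \<le> ennreal (4/3)" by (simp add: suminf_geometric)
  then have "(\<integral>\<^sup>+w. S w \<partial>M) \<noteq> \<infinity>" by (auto simp: top_unique)
  then have fin: "AE w in M. S w \<noteq> \<infinity>" by (intro nn_integral_noteq_infinite) auto
  define R where "R w = sqrt (enn2real (S w))" for w
  have [measurable]: "R \<in> borel_measurable M" unfolding R_def by measurable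
  have R2: "ennreal ((R w)\<^sup>2) \<le> S w" for w unfolding R_def
    by (cases "S w") auto
  have "(\<integral>\<^sup>+w. ennreal ((R w)\<^sup>2) \<partial>M) \<le> ennreal (4/3)"
    using int_S nn_integral_mono[of M "\<lambda>w. ennreal ((R w)\<^sup>2)" S] R2 by (meson order_trans)
  then have "integrable M (\<lambda>w. (norm (R w))\<^sup>2)"
    by (intro integrableI_bounded) (auto intro: le_less_trans)
  then have RL2: "R \<in> L2 M" by (simp add: L2_def)
  have step: "AE w in M. \<forall>n. a n w \<le> R w * (1/2)^n"
    using fin
  proof eventually_elim
    case (elim w)
    show ?case
    proof
      fix n
      have "(\<Sum>i\<in>{n}. ennreal (4 ^ i * (a i w)\<^sup>2)) \<le> S w" unfolding S_def by (rule sum_le_suminf) auto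
      then have "4 ^ n * (a n w)\<^sup>2 \<le> enn2real (S w)"
        using elim by (cases "S w") (auto simp: ennreal_le_iff)
      then have "4 ^ n * (a n w)\<^sup>2 \<le> (R w)\<^sup>2" unfolding R_def by simp
      moreover have "((1/2::real)^n)\<^sup>2 = 1 / 4 ^ n"
        unfolding power_even_eq[symmetric] power_mult by (simp add: power_divide)
      ultimately have "(a n w)\<^sup>2 \<le> (R w)\<^sup>2 * ((1/2)^n)\<^sup>2"
        by (simp add: field_simps)
      then have "(a n w)\<^sup>2 \<le> (R w * (1/2)^n)\<^sup>2" by (simp add: power_mult_distrib)
      moreover have "0 \<le> R w * (1/2)^n" unfolding R_def by auto
      ultimately show "a n w \<le> R w * (1/2)^n" by (rule power2_le_imp_le)
    qed
  qed
  have geo: "norm (F (n + k) w - F n w) \<le> R w * (2 * (1/2)^n)" if s: "\<forall>n. a n w \<le> R w * (1/2)^n" for w n k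
  proof -
    have R0: "0 \<le> R w" unfolding R_def by auto
    \<comment> \<open>The exact partial sum of the geometric series is kept so that the induction
      closes; the weaker bound is read off afterwards.\<close>
    have "norm (F (n + k) w - F n w) \<le> R w * (2 * (1/2)^n - 2 * (1/2)^(n+k))"
    proof (induction k)
      case (Suc k)
      have "norm (F (n + Suc k) w - F n w) \<le> a (n+k) w + norm (F (n + k) w - F n w)"
        unfolding a_def using norm_triangle_ineq[of "F (Suc (n + k)) w - F (n+k) w" "F (n + k) w - F n w"] by simp
      also have "\<dots> \<le> R w * (1/2)^(n+k) + R w * (2 * (1/2)^n - 2 * (1/2)^(n+k))"
        using s Suc by (intro add_mono) auto
      also have "\<dots> = R w * (2 * (1/2)^n - 2 * (1/2)^(n+Suc k))" by (simp add: algebra_simps)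
      finally show ?case .
    qed simp
    also have "\<dots> \<le> R w * (2 * (1/2)^n)" using R0 by (intro mult_left_mono) auto
    finally show ?thesis .
  qed
  have conv: "convergent (\<lambda>n. F n w)" if s: "\<forall>n. a n w \<le> R w * (1/2)^n" for w
  proof (rule Cauchy_convergent, rule metric_CauchyI)
    fix e :: real assume "0 < e"
    have R0: "0 \<le> R w" unfolding R_def by auto
    have "(\<lambda>n. R w * (2 * (1/2)^n)) \<longlonglongrightarrow> R w * (2 * 0)"
      by (intro tendsto_intros LIMSEQ_realpow_zero) auto
    then obtain N where N: "R w * (2 * (1/2)^N) < e/2"
      using \<open>0 < e\<close> order_tendstoD(2)[of "\<lambda>n. R w * (2 * (1/2)^n)" "0::real" sequentially "e/2"]
      unfolding eventually_sequentially by (metis half_gt_zero le_refl mult_zero_right)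
    show "\<exists>N. \<forall>m\<ge>N. \<forall>n\<ge>N. dist (F m w) (F n w) < e"
    proof (intro exI allI impI)
      fix m n assume "N \<le> m" "N \<le> n"
      then have "dist (F m w) (F N w) < e/2" "dist (F n w) (F N w) < e/2"
        using geo[OF s, of N "m - N"] geo[OF s, of N "n - N"] N by (auto simp: dist_norm)
      then show "dist (F m w) (F n w) < e" by (rule dist_triangle_half_l)
    qed
  qed
  define G where "G w = lim (\<lambda>n. F n w)" for w
  have [measurable]: "G \<in> borel_measurable M" unfolding G_def by measurable
  have lim: "AE w in M. (\<lambda>n. F n w) \<longlonglongrightarrow> G w"
    using step by eventually_elim (simp add: G_def conv convergent_LIMSEQ_iff[symmetric])
  have diffG: "AE w in M. \<forall>n. norm (F n w - G w) \<le> R w * (2 * (1/2)^n)"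
    using step lim
  proof eventually_elim
    case (elim w)
    show ?case
    proof
      fix n
      have "(\<lambda>k. norm (F n w - F (k + n) w)) \<longlonglongrightarrow> norm (F n w - G w)"
        using LIMSEQ_ignore_initial_segment[OF elim(2)] by (intro tendsto_intros)
      then show "norm (F n w - G w) \<le> R w * (2 * (1/2)^n)"
        by (rule Lim_bounded) (metis geo[OF elim(1)] add.commute norm_minus_commute)
    qed
  qed
  have dG: "L2dist M (F n) G \<le> 2 * (1/2)^n * L2norm M R" for n
  proof -
    have "L2dist M (F n) G \<le> L2norm M (\<lambda>w. (2 * (1/2)^n) *\<^sub>R R w)"
    proof (rule L2norm_mono[OF L2_scaleR[OF RL2]])
      show "AE w in M. norm (F n w - G w) \<le> norm ((2 * (1 / 2) ^ n) *\<^sub>R R w)"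
        using diffG by eventually_elim (auto simp: R_def mult.commute)
    qed measurable
    then show ?thesis by (simp only: L2norm_scaleR) (simp add: abs_mult)
  qed
  have m: "(\<lambda>w. norm (G w) + 2 * R w) \<in> L2 M" and G: "G \<in> L2 M"
  proof -
    have "(\<lambda>w. F 0 w - G w) \<in> L2 M"
      by (rule L2_bound[OF L2_scaleR[OF RL2, of 2]]) (use diffG in \<open>auto elim!: eventually_mono dest: spec[of _ 0] simp: mult.commute\<close>)
    from L2_diff[OF F[of 0] this] show "G \<in> L2 M" by simp
    then show "(\<lambda>w. norm (G w) + 2 * R w) \<in> L2 M"
      using L2_add[OF L2_norm_real L2_scaleR[OF RL2, of 2]] by force
  qed
  have "AE w in M. \<forall>n. norm (F n w) \<le> norm (G w) + 2 * R w"
    using diffG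
  proof eventually_elim
    case (elim w)
    show ?case
    proof
      fix n
      have "R w * (2 * (1/2)^n) \<le> R w * (2 * 1)" unfolding R_def
        by (intro mult_left_mono power_le_one) auto
      then show "norm (F n w) \<le> norm (G w) + 2 * R w"
        using elim[rule_format, of n] norm_triangle_ineq2[of "F n w" "G w"] by linarith
    qed
  qed
  moreover have "(\<lambda>n. L2dist M (F n) G) \<longlonglongrightarrow> 0"
  proof (rule tendsto_sandwich[OF _ _ tendsto_const])
    have "(\<lambda>n. 2 * (1/2)^n * L2norm M R) \<longlonglongrightarrow> 2 * 0 * L2norm M R"
      by (intro tendsto_intros LIMSEQ_realpow_zero) auto
    then show "(\<lambda>n. 2 * (1/2)^n * L2norm M R) \<longlonglongrightarrow> 0" by simp
  qed (use dG in auto)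
  ultimately show ?thesis using lim by (intro bexI[OF _ G] bexI[OF _ m]) auto
qed

text \<open>\<open>D\<close> is an arbitrary double array, so that the selection applies to
  \<open>L2dist\<close>, which is only a pseudodistance.\<close>

lemma Cauchy_fast_subseq:
  fixes D :: "nat \<Rightarrow> nat \<Rightarrow> real"
  assumes "\<And>e. e > 0 \<Longrightarrow> \<exists>N. \<forall>m\<ge>N. \<forall>n\<ge>N. D m n < e" and "\<And>n. (0::real) < b n"
  shows "\<exists>r. strict_mono r \<and> (\<forall>n. D (r (Suc n)) (r n) \<le> b n)"
proof -
  obtain N where N: "\<And>k m n. N k \<le> m \<Longrightarrow> N k \<le> n \<Longrightarrow> D m n < b k"
    using assms(1)[OF assms(2)] by metis
  \<comment> \<open>\<open>Suc x\<close> makes \<open>r\<close> strictly increasing,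
    \<open>N (Suc n)\<close> places it beyond the Cauchy threshold of the next rate.\<close>
  define r where "r = rec_nat (N 0) (\<lambda>n x. max (Suc x) (N (Suc n)))"
  have r: "r (Suc n) = max (Suc (r n)) (N (Suc n))" "r 0 = N 0" for n by (auto simp: r_def)
  have "strict_mono r" unfolding strict_mono_Suc_iff by (simp add: r(1) less_max_iff_disj)
  moreover have Nr: "N n \<le> r n" for n by (cases n) (auto simp: r)
  moreover have "D (r (Suc n)) (r n) < b n" for n
    by (rule N) (use Nr[of n] in \<open>auto simp: r(1)\<close>)
  ultimately show ?thesis by (auto intro: less_imp_le)
qed

lemma L2_complete:
  fixes F :: "nat \<Rightarrow> 'w \<Rightarrow> 'b::euclidean_space"
  assumes F: "\<And>n. F n \<in> L2 M"
    and C: "\<And>e. e > 0 \<Longrightarrow> \<exists>N. \<forall>m\<ge>N. \<forall>n\<ge>N. L2dist M (F m) (F n) < e"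
  shows "\<exists>G\<in>L2 M. (\<lambda>n. L2dist M (F n) G) \<longlonglongrightarrow> 0"
proof -
  obtain r where r: "strict_mono r" "\<And>n. L2dist M (F (r (Suc n))) (F (r n)) \<le> (1/4)^n"
    using Cauchy_fast_subseq[of "\<lambda>m n. L2dist M (F m) (F n)" "\<lambda>n. (1/4)^n"] C by auto
  obtain G where G: "G \<in> L2 M" "(\<lambda>n. L2dist M (F (r n)) G) \<longlonglongrightarrow> 0"
    using L2_fast_Cauchy[of "\<lambda>n. F (r n)" M] F r(2) by blast
  have "(\<lambda>n. L2dist M (F n) G) \<longlonglongrightarrow> 0"
  proof (rule LIMSEQ_I)
    fix e :: real assume "0 < e"
    obtain N where N: "\<And>m n. m \<ge> N \<Longrightarrow> n \<ge> N \<Longrightarrow> L2dist M (F m) (F n) < e/2"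
      using C[of "e/2"] \<open>0 < e\<close> by auto
    obtain K where K: "\<And>n. n \<ge> K \<Longrightarrow> L2dist M (F (r n)) G < e/2"
      using LIMSEQ_D[OF G(2), of "e/2"] \<open>0 < e\<close> by auto
    show "\<exists>no. \<forall>n\<ge>no. norm (L2dist M (F n) G - 0) < e"
    proof (intro exI[of _ N] allI impI)
      fix n assume "N \<le> n"
      define k where "k = max N K"
      have "N \<le> r k" using seq_suble[OF r(1), of k] by (simp add: k_def)
      then have "L2dist M (F n) (F (r k)) < e/2" using N \<open>N \<le> n\<close> by simp
      moreover have "L2dist M (F (r k)) G < e/2" by (rule K) (simp add: k_def)
      ultimately show "norm (L2dist M (F n) G - 0) < e"
        using L2norm_triangle_diff[OF F[of n] F[of "r k"] G(1)] by simp
    qed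
  qed
  then show ?thesis using G(1) by blast
qed

lemma L2_convergent_imp_Cauchy:
  fixes F :: "nat \<Rightarrow> 'w \<Rightarrow> 'b::euclidean_space"
  assumes F: "\<And>n. F n \<in> L2 M" and G: "G \<in> L2 M" and lim: "(\<lambda>n. L2dist M (F n) G) \<longlonglongrightarrow> 0"
    and "e > 0"
  shows "\<exists>N. \<forall>m\<ge>N. \<forall>n\<ge>N. L2dist M (F m) (F n) < e"
proof -
  obtain N where N: "\<And>n. n \<ge> N \<Longrightarrow> L2dist M (F n) G < e/2"
    using LIMSEQ_D[OF lim, of "e/2"] \<open>0 < e\<close> by auto
  show ?thesis
  proof (intro exI[of _ N] allI impI)
    fix m n assume "N \<le> m" "N \<le> n"
    then show "L2dist M (F m) (F n) < e"
      using N[of m] N[of n] L2norm_triangle_diff[OF F[of m] G F[of n]] L2norm_minus_commute[of M G "F n"] by simp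
  qed
qed

lemma L2_limit_unique:
  fixes F :: "nat \<Rightarrow> 'w \<Rightarrow> 'b::euclidean_space"
  assumes F: "\<And>n. F n \<in> L2 M" and G: "G \<in> L2 M" "G' \<in> L2 M"
    and lim: "(\<lambda>n. L2dist M (F n) G) \<longlonglongrightarrow> 0" "(\<lambda>n. L2dist M (F n) G') \<longlonglongrightarrow> 0"
  shows "AE w in M. G w = G' w"
proof -
  have "(\<lambda>n. L2dist M (F n) G + L2dist M (F n) G') \<longlonglongrightarrow> 0 + 0"
    by (intro tendsto_add lim)
  then have "L2dist M G G' \<le> 0 + 0"
    by (rule LIMSEQ_le_const)
      (metis L2norm_triangle_diff[OF G(1) F G(2)] L2norm_minus_commute)
  then have "L2dist M G G' = 0" using L2norm_nonneg by (metis add.right_neutral antisym)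
  then show ?thesis using L2norm_eq_0[OF L2_diff[OF G]] by simp
qed

text \<open>The majorant \<open>m\<close> is a by-product of choosing the subsequence rapidly
  convergent. In the Fatou argument for the cost it turns the quadratic lower bound on
  \<open>g\<close> into an integrable minorant.\<close>

lemma L2_tendsto_AE_subseq:
  fixes F :: "nat \<Rightarrow> 'w \<Rightarrow> 'b::euclidean_space"
  assumes F: "\<And>n. F n \<in> L2 M" and G: "G \<in> L2 M" and lim: "(\<lambda>n. L2dist M (F n) G) \<longlonglongrightarrow> 0"
  shows "\<exists>r m. strict_mono r \<and> m \<in> L2 M \<and> (AE w in M. (\<lambda>n. F (r n) w) \<longlonglongrightarrow> G w) \<and>
    (AE w in M. \<forall>n. norm (F (r n) w) \<le> (m w :: real))"
proof -
  obtain r where r: "strict_mono r" "\<And>n. L2dist M (F (r (Suc n))) (F (r n)) \<le> (1/4)^n"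
    using Cauchy_fast_subseq[of "\<lambda>m n. L2dist M (F m) (F n)" "\<lambda>n. (1/4)^n"]
      L2_convergent_imp_Cauchy[OF F G lim] by auto
  obtain G' m where G': "G' \<in> L2 M" "m \<in> L2 M" "AE w in M. (\<lambda>n. F (r n) w) \<longlonglongrightarrow> G' w"
    "AE w in M. \<forall>n. norm (F (r n) w) \<le> (m w :: real)"
    "(\<lambda>n. L2dist M (F (r n)) G') \<longlonglongrightarrow> 0"
    using L2_fast_Cauchy[of "\<lambda>n. F (r n)" M] F r(2) by blast
  have "AE w in M. G' w = G w"
    by (rule L2_limit_unique[OF F G'(1) G G'(5)])
      (use LIMSEQ_subseq_LIMSEQ[OF lim r(1)] in \<open>simp add: o_def\<close>)
  with G'(3) have "AE w in M. (\<lambda>n. F (r n) w) \<longlonglongrightarrow> G w" by eventually_elim simp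
  then show ?thesis using r(1) G'(2,4) by blast
qed

lemma L2_dominated_convergence:
  fixes F :: "nat \<Rightarrow> 'w \<Rightarrow> 'b::euclidean_space"
  assumes [measurable]: "\<And>n. F n \<in> borel_measurable M" "G \<in> borel_measurable M" and m: "m \<in> L2 M"
    and lim: "AE w in M. (\<lambda>n. F n w) \<longlonglongrightarrow> G w"
    and bd: "\<And>n. AE w in M. norm (F n w) \<le> (m w :: real)"
  shows "(\<lambda>n. L2dist M (F n) G) \<longlonglongrightarrow> 0"
proof -
  have bd': "AE w in M. \<forall>n. norm (F n w) \<le> m w" using bd by (simp add: AE_all_countable)
  have "(\<lambda>n. \<integral>w. (norm (F n w - G w))\<^sup>2 \<partial>M) \<longlonglongrightarrow> (\<integral>w. 0 \<partial>M)"
  proof (rule integral_dominated_convergence)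
    show "integrable M (\<lambda>w. (norm (2 *\<^sub>R m w))\<^sup>2)" by (intro L2_integrable_square L2_scaleR m)
    show "AE w in M. (\<lambda>n. (norm (F n w - G w))\<^sup>2) \<longlonglongrightarrow> 0"
      using lim
    proof eventually_elim
      case (elim w)
      then have "(\<lambda>n. (norm (F n w - G w))\<^sup>2) \<longlonglongrightarrow> (norm (G w - G w))\<^sup>2"
        by (intro tendsto_intros)
      then show ?case by simp
    qed
    show "AE w in M. norm ((norm (F n w - G w))\<^sup>2) \<le> (norm (2 *\<^sub>R m w))\<^sup>2" for n
      using lim bd'
    proof eventually_elim
      case (elim w)
      have "norm (G w) \<le> m w"
        by (rule Lim_bounded[OF tendsto_norm[OF elim(1)], of 0]) (use elim in auto)
      then have "norm (F n w - G w) \<le> norm (2 *\<^sub>R m w)"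
        using elim(2)[rule_format, of n] norm_triangle_ineq4[of "F n w" "G w"] by simp
      from power_mono[OF this norm_ge_zero, of 2] show ?case by simp
    qed
  qed auto
  then have "(\<lambda>n. sqrt (\<integral>w. (norm (F n w - G w))\<^sup>2 \<partial>M)) \<longlonglongrightarrow> sqrt 0"
    by (intro tendsto_real_sqrt) simp
  then show ?thesis by (simp add: L2norm_def)
qed

section \<open>The pseudometric topology\<close>

lemma openin_L2_ball:
  assumes "\<phi> \<in> L2 M"
  shows "openin (L2_topology M) {\<psi>\<in>L2 M. L2dist M \<psi> \<phi> < e}"
  unfolding openin_L2_topology
proof (intro conjI ballI)
  fix \<psi> assume \<psi>: "\<psi> \<in> {\<psi>\<in>L2 M. L2dist M \<psi> \<phi> < e}"
  show "\<exists>r>0. \<forall>\<zeta>\<in>L2 M. L2dist M \<zeta> \<psi> < r \<longrightarrow> \<zeta> \<in> {\<psi>\<in>L2 M. L2dist M \<psi> \<phi> < e}"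
  proof (intro exI[of _ "e - L2dist M \<psi> \<phi>"] conjI ballI impI)
    fix \<zeta> assume "\<zeta> \<in> L2 M" "L2dist M \<zeta> \<psi> < e - L2dist M \<psi> \<phi>"
    then show "\<zeta> \<in> {\<psi>\<in>L2 M. L2dist M \<psi> \<phi> < e}"
      using L2norm_triangle_diff[of \<zeta> M \<psi> \<phi>] assms \<psi> by simp
  qed (use \<psi> in simp)
qed auto

lemma eventually_nhdsin_L2:
  assumes "\<phi> \<in> L2 M"
  shows "eventually P (nhdsin (L2_topology M) \<phi>) \<longleftrightarrow>
    (\<exists>r>0. \<forall>\<psi>\<in>L2 M. L2dist M \<psi> \<phi> < r \<longrightarrow> P \<psi>)"
proof
  assume "eventually P (nhdsin (L2_topology M) \<phi>)"
  then obtain S where "openin (L2_topology M) S" "\<phi> \<in> S" "\<forall>\<psi>\<in>S. P \<psi>"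
    using assms by (auto simp: eventually_nhdsin)
  then show "\<exists>r>0. \<forall>\<psi>\<in>L2 M. L2dist M \<psi> \<phi> < r \<longrightarrow> P \<psi>"
    unfolding openin_L2_topology by meson
next
  assume "\<exists>r>0. \<forall>\<psi>\<in>L2 M. L2dist M \<psi> \<phi> < r \<longrightarrow> P \<psi>"
  then obtain r where "r > 0" "\<forall>\<psi>\<in>L2 M. L2dist M \<psi> \<phi> < r \<longrightarrow> P \<psi>" by blast
  then show "eventually P (nhdsin (L2_topology M) \<phi>)"
    unfolding eventually_nhdsin using assms
    by (intro disjI2 exI[of _ "{\<psi>\<in>L2 M. L2dist M \<psi> \<phi> < r}"]) (auto intro: openin_L2_ball)
qed

lemma continuous_L2_curve_iff:
  fixes x :: "real \<Rightarrow> 'w \<Rightarrow> 'b::euclidean_space"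
  shows "continuous_L2_curve M s t x \<longleftrightarrow> (\<forall>\<sigma>\<in>{s..t}. x \<sigma> \<in> L2 M) \<and>
    (\<forall>\<sigma>\<in>{s..t}. \<forall>e>0. \<exists>d>0. \<forall>r\<in>{s..t}. \<bar>r - \<sigma>\<bar> < d \<longrightarrow> L2dist M (x r) (x \<sigma>) < e)"
    (is "_ \<longleftrightarrow> ?mem \<and> ?cont")
proof (intro iffI conjI)
  assume c: "continuous_L2_curve M s t x"
  then show mem: ?mem unfolding continuous_L2_curve_def
    using continuous_map_image_subset_topspace[of "top_of_set {s..t}" "L2_topology M" x] by auto
  show ?cont
  proof (intro ballI allI impI)
    fix \<sigma> and e :: real assume \<sigma>: "\<sigma> \<in> {s..t}" and "e > 0"
    have "openin (top_of_set {s..t}) {r \<in> topspace (top_of_set {s..t}). x r \<in> {\<psi>\<in>L2 M. L2dist M \<psi> (x \<sigma>) < e}}"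
      by (rule openin_continuous_map_preimage[OF c[unfolded continuous_L2_curve_def] openin_L2_ball]) (use mem \<sigma> in auto)
    then obtain d where "d > 0" "\<forall>r\<in>{s..t}. dist r \<sigma> < d \<longrightarrow> L2dist M (x r) (x \<sigma>) < e"
      using \<sigma> mem \<open>e > 0\<close> unfolding openin_euclidean_subtopology_iff by auto
    then show "\<exists>d>0. \<forall>r\<in>{s..t}. \<bar>r - \<sigma>\<bar> < d \<longrightarrow> L2dist M (x r) (x \<sigma>) < e"
      by (auto simp: dist_real_def)
  qed
next
  assume *: "?mem \<and> ?cont"
  show "continuous_L2_curve M s t x"
    unfolding continuous_L2_curve_def continuous_map_def
  proof (intro conjI allI impI)
    show "x \<in> topspace (top_of_set {s..t}) \<rightarrow> topspace (L2_topology M)" using * by auto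
    fix W :: "('w \<Rightarrow> 'b) set" assume W: "openin (L2_topology M) W"
    show "openin (top_of_set {s..t}) {r \<in> topspace (top_of_set {s..t}). x r \<in> W}"
      unfolding openin_euclidean_subtopology_iff
    proof (intro conjI ballI)
      fix \<sigma> assume "\<sigma> \<in> {r \<in> topspace (top_of_set {s..t}). x r \<in> W}"
      then have \<sigma>: "\<sigma> \<in> {s..t}" "x \<sigma> \<in> W" by auto
      then obtain e where "e > 0" and e: "\<And>\<psi>. \<psi> \<in> L2 M \<Longrightarrow> L2dist M \<psi> (x \<sigma>) < e \<Longrightarrow> \<psi> \<in> W"
        using W unfolding openin_L2_topology by blast
      then obtain d where "d > 0" "\<forall>r\<in>{s..t}. \<bar>r - \<sigma>\<bar> < d \<longrightarrow> L2dist M (x r) (x \<sigma>) < e"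
        using * \<sigma>(1) by meson
      then show "\<exists>d>0. \<forall>r\<in>{s..t}. dist r \<sigma> < d \<longrightarrow> r \<in> {r \<in> topspace (top_of_set {s..t}). x r \<in> W}"
        using e * by (intro exI[of _ d]) (auto simp: dist_real_def)
    qed auto
  qed
qed

text \<open>Heine-Cantor for the pseudodistance: a Lebesgue number of the cover of
  \<open>{s..t}\<close> by the balls of radius \<open>d \<sigma>\<close> is the uniform
  modulus.\<close>

lemma continuous_L2_curve_uniform:
  fixes x :: "real \<Rightarrow> 'w \<Rightarrow> 'b::euclidean_space"
  assumes x: "continuous_L2_curve M s t x" and "e > 0"
  shows "\<exists>d>0. \<forall>r\<in>{s..t}. \<forall>\<sigma>\<in>{s..t}. \<bar>r - \<sigma>\<bar> < d \<longrightarrow> L2dist M (x r) (x \<sigma>) < e"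
proof -
  have mem: "\<And>\<sigma>. \<sigma> \<in> {s..t} \<Longrightarrow> x \<sigma> \<in> L2 M" using x by (simp add: continuous_L2_curve_iff)
  have "\<forall>\<sigma>\<in>{s..t}. \<exists>d>0. \<forall>r\<in>{s..t}. \<bar>r - \<sigma>\<bar> < d \<longrightarrow> L2dist M (x r) (x \<sigma>) < e/2"
    using x \<open>e > 0\<close> unfolding continuous_L2_curve_iff by (meson half_gt_zero)
  from bchoice[OF this] obtain d where d: "\<And>\<sigma>. \<sigma> \<in> {s..t} \<Longrightarrow> d \<sigma> > 0"
    "\<And>\<sigma> r. \<sigma> \<in> {s..t} \<Longrightarrow> r \<in> {s..t} \<Longrightarrow> \<bar>r - \<sigma>\<bar> < d \<sigma> \<Longrightarrow> L2dist M (x r) (x \<sigma>) < e/2"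
    by blast
  obtain \<epsilon> where "0 < \<epsilon>" and \<epsilon>: "\<And>\<sigma>. \<sigma> \<in> {s..t} \<Longrightarrow> \<exists>G\<in>(\<lambda>\<sigma>. ball \<sigma> (d \<sigma>)) ` {s..t}. ball \<sigma> \<epsilon> \<subseteq> G"
    by (rule Heine_Borel_lemma[of "{s..t}" "(\<lambda>\<sigma>. ball \<sigma> (d \<sigma>)) ` {s..t}"]) (use d(1) in auto)
  show ?thesis
  proof (intro exI[of _ \<epsilon>] conjI ballI impI)
    fix r \<sigma> assume r: "r \<in> {s..t}" and \<sigma>: "\<sigma> \<in> {s..t}" and "\<bar>r - \<sigma>\<bar> < \<epsilon>"
    obtain \<tau> where \<tau>: "\<tau> \<in> {s..t}" "ball \<sigma> \<epsilon> \<subseteq> ball \<tau> (d \<tau>)" using \<epsilon>[OF \<sigma>] by auto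
    have "r \<in> ball \<sigma> \<epsilon>" "\<sigma> \<in> ball \<sigma> \<epsilon>" using \<open>\<bar>r - \<sigma>\<bar> < \<epsilon>\<close> \<open>0 < \<epsilon>\<close> by (auto simp: dist_real_def)
    then have "r \<in> ball \<tau> (d \<tau>)" "\<sigma> \<in> ball \<tau> (d \<tau>)" using \<tau>(2) by blast+
    then have "L2dist M (x r) (x \<tau>) < e/2" "L2dist M (x \<sigma>) (x \<tau>) < e/2"
      using d(2)[OF \<tau>(1)] r \<sigma> by (auto simp: dist_real_def abs_minus_commute)
    then show "L2dist M (x r) (x \<sigma>) < e"
      using L2norm_triangle_diff[OF mem[OF r] mem[OF \<tau>(1)] mem[OF \<sigma>]]
        L2norm_minus_commute[of M "x \<sigma>" "x \<tau>"] by simp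
  qed (fact \<open>0 < \<epsilon>\<close>)
qed

lemma compactin_L2_finite_net:
  fixes K :: "('w \<Rightarrow> 'b::euclidean_space) set"
  assumes "compactin (L2_topology M) K" "e > 0"
  shows "\<exists>Q. finite Q \<and> Q \<subseteq> L2 M \<and> (\<forall>\<psi>\<in>K. \<exists>q\<in>Q. L2dist M \<psi> q < e)"
proof -
  have KL: "K \<subseteq> L2 M" using assms(1) compactin_subset_topspace by fastforce
  let ?B = "\<lambda>\<phi>. {\<psi>\<in>L2 M. L2dist M \<psi> \<phi> < e}"
  have "\<exists>\<F>. finite \<F> \<and> \<F> \<subseteq> ?B ` K \<and> K \<subseteq> \<Union>\<F>"
  proof (rule compactinD[OF assms(1)])
    show "openin (L2_topology M) W" if "W \<in> ?B ` K" for W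
      using that KL openin_L2_ball by blast
    have "\<psi> \<in> ?B \<psi>" if "\<psi> \<in> K" for \<psi> using that KL \<open>e > 0\<close> by auto
    then show "K \<subseteq> \<Union>(?B ` K)" by blast
  qed
  then obtain \<F> where \<F>: "finite \<F>" "\<F> \<subseteq> ?B ` K" "K \<subseteq> \<Union>\<F>" by blast
  then obtain Q where Q: "finite Q" "Q \<subseteq> K" "\<F> = ?B ` Q"
    using finite_subset_image[OF \<F>(1,2)] by blast
  have Q3: "K \<subseteq> \<Union>(?B ` Q)" using \<F>(3) unfolding Q(3) .
  have "\<exists>q\<in>Q. L2dist M \<psi> q < e" if "\<psi> \<in> K" for \<psi>
    using subsetD[OF Q3 that] by blast
  then show ?thesis using Q KL by blast
qed

section \<open>Square-integrable maps on a product\<close>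

text \<open>\<open>N\<close> stands for Lebesgue measure on a time interval and \<open>M\<close> for
  the measure on the parameters. Finiteness makes square-integrable slices integrable.\<close>

locale pair_finite_measure = M1?: finite_measure N + M2?: finite_measure M
  for N :: "'a measure" and M :: "'w measure"

sublocale pair_finite_measure \<subseteq> pair_sigma_finite N M
  by unfold_locales

sublocale pair_finite_measure \<subseteq> P?: finite_measure "N \<Otimes>\<^sub>M M"
  by (rule finite_measure_pair_measure[OF M2.finite_measure_axioms M1.finite_measure_axioms])

context pair_finite_measure
begin

lemma AE_slice_L2:
  assumes "case_prod h \<in> L2 (N \<Otimes>\<^sub>M M)"
  shows "AE \<sigma> in N. h \<sigma> \<in> L2 M"
proof -
  note [measurable] = L2_measurable[OF assms]
  have "integrable (N \<Otimes>\<^sub>M M) (case_prod (\<lambda>\<sigma> w. (norm (h \<sigma> w))\<^sup>2))"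
    using L2_integrable_square[OF assms] by (simp add: case_prod_unfold)
  from AE_integrable_fst[OF this] AE_space show ?thesis
  proof eventually_elim
    case (elim \<sigma>)
    then have "h \<sigma> \<in> borel_measurable M" by measurable
    then show ?case using elim by (simp add: L2_def)
  qed
qed

lemma AE_slice_L2':
  assumes "case_prod h \<in> L2 (N \<Otimes>\<^sub>M M)"
  shows "AE w in M. (\<lambda>\<sigma>. h \<sigma> w) \<in> L2 N"
proof -
  note [measurable] = L2_measurable[OF assms]
  have "integrable (N \<Otimes>\<^sub>M M) (case_prod (\<lambda>\<sigma> w. (norm (h \<sigma> w))\<^sup>2))"
    using L2_integrable_square[OF assms] by (simp add: case_prod_unfold)
  from AE_integrable_snd[OF this] AE_space show ?thesis
  proof eventually_elim
    case (elim w)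
    then have "(\<lambda>\<sigma>. h \<sigma> w) \<in> borel_measurable N" by measurable
    then show ?case using elim by (simp add: L2_def)
  qed
qed

lemma integrable_slice_norm2:
  assumes "case_prod h \<in> L2 (N \<Otimes>\<^sub>M M)"
  shows "integrable N (\<lambda>\<sigma>. (L2norm M (h \<sigma>))\<^sup>2)"
    and "(\<integral>\<sigma>. (L2norm M (h \<sigma>))\<^sup>2 \<partial>N) = (L2norm (N \<Otimes>\<^sub>M M) (case_prod h))\<^sup>2"
proof -
  have *: "integrable (N \<Otimes>\<^sub>M M) (case_prod (\<lambda>\<sigma> w. (norm (h \<sigma> w))\<^sup>2))"
    using L2_integrable_square[OF assms] by (simp add: case_prod_unfold)
  show "integrable N (\<lambda>\<sigma>. (L2norm M (h \<sigma>))\<^sup>2)"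
    using integrable_fst[OF *] by (simp add: L2norm_power2)
  show "(\<integral>\<sigma>. (L2norm M (h \<sigma>))\<^sup>2 \<partial>N) = (L2norm (N \<Otimes>\<^sub>M M) (case_prod h))\<^sup>2"
    using integral_fst[OF *] by (simp add: L2norm_power2 case_prod_unfold)
qed

lemma measurable_slice_norm [measurable (raw)]:
  assumes [measurable]: "case_prod h \<in> borel_measurable (N \<Otimes>\<^sub>M M)"
  shows "(\<lambda>\<sigma>. L2norm M (h \<sigma>)) \<in> borel_measurable N"
  unfolding L2norm_def by measurable

text \<open>By Fubini the norm in the product is the L2 norm in time of the slice norms. Convergence
  in the product therefore gives, along a subsequence, convergence of the slices at almost every
  time.\<close>

lemma slice_norm_L2:
  assumes "case_prod h \<in> L2 (N \<Otimes>\<^sub>M M)"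
  shows "(\<lambda>\<sigma>. L2norm M (h \<sigma>)) \<in> L2 N"
    and "L2norm N (\<lambda>\<sigma>. L2norm M (h \<sigma>)) = L2norm (N \<Otimes>\<^sub>M M) (case_prod h)"
proof -
  show "(\<lambda>\<sigma>. L2norm M (h \<sigma>)) \<in> L2 N"
    using integrable_slice_norm2[OF assms] measurable_slice_norm[OF L2_measurable[OF assms]]
    by (simp add: L2_def)
  show "L2norm N (\<lambda>\<sigma>. L2norm M (h \<sigma>)) = L2norm (N \<Otimes>\<^sub>M M) (case_prod h)"
    using integrable_slice_norm2(2)[OF assms] by (simp add: L2norm_def[of N])
qed

lemma product_L2I:
  assumes [measurable]: "case_prod h \<in> borel_measurable (N \<Otimes>\<^sub>M M)" and m: "m \<in> L2 M"
    and bd: "AE \<sigma> in N. AE w in M. norm (h \<sigma> w) \<le> (m w :: real)"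
  shows "case_prod h \<in> L2 (N \<Otimes>\<^sub>M M)"
proof -
  note [measurable] = L2_measurable[OF m]
  have "(\<integral>\<^sup>+z. ennreal ((norm (case_prod h z))\<^sup>2) \<partial>(N \<Otimes>\<^sub>M M)) = (\<integral>\<^sup>+\<sigma>. \<integral>\<^sup>+w. ennreal ((norm (h \<sigma> w))\<^sup>2) \<partial>M \<partial>N)"
    by (subst M2.nn_integral_fst[symmetric]) auto
  also have "\<dots> \<le> (\<integral>\<^sup>+\<sigma>. \<integral>\<^sup>+w. ennreal ((norm (m w))\<^sup>2) \<partial>M \<partial>N)"
  proof (rule nn_integral_mono_AE, use bd in eventually_elim)
    case (elim \<sigma>)
    then show ?case
      by (intro nn_integral_mono_AE) (auto elim!: eventually_mono intro!: ennreal_leI power_mono)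
  qed
  also have "\<dots> < \<infinity>"
    using nn_integral_norm_square[OF m] M1.emeasure_finite[of "space N"]
    by (simp add: ennreal_mult_eq_top_iff less_top[symmetric])
  finally show ?thesis by (auto simp: L2_def intro!: integrableI_bounded)
qed

end

section \<open>Integration in the first variable\<close>

text \<open>Integration in time at a fixed parameter, the working substitute for the Bochner
  integral. At parameters whose slice is not integrable the value is the default 0; for maps in L2
  of the product these parameters form a null set.\<close>

definition partial_integral :: "'a measure \<Rightarrow> 'a set \<Rightarrow> ('a \<Rightarrow> 'w \<Rightarrow> 'b::euclidean_space) \<Rightarrow> 'w \<Rightarrow> 'b" where
  "partial_integral N A h w = (\<integral>\<sigma>. indicator A \<sigma> *\<^sub>R h \<sigma> w \<partial>N)"

text \<open>Cauchy-Schwarz against the indicator of \<open>A\<close>. The factor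
  \<open>measure N A\<close>, rather than the total mass, is what survives the division by the
  interval length in the differentiation theorem.\<close>

lemma norm_integral_power2_le:
  assumes "finite_measure N" "k \<in> L2 N" and [measurable]: "A \<in> sets N"
  shows "(norm (\<integral>\<sigma>. indicator A \<sigma> *\<^sub>R k \<sigma> \<partial>N))\<^sup>2 \<le> measure N A * (\<integral>\<sigma>. indicator A \<sigma> * (norm (k \<sigma>))\<^sup>2 \<partial>N)"
proof -
  interpret finite_measure N by fact
  note [measurable] = L2_measurable[OF assms(2)]
  have 1: "(\<lambda>\<sigma>. indicator A \<sigma> :: real) \<in> L2 N"
  proof (rule L2_bound[OF L2_const[OF assms(1), of "1::real"]])
    show "AE \<sigma> in N. norm (indicator A \<sigma> :: real) \<le> norm (1::real)" by (auto simp: indicator_def)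
  qed measurable
  have 2: "(\<lambda>\<sigma>. norm (indicator A \<sigma> *\<^sub>R k \<sigma>)) \<in> L2 N"
    by (intro L2_norm_real L2_indicator assms)
  have "norm (\<integral>\<sigma>. indicator A \<sigma> *\<^sub>R k \<sigma> \<partial>N) \<le> (\<integral>\<sigma>. norm (indicator A \<sigma> *\<^sub>R k \<sigma>) \<partial>N)"
    by (rule integral_norm_bound)
  also have "\<dots> = (\<integral>\<sigma>. indicator A \<sigma> \<bullet> norm (indicator A \<sigma> *\<^sub>R k \<sigma>) \<partial>N)"
    by (intro Bochner_Integration.integral_cong) (auto simp: indicator_def)
  also have "\<dots> \<le> L2norm N (indicator A :: _ \<Rightarrow> real) * L2norm N (\<lambda>\<sigma>. norm (indicator A \<sigma> *\<^sub>R k \<sigma>))"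
    using L2_Cauchy_Schwarz[OF 1 2] by simp
  finally have "(norm (\<integral>\<sigma>. indicator A \<sigma> *\<^sub>R k \<sigma> \<partial>N))\<^sup>2 \<le> (L2norm N (indicator A :: _ \<Rightarrow> real))\<^sup>2 * (L2norm N (\<lambda>\<sigma>. norm (indicator A \<sigma> *\<^sub>R k \<sigma>)))\<^sup>2"
    unfolding power_mult_distrib[symmetric] by (rule power_mono) simp
  also have "(L2norm N (indicator A :: _ \<Rightarrow> real))\<^sup>2 = measure N A"
  proof -
    have "(L2norm N (indicator A :: _ \<Rightarrow> real))\<^sup>2 = (\<integral>\<sigma>. indicator A \<sigma> \<partial>N)"
      unfolding L2norm_power2 by (intro Bochner_Integration.integral_cong) (auto simp: indicator_def)
    then show ?thesis by simp
  qed
  also have "(L2norm N (\<lambda>\<sigma>. norm (indicator A \<sigma> *\<^sub>R k \<sigma>)))\<^sup>2 = (\<integral>\<sigma>. indicator A \<sigma> * (norm (k \<sigma>))\<^sup>2 \<partial>N)"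
    unfolding L2norm_power2 by (intro Bochner_Integration.integral_cong) (auto simp: indicator_def)
  finally show ?thesis .
qed

context pair_finite_measure
begin

lemma measurable_partial_integral [measurable]:
  assumes [measurable]: "case_prod h \<in> borel_measurable (N \<Otimes>\<^sub>M M)" "A \<in> sets N"
  shows "partial_integral N A h \<in> borel_measurable M"
  unfolding partial_integral_def by measurable

lemma AE_slice_integrable:
  assumes "case_prod h \<in> L2 (N \<Otimes>\<^sub>M M)" "A \<in> sets N"
  shows "AE w in M. integrable N (\<lambda>\<sigma>. indicator A \<sigma> *\<^sub>R h \<sigma> w)"
  using AE_slice_L2'[OF assms(1)]
proof eventually_elim
  case (elim w)
  have "integrable N (\<lambda>\<sigma>. norm (h \<sigma> w))"
    by (rule M1.square_integrable_imp_integrable)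
      (use L2_integrable_square[OF elim] L2_measurable[OF elim] in auto)
  then have "integrable N (\<lambda>\<sigma>. h \<sigma> w)" using integrable_norm_iff[OF L2_measurable[OF elim]] by simp
  then show ?case using assms(2) by (rule integrable_mult_indicator[rotated])
qed

lemma partial_integral_L2:
  assumes h: "case_prod h \<in> L2 (N \<Otimes>\<^sub>M M)" and A[measurable]: "A \<in> sets N"
  shows "partial_integral N A h \<in> L2 M"
    and "(L2norm M (partial_integral N A h))\<^sup>2 \<le> measure N A * (\<integral>\<sigma>. indicator A \<sigma> * (L2norm M (h \<sigma>))\<^sup>2 \<partial>N)"
proof -
  note [measurable] = L2_measurable[OF h]
  have *: "integrable (N \<Otimes>\<^sub>M M) (case_prod (\<lambda>\<sigma> w. indicator A \<sigma> * (norm (h \<sigma> w))\<^sup>2))"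
    by (rule Bochner_Integration.integrable_bound[OF L2_integrable_square[OF h]])
      (auto simp: indicator_def)
  define k where "k w = measure N A * (\<integral>\<sigma>. indicator A \<sigma> * (norm (h \<sigma> w))\<^sup>2 \<partial>N)" for w
  have bd: "AE w in M. (norm (partial_integral N A h w))\<^sup>2 \<le> k w"
    using AE_slice_L2'[OF h]
  proof eventually_elim
    case (elim w)
    show ?case unfolding partial_integral_def k_def
      by (rule norm_integral_power2_le[OF _ elim A]) unfold_locales
  qed
  have k: "integrable M k" unfolding k_def using integrable_snd[OF *] by simp
  have int: "integrable M (\<lambda>w. (norm (partial_integral N A h w))\<^sup>2)"
    by (rule Bochner_Integration.integrable_bound[OF k]) (use bd in \<open>auto elim!: eventually_mono\<close>)
  then show "partial_integral N A h \<in> L2 M" by (simp add: L2_def)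
  have "(L2norm M (partial_integral N A h))\<^sup>2 \<le> (\<integral>w. k w \<partial>M)"
    unfolding L2norm_power2 by (rule integral_mono_AE[OF int k bd])
  also have "\<dots> = measure N A * (\<integral>\<sigma>. indicator A \<sigma> * (L2norm M (h \<sigma>))\<^sup>2 \<partial>N)"
    unfolding k_def using Fubini_integral[OF *] by (simp add: L2norm_power2)
  finally show "(L2norm M (partial_integral N A h))\<^sup>2 \<le> measure N A * (\<integral>\<sigma>. indicator A \<sigma> * (L2norm M (h \<sigma>))\<^sup>2 \<partial>N)" .
qed

lemma partial_integral_norm_le:
  assumes h: "case_prod h \<in> L2 (N \<Otimes>\<^sub>M M)" and A[measurable]: "A \<in> sets N"
  shows "L2norm M (partial_integral N A h) \<le> sqrt (measure N A) * L2norm (N \<Otimes>\<^sub>M M) (case_prod h)"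
proof (rule power2_le_imp_le)
  note [measurable] = L2_measurable[OF h]
  have "(\<integral>\<sigma>. indicator A \<sigma> * (L2norm M (h \<sigma>))\<^sup>2 \<partial>N) \<le> (\<integral>\<sigma>. (L2norm M (h \<sigma>))\<^sup>2 \<partial>N)"
    by (intro integral_mono_AE' integrable_slice_norm2(1)[OF h]) (auto simp: indicator_def)
  then have "measure N A * (\<integral>\<sigma>. indicator A \<sigma> * (L2norm M (h \<sigma>))\<^sup>2 \<partial>N) \<le> measure N A * (L2norm (N \<Otimes>\<^sub>M M) (case_prod h))\<^sup>2"
    unfolding integrable_slice_norm2(2)[OF h] by (intro mult_left_mono) auto
  with partial_integral_L2(2)[OF h A]
  show "(L2norm M (partial_integral N A h))\<^sup>2 \<le> (sqrt (measure N A) * L2norm (N \<Otimes>\<^sub>M M) (case_prod h))\<^sup>2"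
    by (simp add: power_mult_distrib)
qed simp

lemma partial_integral_norm_le_bound:
  assumes h: "case_prod h \<in> L2 (N \<Otimes>\<^sub>M M)" and A[measurable]: "A \<in> sets N"
    and bd: "AE \<sigma> in N. \<sigma> \<in> A \<longrightarrow> L2norm M (h \<sigma>) \<le> B" and "0 \<le> B"
  shows "L2norm M (partial_integral N A h) \<le> measure N A * B"
proof (rule power2_le_imp_le)
  note [measurable] = L2_measurable[OF h]
  have "(\<integral>\<sigma>. indicator A \<sigma> * (L2norm M (h \<sigma>))\<^sup>2 \<partial>N) \<le> (\<integral>\<sigma>. indicator A \<sigma> * B\<^sup>2 \<partial>N)"
  proof (rule integral_mono_AE')
    show "AE \<sigma> in N. indicator A \<sigma> * (L2norm M (h \<sigma>))\<^sup>2 \<le> indicator A \<sigma> * B\<^sup>2"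
      using bd by eventually_elim (auto simp: indicator_def power_mono)
  qed (auto simp: M1.emeasure_finite less_top[symmetric] intro!: integrable_mult_left)
  also have "\<dots> = measure N A * B\<^sup>2" by simp
  finally have "measure N A * (\<integral>\<sigma>. indicator A \<sigma> * (L2norm M (h \<sigma>))\<^sup>2 \<partial>N) \<le> measure N A * (measure N A * B\<^sup>2)"
    by (intro mult_left_mono) auto
  also have "\<dots> = (measure N A * B)\<^sup>2" by (simp add: power2_eq_square)
  finally show "(L2norm M (partial_integral N A h))\<^sup>2 \<le> (measure N A * B)\<^sup>2"
    using partial_integral_L2(2)[OF h A] by linarith
qed (use \<open>0 \<le> B\<close> in simp)

lemma partial_integral_diff:
  assumes "case_prod h \<in> L2 (N \<Otimes>\<^sub>M M)" "case_prod h' \<in> L2 (N \<Otimes>\<^sub>M M)" "A \<in> sets N"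
  shows "AE w in M. partial_integral N A (\<lambda>\<sigma> w. h \<sigma> w - h' \<sigma> w) w = partial_integral N A h w - partial_integral N A h' w"
  using AE_slice_integrable[OF assms(1,3)] AE_slice_integrable[OF assms(2,3)]
  by eventually_elim (simp add: partial_integral_def scaleR_diff_right)

lemma partial_integral_add:
  assumes "case_prod h \<in> L2 (N \<Otimes>\<^sub>M M)" "case_prod h' \<in> L2 (N \<Otimes>\<^sub>M M)" "A \<in> sets N"
  shows "AE w in M. partial_integral N A (\<lambda>\<sigma> w. h \<sigma> w + h' \<sigma> w) w = partial_integral N A h w + partial_integral N A h' w"
  using AE_slice_integrable[OF assms(1,3)] AE_slice_integrable[OF assms(2,3)]
  by eventually_elim (simp add: partial_integral_def scaleR_add_right)

lemma partial_integral_scaleR: "partial_integral N A (\<lambda>\<sigma> w. c *\<^sub>R h \<sigma> w) w = c *\<^sub>R partial_integral N A h w"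
  unfolding partial_integral_def scaleR_left_commute[of _ c] by (rule integral_scaleR_right)

text \<open>Fubini in the form that replaces duality: testing a time integral with a fixed
  \<open>q\<close> reduces vector-valued statements, such as Minkowski's inequality and the
  fundamental theorem of calculus, to scalar ones.\<close>

lemma partial_integral_inner:
  assumes h: "case_prod h \<in> L2 (N \<Otimes>\<^sub>M M)" and A[measurable]: "A \<in> sets N" and q: "q \<in> L2 M"
  shows "(\<integral>w. partial_integral N A h w \<bullet> q w \<partial>M) = (\<integral>\<sigma>. indicator A \<sigma> * (\<integral>w. h \<sigma> w \<bullet> q w \<partial>M) \<partial>N)"
proof -
  note [measurable] = L2_measurable[OF h] L2_measurable[OF q]
  have "case_prod (\<lambda>\<sigma> w. q w) \<in> L2 (N \<Otimes>\<^sub>M M)"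
    by (rule product_L2I[of _ "\<lambda>w. norm (q w)"]) (auto intro: L2_norm_real q)
  from L2_inner_integrable[OF h this]
  have "integrable (N \<Otimes>\<^sub>M M) (case_prod (\<lambda>\<sigma> w. h \<sigma> w \<bullet> q w))" by (simp add: case_prod_unfold)
  then have *: "integrable (N \<Otimes>\<^sub>M M) (case_prod (\<lambda>\<sigma> w. indicator A \<sigma> * (h \<sigma> w \<bullet> q w)))"
    by (rule Bochner_Integration.integrable_bound) (auto simp: indicator_def)
  have "(\<integral>w. partial_integral N A h w \<bullet> q w \<partial>M) = (\<integral>w. (\<integral>\<sigma>. indicator A \<sigma> * (h \<sigma> w \<bullet> q w) \<partial>N) \<partial>M)"
  proof (rule integral_cong_AE)
    show "AE w in M. partial_integral N A h w \<bullet> q w = (\<integral>\<sigma>. indicator A \<sigma> * (h \<sigma> w \<bullet> q w) \<partial>N)"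
      using AE_slice_integrable[OF h A]
    proof eventually_elim
      case (elim w)
      from integral_inner_left[OF elim, of "q w"] show ?case by (simp add: partial_integral_def)
    qed
  qed measurable
  also have "\<dots> = (\<integral>\<sigma>. (\<integral>w. indicator A \<sigma> * (h \<sigma> w \<bullet> q w) \<partial>M) \<partial>N)"
    by (rule Fubini_integral[OF *])
  finally show ?thesis by simp
qed

end

section \<open>Density of simple maps and the Bochner integral\<close>

text \<open>The product-space counterpart of \<open>L2_simple\<close>: finite sums of elements of
  \<open>L2 M\<close>, each cut off to a measurable set of times. Overlaps are allowed, so that
  addition is concatenation.\<close>

definition rect_simple :: "'a measure \<Rightarrow> 'w measure \<Rightarrow> ('a \<times> 'w \<Rightarrow> 'b::euclidean_space) set" where
  "rect_simple N M = {h. \<exists>(n::nat) A p. (\<forall>i<n. A i \<in> sets N \<and> p i \<in> L2 M) \<and>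
     h = (\<lambda>z. \<Sum>i<n. indicator (A i) (fst z) *\<^sub>R p i (snd z))}"

lemma sum_lessThan_append:
  fixes f :: "nat \<Rightarrow> 'c::comm_monoid_add"
  shows "(\<Sum>i<n + m. f i) = (\<Sum>i<n. f i) + (\<Sum>i<m. f (n + i))"
  by (induction m) (auto simp: add.assoc)

lemma rect_simple_add:
  assumes "h \<in> rect_simple N M" "k \<in> rect_simple N M"
  shows "(\<lambda>z. h z + k z) \<in> rect_simple N M"
proof -
  obtain n :: nat and A p where h: "\<forall>i<n. A i \<in> sets N \<and> p i \<in> L2 M" "h = (\<lambda>z. \<Sum>i<n. indicator (A i) (fst z) *\<^sub>R p i (snd z))"
    using assms(1) unfolding rect_simple_def by blast
  obtain m :: nat and B q where k: "\<forall>i<m. B i \<in> sets N \<and> q i \<in> L2 M" "k = (\<lambda>z. \<Sum>i<m. indicator (B i) (fst z) *\<^sub>R q i (snd z))"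
    using assms(2) unfolding rect_simple_def by blast
  define C where "C i = (if i < n then A i else B (i - n))" for i
  define r where "r i = (if i < n then p i else q (i - n))" for i
  have "\<forall>i<n+m. C i \<in> sets N \<and> r i \<in> L2 M" unfolding C_def r_def using h(1) k(1) by auto
  moreover have "h z + k z = (\<Sum>i<n+m. indicator (C i) (fst z) *\<^sub>R r i (snd z))" for z
    unfolding h k sum_lessThan_append by (simp add: C_def r_def)
  ultimately show ?thesis unfolding rect_simple_def by blast
qed

context pair_finite_measure
begin

lemma rect_simple_L2:
  fixes H :: "'a \<times> 'w \<Rightarrow> 'b::euclidean_space"
  assumes "H \<in> rect_simple N M" shows "H \<in> L2 (N \<Otimes>\<^sub>M M)"
proof -
  obtain n :: nat and A p where h: "\<forall>i<n. A i \<in> sets N \<and> p i \<in> L2 M" "H = (\<lambda>z. \<Sum>i<n. indicator (A i) (fst z) *\<^sub>R p i (snd z))"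
    using assms(1) unfolding rect_simple_def by blast
  have "case_prod (\<lambda>\<sigma> w. indicator (A i) \<sigma> *\<^sub>R p i w) \<in> L2 (N \<Otimes>\<^sub>M M)" if "i < n" for i
  proof (rule product_L2I)
    have [measurable]: "A i \<in> sets N" "p i \<in> borel_measurable M" using h(1) that L2_measurable by auto
    show "case_prod (\<lambda>\<sigma> w. indicator (A i) \<sigma> *\<^sub>R p i w) \<in> borel_measurable (N \<Otimes>\<^sub>M M)" by measurable
    show "(\<lambda>w. norm (p i w)) \<in> L2 M" using h(1) that by (intro L2_norm_real) auto
  qed (auto simp: indicator_def)
  then show ?thesis unfolding h(2) by (intro L2_sum) (auto simp: case_prod_unfold)
qed

definition approximable :: "('a \<times> 'w \<Rightarrow> 'b::euclidean_space) \<Rightarrow> bool" where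
  "approximable h \<longleftrightarrow> h \<in> L2 (N \<Otimes>\<^sub>M M) \<and> (\<forall>e>0. \<exists>H\<in>rect_simple N M. L2dist (N \<Otimes>\<^sub>M M) h H < e)"

lemma approximable_add:
  fixes h k :: "'a \<times> 'w \<Rightarrow> 'b::euclidean_space"
  assumes "approximable h" "approximable k" shows "approximable (\<lambda>z. h z + k z)"
  unfolding approximable_def
proof (intro conjI allI impI)
  show "(\<lambda>z. h z + k z) \<in> L2 (N \<Otimes>\<^sub>M M)" using assms by (auto simp: approximable_def intro: L2_add)
  fix e :: real assume "e > 0"
  then have "e/2 > 0" by simp
  obtain H K where HK: "H \<in> rect_simple N M" "L2dist (N \<Otimes>\<^sub>M M) h H < e/2"
    "K \<in> rect_simple N M" "L2dist (N \<Otimes>\<^sub>M M) k K < e/2"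
    using assms \<open>e/2 > 0\<close> unfolding approximable_def by blast
  have "L2norm (N \<Otimes>\<^sub>M M) (\<lambda>z. (h z - H z) + (k z - K z)) \<le>
      L2dist (N \<Otimes>\<^sub>M M) h H + L2dist (N \<Otimes>\<^sub>M M) k K"
    using assms by (intro L2norm_triangle L2_diff rect_simple_L2[OF HK(1)] rect_simple_L2[OF HK(3)])
      (simp_all add: approximable_def)
  then have "L2norm (N \<Otimes>\<^sub>M M) (\<lambda>z. (h z + k z) - (H z + K z)) < e" using HK by (simp add: algebra_simps)
  then show "\<exists>H\<in>rect_simple N M. L2norm (N \<Otimes>\<^sub>M M) (\<lambda>z. (h z + k z) - H z) < e"
    by (intro bexI[OF _ rect_simple_add[OF HK(1,3)]])
qed

lemma approximable_zero: "approximable (\<lambda>z. 0)"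
proof -
  have "(\<lambda>z. 0) \<in> rect_simple N M" unfolding rect_simple_def by (auto intro!: exI[of _ 0])
  then show ?thesis unfolding approximable_def by (force intro: L2_zero)
qed

lemma approximable_sum:
  fixes h :: "'i \<Rightarrow> 'a \<times> 'w \<Rightarrow> 'b::euclidean_space"
  shows "(\<And>i. i \<in> I \<Longrightarrow> approximable (h i)) \<Longrightarrow> approximable (\<lambda>z. \<Sum>i\<in>I. h i z)"
  by (induction I rule: infinite_finite_induct) (auto intro: approximable_zero approximable_add)

lemma approximable_limit:
  fixes h :: "'a \<times> 'w \<Rightarrow> 'b::euclidean_space"
  assumes k: "\<And>n. approximable (k n)" and h: "h \<in> L2 (N \<Otimes>\<^sub>M M)"
    and lim: "(\<lambda>n. L2dist (N \<Otimes>\<^sub>M M) (k n) h) \<longlonglongrightarrow> 0"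
  shows "approximable h"
  unfolding approximable_def
proof (intro conjI allI impI h)
  fix e :: real assume "e > 0"
  then have "e/2 > 0" by simp
  obtain n where n: "L2dist (N \<Otimes>\<^sub>M M) (k n) h < e/2"
    using LIMSEQ_D[OF lim \<open>e/2 > 0\<close>] by auto
  obtain H where H: "H \<in> rect_simple N M" "L2dist (N \<Otimes>\<^sub>M M) (k n) H < e/2"
    using k[of n] \<open>e/2 > 0\<close> unfolding approximable_def by blast
  have "L2dist (N \<Otimes>\<^sub>M M) h H < e"
    using L2norm_triangle_diff[OF h _ rect_simple_L2[OF H(1)], of "k n"] n H(2) k[of n]
      L2norm_minus_commute[of "N \<Otimes>\<^sub>M M" h "k n"]
    by (simp add: approximable_def)
  then show "\<exists>H\<in>rect_simple N M. L2dist (N \<Otimes>\<^sub>M M) h H < e" using H(1) by blast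
qed

lemma indicator_L2:
  fixes v :: "'b::euclidean_space"
  assumes "S \<in> sets (N \<Otimes>\<^sub>M M)" shows "(\<lambda>z. indicator S z *\<^sub>R v) \<in> L2 (N \<Otimes>\<^sub>M M)"
  by (rule L2_indicator[OF L2_const assms]) (rule P.finite_measure_axioms)

lemma approximable_Times:
  fixes v :: "'b::euclidean_space"
  assumes "A \<in> sets N" "B \<in> sets M"
  shows "approximable (\<lambda>z. indicator (A \<times> B) z *\<^sub>R v)"
proof -
  have "(\<lambda>w. indicator B w *\<^sub>R v) \<in> L2 M"
    by (rule L2_indicator[OF L2_const assms(2)]) (rule M2.finite_measure_axioms)
  then have "(\<lambda>z. \<Sum>i<(1::nat). indicator A (fst z) *\<^sub>R (indicator B (snd z) *\<^sub>R v)) \<in> rect_simple N M"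
    unfolding rect_simple_def using assms(1)
    by (intro CollectI exI[of _ 1] exI[of _ "\<lambda>i. A"] exI[of _ "\<lambda>i w. indicator B w *\<^sub>R v"]) auto
  also have "(\<lambda>z. \<Sum>i<(1::nat). indicator A (fst z) *\<^sub>R (indicator B (snd z) *\<^sub>R v)) = (\<lambda>z. indicator (A \<times> B) z *\<^sub>R v)"
    by (auto simp: fun_eq_iff indicator_times)
  finally have R: "(\<lambda>z. indicator (A \<times> B) z *\<^sub>R v) \<in> rect_simple N M" .
  show ?thesis unfolding approximable_def
    by (intro conjI allI impI rect_simple_L2[OF R] bexI[OF _ R]) simp
qed

text \<open>Dynkin's argument from rectangles: complements are reached because the whole space is
  itself a rectangle of finite measure, disjoint unions by dominated convergence of the finite
  unions.\<close>

lemma approximable_indicator: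
  fixes v :: "'b::euclidean_space"
  assumes "S \<in> sets (N \<Otimes>\<^sub>M M)"
  shows "approximable (\<lambda>z. indicator S z *\<^sub>R v)"
proof -
  let ?G = "{a \<times> b |a b. a \<in> sets N \<and> b \<in> sets M}"
  \<comment> \<open>The vector is quantified inside the induction because the complement of
    \<open>S\<close> uses the claim for \<open>S\<close> with \<open>- v\<close>.\<close>
  have "\<forall>v::'b. approximable (\<lambda>z. indicator S z *\<^sub>R v)"
    using Int_stable_pair_measure_generator[of N M] pair_measure_closed[of N M] assms[unfolded sets_pair_measure]
  proof (induction S rule: sigma_sets_induct_disjoint)
    case (basic S)
    then show ?case using approximable_Times by auto
  next
    case empty
    then show ?case by (simp add: approximable_zero)
  next
    case (compl S)
    show ?case
    proof
      fix v :: 'b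
      have "approximable (\<lambda>z. indicator (space N \<times> space M) z *\<^sub>R v + indicator S z *\<^sub>R (- v))"
        by (intro approximable_add approximable_Times compl(2)[rule_format]) auto
      moreover have "S \<subseteq> space N \<times> space M"
        using compl(1) sets.sets_into_space[of S "N \<Otimes>\<^sub>M M"] by (simp add: sets_pair_measure space_pair_measure)
      then have "indicator (space N \<times> space M) z *\<^sub>R v + indicator S z *\<^sub>R (- v) = indicator (space N \<times> space M - S) z *\<^sub>R v" for z
        by (auto simp: indicator_def)
      ultimately show "approximable (\<lambda>z. indicator (space N \<times> space M - S) z *\<^sub>R v)" by simp
    qed
  next
    case (union A)
    then have A [measurable]: "A i \<in> sets (N \<Otimes>\<^sub>M M)" for i by (auto simp: sets_pair_measure)
    show ?case
    proof
      fix v :: 'b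
      have fin: "approximable (\<lambda>z. indicator (\<Union>i<n. A i) z *\<^sub>R v)" for n :: nat
      proof -
        have "approximable (\<lambda>z. \<Sum>i<n. indicator (A i) z *\<^sub>R v)"
          by (intro approximable_sum) (use union in auto)
        moreover have "disjoint_family_on A {..<n}" using union(1) by (auto simp: disjoint_family_on_def)
        then have "indicator (\<Union>i<n. A i) z = (\<Sum>i<n. indicator (A i) z :: real)" for z
          by (rule indicator_UN_disjoint[rotated]) simp
        ultimately show ?thesis by (simp add: scaleR_sum_left)
      qed
      show "approximable (\<lambda>z. indicator (\<Union>i. A i) z *\<^sub>R v)"
      proof (rule approximable_limit[OF fin])
        show "(\<lambda>z. indicator (\<Union>i. A i) z *\<^sub>R v) \<in> L2 (N \<Otimes>\<^sub>M M)" by (intro indicator_L2) measurable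
        show "(\<lambda>n. L2norm (N \<Otimes>\<^sub>M M) (\<lambda>z. indicator (\<Union>i<n. A i) z *\<^sub>R v - indicator (\<Union>i. A i) z *\<^sub>R v)) \<longlonglongrightarrow> 0"
        proof (rule L2_dominated_convergence)
          show "(\<lambda>z. norm v) \<in> L2 (N \<Otimes>\<^sub>M M)" by (rule L2_const) (rule P.finite_measure_axioms)
          show "AE z in N \<Otimes>\<^sub>M M. (\<lambda>n. indicator (\<Union>i<n. A i) z *\<^sub>R v) \<longlonglongrightarrow> indicator (\<Union>i. A i) z *\<^sub>R v"
            by (intro AE_I2 tendsto_scaleR LIMSEQ_indicator_UN tendsto_const)
          show "AE z in N \<Otimes>\<^sub>M M. norm (indicator (\<Union>i<n. A i) z *\<^sub>R v) \<le> norm v" for n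
            by (auto simp: indicator_def)
        qed measurable
      qed
    qed
  qed
  then show ?thesis by blast
qed

text \<open>Measurable simple functions bounded by twice the norm of \<open>h\<close> converge in L2
  by domination; each of them is a finite sum over its level sets, to which the indicator case
  applies.\<close>

theorem L2_approximable:
  fixes h :: "'a \<times> 'w \<Rightarrow> 'b::euclidean_space"
  assumes h: "h \<in> L2 (N \<Otimes>\<^sub>M M)"
  shows "approximable h"
proof -
  obtain F where F': "\<forall>i. simple_function (N \<Otimes>\<^sub>M M) (F i)"
    "\<forall>z\<in>space (N \<Otimes>\<^sub>M M). (\<lambda>i. F i z) \<longlonglongrightarrow> h z"
    "\<forall>i. \<forall>z\<in>space (N \<Otimes>\<^sub>M M). dist (F i z) 0 \<le> 2 * dist (h z) 0"
    using borel_measurable_implies_sequence_metric[OF L2_measurable[OF h], of 0] by blast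
  note F = F'(1)[rule_format] F'(2)[rule_format] F'(3)[rule_format, unfolded dist_norm diff_zero]
  have Fm [measurable]: "F i \<in> borel_measurable (N \<Otimes>\<^sub>M M)" for i
    by (rule borel_measurable_simple_function[OF F(1)])
  note [measurable] = L2_measurable[OF h]
  have m: "(\<lambda>z. 2 *\<^sub>R norm (h z)) \<in> L2 (N \<Otimes>\<^sub>M M)" by (intro L2_scaleR L2_norm_real h)
  have bd: "AE z in N \<Otimes>\<^sub>M M. norm (F i z) \<le> 2 *\<^sub>R norm (h z)" for i
    using F(3) by (intro AE_I2) auto
  have approx: "approximable (F i)" for i
  proof -
    let ?h = "\<lambda>z. \<Sum>v\<in>F i ` space (N \<Otimes>\<^sub>M M). indicator (F i -` {v} \<inter> space (N \<Otimes>\<^sub>M M)) z *\<^sub>R v"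
    have a: "approximable ?h"
      using F(1)[of i] by (intro approximable_sum approximable_indicator) (auto simp: simple_function_def)
    have eq: "?h z = F i z" if "z \<in> space (N \<Otimes>\<^sub>M M)" for z
    proof -
      have "?h z = (\<Sum>v\<in>F i ` space (N \<Otimes>\<^sub>M M). if v = F i z then v else 0)"
        by (intro sum.cong) (use that in \<open>auto simp: indicator_def\<close>)
      then show ?thesis using that F(1)[of i] by (simp add: simple_function_def sum.delta)
    qed
    have F2: "F i \<in> L2 (N \<Otimes>\<^sub>M M)"
      by (rule L2_bound[OF m Fm]) (use bd[of i] in \<open>auto elim!: eventually_mono\<close>)
    have "L2norm (N \<Otimes>\<^sub>M M) (\<lambda>z. ?h z - F i z) = L2norm (N \<Otimes>\<^sub>M M) (\<lambda>z. 0 :: 'b)"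
      unfolding L2norm_def by (intro arg_cong[of _ _ sqrt] Bochner_Integration.integral_cong) (auto simp: eq)
    then have "(\<lambda>n::nat. L2norm (N \<Otimes>\<^sub>M M) (\<lambda>z. ?h z - F i z)) \<longlonglongrightarrow> 0" by simp
    from approximable_limit[OF a F2 this] show ?thesis .
  qed
  show ?thesis
    by (rule approximable_limit[OF approx h], rule L2_dominated_convergence[OF Fm _ m AE_I2 bd])
      (use F(2) in auto)
qed

text \<open>Convergence in the product says nothing about individual times, hence the passage to a
  subsequence; both modes of convergence enter the definition of the Bochner integral.\<close>

lemma rect_simple_sequence:
  assumes h: "case_prod h \<in> L2 (N \<Otimes>\<^sub>M M)"
  shows "\<exists>H. (\<forall>k. H k \<in> rect_simple N M) \<and>
    (\<lambda>k. L2dist (N \<Otimes>\<^sub>M M) (case_prod h) (H k)) \<longlonglongrightarrow> 0 \<and>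
    (AE \<sigma> in N. (\<lambda>k. L2norm M (\<lambda>w. h \<sigma> w - H k (\<sigma>, w))) \<longlonglongrightarrow> 0)"
proof -
  have "\<exists>H\<in>rect_simple N M. L2dist (N \<Otimes>\<^sub>M M) (case_prod h) H < inverse (real (Suc k))" for k
    using L2_approximable[OF h] unfolding approximable_def by simp
  then obtain H where H: "\<And>k. H k \<in> rect_simple N M"
    "\<And>k. L2dist (N \<Otimes>\<^sub>M M) (case_prod h) (H k) < inverse (real (Suc k))" by metis
  have HL: "\<And>k. H k \<in> L2 (N \<Otimes>\<^sub>M M)" by (rule rect_simple_L2[OF H(1)])
  have lim: "(\<lambda>k. L2dist (N \<Otimes>\<^sub>M M) (case_prod h) (H k)) \<longlonglongrightarrow> 0"
    by (rule tendsto_sandwich[OF _ _ tendsto_const LIMSEQ_inverse_real_of_nat]) (use less_imp_le[OF H(2)] in auto)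
  define d where "d k \<sigma> = L2norm M (\<lambda>w. h \<sigma> w - H k (\<sigma>, w))" for k \<sigma>
  have D: "case_prod (\<lambda>\<sigma> w. h \<sigma> w - H k (\<sigma>, w)) \<in> L2 (N \<Otimes>\<^sub>M M)" for k
    using L2_diff[OF h HL[of k]] by (simp add: case_prod_unfold)
  have d: "d k \<in> L2 N" "L2norm N (d k) = L2dist (N \<Otimes>\<^sub>M M) (case_prod h) (H k)" for k
    using slice_norm_L2[OF D[of k]] unfolding d_def by (simp_all add: case_prod_unfold)
  obtain r where r: "strict_mono r" "AE \<sigma> in N. (\<lambda>k. d (r k) \<sigma>) \<longlonglongrightarrow> 0"
    using L2_tendsto_AE_subseq[of d N "\<lambda>_. 0", OF d(1) L2_zero] d(2) lim by auto
  show ?thesis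
    by (intro exI[of _ "\<lambda>k. H (r k)"] conjI allI H(1) r(2)[unfolded d_def])
      (use LIMSEQ_subseq_LIMSEQ[OF lim r(1)] in \<open>simp add: o_def\<close>)
qed

end

lemma pair_finite_measure_Icc: "finite_measure M \<Longrightarrow> pair_finite_measure (lebesgue_on {a..b::real}) M"
  unfolding pair_finite_measure_def by (simp add: finite_measure_lebesgue_on)

lemma partial_integral_sum_indicator:
  assumes "finite_measure N" "\<And>i. i < n \<Longrightarrow> A i \<in> sets N"
  shows "partial_integral N (space N) (\<lambda>\<sigma> w. \<Sum>i<n. indicator (A i) \<sigma> *\<^sub>R p i w) =
    (\<lambda>w. \<Sum>i<(n::nat). measure N (A i) *\<^sub>R (p i w :: 'b::euclidean_space))"
proof
  fix w
  interpret finite_measure N by fact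
  have "partial_integral N (space N) (\<lambda>\<sigma> w. \<Sum>i<n. indicator (A i) \<sigma> *\<^sub>R p i w) w =
    (\<integral>\<sigma>. (\<Sum>i<n. indicator (A i) \<sigma> *\<^sub>R p i w) \<partial>N)"
    unfolding partial_integral_def by (intro Bochner_Integration.integral_cong) auto
  also have "\<dots> = (\<Sum>i<n. \<integral>\<sigma>. indicator (A i) \<sigma> *\<^sub>R p i w \<partial>N)"
    by (intro Bochner_Integration.integral_sum integrable_scaleR_left)
      (use assms(2) in \<open>auto simp: emeasure_finite less_top[symmetric]\<close>)
  also have "\<dots> = (\<Sum>i<n. measure N (A i) *\<^sub>R p i w)"
    using assms(2) by (intro sum.cong) (auto simp: emeasure_finite less_top[symmetric])
  finally show "partial_integral N (space N) (\<lambda>\<sigma> w. \<Sum>i<n. indicator (A i) \<sigma> *\<^sub>R p i w) w =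
    (\<Sum>i<n. measure N (A i) *\<^sub>R p i w)" .
qed

lemma rect_simple_iff_L2_simple:
  fixes H :: "real \<Rightarrow> 'w \<Rightarrow> 'b::euclidean_space"
  assumes "finite_measure M"
  shows "case_prod H \<in> rect_simple (lebesgue_on {a..b}) M \<and> Y = partial_integral (lebesgue_on {a..b}) {a..b} H
    \<longleftrightarrow> L2_simple M {a..b} H Y"
proof -
  interpret pair_finite_measure "lebesgue_on {a..b}" M by (rule pair_finite_measure_Icc) fact
  have sets: "A \<in> sets (lebesgue_on {a..b}) \<longleftrightarrow> A \<in> lmeasurable \<and> A \<subseteq> {a..b}" for A
    using fmeasurableI2[of "{a..b}" lebesgue A] by (auto simp: sets_restrict_space_iff)
  have Y: "partial_integral (lebesgue_on {a..b}) {a..b} (\<lambda>\<sigma> w. \<Sum>i<n. indicator (A i) \<sigma> *\<^sub>R p i w) =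
      (\<lambda>w. \<Sum>i<n. measure lebesgue (A i) *\<^sub>R (p i w :: 'b))"
    if "\<forall>i<n. A i \<in> lmeasurable \<and> A i \<subseteq> {a..b} \<and> p i \<in> L2 M" for n :: nat and A and p :: "nat \<Rightarrow> 'w \<Rightarrow> 'b"
    using partial_integral_sum_indicator[OF M1.finite_measure_axioms, of n A p] that
    by (auto simp: sets measure_restrict_space intro!: sum.cong)
  show ?thesis
  proof
    assume *: "case_prod H \<in> rect_simple (lebesgue_on {a..b}) M \<and> Y = partial_integral (lebesgue_on {a..b}) {a..b} H"
    then obtain n :: nat and A p where h: "\<forall>i<n. A i \<in> sets (lebesgue_on {a..b}) \<and> p i \<in> L2 M"
      "case_prod H = (\<lambda>z. \<Sum>i<n. indicator (A i) (fst z) *\<^sub>R p i (snd z))"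
      unfolding rect_simple_def by blast
    have H: "H = (\<lambda>\<sigma> w. \<Sum>i<n. indicator (A i) \<sigma> *\<^sub>R p i w)"
      using h(2) by (auto simp: fun_eq_iff split_beta)
    show "L2_simple M {a..b} H Y"
      unfolding L2_simple_def
      using h(1) * Y[of n A p] unfolding sets H by blast
  next
    assume "L2_simple M {a..b} H Y"
    then obtain n :: nat and A p where h: "\<forall>i<n. A i \<in> lmeasurable \<and> A i \<subseteq> {a..b} \<and> p i \<in> L2 M"
      "H = (\<lambda>\<sigma> w. \<Sum>i<n. indicator (A i) \<sigma> *\<^sub>R p i w)"
      "Y = (\<lambda>w. \<Sum>i<n. measure lebesgue (A i) *\<^sub>R p i w)"
      unfolding L2_simple_def by blast
    have "case_prod H = (\<lambda>z. \<Sum>i<n. indicator (A i) (fst z) *\<^sub>R p i (snd z))"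
      unfolding h by (auto simp: fun_eq_iff split_beta)
    then show "case_prod H \<in> rect_simple (lebesgue_on {a..b}) M \<and> Y = partial_integral (lebesgue_on {a..b}) {a..b} H"
      using h(1) Y[of n A p] unfolding rect_simple_def h(2,3) sets by auto
  qed
qed

text \<open>Simple maps that approximate \<open>h\<close> in the product meet both requirements of
  the Bochner integral: by Cauchy-Schwarz in time, the mean error and the error of the integrals are
  at most \<open>C * e k\<close>, with \<open>C\<close> the square root of the measure of the
  interval.\<close>

lemma has_L2_integral_partial_integral:
  fixes h :: "real \<Rightarrow> 'w \<Rightarrow> 'b::euclidean_space"
  assumes M: "finite_measure M" and h: "case_prod h \<in> L2 (lebesgue_on {a..b} \<Otimes>\<^sub>M M)"
  shows "has_L2_integral M h {a..b} (partial_integral (lebesgue_on {a..b}) {a..b} h)"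
proof -
  let ?N = "lebesgue_on {a..b}"
  interpret pair_finite_measure ?N M by (rule pair_finite_measure_Icc) fact
  obtain H' where H': "\<And>k. H' k \<in> rect_simple ?N M"
    "(\<lambda>k. L2dist (?N \<Otimes>\<^sub>M M) (case_prod h) (H' k)) \<longlonglongrightarrow> 0"
    "AE \<sigma> in ?N. (\<lambda>k. L2norm M (\<lambda>w. h \<sigma> w - H' k (\<sigma>, w))) \<longlonglongrightarrow> 0"
    using rect_simple_sequence[OF h] by blast
  define H where "H k \<sigma> w = H' k (\<sigma>, w)" for k \<sigma> w
  have HH: "case_prod (H k) = H' k" for k by (auto simp: H_def)
  define e where "e k = L2dist (?N \<Otimes>\<^sub>M M) (case_prod h) (H' k)" for k
  have sp: "{a..b} \<in> sets ?N" by (simp add: sets_restrict_space_iff)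
  have HL: "case_prod (H k) \<in> L2 (?N \<Otimes>\<^sub>M M)" for k unfolding HH by (rule rect_simple_L2[OF H'(1)])
  have D: "case_prod (\<lambda>\<sigma> w. h \<sigma> w - H k \<sigma> w) \<in> L2 (?N \<Otimes>\<^sub>M M)" for k
    using L2_diff[OF h HL[of k]] by (simp add: case_prod_unfold)
  have e: "L2norm (?N \<Otimes>\<^sub>M M) (case_prod (\<lambda>\<sigma> w. h \<sigma> w - H k \<sigma> w)) = e k" for k
    by (simp add: e_def HH[symmetric] case_prod_unfold)
  define C where "C = sqrt (measure ?N {a..b})"
  have lim: "(\<lambda>k. C * e k) \<longlonglongrightarrow> 0"
    using tendsto_mult_right_zero[OF H'(2), of C] by (simp add: e_def)
  have Y: "L2norm M (\<lambda>w. partial_integral ?N {a..b} (H k) w - partial_integral ?N {a..b} h w) \<le> C * e k" for k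
  proof -
    have "L2norm M (\<lambda>w. partial_integral ?N {a..b} (H k) w - partial_integral ?N {a..b} h w) =
      L2norm M (partial_integral ?N {a..b} (\<lambda>\<sigma> w. h \<sigma> w - H k \<sigma> w))"
      using partial_integral_diff[OF h HL[of k] sp]
        L2_measurable[OF partial_integral_L2(1)[OF h sp]] L2_measurable[OF partial_integral_L2(1)[OF HL[of k] sp]]
        L2_measurable[OF partial_integral_L2(1)[OF D[of k] sp]]
      by (intro L2norm_cong_AE) (auto simp: norm_minus_commute elim!: eventually_mono)
    also have "\<dots> \<le> C * e k"
      using partial_integral_norm_le[OF D[of k] sp] unfolding e C_def by simp
    finally show ?thesis .
  qed
  have nn: "(\<integral>\<^sup>+\<sigma>. ennreal (L2dist M (h \<sigma>) (H k \<sigma>)) \<partial>?N) \<le> ennreal (C * e k)" for k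
  proof -
    let ?d = "\<lambda>\<sigma>. L2dist M (h \<sigma>) (H k \<sigma>)"
    have d: "?d \<in> L2 ?N" "L2norm ?N ?d = e k" using slice_norm_L2[OF D[of k]] unfolding e by auto
    have "integrable ?N ?d"
      by (rule M1.square_integrable_imp_integrable) (use L2_integrable_square[OF d(1)] L2_measurable[OF d(1)] in auto)
    then have "(\<integral>\<^sup>+\<sigma>. ennreal (?d \<sigma>) \<partial>?N) = ennreal (\<integral>\<sigma>. ?d \<sigma> \<partial>?N)"
      by (intro nn_integral_eq_integral) auto
    also have "(\<integral>\<sigma>. ?d \<sigma> \<partial>?N) = (\<integral>\<sigma>. ?d \<sigma> \<bullet> 1 \<partial>?N)" by simp
    also have "\<dots> \<le> L2norm ?N ?d * L2norm ?N (\<lambda>_. 1 :: real)"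
      using L2_Cauchy_Schwarz[OF d(1) L2_const[OF M1.finite_measure_axioms, of "1::real"]] by linarith
    also have "L2norm ?N (\<lambda>_. 1 :: real) = C" by (simp add: L2norm_def C_def)
    finally show ?thesis using d(2) by (simp add: mult.commute ennreal_leI)
  qed
  show ?thesis
    unfolding has_L2_integral_def
  proof (intro conjI exI[of _ H] exI[of _ "\<lambda>k. partial_integral ?N {a..b} (H k)"] allI)
    show "partial_integral ?N {a..b} h \<in> L2 M" by (rule partial_integral_L2(1)[OF h sp])
    show "AE \<sigma> in ?N. h \<sigma> \<in> L2 M" by (rule AE_slice_L2[OF h])
    show "L2_simple M {a..b} (H k) (partial_integral ?N {a..b} (H k))" for k
      using rect_simple_iff_L2_simple[OF M, of "H k" a b] H'(1)[of k] unfolding HH by blast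
    show "AE \<sigma> in ?N. (\<lambda>k. L2dist M (h \<sigma>) (H k \<sigma>)) \<longlonglongrightarrow> 0"
      using H'(3) by (simp add: H_def)
    show "(\<lambda>k. \<integral>\<^sup>+\<sigma>. ennreal (L2dist M (h \<sigma>) (H k \<sigma>)) \<partial>?N) \<longlonglongrightarrow> 0"
      by (rule tendsto_sandwich[OF _ _ tendsto_const tendsto_ennrealI[OF lim, simplified]]) (use nn in auto)
    show "(\<lambda>k. L2norm M (\<lambda>w. partial_integral ?N {a..b} (H k) w - partial_integral ?N {a..b} h w)) \<longlonglongrightarrow> 0"
      by (rule tendsto_sandwich[OF _ _ tendsto_const lim]) (use Y in auto)
  qed
qed

section \<open>Real functions of one variable\<close>

lemma negligible_open_superset:
  assumes "negligible Z" "0 < \<delta>"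
  obtains W :: "real set" where "open W" "Z \<subseteq> W" "emeasure lebesgue W < ennreal \<delta>"
proof -
  have Z: "Z \<in> null_sets lebesgue" using assms(1) by (simp add: negligible_iff_null_sets)
  then have Zs: "Z \<in> sets lebesgue" by auto
  obtain W where W: "open W" "Z \<subseteq> W" "W - Z \<in> lmeasurable" "emeasure lebesgue (W - Z) < ennreal \<delta>"
    using sets_lebesgue_outer_open[OF Zs assms(2)] by blast
  have "emeasure lebesgue (W - Z) = emeasure lebesgue W"
    by (rule emeasure_Diff_null_set[OF Z]) (use W(1) in simp)
  then show thesis using W by (intro that[of W]) auto
qed

text \<open>Fundamental theorem for absolutely continuous functions, proved with gauges. Off
  \<open>Z\<close> differentiability controls the Riemann sums; at tags in \<open>Z\<close> the
  integrand is 0, and the increments of \<open>F\<close> are small in total because the intervals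
  lie in an open set of small measure.\<close>

lemma absolutely_continuous_has_integral_derivative:
  fixes F g :: "real \<Rightarrow> real"
  assumes "a \<le> b"
    and ac: "\<And>\<epsilon>. \<epsilon> > 0 \<Longrightarrow> \<exists>\<delta>>0. \<forall>(n::nat) u v. (\<forall>i<n. a \<le> u i \<and> u i \<le> v i \<and> v i \<le> b) \<and>
        disjoint_family_on (\<lambda>i. {u i<..<v i}) {..<n} \<and> (\<Sum>i<n. v i - u i) < \<delta>
        \<longrightarrow> (\<Sum>i<n. \<bar>F (v i) - F (u i)\<bar>) < \<epsilon>"
    and Z: "negligible Z"
    and der: "\<And>\<tau>. \<tau> \<in> {a..b} - Z \<Longrightarrow> (F has_vector_derivative g \<tau>) (at \<tau> within {a..b})"
  shows "((\<lambda>\<tau>. if \<tau> \<in> Z then 0 else g \<tau>) has_integral (F b - F a)) {a..b}"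
  unfolding has_integral_real
proof (intro allI impI)
  fix e :: real assume "e > 0"
  \<comment> \<open>The summand 2 keeps the denominator positive when \<open>a = b\<close>; tags off
    \<open>Z\<close> contribute at most \<open>e1 * (b - a)\<close>, which is below
    \<open>e / 2\<close>.\<close>
  define e1 where "e1 = e / (2 * (b - a) + 2)"
  have "e1 > 0" using \<open>e > 0\<close> \<open>a \<le> b\<close> by (simp add: e1_def)
  have e1: "e1 * (b - a) < e / 2" using \<open>e > 0\<close> \<open>a \<le> b\<close> by (simp add: e1_def field_simps)
  obtain \<delta> where "\<delta> > 0" and \<delta>: "\<And>(n::nat) u v. (\<forall>i<n. a \<le> u i \<and> u i \<le> v i \<and> v i \<le> b) \<Longrightarrow>
        disjoint_family_on (\<lambda>i. {u i<..<v i}) {..<n} \<Longrightarrow> (\<Sum>i<n. v i - u i) < \<delta>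
        \<Longrightarrow> (\<Sum>i<n. \<bar>F (v i) - F (u i)\<bar>) < e / 2"
    using ac[of "e/2"] \<open>e > 0\<close> by auto
  \<comment> \<open>The gauge will keep the intervals of tags in \<open>Z\<close> inside
    \<open>W\<close>, so that their total length stays below the \<open>\<delta>\<close> of absolute
    continuity.\<close>
  obtain W where W: "open W" "Z \<subseteq> W" "emeasure lebesgue W < ennreal \<delta>"
    by (rule negligible_open_superset[OF Z \<open>\<delta> > 0\<close>])
  have "\<exists>d>0. (x \<in> {a..b} - Z \<longrightarrow> (\<forall>y\<in>{a..b}. norm (y-x) < d \<longrightarrow> norm (F y - F x - (y-x) *\<^sub>R g x) \<le> e1 * norm (y-x))) \<and>
      (x \<in> Z \<longrightarrow> ball x d \<subseteq> W)" for x
  proof (cases "x \<in> Z")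
    case True
    then obtain d where "d > 0" "ball x d \<subseteq> W" using W(1,2) by (meson openE subsetD)
    then show ?thesis using True by blast
  next
    case False
    show ?thesis
    proof (cases "x \<in> {a..b}")
      case True
      then have "(F has_vector_derivative g x) (at x within {a..b})" using der False by blast
      then obtain d where "d > 0" "\<forall>y\<in>{a..b}. norm (y-x) < d \<longrightarrow> norm (F y - F x - (y-x) *\<^sub>R g x) \<le> e1 * norm (y-x)"
        unfolding has_vector_derivative_def has_derivative_within_alt using \<open>e1 > 0\<close> by blast
      then show ?thesis using False by blast
    qed (use False in \<open>auto intro: exI[of _ 1]\<close>)
  qed
  then have "\<exists>d. \<forall>x. 0 < d x \<and> (x \<in> {a..b} - Z \<longrightarrow> (\<forall>y\<in>{a..b}. norm (y-x) < d x \<longrightarrow> norm (F y - F x - (y-x) *\<^sub>R g x) \<le> e1 * norm (y-x))) \<and>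
      (x \<in> Z \<longrightarrow> ball x (d x) \<subseteq> W)" by (intro choice allI)
  then obtain d where dd: "\<forall>x. 0 < d x \<and> (x \<in> {a..b} - Z \<longrightarrow> (\<forall>y\<in>{a..b}. norm (y-x) < d x \<longrightarrow> norm (F y - F x - (y-x) *\<^sub>R g x) \<le> e1 * norm (y-x))) \<and>
      (x \<in> Z \<longrightarrow> ball x (d x) \<subseteq> W)" ..
  have d: "\<And>x. 0 < d x"
    "\<And>x y. x \<in> {a..b} - Z \<Longrightarrow> y \<in> {a..b} \<Longrightarrow> norm (y-x) < d x \<Longrightarrow> norm (F y - F x - (y-x) *\<^sub>R g x) \<le> e1 * norm (y-x)"
    "\<And>x. x \<in> Z \<Longrightarrow> ball x (d x) \<subseteq> W" using dd by simp_all
  show "\<exists>\<gamma>. gauge \<gamma> \<and> (\<forall>p. p tagged_division_of {a..b} \<and> \<gamma> fine p \<longrightarrow>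
        norm ((\<Sum>(x, K)\<in>p. measure lborel K *\<^sub>R (if x \<in> Z then 0 else g x)) - (F b - F a)) < e)"
  proof (intro exI[of _ "\<lambda>x. ball x (d x)"] conjI allI impI)
    show "gauge (\<lambda>x. ball x (d x))" using d(1) gauge_ball_dependent by blast
    fix p assume p: "p tagged_division_of {a..b} \<and> (\<lambda>x. ball x (d x)) fine p"
    then have pt: "p tagged_division_of {a..b}" and fine: "\<And>x K. (x, K) \<in> p \<Longrightarrow> K \<subseteq> ball x (d x)"
      by (auto simp: fine_def)
    have finp: "finite p" using pt by blast
    have ba: "b - a = (\<Sum>(x,K)\<in>p. Sup K - Inf K)" "F b - F a = (\<Sum>(x,K)\<in>p. F (Sup K) - F (Inf K))"
      using additive_tagged_division_1[where f= "\<lambda>x. x", OF \<open>a \<le> b\<close> pt]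
        additive_tagged_division_1[where f= F, OF \<open>a \<le> b\<close> pt] by auto
    have K: "\<exists>u v. K = {u..v} \<and> u \<le> v \<and> Inf K = u \<and> Sup K = v \<and> a \<le> u \<and> v \<le> b \<and> x \<in> {u..v}" if xK: "(x, K) \<in> p" for x K
    proof -
      obtain u v where "K = cbox u v" using tagged_division_ofD(4)[OF pt xK] by blast
      moreover have "x \<in> K" "K \<subseteq> {a..b}" using tagged_division_ofD(2,3)[OF pt xK] by auto
      ultimately show ?thesis by (intro exI[of _ u] exI[of _ v]) auto
    qed
    define p1 where "p1 = {z \<in> p. fst z \<notin> Z}"
    define p2 where "p2 = {z \<in> p. fst z \<in> Z}"
    have pp: "p = p1 \<union> p2" "p1 \<inter> p2 = {}" "finite p1" "finite p2" using finp by (auto simp: p1_def p2_def)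
    define T where "T = (\<lambda>(x, K). measure lborel K *\<^sub>R (if x \<in> Z then 0 else g x) - (F (Sup K) - F (Inf K)))"
    have eq: "(\<Sum>(x, K)\<in>p. measure lborel K *\<^sub>R (if x \<in> Z then 0 else g x)) - (F b - F a) = sum T p1 + sum T p2"
    proof -
      have "(\<Sum>(x, K)\<in>p. measure lborel K *\<^sub>R (if x \<in> Z then 0 else g x)) - (F b - F a) = sum T p"
        unfolding ba(2) T_def by (simp add: sum_subtractf case_prod_unfold)
      then show ?thesis unfolding pp(1) by (simp add: sum.union_disjoint pp)
    qed
    have "norm (sum T p1) \<le> (\<Sum>z\<in>p1. e1 * (Sup (snd z) - Inf (snd z)))"
    proof (rule sum_norm_le)
      fix z assume "z \<in> p1"
      then obtain x K where z: "z = (x, K)" "(x, K) \<in> p" "x \<notin> Z" by (cases z) (auto simp: p1_def)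
      obtain u v where k: "K = {u..v}" "u \<le> v" "Inf K = u" "Sup K = v" "a \<le> u" "v \<le> b" "x \<in> {u..v}"
        using K[OF z(2)] by blast
      have ball: "norm (u - x) < d x" "norm (v - x) < d x"
        using subsetD[OF fine[OF z(2)], of u] subsetD[OF fine[OF z(2)], of v] k(1,2)
        by (auto simp: dist_real_def)
      have *: "norm (F u - F x - (u - x) *\<^sub>R g x) \<le> e1 * norm (u - x)"
        "norm (F v - F x - (v - x) *\<^sub>R g x) \<le> e1 * norm (v - x)"
        using d(2)[of x u] d(2)[of x v] ball k z(3) by auto
      have "norm (T z) = norm ((F u - F x - (u - x) *\<^sub>R g x) - (F v - F x - (v - x) *\<^sub>R g x))"
        using k(1-4) z(1,3) by (simp add: T_def algebra_simps)
      also have "\<dots> \<le> e1 * norm (u - x) + e1 * norm (v - x)"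
        using norm_triangle_ineq4 * by (meson add_mono order_trans)
      \<comment> \<open>The tag lies between \<open>u\<close> and \<open>v\<close>, so the two
        distances add up to the length of the interval (the straddle lemma).\<close>
      also have "\<dots> = e1 * (v - u)" using k(7) by (simp add: algebra_simps)
      finally show "norm (T z) \<le> e1 * (Sup (snd z) - Inf (snd z))" using k z by simp
    qed
    also have "\<dots> \<le> (\<Sum>z\<in>p. e1 * (Sup (snd z) - Inf (snd z)))"
    proof (rule sum_mono2[OF finp])
      fix z assume "z \<in> p - p1"
      then show "0 \<le> e1 * (Sup (snd z) - Inf (snd z))" using K[of "fst z" "snd z"] \<open>e1 > 0\<close> by fastforce
    qed (auto simp: p1_def)
    also have "\<dots> = e1 * (b - a)" unfolding ba(1) by (simp add: sum_distrib_left case_prod_unfold)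
    finally have b1: "norm (sum T p1) < e / 2" using e1 by simp
    have b2: "norm (sum T p2) < e / 2"
    proof -
      obtain \<phi> where \<phi>: "bij_betw \<phi> {..<card p2} p2"
        using ex_bij_betw_nat_finite[OF pp(4)] by (auto simp: atLeast0LessThan)
      define u where "u i = Inf (snd (\<phi> i))" for i
      define v where "v i = Sup (snd (\<phi> i))" for i
      have in_p2: "\<phi> i \<in> p2" if "i < card p2" for i using \<phi> that by (auto simp: bij_betw_def)
      have k: "snd (\<phi> i) = {u i..v i} \<and> u i \<le> v i \<and> a \<le> u i \<and> v i \<le> b" if "i < card p2" for i
        using K[of "fst (\<phi> i)" "snd (\<phi> i)"] in_p2[OF that] unfolding u_def v_def p2_def by force
      have sub: "{u i<..<v i} \<subseteq> W" if "i < card p2" for i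
      proof -
        have "\<phi> i \<in> p" "fst (\<phi> i) \<in> Z" using in_p2[OF that] by (auto simp: p2_def)
        then have "{u i..v i} \<subseteq> W" using fine[of "fst (\<phi> i)" "snd (\<phi> i)"] d(3) k[OF that] by fastforce
        then show ?thesis by force
      qed
      have disj: "disjoint_family_on (\<lambda>i. {u i<..<v i}) {..<card p2}"
        unfolding disjoint_family_on_def
      proof (intro ballI impI)
        fix i j assume ij: "i \<in> {..<card p2}" "j \<in> {..<card p2}" "i \<noteq> j"
        then have ne: "\<phi> i \<noteq> \<phi> j" using \<phi> by (auto simp: bij_betw_def inj_on_def)
        have "interior (snd (\<phi> i)) \<inter> interior (snd (\<phi> j)) = {}"
          using tagged_division_ofD(5)[OF pt, of "fst (\<phi> i)" "snd (\<phi> i)" "fst (\<phi> j)" "snd (\<phi> j)"]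
            in_p2[of i] in_p2[of j] ij ne by (simp add: p2_def)
        then show "{u i<..<v i} \<inter> {u j<..<v j} = {}" using k[of i] k[of j] ij by simp
      qed
      have "ennreal (\<Sum>i<card p2. v i - u i) = (\<Sum>i<card p2. ennreal (v i - u i))"
        using k by (intro sum_ennreal[symmetric]) auto
      also have "\<dots> = (\<Sum>i<card p2. emeasure lebesgue {u i<..<v i})" using k by (intro sum.cong) auto
      also have "\<dots> = emeasure lebesgue (\<Union>i<card p2. {u i<..<v i})"
        using disj by (intro sum_emeasure) auto
      also have "\<dots> \<le> emeasure lebesgue W" using sub W(1) by (intro emeasure_mono) auto
      also have "\<dots> < ennreal \<delta>" by (rule W(3))
      finally have "(\<Sum>i<card p2. v i - u i) < \<delta>"
        using k by (subst (asm) ennreal_less_iff) (auto intro!: sum_nonneg)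
      then have "(\<Sum>i<card p2. \<bar>F (v i) - F (u i)\<bar>) < e / 2" using \<delta> disj k by blast
      moreover have "(\<Sum>i<card p2. \<bar>F (v i) - F (u i)\<bar>) = (\<Sum>z\<in>p2. norm (T z))"
        unfolding sum.reindex_bij_betw[OF \<phi>, of "\<lambda>z. norm (T z)", symmetric]
        by (intro sum.cong) (use in_p2 in \<open>auto simp: T_def u_def v_def p2_def case_prod_unfold abs_minus_commute\<close>)
      ultimately show ?thesis using norm_sum[of T p2] by linarith
    qed
    show "norm ((\<Sum>(x, K)\<in>p. measure lborel K *\<^sub>R (if x \<in> Z then 0 else g x)) - (F b - F a)) < e"
      unfolding eq using b1 b2 norm_triangle_ineq[of "sum T p1" "sum T p2"] by linarith
  qed
qed

text \<open>Only the upper bound is kept, for intervals with \<open>\<tau>\<close> at either end: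
  the lemma is applied to the nonnegative errors \<open>\<kappa> p\<close> of the differentiation
  theorem below.\<close>

lemma Lebesgue_points:
  fixes k :: "real \<Rightarrow> real"
  assumes "k integrable_on {a..b}"
  obtains Z where "negligible Z"
    "\<And>\<tau> e. \<tau> \<in> {a..b} - Z \<Longrightarrow> 0 < e \<Longrightarrow> \<exists>\<delta>>0. \<forall>r\<in>{a..b}. 0 < \<bar>r - \<tau>\<bar> \<and> \<bar>r - \<tau>\<bar> < \<delta> \<longrightarrow>
       integral {min r \<tau>..max r \<tau>} k \<le> (k \<tau> + e) * \<bar>r - \<tau>\<bar>"
proof -
  define k0 where "k0 x = (if x \<in> {a..b} then k x else 0)" for x
  have "k0 integrable_on UNIV" using assms unfolding k0_def integrable_restrict_UNIV .
  then have k0: "k0 integrable_on cbox u v" for u v by (rule integrable_on_subcbox) auto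
  \<comment> \<open>Reflection: averages of \<open>k1\<close> to the right of
    \<open>- \<tau>\<close> are averages of \<open>k0\<close> to the left of \<open>\<tau>\<close>,
    so a theorem on right averages covers both sides.\<close>
  define k1 where "k1 x = k0 (- x)" for x
  have k1: "k1 integrable_on cbox u v" for u v
    using k0[of "-v" "-u"] Henstock_Kurzweil_Integration.integrable_reflect_real[where f = k0 and a = "-v" and b = "-u"] unfolding k1_def by simp
  obtain Z0 where Z0: "negligible Z0" "\<And>x e. x \<notin> Z0 \<Longrightarrow> 0 < e \<Longrightarrow>
    \<exists>d>0. \<forall>h. 0 < h \<and> h < d \<longrightarrow> norm (integral (cbox x (x + h *\<^sub>R One)) k0 /\<^sub>R h ^ DIM(real) - k0 x) < e"
    using integrable_ccontinuous_explicit[OF k0] by blast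
  obtain Z1 where Z1: "negligible Z1" "\<And>x e. x \<notin> Z1 \<Longrightarrow> 0 < e \<Longrightarrow>
    \<exists>d>0. \<forall>h. 0 < h \<and> h < d \<longrightarrow> norm (integral (cbox x (x + h *\<^sub>R One)) k1 /\<^sub>R h ^ DIM(real) - k1 x) < e"
    using integrable_ccontinuous_explicit[OF k1] by blast
  have "negligible (uminus ` Z1)"
    by (rule negligible_differentiable_image_negligible[OF _ Z1(1)]) (auto intro!: derivative_intros)
  then have neg: "negligible (Z0 \<union> uminus ` Z1)"
    using Z0(1) by (rule negligible_Un[rotated])
  show thesis
  proof (rule that[OF neg])
    fix \<tau> e :: real assume \<tau>: "\<tau> \<in> {a..b} - (Z0 \<union> uminus ` Z1)" and "0 < e"
    have "\<tau> \<notin> Z0" "- \<tau> \<notin> Z1" using \<tau> by (auto simp: image_iff)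
    obtain d0 where d0: "d0 > 0" "\<And>h. 0 < h \<Longrightarrow> h < d0 \<Longrightarrow> \<bar>integral {\<tau>..\<tau> + h} k0 / h - k0 \<tau>\<bar> < e"
      using Z0(2)[OF \<open>\<tau> \<notin> Z0\<close> \<open>0 < e\<close>] by (auto simp: divide_inverse_commute)
    obtain d1 where d1: "d1 > 0" "\<And>h. 0 < h \<Longrightarrow> h < d1 \<Longrightarrow> \<bar>integral {-\<tau>..-\<tau> + h} k1 / h - k1 (-\<tau>)\<bar> < e"
      using Z1(2)[OF \<open>- \<tau> \<notin> Z1\<close> \<open>0 < e\<close>] by (auto simp: divide_inverse_commute)
    show "\<exists>\<delta>>0. \<forall>r\<in>{a..b}. 0 < \<bar>r - \<tau>\<bar> \<and> \<bar>r - \<tau>\<bar> < \<delta> \<longrightarrow>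
       integral {min r \<tau>..max r \<tau>} k \<le> (k \<tau> + e) * \<bar>r - \<tau>\<bar>"
    proof (intro exI[of _ "min d0 d1"] conjI ballI impI)
      fix r assume r: "r \<in> {a..b}" "0 < \<bar>r - \<tau>\<bar> \<and> \<bar>r - \<tau>\<bar> < min d0 d1"
      have kk: "integral {min r \<tau>..max r \<tau>} k = integral {min r \<tau>..max r \<tau>} k0"
        using r(1) \<tau> by (intro integral_cong) (auto simp: k0_def)
      have "k0 \<tau> = k \<tau>" using \<tau> by (simp add: k0_def)
      have "\<bar>integral {min r \<tau>..max r \<tau>} k0 / \<bar>r - \<tau>\<bar> - k0 \<tau>\<bar> < e"
      proof (cases "\<tau> < r")
        case True
        then show ?thesis using d0(2)[of "r - \<tau>"] r(2) by simp
      next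
        case False
        then have "r < \<tau>" using r(2) by auto
        have "integral {-\<tau>..- r} k1 = integral {r..\<tau>} k0"
          unfolding k1_def using integral_reflect_real[of \<tau> r k0] by simp
        then show ?thesis using d1(2)[of "\<tau> - r"] r(2) \<open>r < \<tau>\<close> by (simp add: min_absorb1 max_absorb2) (simp add: k1_def)
      qed
      then have "integral {min r \<tau>..max r \<tau>} k0 / \<bar>r - \<tau>\<bar> \<le> k0 \<tau> + e" by linarith
      then show "integral {min r \<tau>..max r \<tau>} k \<le> (k \<tau> + e) * \<bar>r - \<tau>\<bar>"
        using r(2) unfolding kk \<open>k0 \<tau> = k \<tau>\<close> by (simp add: divide_le_eq)
    qed (use d0 d1 in auto)
  qed
qed

text \<open>At a maximum point \<open>\<rho>\<close> of
  \<open>exp (- 2 * k * \<sigma>) * v \<sigma>\<close> the integral inequality yields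
  \<open>v \<rho> \<le> v \<rho> / 2\<close>. The exponent has twice the constant \<open>k\<close>
  in order to produce this factor one half.\<close>

lemma Gronwall_zero:
  fixes v :: "real \<Rightarrow> real"
  assumes cont: "continuous_on {a..b} v" and v0: "\<And>\<tau>. \<tau> \<in> {a..b} \<Longrightarrow> 0 \<le> v \<tau>" and "0 < k"
    and bd: "\<And>\<tau>. \<tau> \<in> {a..b} \<Longrightarrow> v \<tau> \<le> integral {a..\<tau>} (\<lambda>\<sigma>. k * v \<sigma>)" and \<tau>: "\<tau> \<in> {a..b}"
  shows "v \<tau> = 0"
proof -
  define w where "w \<sigma> = exp (- 2 * k * \<sigma>) * v \<sigma>" for \<sigma>
  have "continuous_on {a..b} w" unfolding w_def by (intro continuous_intros cont)
  then obtain \<rho> where \<rho>: "\<rho> \<in> {a..b}" "\<And>\<sigma>. \<sigma> \<in> {a..b} \<Longrightarrow> w \<sigma> \<le> w \<rho>"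
    using continuous_attains_sup[of "{a..b}" w] \<tau> by auto
  have v_le: "v \<sigma> \<le> w \<rho> * exp (2 * k * \<sigma>)" if "\<sigma> \<in> {a..b}" for \<sigma>
  proof -
    have "v \<sigma> = w \<sigma> * exp (2 * k * \<sigma>)" by (simp add: w_def exp_minus field_simps)
    also have "\<dots> \<le> w \<rho> * exp (2 * k * \<sigma>)" using \<rho>(2)[OF that] by simp
    finally show ?thesis .
  qed
  have w0: "0 \<le> w \<rho>" using v0[OF \<rho>(1)] by (simp add: w_def)
  have I: "((\<lambda>\<sigma>. k * (w \<rho> * exp (2 * k * \<sigma>))) has_integral
      (w \<rho> / 2 * exp (2 * k * \<rho>) - w \<rho> / 2 * exp (2 * k * a))) {a..\<rho>}"
    by (rule fundamental_theorem_of_calculus)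
      (use \<rho>(1) \<open>0 < k\<close> in \<open>auto intro!: derivative_eq_intros simp: has_real_derivative_iff_has_vector_derivative[symmetric]\<close>)
  have "v \<rho> \<le> integral {a..\<rho>} (\<lambda>\<sigma>. k * v \<sigma>)" by (rule bd[OF \<rho>(1)])
  also have "\<dots> \<le> integral {a..\<rho>} (\<lambda>\<sigma>. k * (w \<rho> * exp (2 * k * \<sigma>)))"
  proof (rule integral_le)
    show "(\<lambda>\<sigma>. k * v \<sigma>) integrable_on {a..\<rho>}"
      by (intro integrable_continuous_real continuous_intros continuous_on_subset[OF cont]) (use \<rho>(1) in auto)
    show "(\<lambda>\<sigma>. k * (w \<rho> * exp (2 * k * \<sigma>))) integrable_on {a..\<rho>}" using I by blast
    show "k * v \<sigma> \<le> k * (w \<rho> * exp (2 * k * \<sigma>))" if "\<sigma> \<in> {a..\<rho>}" for \<sigma>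
      using v_le[of \<sigma>] that \<rho>(1) \<open>0 < k\<close> by (intro mult_left_mono) auto
  qed
  also have "\<dots> \<le> w \<rho> / 2 * exp (2 * k * \<rho>)"
    using integral_unique[OF I] w0 by simp
  also have "w \<rho> * exp (2 * k * \<rho>) = v \<rho>" by (simp add: w_def exp_minus field_simps)
  then have "w \<rho> / 2 * exp (2 * k * \<rho>) = v \<rho> / 2" by simp
  finally have "v \<rho> \<le> 0" by simp
  then have "w \<rho> \<le> 0" by (simp add: w_def mult_nonneg_nonpos)
  then have "v \<tau> \<le> 0" using v_le[OF \<tau>] w0 by simp
  then show ?thesis using v0[OF \<tau>] by simp
qed

section \<open>Calculus for curves of square-integrable maps\<close>

lemma AE_lebesgue_on_iff_negligible:
  assumes "S \<in> sets lebesgue"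
  shows "(AE x in lebesgue_on S. P x) \<longleftrightarrow> negligible {x\<in>S. \<not> P x}"
  using assms by (simp add: AE_restrict_space_iff completion.AE_iff_null_sets negligible_iff_null_sets)

lemma AE_lebesgue_on_neq: "AE \<sigma> in lebesgue_on {a..b::real}. \<sigma> \<noteq> \<tau>"
  by (subst AE_lebesgue_on_iff_negligible) (auto intro: negligible_subset[of "{\<tau>}"])

lemma integral_indicator_lebesgue_on:
  fixes k :: "real \<Rightarrow> real"
  assumes k: "integrable (lebesgue_on {a..b}) k" and sub: "{u..v} \<subseteq> {a..b}"
  shows "(\<integral>\<sigma>. indicator {u..v} \<sigma> * k \<sigma> \<partial>lebesgue_on {a..b}) = integral {u..v} k" and "k integrable_on {u..v}"
proof -
  have 1: "(\<lambda>\<sigma>. indicator {a..b} \<sigma> *\<^sub>R (indicator {u..v} \<sigma> *\<^sub>R k \<sigma>)) = (\<lambda>\<sigma>. indicator {u..v} \<sigma> *\<^sub>R k \<sigma>)"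
    using sub by (auto simp: indicator_def fun_eq_iff)
  have "integrable (lebesgue_on {a..b}) (\<lambda>\<sigma>. indicator {u..v} \<sigma> *\<^sub>R k \<sigma>)"
    by (rule integrable_mult_indicator[OF _ k]) (use sub in \<open>simp add: sets_restrict_space_iff\<close>)
  then have "integrable lebesgue (\<lambda>\<sigma>. indicator {a..b} \<sigma> *\<^sub>R (indicator {u..v} \<sigma> *\<^sub>R k \<sigma>))"
    by (subst (asm) integrable_restrict_space) auto
  then have 2: "integrable (lebesgue_on {u..v}) k"
    unfolding 1 by (subst integrable_restrict_space) auto
  then show "k integrable_on {u..v}" by (rule integrable_on_lebesgue_on) simp
  have "(\<integral>\<sigma>. indicator {u..v} \<sigma> *\<^sub>R k \<sigma> \<partial>lebesgue_on {a..b}) = (\<integral>\<sigma>. indicator {u..v} \<sigma> *\<^sub>R k \<sigma> \<partial>lebesgue)"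
    by (subst integral_restrict_space) (auto simp only: 1 space_completion space_lborel, simp)
  also have "\<dots> = integral\<^sup>L (lebesgue_on {u..v}) k" by (subst integral_restrict_space) auto
  also have "\<dots> = integral {u..v} k" by (rule lebesgue_integral_eq_integral[OF 2]) simp
  finally show "(\<integral>\<sigma>. indicator {u..v} \<sigma> * k \<sigma> \<partial>lebesgue_on {a..b}) = integral {u..v} k" by simp
qed

lemma integral_indicator_split:
  fixes k :: "real \<Rightarrow> 'b::euclidean_space"
  assumes k: "integrable (lebesgue_on {a..b}) k" and "a \<le> u" "u \<le> v" "v \<le> w" "w \<le> b"
  shows "(\<integral>\<sigma>. indicator {u..w} \<sigma> *\<^sub>R k \<sigma> \<partial>lebesgue_on {a..b}) =
    (\<integral>\<sigma>. indicator {u..v} \<sigma> *\<^sub>R k \<sigma> \<partial>lebesgue_on {a..b}) + (\<integral>\<sigma>. indicator {v..w} \<sigma> *\<^sub>R k \<sigma> \<partial>lebesgue_on {a..b})"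
proof -
  note [measurable] = borel_measurable_integrable[OF k]
  have s: "{u..v} \<in> sets (lebesgue_on {a..b})" "{v..w} \<in> sets (lebesgue_on {a..b})" "{u..w} \<in> sets (lebesgue_on {a..b})"
    using assms by (auto simp: sets_restrict_space_iff)
  note [measurable] = s
  have i: "integrable (lebesgue_on {a..b}) (\<lambda>\<sigma>. indicator {u..v} \<sigma> *\<^sub>R k \<sigma>)"
    "integrable (lebesgue_on {a..b}) (\<lambda>\<sigma>. indicator {v..w} \<sigma> *\<^sub>R k \<sigma>)"
    by (rule integrable_mult_indicator[OF _ k], rule s)+
  have "(\<integral>\<sigma>. indicator {u..w} \<sigma> *\<^sub>R k \<sigma> \<partial>lebesgue_on {a..b}) =
    (\<integral>\<sigma>. indicator {u..v} \<sigma> *\<^sub>R k \<sigma> + indicator {v..w} \<sigma> *\<^sub>R k \<sigma> \<partial>lebesgue_on {a..b})"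
  proof (rule integral_cong_AE)
    show "AE \<sigma> in lebesgue_on {a..b}. indicator {u..w} \<sigma> *\<^sub>R k \<sigma> = indicator {u..v} \<sigma> *\<^sub>R k \<sigma> + indicator {v..w} \<sigma> *\<^sub>R k \<sigma>"
      using AE_lebesgue_on_neq[of v] by eventually_elim (use assms in \<open>auto simp: indicator_def\<close>)
  qed measurable
  also have "\<dots> = (\<integral>\<sigma>. indicator {u..v} \<sigma> *\<^sub>R k \<sigma> \<partial>lebesgue_on {a..b}) + (\<integral>\<sigma>. indicator {v..w} \<sigma> *\<^sub>R k \<sigma> \<partial>lebesgue_on {a..b})"
    by (rule Bochner_Integration.integral_add[OF i])
  finally show ?thesis .
qed

lemma measure_lebesgue_on_Icc: "a \<le> u \<Longrightarrow> u \<le> v \<Longrightarrow> v \<le> b \<Longrightarrow> measure (lebesgue_on {a..b}) {u..v} = v - (u::real)"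
  by (simp add: measure_restrict_space)

context pair_finite_measure
begin

lemma slice_norm_integrable:
  assumes h: "case_prod h \<in> L2 (N \<Otimes>\<^sub>M M)" and A: "A \<in> sets N"
  shows "integrable N (\<lambda>\<sigma>. indicator A \<sigma> * L2norm M (h \<sigma>))"
proof -
  have "integrable N (\<lambda>\<sigma>. L2norm M (h \<sigma>))"
    by (rule M1.square_integrable_imp_integrable)
      (use L2_integrable_square[OF slice_norm_L2(1)[OF h]] L2_measurable[OF slice_norm_L2(1)[OF h]] in auto)
  from integrable_mult_indicator[OF A this] show ?thesis by simp
qed

text \<open>The integral is tested with itself: the square of its norm is an inner product, to which
  Fubini and Cauchy-Schwarz at each time apply, and one factor is then cancelled.\<close>

lemma partial_integral_Minkowski:
  assumes h: "case_prod h \<in> L2 (N \<Otimes>\<^sub>M M)" and A: "A \<in> sets N"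
  shows "L2norm M (partial_integral N A h) \<le> (\<integral>\<sigma>. indicator A \<sigma> * L2norm M (h \<sigma>) \<partial>N)"
proof (cases "L2norm M (partial_integral N A h) = 0")
  case True
  then show ?thesis by (simp add: integral_nonneg_AE)
next
  case False
  define Y where "Y = partial_integral N A h"
  have Y: "Y \<in> L2 M" unfolding Y_def by (rule partial_integral_L2(1)[OF h A])
  have "(L2norm M Y)\<^sup>2 = (\<integral>w. partial_integral N A h w \<bullet> Y w \<partial>M)"
    unfolding L2norm_power2 Y_def[symmetric] by (simp add: power2_norm_eq_inner)
  also have "\<dots> = (\<integral>\<sigma>. indicator A \<sigma> * (\<integral>w. h \<sigma> w \<bullet> Y w \<partial>M) \<partial>N)"
    by (rule partial_integral_inner[OF h A Y])
  also have "\<dots> \<le> (\<integral>\<sigma>. indicator A \<sigma> * L2norm M (h \<sigma>) * L2norm M Y \<partial>N)"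
  proof (rule integral_mono_AE')
    show "integrable N (\<lambda>\<sigma>. indicator A \<sigma> * L2norm M (h \<sigma>) * L2norm M Y)"
      using slice_norm_integrable[OF h A] by (rule integrable_mult_left)
    show "AE \<sigma> in N. indicator A \<sigma> * (\<integral>w. h \<sigma> w \<bullet> Y w \<partial>M) \<le> indicator A \<sigma> * L2norm M (h \<sigma>) * L2norm M Y"
      using AE_slice_L2[OF h]
    proof eventually_elim
      case (elim \<sigma>)
      show ?case using L2_Cauchy_Schwarz[OF elim Y] by (auto simp: indicator_def)
    qed
  qed auto
  also have "\<dots> = (\<integral>\<sigma>. indicator A \<sigma> * L2norm M (h \<sigma>) \<partial>N) * L2norm M Y" by simp
  finally show ?thesis using False L2norm_nonneg[of M Y] unfolding Y_def[symmetric]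
    by (simp add: power2_eq_square)
qed

end

text \<open>Works from the definition of the Bochner integral alone, since competing solutions of
  the state equation come without jointly measurable representatives. Measurability of the slice
  distance is not at hand either, hence the measurable majorant \<open>\<kappa>\<close>.\<close>

lemma has_L2_integral_diff_norm_le:
  fixes h h' :: "real \<Rightarrow> 'w \<Rightarrow> 'b::euclidean_space"
  assumes M: "finite_measure M"
    and h: "has_L2_integral M h {a..b} y" and h': "has_L2_integral M h' {a..b} y'"
    and \<kappa> [measurable]: "\<kappa> \<in> borel_measurable (lebesgue_on {a..b})"
    and bd: "AE \<sigma> in lebesgue_on {a..b}. L2dist M (h \<sigma>) (h' \<sigma>) \<le> \<kappa> \<sigma>"
  shows "ennreal (L2dist M y y') \<le> (\<integral>\<^sup>+\<sigma>. ennreal (\<kappa> \<sigma>) \<partial>lebesgue_on {a..b})"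
proof -
  let ?N = "lebesgue_on {a..b}"
  interpret pair_finite_measure ?N M by (rule pair_finite_measure_Icc) fact
  obtain H Y where H: "\<And>k. L2_simple M {a..b} (H k) (Y k)"
    "AE \<sigma> in ?N. (\<lambda>k. L2dist M (h \<sigma>) (H k \<sigma>)) \<longlonglongrightarrow> 0"
    "(\<lambda>k. \<integral>\<^sup>+\<sigma>. ennreal (L2dist M (h \<sigma>) (H k \<sigma>)) \<partial>?N) \<longlonglongrightarrow> 0"
    "(\<lambda>k. L2dist M (Y k) y) \<longlonglongrightarrow> 0"
    and y: "y \<in> L2 M" and hL: "AE \<sigma> in ?N. h \<sigma> \<in> L2 M"
    using h unfolding has_L2_integral_def by blast
  obtain H' Y' where H': "\<And>k. L2_simple M {a..b} (H' k) (Y' k)"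
    "AE \<sigma> in ?N. (\<lambda>k. L2dist M (h' \<sigma>) (H' k \<sigma>)) \<longlonglongrightarrow> 0"
    "(\<lambda>k. \<integral>\<^sup>+\<sigma>. ennreal (L2dist M (h' \<sigma>) (H' k \<sigma>)) \<partial>?N) \<longlonglongrightarrow> 0"
    "(\<lambda>k. L2dist M (Y' k) y') \<longlonglongrightarrow> 0"
    and y': "y' \<in> L2 M" and hL': "AE \<sigma> in ?N. h' \<sigma> \<in> L2 M"
    using h' unfolding has_L2_integral_def by blast
  have sp: "{a..b} \<in> sets ?N" by (simp add: sets_restrict_space_iff)
  have simple: "case_prod K \<in> L2 (?N \<Otimes>\<^sub>M M) \<and> Z = partial_integral ?N {a..b} K \<and> (\<forall>\<sigma>. K \<sigma> \<in> L2 M)"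
    if "L2_simple M {a..b} K Z" for K :: "real \<Rightarrow> 'w \<Rightarrow> 'b" and Z
  proof -
    have "case_prod K \<in> rect_simple ?N M" "Z = partial_integral ?N {a..b} K"
      using rect_simple_iff_L2_simple[OF M, of K a b Z] that by auto
    moreover have "K \<sigma> \<in> L2 M" for \<sigma>
      using that unfolding L2_simple_def by (auto intro!: L2_sum L2_scaleR)
    ultimately show ?thesis using rect_simple_L2 by blast
  qed
  have m [measurable]: "(\<lambda>\<sigma>. L2dist M (K \<sigma>) (K' \<sigma>)) \<in> borel_measurable ?N"
    if "L2_simple M {a..b} K Z" "L2_simple M {a..b} K' Z'" for K K' :: "real \<Rightarrow> 'w \<Rightarrow> 'b" and Z Z'
  proof -
    have [measurable]: "case_prod K \<in> borel_measurable (?N \<Otimes>\<^sub>M M)" "case_prod K' \<in> borel_measurable (?N \<Otimes>\<^sub>M M)"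
      using simple[OF that(1)] simple[OF that(2)] L2_measurable by auto
    show ?thesis by measurable
  qed
  \<comment> \<open>The distance of an integrand to a simple map is, at almost every time, a limit
    of distances between simple maps, and so agrees with a measurable \<open>d\<close>. This makes
    the integrals below additive.\<close>
  have m': "\<exists>d\<in>borel_measurable ?N. AE \<sigma> in ?N. L2dist M (g \<sigma>) (K k \<sigma>) = (d \<sigma> :: real)"
    if K: "\<And>k. L2_simple M {a..b} (K k) (Z k)" and g: "AE \<sigma> in ?N. (g \<sigma> :: 'w \<Rightarrow> 'b) \<in> L2 M"
      "AE \<sigma> in ?N. (\<lambda>k. L2dist M (g \<sigma>) (K k \<sigma>)) \<longlonglongrightarrow> 0" for g K Z k
  proof (intro bexI)
    define d where "d \<sigma> = lim (\<lambda>j. L2dist M (K j \<sigma>) (K k \<sigma>))" for \<sigma>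
    have [measurable]: "(\<lambda>\<sigma>. L2dist M (K j \<sigma>) (K k \<sigma>)) \<in> borel_measurable ?N" for j by (rule m[OF K K])
    show "d \<in> borel_measurable ?N" unfolding d_def by measurable
    show "AE \<sigma> in ?N. L2dist M (g \<sigma>) (K k \<sigma>) = d \<sigma>"
      using g
    proof eventually_elim
      case (elim \<sigma>)
      have KL: "K j \<sigma> \<in> L2 M" for j using simple[OF K] by blast
      have "\<bar>L2dist M (K j \<sigma>) (K k \<sigma>) - L2dist M (g \<sigma>) (K k \<sigma>)\<bar> \<le> L2dist M (g \<sigma>) (K j \<sigma>)" for j
        using L2norm_triangle_reverse[OF L2_diff[OF KL[of j] KL[of k]] L2_diff[OF elim(1) KL[of k]]]
          L2norm_minus_commute[of M "K j \<sigma>" "g \<sigma>"] by simp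
      then have "(\<lambda>j. L2dist M (K j \<sigma>) (K k \<sigma>) - L2dist M (g \<sigma>) (K k \<sigma>)) \<longlonglongrightarrow> 0"
        by (intro Lim_null_comparison[OF always_eventually elim(2)]) simp
      then have "(\<lambda>j. L2dist M (K j \<sigma>) (K k \<sigma>)) \<longlonglongrightarrow> L2dist M (g \<sigma>) (K k \<sigma>)"
        by (simp add: LIM_zero_iff)
      then show ?case unfolding d_def by (rule limI[symmetric])
    qed
  qed
  have step: "ennreal (L2dist M (Y k) (Y' k)) \<le>
      (\<integral>\<^sup>+\<sigma>. ennreal (L2dist M (h \<sigma>) (H k \<sigma>)) \<partial>?N) + (\<integral>\<^sup>+\<sigma>. ennreal (\<kappa> \<sigma>) \<partial>?N)
      + (\<integral>\<^sup>+\<sigma>. ennreal (L2dist M (h' \<sigma>) (H' k \<sigma>)) \<partial>?N)" for k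
  proof -
    let ?D = "\<lambda>\<sigma> w. H k \<sigma> w - H' k \<sigma> w"
    note s = simple[OF H(1)[of k]] and s' = simple[OF H'(1)[of k]]
    have D: "case_prod ?D \<in> L2 (?N \<Otimes>\<^sub>M M)"
      using L2_diff[of "case_prod (H k)" _ "case_prod (H' k)"] s s' by (simp add: case_prod_unfold)
    obtain d where d [measurable]: "d \<in> borel_measurable ?N" "AE \<sigma> in ?N. L2dist M (h \<sigma>) (H k \<sigma>) = (d \<sigma> :: real)"
      using m'[OF H(1) hL H(2)] by blast
    obtain d' where d' [measurable]: "d' \<in> borel_measurable ?N" "AE \<sigma> in ?N. L2dist M (h' \<sigma>) (H' k \<sigma>) = (d' \<sigma> :: real)"
      using m'[OF H'(1) hL' H'(2)] by blast
    have "L2dist M (Y k) (Y' k) = L2norm M (partial_integral ?N {a..b} ?D)"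
    proof (rule L2norm_cong_AE)
      show "(\<lambda>w. Y k w - Y' k w) \<in> borel_measurable M" "partial_integral ?N {a..b} ?D \<in> borel_measurable M"
        using s s' D sp by (auto intro!: L2_measurable L2_diff partial_integral_L2(1))
      show "AE w in M. norm (Y k w - Y' k w) = norm (partial_integral ?N {a..b} ?D w)"
        using partial_integral_diff[OF conjunct1[OF s] conjunct1[OF s'] sp] s s' by auto
    qed
    also have "\<dots> \<le> (\<integral>\<sigma>. indicator {a..b} \<sigma> * L2norm M (?D \<sigma>) \<partial>?N)" by (rule partial_integral_Minkowski[OF D sp])
    finally have "ennreal (L2dist M (Y k) (Y' k)) \<le> ennreal (\<integral>\<sigma>. indicator {a..b} \<sigma> * L2norm M (?D \<sigma>) \<partial>?N)"
      by (rule ennreal_leI)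
    also have "\<dots> = (\<integral>\<^sup>+\<sigma>. ennreal (indicator {a..b} \<sigma> * L2norm M (?D \<sigma>)) \<partial>?N)"
      by (rule nn_integral_eq_integral[symmetric, OF slice_norm_integrable[OF D sp]]) simp
    also have "\<dots> \<le> (\<integral>\<^sup>+\<sigma>. ennreal (d \<sigma>) + ennreal (\<kappa> \<sigma>) + ennreal (d' \<sigma>) \<partial>?N)"
    proof (rule nn_integral_mono_AE)
      show "AE \<sigma> in ?N. ennreal (indicator {a..b} \<sigma> * L2norm M (?D \<sigma>)) \<le> ennreal (d \<sigma>) + ennreal (\<kappa> \<sigma>) + ennreal (d' \<sigma>)"
        using hL hL' bd d(2) d'(2)
      proof eventually_elim
        case (elim \<sigma>)
        have "L2norm M (?D \<sigma>) \<le> L2dist M (h \<sigma>) (H k \<sigma>) + L2dist M (h \<sigma>) (h' \<sigma>) + L2dist M (h' \<sigma>) (H' k \<sigma>)"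
          using L2norm_triangle_diff[of "H k \<sigma>" M "h \<sigma>" "H' k \<sigma>"] L2norm_triangle_diff[of "h \<sigma>" M "h' \<sigma>" "H' k \<sigma>"]
            elim(1,2) s s' L2norm_minus_commute[of M "H k \<sigma>" "h \<sigma>"] by simp
        also have "\<dots> \<le> d \<sigma> + \<kappa> \<sigma> + d' \<sigma>" using elim(3-5) by simp
        finally have le: "L2norm M (?D \<sigma>) \<le> d \<sigma> + \<kappa> \<sigma> + d' \<sigma>" .
        have "0 \<le> d \<sigma>" "0 \<le> d' \<sigma>" using elim(4,5) by (metis L2norm_nonneg)+
        moreover have "0 \<le> \<kappa> \<sigma>" using elim(3) L2norm_nonneg order_trans by blast
        ultimately have "ennreal (d \<sigma>) + ennreal (\<kappa> \<sigma>) + ennreal (d' \<sigma>) = ennreal (d \<sigma> + \<kappa> \<sigma> + d' \<sigma>)" by simp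
        moreover have "indicator {a..b} \<sigma> * L2norm M (?D \<sigma>) \<le> L2norm M (?D \<sigma>)" by (auto simp: indicator_def)
        ultimately show ?case using le by (simp add: ennreal_leI)
      qed
    qed
    also have "\<dots> = (\<integral>\<^sup>+\<sigma>. ennreal (d \<sigma>) \<partial>?N) + (\<integral>\<^sup>+\<sigma>. ennreal (\<kappa> \<sigma>) \<partial>?N) + (\<integral>\<^sup>+\<sigma>. ennreal (d' \<sigma>) \<partial>?N)"
      by (simp add: nn_integral_add)
    also have "(\<integral>\<^sup>+\<sigma>. ennreal (d \<sigma>) \<partial>?N) = (\<integral>\<^sup>+\<sigma>. ennreal (L2dist M (h \<sigma>) (H k \<sigma>)) \<partial>?N)"
      by (rule nn_integral_cong_AE) (use d(2) in \<open>auto elim!: eventually_mono\<close>)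
    also have "(\<integral>\<^sup>+\<sigma>. ennreal (d' \<sigma>) \<partial>?N) = (\<integral>\<^sup>+\<sigma>. ennreal (L2dist M (h' \<sigma>) (H' k \<sigma>)) \<partial>?N)"
      by (rule nn_integral_cong_AE) (use d'(2) in \<open>auto elim!: eventually_mono\<close>)
    finally show ?thesis .
  qed
  let ?A = "\<lambda>k. ennreal (L2dist M (Y k) y) + ((\<integral>\<^sup>+\<sigma>. ennreal (L2dist M (h \<sigma>) (H k \<sigma>)) \<partial>?N) + (\<integral>\<^sup>+\<sigma>. ennreal (\<kappa> \<sigma>) \<partial>?N)
      + (\<integral>\<^sup>+\<sigma>. ennreal (L2dist M (h' \<sigma>) (H' k \<sigma>)) \<partial>?N)) + ennreal (L2dist M (Y' k) y')"
  have "?A \<longlonglongrightarrow> ennreal 0 + (0 + (\<integral>\<^sup>+\<sigma>. ennreal (\<kappa> \<sigma>) \<partial>?N) + 0) + ennreal 0"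
    by (intro tendsto_add tendsto_ennrealI H(3,4) H'(3,4) tendsto_const)
  moreover have "ennreal (L2dist M y y') \<le> ?A k" for k
  proof -
    have Yk: "Y k \<in> L2 M" "Y' k \<in> L2 M"
      using simple[OF H(1)[of k]] simple[OF H'(1)[of k]] sp by (auto intro: partial_integral_L2(1))
    have "L2dist M y y' \<le> L2dist M (Y k) y + L2dist M (Y k) (Y' k) + L2dist M (Y' k) y'"
      using L2norm_triangle_diff[OF y Yk(1) y'] L2norm_triangle_diff[OF Yk y'] L2norm_minus_commute[of M y "Y k"] by simp
    then have "ennreal (L2dist M y y') \<le> ennreal (L2dist M (Y k) y) + ennreal (L2dist M (Y k) (Y' k)) + ennreal (L2dist M (Y' k) y')"
      by (simp flip: ennreal_plus)
    also have "\<dots> \<le> ?A k" by (intro add_mono step order_refl)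
    finally show ?thesis .
  qed
  ultimately show ?thesis using LIMSEQ_le_const[of ?A] by simp
qed

text \<open>Freezing the curve at grid points gives jointly measurable step maps \<open>X n\<close>
  within \<open>(1/4)^n / 2\<close> of the curve at every time. Consecutive ones differ by at most
  \<open>(1/4)^n\<close>, so at each time they converge for almost every parameter, and the
  pointwise limit is again jointly measurable.\<close>

lemma continuous_L2_curve_version:
  fixes x :: "real \<Rightarrow> 'w \<Rightarrow> 'b::euclidean_space"
  assumes x: "continuous_L2_curve M a b x"
  shows "\<exists>X. case_prod X \<in> borel_measurable (lebesgue_on {a..b} \<Otimes>\<^sub>M M) \<and>
    (\<forall>\<sigma>\<in>{a..b}. AE w in M. X \<sigma> w = x \<sigma> w)"
proof -
  let ?N = "lebesgue_on {a..b}"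
  have xL: "\<And>\<sigma>. \<sigma> \<in> {a..b} \<Longrightarrow> x \<sigma> \<in> L2 M" using x by (simp add: continuous_L2_curve_iff)
  have "\<exists>d>0. \<forall>r\<in>{a..b}. \<forall>\<sigma>\<in>{a..b}. \<bar>r - \<sigma>\<bar> < d \<longrightarrow> L2dist M (x r) (x \<sigma>) < (1/4)^n / 2" for n :: nat
    by (rule continuous_L2_curve_uniform[OF x]) simp
  then obtain d where d: "\<And>n. d n > 0"
    "\<And>n r \<sigma>. r \<in> {a..b} \<Longrightarrow> \<sigma> \<in> {a..b} \<Longrightarrow> \<bar>r - \<sigma>\<bar> < d n \<Longrightarrow> L2dist M (x r) (x \<sigma>) < (1/4)^n / 2"
    by metis
  \<comment> \<open>The mesh \<open>d n / 2\<close> is below the modulus \<open>d n\<close>, and the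
    grid point to the left of \<open>\<sigma>\<close> stays in \<open>{a..b}\<close>.\<close>
  define j where "j n \<sigma> = nat \<lfloor>(\<sigma> - a) / (d n / 2)\<rfloor>" for n \<sigma>
  \<comment> \<open>The value 0 at grid points outside \<open>{a..b}\<close> only serves to make
    every \<open>y n i\<close> measurable.\<close>
  define y where "y n i = (let r = a + real i * (d n / 2) in if r \<in> {a..b} then x r else (\<lambda>_. 0))" for n i
  define X where "X n \<sigma> w = y n (j n \<sigma>) w" for n \<sigma> w
  have y [measurable]: "y n i \<in> borel_measurable M" for n i
    unfolding y_def Let_def using L2_measurable[OF xL] by auto
  have j [measurable]: "j n \<in> measurable ?N (count_space UNIV)" for n
  proof -
    have "(\<lambda>\<sigma>. (\<sigma> - a) / (d n / 2)) \<in> borel_measurable lebesgue" by (rule measurable_completion) measurable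
    then have [measurable]: "(\<lambda>\<sigma>. (\<sigma> - a) / (d n / 2)) \<in> borel_measurable ?N" by (rule measurable_restrict_space1)
    show ?thesis unfolding j_def by measurable
  qed
  have Xm [measurable]: "(\<lambda>z. X n (fst z) (snd z)) \<in> borel_measurable (?N \<Otimes>\<^sub>M M)" for n
    unfolding X_def
    by (rule measurable_compose_countable'[where I = UNIV and f = "\<lambda>i z. y n i (snd z)" and g = "\<lambda>z. j n (fst z)"]) auto
  have Xx: "X n \<sigma> \<in> L2 M \<and> L2dist M (X n \<sigma>) (x \<sigma>) < (1/4)^n / 2" if "\<sigma> \<in> {a..b}" for n \<sigma>
  proof -
    define r where "r = a + real (j n \<sigma>) * (d n / 2)"
    have "0 \<le> (\<sigma> - a) / (d n / 2)" using that d(1)[of n] by simp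
    then have "real (j n \<sigma>) \<le> (\<sigma> - a) / (d n / 2)" "(\<sigma> - a) / (d n / 2) < real (j n \<sigma>) + 1"
      unfolding j_def by linarith+
    then have "real (j n \<sigma>) * (d n / 2) \<le> \<sigma> - a" "\<sigma> - a < (real (j n \<sigma>) + 1) * (d n / 2)"
      using d(1)[of n] by (simp_all add: field_simps)
    then have r: "r \<in> {a..b}" "\<bar>r - \<sigma>\<bar> < d n"
      using that d(1)[of n] unfolding r_def by (auto simp: algebra_simps abs_if)
    have "X n \<sigma> = x r" unfolding X_def y_def Let_def using r(1) by (simp add: r_def)
    then show ?thesis using d(2)[OF r(1) that r(2)] xL[OF r(1)] by simp
  qed
  define Y where "Y \<sigma> w = lim (\<lambda>n. X n \<sigma> w)" for \<sigma> w
  have "case_prod Y \<in> borel_measurable (?N \<Otimes>\<^sub>M M)"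
    unfolding Y_def case_prod_unfold by measurable
  moreover have "AE w in M. Y \<sigma> w = x \<sigma> w" if "\<sigma> \<in> {a..b}" for \<sigma>
  proof -
    have XL: "X n \<sigma> \<in> L2 M" for n using Xx[OF that] by blast
    have fast: "L2dist M (X (Suc n) \<sigma>) (X n \<sigma>) \<le> (1/4)^n" for n
    proof -
      have "L2dist M (X (Suc n) \<sigma>) (X n \<sigma>) \<le> (1/4)^(Suc n) / 2 + (1/4)^n / 2"
        using L2norm_triangle_diff[OF XL[of "Suc n"] xL[OF that] XL[of n]] Xx[OF that, of n] Xx[OF that, of "Suc n"]
          L2norm_minus_commute[of M "x \<sigma>" "X n \<sigma>"] by linarith
      also have "\<dots> \<le> (1/4)^n" by simp
      finally show ?thesis .
    qed
    obtain G where G: "G \<in> L2 M" "AE w in M. (\<lambda>n. X n \<sigma> w) \<longlonglongrightarrow> G w" "(\<lambda>n. L2dist M (X n \<sigma>) G) \<longlonglongrightarrow> 0"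
      using L2_fast_Cauchy[of "\<lambda>n. X n \<sigma>" M, OF XL fast] by blast
    have q: "(\<lambda>n. (1/4::real)^n / 2) \<longlonglongrightarrow> 0" by (intro tendsto_divide_zero LIMSEQ_realpow_zero) auto
    have "(\<lambda>n. L2dist M (X n \<sigma>) (x \<sigma>)) \<longlonglongrightarrow> 0"
      by (rule tendsto_sandwich[OF _ _ tendsto_const q], simp, rule always_eventually)
        (use Xx[OF that] less_imp_le in blast)
    from L2_limit_unique[OF XL G(1) xL[OF that] G(3) this] G(2) show ?thesis
      by eventually_elim (auto simp: Y_def limI)
  qed
  ultimately show ?thesis by blast
qed

lemma has_L2_derivative_cong:
  fixes x x' :: "real \<Rightarrow> 'w \<Rightarrow> 'b::euclidean_space"
  assumes x: "\<And>r. r \<in> I \<Longrightarrow> x r \<in> L2 M" "\<And>r. r \<in> I \<Longrightarrow> x' r \<in> L2 M" "\<And>r. r \<in> I \<Longrightarrow> AE w in M. x r w = x' r w"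
    and p: "\<psi> \<in> L2 M" "\<psi>' \<in> L2 M" "AE w in M. \<psi> w = \<psi>' w" and t: "t \<in> I"
  shows "has_L2_derivative M x \<psi> t I \<longleftrightarrow> has_L2_derivative M x' \<psi>' t I"
proof -
  have "L2norm M (\<lambda>w. (x r w - x t w) /\<^sub>R (r - t) - \<psi> w) = L2norm M (\<lambda>w. (x' r w - x' t w) /\<^sub>R (r - t) - \<psi>' w)" if "r \<in> I" for r
  proof (rule L2norm_cong_AE)
    show "(\<lambda>w. (x r w - x t w) /\<^sub>R (r - t) - \<psi> w) \<in> borel_measurable M"
      by (intro L2_measurable L2_diff L2_scaleR x p t that)
    show "(\<lambda>w. (x' r w - x' t w) /\<^sub>R (r - t) - \<psi>' w) \<in> borel_measurable M"
      by (intro L2_measurable L2_diff L2_scaleR x p t that)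
    show "AE w in M. norm ((x r w - x t w) /\<^sub>R (r - t) - \<psi> w) = norm ((x' r w - x' t w) /\<^sub>R (r - t) - \<psi>' w)"
      using x(3)[OF that] x(3)[OF t] p(3) by eventually_elim simp
  qed
  then show ?thesis unfolding has_L2_derivative_def
    by (intro filterlim_cong refl) (auto simp: eventually_at_filter)
qed

text \<open>The difference \<open>z\<close> of the two sides is used as test function against
  itself. The scalar function \<open>F\<close>, the inner product of the curve with
  \<open>z\<close>, is absolutely continuous with derivative \<open>g\<close> almost everywhere, so
  the scalar fundamental theorem applies and gives \<open>(L2norm M z)\<^sup>2 = 0\<close>.\<close>

theorem L2_absolutely_continuous_imp_integral:
  fixes x D :: "real \<Rightarrow> 'w \<Rightarrow> 'b::euclidean_space"
  assumes M: "finite_measure M"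
    and x: "\<And>\<sigma>. \<sigma> \<in> {a..b} \<Longrightarrow> x \<sigma> \<in> L2 M" and ac: "L2_absolutely_continuous_on M a b x"
    and D: "case_prod D \<in> L2 (lebesgue_on {a..b} \<Otimes>\<^sub>M M)"
    and der: "AE \<sigma> in lebesgue_on {a..b}. has_L2_derivative M x (D \<sigma>) \<sigma> {a..b}"
    and \<tau>: "\<tau> \<in> {a..b}"
  shows "AE w in M. x \<tau> w = x a w + partial_integral (lebesgue_on {a..b}) {a..\<tau>} D w"
proof -
  let ?N = "lebesgue_on {a..b}"
  interpret pair_finite_measure ?N M by (rule pair_finite_measure_Icc) fact
  have sp: "{a..\<tau>} \<in> sets ?N" using \<tau> by (auto simp: sets_restrict_space_iff)
  define P where "P = partial_integral ?N {a..\<tau>} D"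
  have P: "P \<in> L2 M" unfolding P_def by (rule partial_integral_L2(1)[OF D sp])
  have xa: "x a \<in> L2 M" "x \<tau> \<in> L2 M" using x \<tau> by auto
  define z where "z w = x \<tau> w - x a w - P w" for w
  have z: "z \<in> L2 M" unfolding z_def by (intro L2_diff xa P)
  define F where "F \<sigma> = (\<integral>w. x \<sigma> w \<bullet> z w \<partial>M)" for \<sigma>
  define g where "g \<sigma> = (\<integral>w. D \<sigma> w \<bullet> z w \<partial>M)" for \<sigma>
  have Fdiff: "F v - F u = (\<integral>w. (x v w - x u w) \<bullet> z w \<partial>M)" if "u \<in> {a..b}" "v \<in> {a..b}" for u v
    unfolding F_def using L2_inner_integrable[OF x[OF that(1)] z] L2_inner_integrable[OF x[OF that(2)] z]
    by (simp add: inner_diff_left)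
  have Fle: "\<bar>F v - F u\<bar> \<le> L2dist M (x v) (x u) * L2norm M z" if "u \<in> {a..b}" "v \<in> {a..b}" for u v
    unfolding Fdiff[OF that] by (rule L2_Cauchy_Schwarz[OF L2_diff[OF x[OF that(2)] x[OF that(1)]] z])
  define Z where "Z = {\<sigma>\<in>{a..b}. \<not> (has_L2_derivative M x (D \<sigma>) \<sigma> {a..b} \<and> D \<sigma> \<in> L2 M)}"
  have "AE \<sigma> in ?N. has_L2_derivative M x (D \<sigma>) \<sigma> {a..b} \<and> D \<sigma> \<in> L2 M"
    using der AE_slice_L2[OF D] by eventually_elim simp
  then have Z: "negligible Z" unfolding Z_def by (subst (asm) AE_lebesgue_on_iff_negligible) auto
  have FTC: "((\<lambda>\<sigma>. if \<sigma> \<in> Z then 0 else g \<sigma>) has_integral (F \<tau> - F a)) {a..\<tau>}"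
  proof (rule absolutely_continuous_has_integral_derivative[OF _ _ Z])
    show "a \<le> \<tau>" using \<tau> by simp
    fix \<epsilon> :: real assume "\<epsilon> > 0"
    define \<epsilon>' where "\<epsilon>' = \<epsilon> / (L2norm M z + 1)"
    have L: "L2norm M z + 1 > 0" using L2norm_nonneg[of M z] by linarith
    then have "\<epsilon>' > 0" using \<open>\<epsilon> > 0\<close> by (simp add: \<epsilon>'_def)
    then obtain \<delta> where \<delta>: "\<delta> > 0" "\<And>(n::nat) u v.
        (\<forall>i<n. a \<le> u i \<and> u i \<le> v i \<and> v i \<le> b) \<and> disjoint_family_on (\<lambda>i. {u i<..<v i}) {..<n} \<and> (\<Sum>i<n. v i - u i) < \<delta>
        \<Longrightarrow> (\<Sum>i<n. L2dist M (x (v i)) (x (u i))) < \<epsilon>'"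
      using ac unfolding L2_absolutely_continuous_on_def by meson
    show "\<exists>\<delta>>0. \<forall>(n::nat) u v. (\<forall>i<n. a \<le> u i \<and> u i \<le> v i \<and> v i \<le> \<tau>) \<and>
        disjoint_family_on (\<lambda>i. {u i<..<v i}) {..<n} \<and> (\<Sum>i<n. v i - u i) < \<delta>
        \<longrightarrow> (\<Sum>i<n. \<bar>F (v i) - F (u i)\<bar>) < \<epsilon>"
    proof (intro exI[of _ \<delta>] conjI allI impI \<delta>(1))
      fix n :: nat and u v
      assume *: "(\<forall>i<n. a \<le> u i \<and> u i \<le> v i \<and> v i \<le> \<tau>) \<and>
        disjoint_family_on (\<lambda>i. {u i<..<v i}) {..<n} \<and> (\<Sum>i<n. v i - u i) < \<delta>"
      then have **: "\<forall>i<n. a \<le> u i \<and> u i \<le> v i \<and> v i \<le> b" using \<tau> by fastforce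
      have "(\<Sum>i<n. \<bar>F (v i) - F (u i)\<bar>) \<le> (\<Sum>i<n. L2dist M (x (v i)) (x (u i)) * L2norm M z)"
        using ** by (intro sum_mono Fle) force+
      also have "\<dots> = (\<Sum>i<n. L2dist M (x (v i)) (x (u i))) * L2norm M z" by (simp add: sum_distrib_right)
      also have "\<dots> \<le> \<epsilon>' * L2norm M z"
        using \<delta>(2)[of n u v] * ** by (intro mult_right_mono less_imp_le[of _ \<epsilon>']) auto
      also have "\<dots> < \<epsilon>" using L \<open>\<epsilon> > 0\<close> by (simp add: \<epsilon>'_def field_simps)
      finally show "(\<Sum>i<n. \<bar>F (v i) - F (u i)\<bar>) < \<epsilon>" .
    qed
  next
    fix \<sigma> assume \<sigma>: "\<sigma> \<in> {a..\<tau>} - Z"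
    then have \<sigma>': "\<sigma> \<in> {a..b}" "has_L2_derivative M x (D \<sigma>) \<sigma> {a..b}" "D \<sigma> \<in> L2 M" using \<tau> by (auto simp: Z_def)
    have q: "\<bar>(F r - F \<sigma>) / (r - \<sigma>) - g \<sigma>\<bar> \<le> L2norm M (\<lambda>w. (x r w - x \<sigma> w) /\<^sub>R (r - \<sigma>) - D \<sigma> w) * L2norm M z" if "r \<in> {a..b}" for r
    proof -
      have L: "(\<lambda>w. (x r w - x \<sigma> w) /\<^sub>R (r - \<sigma>)) \<in> L2 M" by (intro L2_scaleR L2_diff x that \<sigma>')
      have "(F r - F \<sigma>) / (r - \<sigma>) = (\<integral>w. ((x r w - x \<sigma> w) /\<^sub>R (r - \<sigma>)) \<bullet> z w \<partial>M)"
        unfolding Fdiff[OF \<sigma>'(1) that] by (simp add: divide_inverse mult.commute)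
      then have "(F r - F \<sigma>) / (r - \<sigma>) - g \<sigma> = (\<integral>w. ((x r w - x \<sigma> w) /\<^sub>R (r - \<sigma>) - D \<sigma> w) \<bullet> z w \<partial>M)"
        unfolding g_def inner_diff_left[of _ "D \<sigma> _"]
        by (subst Bochner_Integration.integral_diff[OF L2_inner_integrable[OF L z] L2_inner_integrable[OF \<sigma>'(3) z]]) simp
      then show ?thesis using L2_Cauchy_Schwarz[OF L2_diff[OF L \<sigma>'(3)] z] by simp
    qed
    have "((\<lambda>r. L2norm M (\<lambda>w. (x r w - x \<sigma> w) /\<^sub>R (r - \<sigma>) - D \<sigma> w) * L2norm M z) \<longlongrightarrow> 0) (at \<sigma> within {a..b})"
      using tendsto_mult_left_zero[OF \<sigma>'(2)[unfolded has_L2_derivative_def]] .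
    then have "((\<lambda>r. (F r - F \<sigma>) / (r - \<sigma>) - g \<sigma>) \<longlongrightarrow> 0) (at \<sigma> within {a..b})"
      by (rule Lim_null_comparison[rotated]) (use q in \<open>auto simp: eventually_at_filter\<close>)
    then have "(F has_field_derivative g \<sigma>) (at \<sigma> within {a..b})"
      by (simp add: has_field_derivative_iff LIM_zero_iff)
    then show "(F has_vector_derivative g \<sigma>) (at \<sigma> within {a..\<tau>})"
      using has_vector_derivative_within_subset[of F "g \<sigma>" \<sigma> "{a..b}" "{a..\<tau>}"] \<tau>
      by (simp add: has_real_derivative_iff_has_vector_derivative)
  qed
  have "(g has_integral (F \<tau> - F a)) {a..\<tau>}"
    by (rule has_integral_spike[OF Z _ FTC]) auto
  then have I1: "integral {a..\<tau>} g = F \<tau> - F a" by (rule integral_unique)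
  have gi: "integrable ?N g"
  proof -
    have "case_prod (\<lambda>\<sigma> w. z w) \<in> L2 (?N \<Otimes>\<^sub>M M)"
      using L2_measurable[OF z] by (intro product_L2I[of _ "\<lambda>w. norm (z w)"]) (auto intro: L2_norm_real z)
    from L2_inner_integrable[OF D this]
    have "integrable (?N \<Otimes>\<^sub>M M) (case_prod (\<lambda>\<sigma> w. D \<sigma> w \<bullet> z w))" by (simp add: case_prod_unfold)
    from integrable_fst[OF this] show ?thesis unfolding g_def .
  qed
  have "(\<integral>w. P w \<bullet> z w \<partial>M) = (\<integral>\<sigma>. indicator {a..\<tau>} \<sigma> * g \<sigma> \<partial>?N)"
    unfolding P_def g_def by (rule partial_integral_inner[OF D sp z])
  also have "\<dots> = F \<tau> - F a" using integral_indicator_lebesgue_on(1)[OF gi, of a \<tau>] \<tau> I1 by simp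
  also have "\<dots> = (\<integral>w. (x \<tau> w - x a w) \<bullet> z w \<partial>M)" using \<tau> by (intro Fdiff) auto
  finally have "(\<integral>w. (x \<tau> w - x a w) \<bullet> z w \<partial>M) - (\<integral>w. P w \<bullet> z w \<partial>M) = 0" by simp
  then have "(\<integral>w. (x \<tau> w - x a w) \<bullet> z w - P w \<bullet> z w \<partial>M) = 0"
    by (subst Bochner_Integration.integral_diff[OF L2_inner_integrable[OF L2_diff[OF xa(2,1)] z] L2_inner_integrable[OF P z]])
  moreover have "(x \<tau> w - x a w) \<bullet> z w - P w \<bullet> z w = (norm (z w))\<^sup>2" for w
    unfolding power2_norm_eq_inner inner_diff_left[symmetric] z_def ..
  ultimately have "(L2norm M z)\<^sup>2 = 0" unfolding L2norm_power2 by simp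
  then have "AE w in M. z w = 0" using L2norm_eq_0[OF z] by simp
  then show ?thesis by eventually_elim (simp add: z_def P_def algebra_simps)
qed

text \<open>Lebesgue's differentiation theorem for L2-valued maps. It reduces to the scalar one,
  applied to the squared distance of \<open>h\<close> from each vector of a countable set; at almost
  every \<open>\<tau>\<close> such a vector can be chosen close to \<open>h \<tau>\<close>.\<close>

theorem AE_has_L2_derivative_partial_integral:
  fixes x h :: "real \<Rightarrow> 'w \<Rightarrow> 'b::euclidean_space"
  assumes M: "finite_measure M" and h: "case_prod h \<in> L2 (lebesgue_on {a..b} \<Otimes>\<^sub>M M)"
    and x: "\<And>r. r \<in> {a..b} \<Longrightarrow> x r \<in> L2 M"
    and eq: "\<And>r. r \<in> {a..b} \<Longrightarrow> AE w in M. x r w = x0 w + partial_integral (lebesgue_on {a..b}) {a..r} h w"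
  shows "AE \<tau> in lebesgue_on {a..b}. has_L2_derivative M x (h \<tau>) \<tau> {a..b}"
proof -
  let ?N = "lebesgue_on {a..b}"
  interpret pair_finite_measure ?N M by (rule pair_finite_measure_Icc) fact
  obtain H where H: "\<And>k. H k \<in> rect_simple ?N M"
    "AE \<sigma> in ?N. (\<lambda>k. L2norm M (\<lambda>w. h \<sigma> w - H k (\<sigma>, w))) \<longlonglongrightarrow> 0"
    using rect_simple_sequence[OF h] by blast
  \<comment> \<open>A rectangle simple map takes finitely many values, so that \<open>P\<close>
    below is countable and still approximates \<open>h \<tau>\<close> at almost every
    \<open>\<tau>\<close>. Countability keeps the union of the exceptional sets of times
    null.\<close>
  define V where "V k = range (\<lambda>\<sigma> w. H k (\<sigma>, w))" for k
  have V: "finite (V k) \<and> V k \<subseteq> L2 M" for k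
  proof -
    obtain n :: nat and A p where n: "\<forall>i<n. A i \<in> sets ?N \<and> p i \<in> L2 M"
      "H k = (\<lambda>z. \<Sum>i<n. indicator (A i) (fst z) *\<^sub>R p i (snd z))"
      using H(1)[of k] unfolding rect_simple_def by blast
    have "V k \<subseteq> (\<lambda>J w. \<Sum>i\<in>J. p i w) ` Pow {..<n}"
    proof
      fix v assume "v \<in> V k"
      then obtain \<sigma> where v: "v = (\<lambda>w. H k (\<sigma>, w))" by (auto simp: V_def)
      have "v = (\<lambda>w. \<Sum>i\<in>{i\<in>{..<n}. \<sigma> \<in> A i}. p i w)"
        unfolding v n(2) sum.inter_filter[OF finite_lessThan] by (auto simp: fun_eq_iff indicator_def intro!: sum.cong)
      then show "v \<in> (\<lambda>J w. \<Sum>i\<in>J. p i w) ` Pow {..<n}" by blast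
    qed
    then have "finite (V k)" by (rule finite_subset) simp
    moreover have "V k \<subseteq> L2 M" unfolding V_def n(2) using n(1) by (auto intro!: L2_sum L2_scaleR)
    ultimately show ?thesis by simp
  qed
  define P where "P = (\<Union>k. V k)"
  have "countable P" unfolding P_def using V by (auto intro: countable_finite)
  have PL: "P \<subseteq> L2 M" unfolding P_def using V by auto
  \<comment> \<open>Squared distances fit the quadratic estimate for \<open>partial_integral\<close>
    and are integrable because \<open>h\<close> is square-integrable on the product.\<close>
  define \<kappa> where "\<kappa> p \<sigma> = (L2dist M (h \<sigma>) p)\<^sup>2" for p \<sigma>
  have const: "case_prod (\<lambda>\<sigma> w. p w) \<in> L2 (?N \<Otimes>\<^sub>M M)" if "p \<in> L2 M" for p :: "'w \<Rightarrow> 'b"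
    using L2_measurable[OF that] by (intro product_L2I[of _ "\<lambda>w. norm (p w)"]) (auto intro: L2_norm_real that)
  have hp: "case_prod (\<lambda>\<sigma> w. h \<sigma> w - p w) \<in> L2 (?N \<Otimes>\<^sub>M M)" if "p \<in> L2 M" for p
    using L2_diff[OF h const[OF that]] by (simp add: case_prod_unfold)
  have \<kappa>: "integrable ?N (\<kappa> p)" if "p \<in> L2 M" for p
    unfolding \<kappa>_def by (rule integrable_slice_norm2(1)[OF hp[OF that]])
  define good where "good p \<tau> \<longleftrightarrow> (\<forall>e>0. \<exists>\<delta>>0. \<forall>r\<in>{a..b}. 0 < \<bar>r - \<tau>\<bar> \<and> \<bar>r - \<tau>\<bar> < \<delta> \<longrightarrow>
       integral {min r \<tau>..max r \<tau>} (\<kappa> p) \<le> (\<kappa> p \<tau> + e) * \<bar>r - \<tau>\<bar>)" for p \<tau>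
  have "AE \<tau> in ?N. good p \<tau>" if p: "p \<in> P" for p
  proof -
    have "\<kappa> p integrable_on {a..b}" using integral_indicator_lebesgue_on(2)[OF \<kappa>, of p a b] p PL by auto
    then obtain Z where Z: "negligible Z" "\<And>\<tau> e. \<tau> \<in> {a..b} - Z \<Longrightarrow> 0 < e \<Longrightarrow> \<exists>\<delta>>0. \<forall>r\<in>{a..b}. 0 < \<bar>r - \<tau>\<bar> \<and> \<bar>r - \<tau>\<bar> < \<delta> \<longrightarrow>
       integral {min r \<tau>..max r \<tau>} (\<kappa> p) \<le> (\<kappa> p \<tau> + e) * \<bar>r - \<tau>\<bar>"
      by (rule Lebesgue_points) blast
    have "{\<tau>\<in>{a..b}. \<not> good p \<tau>} \<subseteq> Z"
    proof
      fix \<tau> assume "\<tau> \<in> {\<tau>\<in>{a..b}. \<not> good p \<tau>}"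
      then show "\<tau> \<in> Z" using Z(2)[of \<tau>] unfolding good_def by blast
    qed
    then show ?thesis using Z(1) by (subst AE_lebesgue_on_iff_negligible) (auto intro: negligible_subset)
  qed
  then have "AE \<tau> in ?N. \<forall>p\<in>P. good p \<tau>" unfolding AE_ball_countable[OF \<open>countable P\<close>] by blast
  with H(2) AE_slice_L2[OF h] AE_space show ?thesis
  proof eventually_elim
    case (elim \<tau>)
    then have \<tau>: "\<tau> \<in> {a..b}" and h\<tau>: "h \<tau> \<in> L2 M" by auto
    show ?case unfolding has_L2_derivative_def
    proof (rule tendstoI)
      fix \<epsilon> :: real assume "\<epsilon> > 0"
      \<comment> \<open>The squared error of the difference quotient comes out as
        \<open>6 * \<eta>\<^sup>2\<close>, and 6/9 is below 1.\<close>
      define \<eta> where "\<eta> = \<epsilon> / 3"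
      have "\<eta> > 0" using \<open>\<epsilon> > 0\<close> by (simp add: \<eta>_def)
      obtain k where k: "L2norm M (\<lambda>w. h \<tau> w - H k (\<tau>, w)) < \<eta>"
        using LIMSEQ_D[OF elim(1) \<open>\<eta> > 0\<close>] by auto
      define p where "p = (\<lambda>w. H k (\<tau>, w))"
      have "p \<in> P" unfolding P_def V_def p_def by blast
      then have pL: "p \<in> L2 M" using PL by auto
      have k2: "\<kappa> p \<tau> \<le> \<eta>\<^sup>2" unfolding \<kappa>_def p_def using k by (intro power_mono) auto
      obtain \<delta> where \<delta>: "\<delta> > 0" "\<And>r. r \<in> {a..b} \<Longrightarrow> 0 < \<bar>r - \<tau>\<bar> \<Longrightarrow> \<bar>r - \<tau>\<bar> < \<delta> \<Longrightarrow>
         integral {min r \<tau>..max r \<tau>} (\<kappa> p) \<le> (\<kappa> p \<tau> + \<eta>\<^sup>2) * \<bar>r - \<tau>\<bar>"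
        using bspec[OF elim(4) \<open>p \<in> P\<close>, unfolded good_def, THEN spec, of "\<eta>\<^sup>2"] \<open>\<eta> > 0\<close> by auto
      have "L2norm M (\<lambda>w. (x r w - x \<tau> w) /\<^sub>R (r - \<tau>) - h \<tau> w) < \<epsilon>"
        if r: "r \<in> {a..b}" "r \<noteq> \<tau>" "\<bar>r - \<tau>\<bar> < \<delta>" for r
      proof -
        define u where "u = min r \<tau>"
        define v where "v = max r \<tau>"
        define l where "l = \<bar>r - \<tau>\<bar>"
        have uv: "a \<le> u" "u \<le> v" "v \<le> b" "l = v - u" "l > 0" using r \<tau> by (auto simp: u_def v_def l_def)
        have sets: "{u..v} \<in> sets ?N" "{a..u} \<in> sets ?N" "{a..v} \<in> sets ?N" using uv by (auto simp: sets_restrict_space_iff)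
        define D where "D = (\<lambda>\<sigma> w. h \<sigma> w - h \<tau> w)"
        have D: "case_prod D \<in> L2 (?N \<Otimes>\<^sub>M M)" unfolding D_def by (rule hp[OF h\<tau>])
        have "AE w in M. (x r w - x \<tau> w) /\<^sub>R (r - \<tau>) - h \<tau> w = inverse l *\<^sub>R partial_integral ?N {u..v} D w"
          using eq[OF r(1)] eq[OF \<tau>] AE_slice_L2'[OF h] partial_integral_diff[OF h const[OF h\<tau>] sets(1)]
        proof eventually_elim
          case (elim w)
          have "integrable ?N (\<lambda>\<sigma>. norm (h \<sigma> w))"
            by (rule M1.square_integrable_imp_integrable)
              (use L2_integrable_square[OF elim(3)] L2_measurable[OF elim(3)] in auto)
          then have i: "integrable ?N (\<lambda>\<sigma>. h \<sigma> w)" using integrable_norm_iff[OF L2_measurable[OF elim(3)]] by simp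
          have split: "partial_integral ?N {a..v} h w = partial_integral ?N {a..u} h w + partial_integral ?N {u..v} h w"
            unfolding partial_integral_def by (rule integral_indicator_split[OF i]) (use uv in auto)
          have c: "partial_integral ?N {u..v} (\<lambda>\<sigma>. h \<tau>) w = l *\<^sub>R h \<tau> w"
            unfolding partial_integral_def using sets(1) uv measure_lebesgue_on_Icc[of a u v b] by (simp add: M1.emeasure_finite less_top[symmetric])
          have "(x r w - x \<tau> w) /\<^sub>R (r - \<tau>) = inverse l *\<^sub>R partial_integral ?N {u..v} h w"
          proof (cases "\<tau> < r")
            case True
            then have "u = \<tau>" "v = r" "l = r - \<tau>" by (auto simp: u_def v_def l_def)
            then show ?thesis using elim(1,2) split by simp
          next
            case False
            then have "u = r" "v = \<tau>" and l: "r - \<tau> = - l" using r(2) by (auto simp: u_def v_def l_def)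
            then have "x r w - x \<tau> w = - partial_integral ?N {u..v} h w" using elim(1,2) split by simp
            then show ?thesis unfolding l by simp
          qed
          moreover have "partial_integral ?N {u..v} D w = partial_integral ?N {u..v} h w - l *\<^sub>R h \<tau> w"
            using elim(4) c unfolding D_def by simp
          ultimately show ?case using uv(5) by (simp add: scaleR_diff_right)
        qed
        then have "L2norm M (\<lambda>w. (x r w - x \<tau> w) /\<^sub>R (r - \<tau>) - h \<tau> w) = L2norm M (\<lambda>w. inverse l *\<^sub>R partial_integral ?N {u..v} D w)"
          by (intro L2norm_cong_AE L2_measurable L2_diff L2_scaleR x r \<tau> h\<tau> partial_integral_L2(1)[OF D sets(1)])
            (auto elim!: eventually_mono)
        then have "(L2norm M (\<lambda>w. (x r w - x \<tau> w) /\<^sub>R (r - \<tau>) - h \<tau> w))\<^sup>2 = inverse (l\<^sup>2) * (L2norm M (partial_integral ?N {u..v} D))\<^sup>2"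
          by (simp add: L2norm_scaleR power_mult_distrib power_inverse)
        also have "\<dots> \<le> inverse (l\<^sup>2) * (l * (6 * \<eta>\<^sup>2 * l))"
        proof (rule mult_left_mono)
          have "(L2norm M (partial_integral ?N {u..v} D))\<^sup>2 \<le> l * (\<integral>\<sigma>. indicator {u..v} \<sigma> * (L2norm M (D \<sigma>))\<^sup>2 \<partial>?N)"
            using partial_integral_L2(2)[OF D sets(1)] measure_lebesgue_on_Icc[of a u v b] uv by simp
          also have "\<dots> \<le> l * (6 * \<eta>\<^sup>2 * l)"
          proof (rule mult_left_mono)
            have i1: "integrable ?N (\<lambda>\<sigma>. indicator {u..v} \<sigma> * \<kappa> p \<sigma>)"
              using integrable_mult_indicator[OF sets(1) \<kappa>[OF pL]] by simp
            have i2: "integrable ?N (indicator {u..v} :: real \<Rightarrow> real)"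
              using sets(1) by (simp add: M1.emeasure_finite less_top[symmetric])
            have "(\<integral>\<sigma>. indicator {u..v} \<sigma> * (L2norm M (D \<sigma>))\<^sup>2 \<partial>?N) \<le> (\<integral>\<sigma>. 2 * (indicator {u..v} \<sigma> * \<kappa> p \<sigma>) + 2 * \<eta>\<^sup>2 * indicator {u..v} \<sigma> \<partial>?N)"
            proof (rule integral_mono_AE')
              show "integrable ?N (\<lambda>\<sigma>. 2 * (indicator {u..v} \<sigma> * \<kappa> p \<sigma>) + 2 * \<eta>\<^sup>2 * indicator {u..v} \<sigma>)"
                using i1 i2 by simp
              show "AE \<sigma> in ?N. 0 \<le> 2 * (indicator {u..v} \<sigma> * \<kappa> p \<sigma>) + 2 * \<eta>\<^sup>2 * indicator {u..v} \<sigma>"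
                by (auto simp: \<kappa>_def)
              show "AE \<sigma> in ?N. indicator {u..v} \<sigma> * (L2norm M (D \<sigma>))\<^sup>2 \<le> 2 * (indicator {u..v} \<sigma> * \<kappa> p \<sigma>) + 2 * \<eta>\<^sup>2 * indicator {u..v} \<sigma>"
                using AE_slice_L2[OF h]
              proof eventually_elim
                case (elim \<sigma>)
                have "L2norm M (D \<sigma>) \<le> L2dist M (h \<sigma>) p + L2dist M (h \<tau>) p"
                  unfolding D_def using L2norm_triangle_diff[OF elim pL h\<tau>] L2norm_minus_commute[of M p "h \<tau>"] by simp
                also have "\<dots> \<le> L2dist M (h \<sigma>) p + \<eta>" using k by (simp add: p_def)
                finally have "(L2norm M (D \<sigma>))\<^sup>2 \<le> (L2dist M (h \<sigma>) p + \<eta>)\<^sup>2" by (intro power_mono) auto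
                also have "\<dots> \<le> 2 * \<kappa> p \<sigma> + 2 * \<eta>\<^sup>2"
                  using sum_squares_bound[of "L2dist M (h \<sigma>) p" \<eta>] by (simp add: \<kappa>_def power2_sum)
                finally show ?case by (auto simp: indicator_def)
              qed
            qed
            also have "\<dots> = 2 * (\<integral>\<sigma>. indicator {u..v} \<sigma> * \<kappa> p \<sigma> \<partial>?N) + 2 * \<eta>\<^sup>2 * l"
              using i1 i2 sets(1) measure_lebesgue_on_Icc[of a u v b] uv by simp
            also have "(\<integral>\<sigma>. indicator {u..v} \<sigma> * \<kappa> p \<sigma> \<partial>?N) = integral {u..v} (\<kappa> p)"
              using uv by (intro integral_indicator_lebesgue_on(1) \<kappa>[OF pL]) auto
            also have "\<dots> \<le> (\<kappa> p \<tau> + \<eta>\<^sup>2) * l" using \<delta>(2)[OF r(1) _ r(3)] r(2) unfolding u_def v_def l_def by auto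
            also have "\<dots> \<le> (2 * \<eta>\<^sup>2) * l" using k2 uv(5) by (intro mult_right_mono) auto
            finally show "(\<integral>\<sigma>. indicator {u..v} \<sigma> * (L2norm M (D \<sigma>))\<^sup>2 \<partial>?N) \<le> 6 * \<eta>\<^sup>2 * l" by (simp add: mult_ac)
          qed (use uv in simp)
          finally show "(L2norm M (partial_integral ?N {u..v} D))\<^sup>2 \<le> l * (6 * \<eta>\<^sup>2 * l)" .
        qed simp
        also have "\<dots> = 6 * \<eta>\<^sup>2" using uv(5) by (simp add: power2_eq_square field_simps)
        also have "\<dots> < \<epsilon>\<^sup>2" using \<open>\<epsilon> > 0\<close> by (simp add: \<eta>_def power2_eq_square)
        finally show ?thesis using \<open>\<epsilon> > 0\<close> by (simp add: power_less_imp_less_base)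
      qed
      then show "\<forall>\<^sub>F r in at \<tau> within {a..b}. dist (L2norm M (\<lambda>w. (x r w - x \<tau> w) /\<^sub>R (r - \<tau>) - h \<tau> w)) 0 < \<epsilon>"
        unfolding eventually_at using \<delta>(1) by (intro exI[of _ \<delta>]) (auto simp: dist_real_def)
    qed
  qed
qed

section \<open>Parametrized ordinary differential equations\<close>

lemma geometric_increments_convergent:
  fixes s :: "nat \<Rightarrow> 'b::banach"
  assumes s: "\<And>n. norm (s (Suc n) - s n) \<le> R * (1/2) ^ n" and R0: "0 \<le> R"
  shows "convergent s" and "norm (s n - lim s) \<le> R * (2 * (1/2) ^ n)"
proof -
  have geo: "norm (s (n + k) - s n) \<le> R * (2 * (1/2)^n)" for n k
  proof -
    have "norm (s (n + k) - s n) \<le> R * (2 * (1/2)^n - 2 * (1/2)^(n+k))"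
    proof (induction k)
      case (Suc k)
      have "norm (s (n + Suc k) - s n) \<le> norm (s (Suc (n + k)) - s (n + k)) + norm (s (n + k) - s n)"
        using norm_triangle_ineq[of "s (Suc (n + k)) - s (n + k)" "s (n + k) - s n"] by simp
      also have "\<dots> \<le> R * (1/2)^(n+k) + R * (2 * (1/2)^n - 2 * (1/2)^(n+k))"
        using s Suc by (intro add_mono) auto
      also have "\<dots> = R * (2 * (1/2)^n - 2 * (1/2)^(n+Suc k))" by (simp add: algebra_simps)
      finally show ?case .
    qed simp
    also have "\<dots> \<le> R * (2 * (1/2)^n)" using R0 by (intro mult_left_mono) auto
    finally show ?thesis .
  qed
  show conv: "convergent s"
  proof (rule Cauchy_convergent, rule metric_CauchyI)
    fix e :: real assume "0 < e"
    have "(\<lambda>n. R * (2 * (1/2)^n)) \<longlonglongrightarrow> R * (2 * 0)"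
      by (intro tendsto_intros LIMSEQ_realpow_zero) auto
    then obtain N where N: "R * (2 * (1/2)^N) < e/2"
      using \<open>0 < e\<close> order_tendstoD(2)[of "\<lambda>n. R * (2 * (1/2)^n)" "0::real" sequentially "e/2"]
      unfolding eventually_sequentially by (metis half_gt_zero le_refl mult_zero_right)
    show "\<exists>N. \<forall>m\<ge>N. \<forall>n\<ge>N. dist (s m) (s n) < e"
    proof (intro exI allI impI)
      fix m n assume "N \<le> m" "N \<le> n"
      then have "dist (s m) (s N) < e/2" "dist (s n) (s N) < e/2"
        using geo[of N "m - N"] geo[of N "n - N"] N by (auto simp: dist_norm)
      then show "dist (s m) (s n) < e" by (rule dist_triangle_half_l)
    qed
  qed
  have "(\<lambda>k. norm (s n - s (k + n))) \<longlonglongrightarrow> norm (s n - lim s)"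
    using LIMSEQ_ignore_initial_segment[OF convergent_LIMSEQ_iff[THEN iffD1, OF conv]] by (intro tendsto_intros)
  then show "norm (s n - lim s) \<le> R * (2 * (1/2) ^ n)"
    by (rule Lim_bounded) (metis geo add.commute norm_minus_commute)
qed

lemma id_measurable_lebesgue_on [measurable]: "(\<lambda>\<sigma>. \<sigma>) \<in> borel_measurable (lebesgue_on {a..b::real})"
  by (intro measurable_restrict_space1 measurable_completion) simp

lemma bounded_integrable_lebesgue_on:
  fixes k :: "real \<Rightarrow> 'b::euclidean_space"
  assumes "k \<in> borel_measurable (lebesgue_on {a..b})" "\<And>\<sigma>. \<sigma> \<in> {a..b} \<Longrightarrow> norm (k \<sigma>) \<le> B"
  shows "integrable (lebesgue_on {a..b}) k"
proof (rule finite_measure.integrable_const_bound[of _ k B])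
  show "finite_measure (lebesgue_on {a..b})" by (simp add: finite_measure_lebesgue_on)
  show "AE \<sigma> in lebesgue_on {a..b}. norm (k \<sigma>) \<le> B" using assms(2) by (intro AE_I2) auto
qed (fact assms(1))

lemma integral_indicator_diff:
  fixes k :: "real \<Rightarrow> 'b::euclidean_space"
  assumes k: "integrable (lebesgue_on {a..b}) k" and t: "t \<in> {a..b}" "r \<in> {a..b}"
  shows "norm ((\<integral>\<sigma>. indicator {a..t} \<sigma> *\<^sub>R k \<sigma> \<partial>lebesgue_on {a..b}) - (\<integral>\<sigma>. indicator {a..r} \<sigma> *\<^sub>R k \<sigma> \<partial>lebesgue_on {a..b}))
    = norm (\<integral>\<sigma>. indicator {min t r..max t r} \<sigma> *\<^sub>R k \<sigma> \<partial>lebesgue_on {a..b})"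
proof (cases "t \<le> r")
  case True
  then show ?thesis using integral_indicator_split[OF k, of a t r] t by (simp add: min_absorb1 max_absorb2)
next
  case False
  then show ?thesis using integral_indicator_split[OF k, of a r t] t by (simp add: min_absorb2 max_absorb1)
qed

text \<open>Integration from \<open>r\<close>, in either direction, reproduces the weight
  \<open>exp (l * \<bar>\<sigma> - r\<bar>)\<close> up to the factor \<open>1 / l\<close>. With
  \<open>l = 2 * k\<close> this beats a Lipschitz constant \<open>k\<close> by a factor of
  two.\<close>

lemma exp_weight_integral_bound:
  fixes k :: "real \<Rightarrow> 'b::euclidean_space"
  assumes k: "integrable (lebesgue_on {a..b}) k" and t: "t \<in> {a..b}" "r \<in> {a..b}" and "0 < l" "0 \<le> B"
    and bd: "\<And>\<sigma>. \<sigma> \<in> {a..b} \<Longrightarrow> norm (k \<sigma>) \<le> B * exp (l * \<bar>\<sigma> - r\<bar>)"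
  shows "norm ((\<integral>\<sigma>. indicator {a..t} \<sigma> *\<^sub>R k \<sigma> \<partial>lebesgue_on {a..b}) - (\<integral>\<sigma>. indicator {a..r} \<sigma> *\<^sub>R k \<sigma> \<partial>lebesgue_on {a..b}))
    \<le> B / l * exp (l * \<bar>t - r\<bar>)"
proof -
  let ?w = "\<lambda>\<sigma>. B * exp (l * \<bar>\<sigma> - r\<bar>)"
  let ?J = "{min t r..max t r}"
  have J: "?J \<subseteq> {a..b}" using t by auto
  have wi: "integrable (lebesgue_on {a..b}) ?w"
    by (rule continuous_imp_integrable_real) (intro continuous_intros)
  have "norm (\<integral>\<sigma>. indicator ?J \<sigma> *\<^sub>R k \<sigma> \<partial>lebesgue_on {a..b}) \<le> (\<integral>\<sigma>. indicator ?J \<sigma> * ?w \<sigma> \<partial>lebesgue_on {a..b})"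
  proof (rule Bochner_Integration.integral_norm_bound_integral)
    have "?J \<in> sets (lebesgue_on {a..b})" using J by (simp add: sets_restrict_space_iff)
    from integrable_mult_indicator[OF this k] integrable_mult_indicator[OF this wi]
    show "integrable (lebesgue_on {a..b}) (\<lambda>\<sigma>. indicator ?J \<sigma> *\<^sub>R k \<sigma>)"
      "integrable (lebesgue_on {a..b}) (\<lambda>\<sigma>. indicator ?J \<sigma> * ?w \<sigma>)" by simp_all
    show "norm (indicator ?J \<sigma> *\<^sub>R k \<sigma>) \<le> indicator ?J \<sigma> * ?w \<sigma>" if "\<sigma> \<in> space (lebesgue_on {a..b})" for \<sigma>
      using bd[of \<sigma>] that by (auto simp: indicator_def)
  qed
  also have "\<dots> = integral ?J ?w" by (rule integral_indicator_lebesgue_on(1)[OF wi J])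
  also have "\<dots> \<le> B / l * exp (l * \<bar>t - r\<bar>)"
  proof (cases "t \<le> r")
    case True
    have "((\<lambda>\<sigma>. B * exp (l * (r - \<sigma>))) has_integral (- (B / l * exp (l * (r - r))) - - (B / l * exp (l * (r - t))))) {t..r}"
      by (rule fundamental_theorem_of_calculus[OF True])
        (use \<open>0 < l\<close> in \<open>auto intro!: derivative_eq_intros simp: has_real_derivative_iff_has_vector_derivative[symmetric]\<close>)
    then have "((\<lambda>\<sigma>. B * exp (l * (r - \<sigma>))) has_integral (B / l * exp (l * (r - t)) - B / l)) {t..r}" by simp
    then have "(?w has_integral (B / l * exp (l * (r - t)) - B / l)) {t..r}"
      by (rule has_integral_eq[rotated]) auto
    then have "integral {t..r} ?w = B / l * exp (l * (r - t)) - B / l" by (rule integral_unique)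
    moreover have "0 \<le> B / l" using \<open>0 < l\<close> \<open>0 \<le> B\<close> by simp
    ultimately show ?thesis using True by (simp add: min_absorb1 max_absorb2 del: integral_mult_right)
  next
    case False
    have "((\<lambda>\<sigma>. B * exp (l * (\<sigma> - r))) has_integral (B / l * exp (l * (t - r)) - B / l * exp (l * (r - r)))) {r..t}"
      by (rule fundamental_theorem_of_calculus)
        (use False \<open>0 < l\<close> in \<open>auto intro!: derivative_eq_intros simp: has_real_derivative_iff_has_vector_derivative[symmetric]\<close>)
    then have "(?w has_integral (B / l * exp (l * (t - r)) - B / l * exp (l * (r - r)))) {r..t}"
      by (rule has_integral_eq[rotated]) auto
    then have "integral {r..t} ?w = B / l * exp (l * (t - r)) - B / l * exp (l * (r - r))" by (rule integral_unique)
    moreover have "0 \<le> B / l" using \<open>0 < l\<close> \<open>0 \<le> B\<close> by simp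
    ultimately show ?thesis using False by (simp add: min_absorb2 max_absorb1 del: integral_mult_right)
  qed
  finally show ?thesis unfolding integral_indicator_diff[OF k t] .
qed

text \<open>The control is absorbed into the time dependence of \<open>G\<close>. All bounds hold at
  every time of \<open>{0..T}\<close> and for every parameter, so that the equation can be solved
  separately for each parameter; \<open>measurable_comp\<close> keeps the Picard iterates jointly
  measurable.\<close>

locale lipschitz_ode =
  fixes T :: real and \<mu> :: "'w measure" and G :: "real \<Rightarrow> 'b::euclidean_space \<Rightarrow> 'w \<Rightarrow> 'b" and c k :: real
  assumes T_pos: "0 < T" and c_pos: "0 < c" and k_pos: "0 < k"
    and finite_\<mu>: "finite_measure \<mu>" and space_\<mu>: "space \<mu> = UNIV"
    and measurable_comp: "\<And>X. case_prod X \<in> borel_measurable (lebesgue_on {0..T} \<Otimes>\<^sub>M \<mu>) \<Longrightarrow>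
      case_prod (\<lambda>\<sigma> w. G \<sigma> (X \<sigma> w) w) \<in> borel_measurable (lebesgue_on {0..T} \<Otimes>\<^sub>M \<mu>)"
    and growth: "\<And>\<sigma> x w. \<sigma> \<in> {0..T} \<Longrightarrow> norm (G \<sigma> x w) \<le> c * (1 + norm x)"
    and lipschitz: "\<And>\<sigma> x y w. \<sigma> \<in> {0..T} \<Longrightarrow> norm (G \<sigma> x w - G \<sigma> y w) \<le> k * norm (x - y)"

sublocale lipschitz_ode \<subseteq> pair_finite_measure "lebesgue_on {0..T}" \<mu>
  by (rule pair_finite_measure_Icc[OF finite_\<mu>])

context lipschitz_ode
begin

abbreviation "N \<equiv> lebesgue_on {0..T}"

definition velocity :: "(real \<Rightarrow> 'w \<Rightarrow> 'b) \<Rightarrow> real \<Rightarrow> 'w \<Rightarrow> 'b" where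
  "velocity X \<sigma> w = G \<sigma> (X \<sigma> w) w"

text \<open>Based at 0 whatever the initial time: the increment from \<open>s\<close> to
  \<open>t\<close> is then meaningful for \<open>t\<close> on either side of
  \<open>s\<close>.\<close>

definition primitive :: "(real \<Rightarrow> 'w \<Rightarrow> 'b) \<Rightarrow> real \<Rightarrow> 'w \<Rightarrow> 'b" where
  "primitive h t = partial_integral N {0..t} h"

definition ode_solution :: "real \<Rightarrow> ('w \<Rightarrow> 'b) \<Rightarrow> (real \<Rightarrow> 'w \<Rightarrow> 'b) \<Rightarrow> bool" where
  "ode_solution s \<phi> X \<longleftrightarrow> case_prod X \<in> borel_measurable (N \<Otimes>\<^sub>M \<mu>) \<and>
    (\<forall>w. \<forall>t\<in>{0..T}. X t w = \<phi> w + (primitive (velocity X) t w - primitive (velocity X) s w))"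

text \<open>Picard iteration bounds the solution by \<open>norm (\<phi> w) + 2 * R w\<close> with
  \<open>R w = c * T * (1 + norm (\<phi> w)) * exp (2 * k * T)\<close>; the constant dominates this
  by a multiple of \<open>1 + norm (\<phi> w)\<close>.\<close>

definition growth_const :: real where
  "growth_const = 1 + 2 * c * T * exp (2 * k * T)"

lemma growth_const_ge_1: "1 \<le> growth_const"
  unfolding growth_const_def using T_pos c_pos by simp

lemma velocity_measurable:
  "case_prod X \<in> borel_measurable (N \<Otimes>\<^sub>M \<mu>) \<Longrightarrow> case_prod (velocity X) \<in> borel_measurable (N \<Otimes>\<^sub>M \<mu>)"
  using measurable_comp[of X] unfolding velocity_def .

lemma slice_measurable:
  fixes h :: "real \<Rightarrow> 'w \<Rightarrow> 'b"
  assumes [measurable]: "case_prod h \<in> borel_measurable (N \<Otimes>\<^sub>M \<mu>)"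
  shows "(\<lambda>\<sigma>. h \<sigma> w) \<in> borel_measurable N"
proof -
  have [measurable]: "w \<in> space \<mu>" by (simp add: space_\<mu>)
  show ?thesis by measurable
qed

lemma primitive_measurable:
  fixes h :: "real \<Rightarrow> 'w \<Rightarrow> 'b"
  assumes [measurable]: "case_prod h \<in> borel_measurable (N \<Otimes>\<^sub>M \<mu>)"
  shows "case_prod (primitive h) \<in> borel_measurable (N \<Otimes>\<^sub>M \<mu>)"
proof -
  have h1: "(\<lambda>p. h (snd p) (snd (fst p))) \<in> borel_measurable ((N \<Otimes>\<^sub>M \<mu>) \<Otimes>\<^sub>M N)"
    by measurable
  have t1: "(\<lambda>p. snd p) \<in> borel_measurable ((N \<Otimes>\<^sub>M \<mu>) \<Otimes>\<^sub>M N)"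
    by (rule measurable_compose[OF measurable_snd id_measurable_lebesgue_on])
  have t2: "(\<lambda>p. fst (fst p)) \<in> borel_measurable ((N \<Otimes>\<^sub>M \<mu>) \<Otimes>\<^sub>M N)"
    by (rule measurable_compose[OF measurable_compose[OF measurable_fst measurable_fst] id_measurable_lebesgue_on])
  have "{p \<in> space ((N \<Otimes>\<^sub>M \<mu>) \<Otimes>\<^sub>M N). snd p \<le> fst (fst p)} \<in> sets ((N \<Otimes>\<^sub>M \<mu>) \<Otimes>\<^sub>M N)"
    by (rule borel_measurable_le[OF t1 t2])
  then have "(\<lambda>p. if snd p \<le> fst (fst p) then h (snd p) (snd (fst p)) else 0) \<in> borel_measurable ((N \<Otimes>\<^sub>M \<mu>) \<Otimes>\<^sub>M N)"
    by (intro measurable_If h1) auto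
  then have "(\<lambda>z. \<integral>\<sigma>. (if \<sigma> \<le> fst z then h \<sigma> (snd z) else 0) \<partial>N) \<in> borel_measurable (N \<Otimes>\<^sub>M \<mu>)"
    by (intro M1.borel_measurable_lebesgue_integral) (simp add: case_prod_unfold)
  moreover have "case_prod (primitive h) z = (\<integral>\<sigma>. (if \<sigma> \<le> fst z then h \<sigma> (snd z) else 0) \<partial>N)" for z
    unfolding primitive_def partial_integral_def case_prod_unfold
    by (rule Bochner_Integration.integral_cong) (auto simp: indicator_def)
  ultimately show ?thesis by presburger
qed

lemma primitive_diff_weighted:
  fixes h :: "real \<Rightarrow> 'w \<Rightarrow> 'b"
  assumes "case_prod h \<in> borel_measurable (N \<Otimes>\<^sub>M \<mu>)" "t \<in> {0..T}" "s \<in> {0..T}" "0 \<le> B"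
    and "\<And>\<sigma>. \<sigma> \<in> {0..T} \<Longrightarrow> norm (h \<sigma> w) \<le> B * exp (2 * k * \<bar>\<sigma> - s\<bar>)"
  shows "norm (primitive h t w - primitive h s w) \<le> B / (2 * k) * exp (2 * k * \<bar>t - s\<bar>)"
proof -
  have "norm (h \<sigma> w) \<le> B * exp (2 * k * T)" if "\<sigma> \<in> {0..T}" for \<sigma>
    by (rule order_trans[OF assms(5)[OF that]]) (use that assms(3,4) k_pos in \<open>auto intro!: mult_left_mono\<close>)
  then have "integrable N (\<lambda>\<sigma>. h \<sigma> w)" by (rule bounded_integrable_lebesgue_on[OF slice_measurable[OF assms(1)]])
  then show ?thesis unfolding primitive_def partial_integral_def
    by (rule exp_weight_integral_bound) (use assms k_pos in auto)
qed

lemma primitive_diff_le: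
  fixes h :: "real \<Rightarrow> 'w \<Rightarrow> 'b"
  assumes "case_prod h \<in> borel_measurable (N \<Otimes>\<^sub>M \<mu>)" "t \<in> {0..T}" "s \<in> {0..T}"
    and bd: "\<And>\<sigma>. \<sigma> \<in> {0..T} \<Longrightarrow> norm (h \<sigma> w) \<le> B"
  shows "norm (primitive h t w - primitive h s w) \<le> B * \<bar>t - s\<bar>"
proof -
  let ?J = "{min t s..max t s}"
  have J: "?J \<in> sets N" using assms(2,3) by (auto simp: sets_restrict_space_iff)
  have i: "integrable N (\<lambda>\<sigma>. h \<sigma> w)" by (rule bounded_integrable_lebesgue_on[OF slice_measurable[OF assms(1)] bd])
  have "norm (\<integral>\<sigma>. indicator ?J \<sigma> *\<^sub>R h \<sigma> w \<partial>N) \<le> (\<integral>\<sigma>. indicator ?J \<sigma> * B \<partial>N)"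
  proof (rule Bochner_Integration.integral_norm_bound_integral)
    show "integrable N (\<lambda>\<sigma>. indicator ?J \<sigma> *\<^sub>R h \<sigma> w)" by (rule integrable_mult_indicator[OF J i])
    show "integrable N (\<lambda>\<sigma>. indicator ?J \<sigma> * B)" using J by (simp add: M1.emeasure_finite less_top[symmetric])
    show "norm (indicator ?J \<sigma> *\<^sub>R h \<sigma> w) \<le> indicator ?J \<sigma> * B" if "\<sigma> \<in> space N" for \<sigma>
      using bd[of \<sigma>] that by (auto simp: indicator_def)
  qed
  also have "\<dots> = B * \<bar>t - s\<bar>"
  proof -
    have "measure N ?J = max t s - min t s"
      by (rule measure_lebesgue_on_Icc) (use assms(2,3) in auto)
    moreover have "max t s - min t s = \<bar>t - s\<bar>" by linarith
    moreover have "?J \<inter> space N = ?J" using assms(2,3) by auto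
    ultimately show ?thesis by (simp add: mult.commute del: Int_atLeastAtMost)
  qed
  finally show ?thesis unfolding primitive_def partial_integral_def integral_indicator_diff[OF i assms(2,3)] .
qed

lemma primitive_minus:
  fixes h g :: "real \<Rightarrow> 'w \<Rightarrow> 'b"
  assumes h: "case_prod h \<in> borel_measurable (N \<Otimes>\<^sub>M \<mu>)" "\<And>\<sigma>. \<sigma> \<in> {0..T} \<Longrightarrow> norm (h \<sigma> w) \<le> B"
    and g: "case_prod g \<in> borel_measurable (N \<Otimes>\<^sub>M \<mu>)" "\<And>\<sigma>. \<sigma> \<in> {0..T} \<Longrightarrow> norm (g \<sigma> w) \<le> B'"
    and "t \<in> {0..T}"
  shows "primitive (\<lambda>\<sigma> w. h \<sigma> w - g \<sigma> w) t w = primitive h t w - primitive g t w"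
proof -
  have s: "{0..t} \<in> sets N" using assms(5) by (auto simp: sets_restrict_space_iff)
  have i: "integrable N (\<lambda>\<sigma>. h \<sigma> w)" "integrable N (\<lambda>\<sigma>. g \<sigma> w)"
    using bounded_integrable_lebesgue_on[OF slice_measurable[OF h(1)] h(2)]
      bounded_integrable_lebesgue_on[OF slice_measurable[OF g(1)] g(2)] by auto
  show ?thesis unfolding primitive_def partial_integral_def scaleR_diff_right
    by (rule Bochner_Integration.integral_diff[OF integrable_mult_indicator[OF s i(1)] integrable_mult_indicator[OF s i(2)]])
qed

lemma velocity_diff_measurable:
  assumes "case_prod X \<in> borel_measurable (N \<Otimes>\<^sub>M \<mu>)" "case_prod Y \<in> borel_measurable (N \<Otimes>\<^sub>M \<mu>)"
  shows "case_prod (\<lambda>\<sigma> w. velocity X \<sigma> w - velocity Y \<sigma> w) \<in> borel_measurable (N \<Otimes>\<^sub>M \<mu>)"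
  using borel_measurable_diff[OF velocity_measurable[OF assms(1)] velocity_measurable[OF assms(2)]]
  by (simp add: case_prod_unfold)

lemma velocity_bound:
  assumes "\<And>\<sigma>. \<sigma> \<in> {0..T} \<Longrightarrow> norm (X \<sigma> w) \<le> B" "\<sigma> \<in> {0..T}"
  shows "norm (velocity X \<sigma> w) \<le> c * (1 + B)"
  unfolding velocity_def by (rule order_trans[OF growth[OF assms(2)]]) (use assms c_pos in auto)

text \<open>Picard iteration contracts by the factor one half in the norm weighted by
  \<open>exp (- 2 * k * \<bar>t - s\<bar>)\<close>, which treats both time directions at once.\<close>

theorem ode_solution_exists:
  assumes s: "s \<in> {0..T}" and \<phi>: "\<phi> \<in> borel_measurable \<mu>"
  shows "\<exists>X. ode_solution s \<phi> X \<and> (\<forall>w. \<forall>t\<in>{0..T}. norm (X t w) \<le> growth_const * (1 + norm (\<phi> w)))"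
proof -
  define \<Phi> where "\<Phi> X t w = \<phi> w + (primitive (velocity X) t w - primitive (velocity X) s w)" for X t w
  define X where "X = rec_nat (\<lambda>t. \<phi>) (\<lambda>n. \<Phi>)"
  have X: "X 0 = (\<lambda>t. \<phi>)" "\<And>n. X (Suc n) = \<Phi> (X n)" by (simp_all add: X_def)
  have pm: "(\<lambda>w. primitive h t w) \<in> borel_measurable \<mu>"
    if h: "case_prod h \<in> borel_measurable (N \<Otimes>\<^sub>M \<mu>)" and t: "t \<in> {0..T}" for h :: "real \<Rightarrow> 'w \<Rightarrow> 'b" and t
  proof -
    note [measurable] = primitive_measurable[OF h]
    have [measurable]: "t \<in> space N" using t by simp
    show ?thesis by measurable
  qed
  have \<Phi>m: "case_prod (\<Phi> Y) \<in> borel_measurable (N \<Otimes>\<^sub>M \<mu>)" if Y: "case_prod Y \<in> borel_measurable (N \<Otimes>\<^sub>M \<mu>)" for Y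
  proof -
    note [measurable] = primitive_measurable[OF velocity_measurable[OF Y]] pm[OF velocity_measurable[OF Y] s] \<phi>
    show ?thesis unfolding \<Phi>_def by measurable
  qed
  have Xm: "case_prod (X n) \<in> borel_measurable (N \<Otimes>\<^sub>M \<mu>)" for n
  proof (induction n)
    case 0
    show ?case unfolding X using \<phi> by measurable
  qed (unfold X, rule \<Phi>m)
  \<comment> \<open>These bounds may depend on the iterate and the parameter; they only ensure that
    the velocities are integrable in time.\<close>
  have Xbd: "\<exists>B. \<forall>\<sigma>\<in>{0..T}. norm (X n \<sigma> w) \<le> B" for n w
  proof (induction n)
    case 0
    show ?case by (auto simp: X)
  next
    case (Suc n)
    then obtain B where B: "\<And>\<sigma>. \<sigma> \<in> {0..T} \<Longrightarrow> norm (X n \<sigma> w) \<le> B" by blast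
    have "norm (X (Suc n) \<sigma> w) \<le> norm (\<phi> w) + c * (1 + B) * T" if \<sigma>: "\<sigma> \<in> {0..T}" for \<sigma>
    proof -
      have "0 \<le> B" using B[OF \<sigma>] norm_ge_zero order_trans by blast
      have "norm (primitive (velocity (X n)) \<sigma> w - primitive (velocity (X n)) s w) \<le> c * (1 + B) * \<bar>\<sigma> - s\<bar>"
        by (rule primitive_diff_le[OF velocity_measurable[OF Xm] \<sigma> s velocity_bound[of "X n" w B, OF B]])
      also have "\<dots> \<le> c * (1 + B) * T" using \<sigma> s c_pos \<open>0 \<le> B\<close> by (intro mult_left_mono) auto
      finally show ?thesis unfolding X \<Phi>_def using norm_triangle_ineq[of "\<phi> w"] by (meson add_left_mono order_trans)
    qed
    then show ?case by blast
  qed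
  \<comment> \<open>Bound for the first Picard increment, from linear growth at the initial
    value.\<close>
  define A where "A w = c * T * (1 + norm (\<phi> w))" for w
  have A0: "0 \<le> A w" for w unfolding A_def using c_pos T_pos by simp
  have \<Phi>diff: "norm (\<Phi> Y t w - \<Phi> Z t w) \<le> \<beta> / 2 * exp (2 * k * \<bar>t - s\<bar>)"
    if Y: "case_prod Y \<in> borel_measurable (N \<Otimes>\<^sub>M \<mu>)" "\<exists>B. \<forall>\<sigma>\<in>{0..T}. norm (Y \<sigma> w) \<le> B"
      and Z: "case_prod Z \<in> borel_measurable (N \<Otimes>\<^sub>M \<mu>)" "\<exists>B. \<forall>\<sigma>\<in>{0..T}. norm (Z \<sigma> w) \<le> B"
      and B: "0 \<le> \<beta>" "\<And>\<sigma>. \<sigma> \<in> {0..T} \<Longrightarrow> norm (Y \<sigma> w - Z \<sigma> w) \<le> \<beta> * exp (2 * k * \<bar>\<sigma> - s\<bar>)" and t: "t \<in> {0..T}"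
    for Y Z \<beta> t w
  proof -
    obtain B1 B2 where B1: "\<And>\<sigma>. \<sigma> \<in> {0..T} \<Longrightarrow> norm (Y \<sigma> w) \<le> B1" and B2: "\<And>\<sigma>. \<sigma> \<in> {0..T} \<Longrightarrow> norm (Z \<sigma> w) \<le> B2"
      using Y Z by blast
    let ?d = "\<lambda>\<sigma> w. velocity Y \<sigma> w - velocity Z \<sigma> w"
    have "norm (primitive ?d t w - primitive ?d s w) \<le> k * \<beta> / (2 * k) * exp (2 * k * \<bar>t - s\<bar>)"
    proof (rule primitive_diff_weighted[OF velocity_diff_measurable[OF Y(1) Z(1)] t s])
      show "norm (?d \<sigma> w) \<le> k * \<beta> * exp (2 * k * \<bar>\<sigma> - s\<bar>)" if "\<sigma> \<in> {0..T}" for \<sigma>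
        unfolding velocity_def mult.assoc[of k] by (rule order_trans[OF lipschitz[OF that]]) (use k_pos B(2)[OF that] in auto)
    qed (use k_pos B in auto)
    moreover have "\<Phi> Y t w - \<Phi> Z t w = primitive ?d t w - primitive ?d s w"
      using primitive_minus[OF velocity_measurable[OF Y(1)] velocity_bound[of Y w B1, OF B1] velocity_measurable[OF Z(1)] velocity_bound[of Z w B2, OF B2] t]
        primitive_minus[OF velocity_measurable[OF Y(1)] velocity_bound[of Y w B1, OF B1] velocity_measurable[OF Z(1)] velocity_bound[of Z w B2, OF B2] s]
      unfolding \<Phi>_def by simp
    ultimately show ?thesis using k_pos by simp
  qed
  have step: "norm (X (Suc n) t w - X n t w) \<le> A w * (1/2)^n * exp (2 * k * \<bar>t - s\<bar>)" if "t \<in> {0..T}" for n t w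
    using that
  proof (induction n arbitrary: t)
    case 0
    have "norm (primitive (velocity (X 0)) t w - primitive (velocity (X 0)) s w) \<le> c * (1 + norm (\<phi> w)) * \<bar>t - s\<bar>"
      by (rule primitive_diff_le[OF velocity_measurable[OF Xm] 0 s velocity_bound]) (auto simp: X)
    also have "\<dots> \<le> c * (1 + norm (\<phi> w)) * T" using 0 s c_pos by (intro mult_left_mono) auto
    also have "\<dots> \<le> A w * exp (2 * k * \<bar>t - s\<bar>)"
      using mult_left_mono[OF _ A0, of 1 "exp (2 * k * \<bar>t - s\<bar>)"] k_pos by (simp add: A_def mult_ac)
    finally show ?case by (simp add: X \<Phi>_def)
  next
    case (Suc n)
    have "norm (\<Phi> (X (Suc n)) t w - \<Phi> (X n) t w) \<le> A w * (1/2)^n / 2 * exp (2 * k * \<bar>t - s\<bar>)"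
      by (rule \<Phi>diff[of "X (Suc n)" w "X n" "A w * (1/2)^n", OF Xm Xbd Xm Xbd _ Suc.IH Suc.prems]) (use A0 in auto)
    then show ?case by (simp add: X)
  qed
  define E where "E = exp (2 * k * T)"
  define R where "R w = A w * E" for w
  have R0: "0 \<le> R w" for w unfolding R_def E_def using A0 by simp
  have step': "norm (X (Suc n) t w - X n t w) \<le> R w * (1/2)^n" if t: "t \<in> {0..T}" for n t w
  proof -
    have "exp (2 * k * \<bar>t - s\<bar>) \<le> E" unfolding E_def using t s k_pos by auto
    then have "A w * (1/2)^n * exp (2 * k * \<bar>t - s\<bar>) \<le> A w * (1/2)^n * E" using A0 by (intro mult_left_mono) auto
    then show ?thesis using step[OF t, of n w] by (simp add: R_def mult_ac)
  qed
  define Y where "Y t w = lim (\<lambda>n. X n t w)" for t w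
  have Ym: "case_prod Y \<in> borel_measurable (N \<Otimes>\<^sub>M \<mu>)"
  proof -
    have "(\<lambda>z. lim (\<lambda>n. case_prod (X n) z)) \<in> borel_measurable (N \<Otimes>\<^sub>M \<mu>)" using Xm by measurable
    then show ?thesis by (simp add: Y_def case_prod_unfold)
  qed
  have Yd: "norm (X n t w - Y t w) \<le> R w * (2 * (1/2)^n)" if "t \<in> {0..T}" for n t w
    unfolding Y_def using geometric_increments_convergent(2)[of "\<lambda>n. X n t w", OF step'[OF that] R0] .
  have Ybd: "norm (Y t w) \<le> norm (\<phi> w) + 2 * R w" if "t \<in> {0..T}" for t w
    using Yd[OF that, of 0 w] norm_triangle_ineq2[of "Y t w" "\<phi> w"] by (simp add: X norm_minus_commute)
  \<comment> \<open>\<open>X (Suc n)\<close> and \<open>\<Phi> (X n)\<close> are the same map: in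
    the first form it converges to \<open>Y\<close>, in the second, by the contraction estimate, to
    \<open>\<Phi> Y\<close>.\<close>
  have fixpoint: "Y t w = \<Phi> Y t w" if t: "t \<in> {0..T}" for t w
  proof -
    have half: "(\<lambda>n. (1/2::real)^n) \<longlonglongrightarrow> 0" by (rule LIMSEQ_realpow_zero) auto
    have l1: "(\<lambda>n. X (Suc n) t w - Y t w) \<longlonglongrightarrow> 0"
    proof (rule Lim_null_comparison[OF always_eventually])
      show "\<forall>n. norm (X (Suc n) t w - Y t w) \<le> R w * (2 * (1/2)^Suc n)" using Yd[OF t] by blast
      show "(\<lambda>n. R w * (2 * (1/2)^Suc n)) \<longlonglongrightarrow> 0"
        using tendsto_mult_right_zero[OF half, of "R w"] by simp
    qed
    have l2: "(\<lambda>n. \<Phi> (X n) t w - \<Phi> Y t w) \<longlonglongrightarrow> 0"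
    proof (rule Lim_null_comparison[OF always_eventually])
      show "\<forall>n. norm (\<Phi> (X n) t w - \<Phi> Y t w) \<le> R w * (2 * (1/2)^n) / 2 * exp (2 * k * \<bar>t - s\<bar>)"
      proof
        fix n
        show "norm (\<Phi> (X n) t w - \<Phi> Y t w) \<le> R w * (2 * (1/2)^n) / 2 * exp (2 * k * \<bar>t - s\<bar>)"
        proof (rule \<Phi>diff[of "X n" w Y "R w * (2 * (1/2)^n)", OF Xm Xbd Ym _ _ _ t])
          show "\<exists>B. \<forall>\<sigma>\<in>{0..T}. norm (Y \<sigma> w) \<le> B" using Ybd by blast
          show "0 \<le> R w * (2 * (1/2)^n)" using R0 by simp
          show "norm (X n \<sigma> w - Y \<sigma> w) \<le> R w * (2 * (1/2)^n) * exp (2 * k * \<bar>\<sigma> - s\<bar>)" if "\<sigma> \<in> {0..T}" for \<sigma>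
          proof -
            have "R w * (2 * (1/2)^n) * 1 \<le> R w * (2 * (1/2)^n) * exp (2 * k * \<bar>\<sigma> - s\<bar>)"
              using R0 k_pos by (intro mult_left_mono) auto
            then show ?thesis using Yd[OF that, of n w] by simp
          qed
        qed
      qed
      show "(\<lambda>n. R w * (2 * (1/2)^n) / 2 * exp (2 * k * \<bar>t - s\<bar>)) \<longlonglongrightarrow> 0"
        using tendsto_mult_left_zero[OF tendsto_mult_right_zero[OF half, of "R w"], of "exp (2 * k * \<bar>t - s\<bar>)"] by simp
    qed
    have "(\<lambda>n. (X (Suc n) t w - Y t w) - (\<Phi> (X n) t w - \<Phi> Y t w)) \<longlonglongrightarrow> 0 - 0"
      by (rule tendsto_diff[OF l1 l2])
    then have "(\<lambda>n::nat. \<Phi> Y t w - Y t w) \<longlonglongrightarrow> 0" unfolding X(2) by simp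
    then have "\<Phi> Y t w - Y t w = 0" by (simp only: LIMSEQ_const_iff)
    then show ?thesis by simp
  qed
  have "norm (Y t w) \<le> growth_const * (1 + norm (\<phi> w))" if "t \<in> {0..T}" for t w
    using Ybd[OF that, of w] by (simp add: R_def A_def E_def growth_const_def algebra_simps)
  moreover have "ode_solution s \<phi> Y"
    unfolding ode_solution_def using Ym fixpoint unfolding \<Phi>_def by blast
  ultimately show ?thesis by blast
qed

end

section \<open>Curves with a square-integrable velocity\<close>

text \<open>What is retained of a trajectory in the limit: a velocity in L2 of the product, the
  integral relation for each pair of times up to a null set of parameters that may depend on the
  pair, and a Lipschitz constant. The pointwise equation and the control are left out on
  purpose.\<close>

definition primitive_curve ::
    "real \<Rightarrow> 'w measure \<Rightarrow> (real \<Rightarrow> 'w \<Rightarrow> 'b::euclidean_space) \<Rightarrow> real \<Rightarrow> (real \<Rightarrow> 'w \<Rightarrow> 'b) \<Rightarrow> bool" where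
  "primitive_curve T \<mu> h B x \<longleftrightarrow> case_prod h \<in> L2 (lebesgue_on {0..T} \<Otimes>\<^sub>M \<mu>) \<and> 0 \<le> B \<and> (\<forall>t\<in>{0..T}. x t \<in> L2 \<mu>) \<and>
    (\<forall>r t. 0 \<le> r \<and> r \<le> t \<and> t \<le> T \<longrightarrow> (AE w in \<mu>. x t w = x r w + partial_integral (lebesgue_on {0..T}) {r..t} h w) \<and>
      L2dist \<mu> (x t) (x r) \<le> B * (t - r))"

lemma L2_lebesgue_on_subinterval:
  fixes h :: "real \<Rightarrow> 'w \<Rightarrow> 'b::euclidean_space"
  assumes M: "finite_measure M" and h: "case_prod h \<in> L2 (lebesgue_on {a..b} \<Otimes>\<^sub>M M)" and sub: "{u..v} \<subseteq> {a..b}"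
  shows "case_prod h \<in> L2 (lebesgue_on {u..v} \<Otimes>\<^sub>M M)"
proof -
  let ?N = "lebesgue_on {a..b}" and ?N' = "lebesgue_on {u..v}"
  interpret M2: finite_measure M by fact
  have id: "(\<lambda>\<sigma>. \<sigma>) \<in> measurable ?N' ?N"
    by (rule measurable_restrict_space2) (use sub in \<open>auto intro: measurable_restrict_space1\<close>)
  have [measurable]: "case_prod h \<in> borel_measurable (?N \<Otimes>\<^sub>M M)" by (rule L2_measurable[OF h])
  have "(\<lambda>z. case_prod h (fst z, snd z)) \<in> borel_measurable (?N' \<Otimes>\<^sub>M M)"
    by (rule measurable_compose[OF measurable_Pair[OF measurable_compose[OF measurable_fst id] measurable_snd]]) measurable
  then have m [measurable]: "case_prod h \<in> borel_measurable (?N' \<Otimes>\<^sub>M M)" by simp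
  have "(\<integral>\<^sup>+z. ennreal ((norm (case_prod h z))\<^sup>2) \<partial>(?N' \<Otimes>\<^sub>M M)) = (\<integral>\<^sup>+\<sigma>. \<integral>\<^sup>+w. ennreal ((norm (h \<sigma> w))\<^sup>2) \<partial>M \<partial>?N')"
    by (subst M2.nn_integral_fst[symmetric]) auto
  also have "\<dots> = (\<integral>\<^sup>+\<sigma>. (\<integral>\<^sup>+w. ennreal ((norm (h \<sigma> w))\<^sup>2) \<partial>M) * indicator {u..v} \<sigma> \<partial>lebesgue)"
    by (rule nn_integral_restrict_space) simp
  also have "\<dots> \<le> (\<integral>\<^sup>+\<sigma>. (\<integral>\<^sup>+w. ennreal ((norm (h \<sigma> w))\<^sup>2) \<partial>M) * indicator {a..b} \<sigma> \<partial>lebesgue)"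
    using sub by (intro nn_integral_mono) (auto simp: indicator_def)
  also have "\<dots> = (\<integral>\<^sup>+\<sigma>. \<integral>\<^sup>+w. ennreal ((norm (h \<sigma> w))\<^sup>2) \<partial>M \<partial>?N)"
    by (rule nn_integral_restrict_space[symmetric]) simp
  also have "\<dots> = (\<integral>\<^sup>+z. ennreal ((norm (case_prod h z))\<^sup>2) \<partial>(?N \<Otimes>\<^sub>M M))"
    by (subst M2.nn_integral_fst[symmetric]) auto
  also have "\<dots> < \<infinity>" using nn_integral_norm_square[OF h] by simp
  finally show ?thesis by (auto simp: L2_def intro!: integrableI_bounded)
qed

lemma integral_indicator_lebesgue_on_sub:
  fixes k :: "real \<Rightarrow> 'b::euclidean_space"
  assumes "{u..v} \<subseteq> {a'..b'}" "{a'..b'} \<subseteq> {a..b}"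
  shows "(\<integral>\<sigma>. indicator {u..v} \<sigma> *\<^sub>R k \<sigma> \<partial>lebesgue_on {a'..b'}) = (\<integral>\<sigma>. indicator {u..v} \<sigma> *\<^sub>R k \<sigma> \<partial>lebesgue_on {a..b})"
proof -
  have *: "(\<lambda>\<sigma>. indicator {p..q} \<sigma> *\<^sub>R (indicator {u..v} \<sigma> *\<^sub>R k \<sigma>)) = (\<lambda>\<sigma>. indicator {u..v} \<sigma> *\<^sub>R k \<sigma>)"
    if "{u..v} \<subseteq> {p..q}" for p q using that by (auto simp: indicator_def fun_eq_iff)
  have **: "(\<integral>\<sigma>. indicator {u..v} \<sigma> *\<^sub>R k \<sigma> \<partial>lebesgue_on {p..q}) = (\<integral>\<sigma>. indicator {u..v} \<sigma> *\<^sub>R k \<sigma> \<partial>lebesgue)"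
    if "{u..v} \<subseteq> {p..q}" for p q
    by (subst integral_restrict_space) (simp, simp only: *[OF that])
  show ?thesis using **[OF assms(1)] **[OF order_trans[OF assms]] by simp
qed

lemma partial_integral_sub:
  fixes h :: "real \<Rightarrow> 'w \<Rightarrow> 'b::euclidean_space"
  assumes "{u..v} \<subseteq> {a'..b'}" "{a'..b'} \<subseteq> {a..b}"
  shows "partial_integral (lebesgue_on {a'..b'}) {u..v} h = partial_integral (lebesgue_on {a..b}) {u..v} h"
  unfolding partial_integral_def by (rule ext) (rule integral_indicator_lebesgue_on_sub[OF assms])

lemma has_L2_integral_cong_AE:
  assumes I: "AE \<sigma> in lebesgue_on I. h \<sigma> = h' \<sigma>" and h: "has_L2_integral M h I y"
    and y: "y' \<in> L2 M" "AE w in M. y w = y' w"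
  shows "has_L2_integral M h' I y'"
proof -
  obtain H Y where H: "\<And>k. L2_simple M I (H k) (Y k)"
    "AE \<sigma> in lebesgue_on I. (\<lambda>k. L2dist M (h \<sigma>) (H k \<sigma>)) \<longlonglongrightarrow> 0"
    "(\<lambda>k. \<integral>\<^sup>+\<sigma>. ennreal (L2dist M (h \<sigma>) (H k \<sigma>)) \<partial>lebesgue_on I) \<longlonglongrightarrow> 0"
    "(\<lambda>k. L2dist M (Y k) y) \<longlonglongrightarrow> 0"
    and yL: "y \<in> L2 M" and hL: "AE \<sigma> in lebesgue_on I. h \<sigma> \<in> L2 M"
    using h unfolding has_L2_integral_def by blast
  have YL: "Y k \<in> L2 M" for k
    using H(1)[of k] unfolding L2_simple_def by (auto intro!: L2_sum L2_scaleR)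
  have "L2dist M (Y k) y = L2dist M (Y k) y'" for k
  proof (rule L2norm_cong_AE)
    show "AE w in M. norm (Y k w - y w) = norm (Y k w - y' w)" using y(2) by eventually_elim simp
  qed (use L2_measurable[OF L2_diff[OF YL yL]] L2_measurable[OF L2_diff[OF YL y(1)]] in auto)
  then have Y': "(\<lambda>k. L2dist M (Y k) y') \<longlonglongrightarrow> 0" using H(4) by simp
  have nn: "(\<integral>\<^sup>+\<sigma>. ennreal (L2dist M (h \<sigma>) (H k \<sigma>)) \<partial>lebesgue_on I) =
      (\<integral>\<^sup>+\<sigma>. ennreal (L2dist M (h' \<sigma>) (H k \<sigma>)) \<partial>lebesgue_on I)" for k
    by (rule nn_integral_cong_AE) (use I in \<open>eventually_elim, simp\<close>)
  show ?thesis unfolding has_L2_integral_def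
  proof (intro conjI exI[of _ H] exI[of _ Y] allI)
    show "AE \<sigma> in lebesgue_on I. h' \<sigma> \<in> L2 M" using hL I by eventually_elim simp
    show "AE \<sigma> in lebesgue_on I. (\<lambda>k. L2dist M (h' \<sigma>) (H k \<sigma>)) \<longlonglongrightarrow> 0"
      using H(2) I by eventually_elim simp
    show "(\<lambda>k. \<integral>\<^sup>+\<sigma>. ennreal (L2dist M (h' \<sigma>) (H k \<sigma>)) \<partial>lebesgue_on I) \<longlonglongrightarrow> 0"
      using H(3) unfolding nn .
  qed (fact y(1) H(1) Y')+
qed

context
  fixes T :: real and \<mu> :: "'w measure" and h :: "real \<Rightarrow> 'w \<Rightarrow> 'b::euclidean_space" and B and x
  assumes M: "finite_measure \<mu>" and px: "primitive_curve T \<mu> h B x"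
begin

lemma primitive_curve_L2: "t \<in> {0..T} \<Longrightarrow> x t \<in> L2 \<mu>"
  using px by (auto simp: primitive_curve_def)

lemma primitive_curve_Lipschitz:
  assumes "t \<in> {0..T}" "r \<in> {0..T}"
  shows "L2dist \<mu> (x t) (x r) \<le> B * \<bar>t - r\<bar>"
proof (cases "r \<le> t")
  case True
  then show ?thesis using px assms by (auto simp: primitive_curve_def)
next
  case False
  then have "L2dist \<mu> (x r) (x t) \<le> B * (r - t)" using px assms by (auto simp: primitive_curve_def)
  then show ?thesis using False by (simp add: L2norm_minus_commute[of _ "x t"])
qed

lemma primitive_curve_continuous:
  assumes "0 \<le> a" "b \<le> T"
  shows "continuous_L2_curve \<mu> a b x"
  unfolding continuous_L2_curve_iff
proof (intro conjI ballI allI impI)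
  show "x t \<in> L2 \<mu>" if "t \<in> {a..b}" for t using that assms by (intro primitive_curve_L2) auto
  fix \<sigma> and e :: real assume \<sigma>: "\<sigma> \<in> {a..b}" and "e > 0"
  have B: "0 \<le> B" using px by (simp add: primitive_curve_def)
  show "\<exists>d>0. \<forall>r\<in>{a..b}. \<bar>r - \<sigma>\<bar> < d \<longrightarrow> L2dist \<mu> (x r) (x \<sigma>) < e"
  proof (intro exI[of _ "e / (B + 1)"] conjI ballI impI)
    fix r assume r: "r \<in> {a..b}" "\<bar>r - \<sigma>\<bar> < e / (B + 1)"
    have "L2dist \<mu> (x r) (x \<sigma>) \<le> B * \<bar>r - \<sigma>\<bar>"
      using r \<sigma> assms by (intro primitive_curve_Lipschitz) auto
    also have "\<dots> \<le> (B + 1) * \<bar>r - \<sigma>\<bar>" by (simp add: mult_right_mono)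
    also have "\<dots> < e" using r(2) B by (simp add: field_simps)
    finally show "L2dist \<mu> (x r) (x \<sigma>) < e" .
  qed (use B \<open>e > 0\<close> in simp)
qed

lemma primitive_curve_absolutely_continuous:
  assumes "0 \<le> a" "b \<le> T"
  shows "L2_absolutely_continuous_on \<mu> a b x"
  unfolding L2_absolutely_continuous_on_def
proof (intro allI impI)
  fix \<epsilon> :: real assume "\<epsilon> > 0"
  have B: "0 \<le> B" using px by (simp add: primitive_curve_def)
  show "\<exists>\<delta>>0. \<forall>(n::nat) u v. (\<forall>i<n. a \<le> u i \<and> u i \<le> v i \<and> v i \<le> b) \<and>
      disjoint_family_on (\<lambda>i. {u i<..<v i}) {..<n} \<and> (\<Sum>i<n. v i - u i) < \<delta> \<longrightarrow>
      (\<Sum>i<n. L2dist \<mu> (x (v i)) (x (u i))) < \<epsilon>"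
  proof (intro exI[of _ "\<epsilon> / (B + 1)"] conjI allI impI)
    fix n :: nat and u v
    assume *: "(\<forall>i<n. a \<le> u i \<and> u i \<le> v i \<and> v i \<le> b) \<and>
      disjoint_family_on (\<lambda>i. {u i<..<v i}) {..<n} \<and> (\<Sum>i<n. v i - u i) < \<epsilon> / (B + 1)"
    have "(\<Sum>i<n. L2dist \<mu> (x (v i)) (x (u i))) \<le> (\<Sum>i<n. B * (v i - u i))"
    proof (rule sum_mono)
      fix i assume "i \<in> {..<n}"
      then have "a \<le> u i" "u i \<le> v i" "v i \<le> b" using * by auto
      then show "L2dist \<mu> (x (v i)) (x (u i)) \<le> B * (v i - u i)"
        using primitive_curve_Lipschitz[of "v i" "u i"] assms by auto
    qed
    also have "\<dots> = B * (\<Sum>i<n. v i - u i)" by (simp add: sum_distrib_left)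
    also have "\<dots> \<le> (B + 1) * (\<Sum>i<n. v i - u i)" using * by (intro mult_right_mono sum_nonneg) auto
    also have "\<dots> < \<epsilon>" using * B by (simp add: field_simps)
    finally show "(\<Sum>i<n. L2dist \<mu> (x (v i)) (x (u i))) < \<epsilon>" .
  qed (use B \<open>\<epsilon> > 0\<close> in simp)
qed

lemma primitive_curve_derivative:
  assumes "0 \<le> a" "b \<le> T"
  shows "AE \<tau> in lebesgue_on {a..b}. has_L2_derivative \<mu> x (h \<tau>) \<tau> {a..b}"
proof (rule AE_has_L2_derivative_partial_integral[OF M])
  have h: "case_prod h \<in> L2 (lebesgue_on {0..T} \<Otimes>\<^sub>M \<mu>)" using px by (simp add: primitive_curve_def)
  show "case_prod h \<in> L2 (lebesgue_on {a..b} \<Otimes>\<^sub>M \<mu>)"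
    by (rule L2_lebesgue_on_subinterval[OF M h]) (use assms in auto)
  show "x r \<in> L2 \<mu>" if "r \<in> {a..b}" for r using that assms by (intro primitive_curve_L2) auto
  show "AE w in \<mu>. x r w = x a w + partial_integral (lebesgue_on {a..b}) {a..r} h w" if "r \<in> {a..b}" for r
  proof -
    have "partial_integral (lebesgue_on {a..b}) {a..r} h = partial_integral (lebesgue_on {0..T}) {a..r} h"
      by (rule partial_integral_sub) (use that assms in auto)
    then show ?thesis using px that assms by (auto simp: primitive_curve_def)
  qed
qed

lemma primitive_curve_has_L2_integral:
  assumes "0 \<le> a" "a \<le> t" "t \<le> T"
  shows "has_L2_integral \<mu> h {a..t} (\<lambda>w. x t w - x a w)"
proof (rule has_L2_integral_cong_AE)
  have h: "case_prod h \<in> L2 (lebesgue_on {0..T} \<Otimes>\<^sub>M \<mu>)" using px by (simp add: primitive_curve_def)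
  have h': "case_prod h \<in> L2 (lebesgue_on {a..t} \<Otimes>\<^sub>M \<mu>)"
    by (rule L2_lebesgue_on_subinterval[OF M h]) (use assms in auto)
  show "has_L2_integral \<mu> h {a..t} (partial_integral (lebesgue_on {a..t}) {a..t} h)"
    by (rule has_L2_integral_partial_integral[OF M h'])
  show "(\<lambda>w. x t w - x a w) \<in> L2 \<mu>" using assms by (intro L2_diff primitive_curve_L2) auto
  have "partial_integral (lebesgue_on {a..t}) {a..t} h = partial_integral (lebesgue_on {0..T}) {a..t} h"
    by (rule partial_integral_sub) (use assms in auto)
  moreover have "AE w in \<mu>. x t w = x a w + partial_integral (lebesgue_on {0..T}) {a..t} h w"
    using px assms by (auto simp: primitive_curve_def)
  ultimately show "AE w in \<mu>. partial_integral (lebesgue_on {a..t}) {a..t} h w = x t w - x a w"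
    by (auto elim!: eventually_mono)
qed simp

end

context lipschitz_ode
begin

text \<open>Linear growth combined with the a priori bound on the solution. It depends on the
  initial value but not on the initial time or the control, which gives one Lipschitz constant for a
  whole family of trajectories.\<close>

definition velocity_bound_fun :: "('w \<Rightarrow> 'b) \<Rightarrow> 'w \<Rightarrow> real" where
  "velocity_bound_fun \<phi> w = c * (1 + growth_const * (1 + norm (\<phi> w)))"

lemma velocity_bound_fun_L2:
  assumes "\<phi> \<in> L2 \<mu>"
  shows "velocity_bound_fun \<phi> \<in> L2 \<mu>"
proof -
  have "(\<lambda>w. (c * (1 + growth_const)) *\<^sub>R (1::real) + (c * growth_const) *\<^sub>R norm (\<phi> w)) \<in> L2 \<mu>"
    by (intro L2_add L2_scaleR L2_const finite_\<mu> L2_norm_real assms)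
  then show ?thesis unfolding velocity_bound_fun_def by (simp add: algebra_simps)
qed

definition regular_solution :: "real \<Rightarrow> ('w \<Rightarrow> 'b) \<Rightarrow> (real \<Rightarrow> 'w \<Rightarrow> 'b) \<Rightarrow> bool" where
  "regular_solution s \<phi> X \<longleftrightarrow> ode_solution s \<phi> X \<and> (\<forall>w. \<forall>t\<in>{0..T}. norm (X t w) \<le> growth_const * (1 + norm (\<phi> w)))"

context
  fixes s \<phi> X
  assumes X: "regular_solution s \<phi> X" and s: "s \<in> {0..T}" and \<phi>: "\<phi> \<in> L2 \<mu>"
begin

lemma regular_velocity_bound: "\<sigma> \<in> {0..T} \<Longrightarrow> norm (velocity X \<sigma> w) \<le> velocity_bound_fun \<phi> w"
  unfolding velocity_bound_fun_def
  by (rule velocity_bound[of X w "growth_const * (1 + norm (\<phi> w))"]) (use X in \<open>auto simp: regular_solution_def\<close>)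

lemma regular_measurable: "case_prod X \<in> borel_measurable (N \<Otimes>\<^sub>M \<mu>)"
  using X by (simp add: regular_solution_def ode_solution_def)

lemma regular_velocity_L2: "case_prod (velocity X) \<in> L2 (N \<Otimes>\<^sub>M \<mu>)"
  by (rule product_L2I[OF velocity_measurable[OF regular_measurable] velocity_bound_fun_L2[OF \<phi>]])
    (auto simp: regular_velocity_bound)

lemma regular_slice_integrable: "integrable N (\<lambda>\<sigma>. velocity X \<sigma> w)"
  by (rule bounded_integrable_lebesgue_on[OF slice_measurable[OF velocity_measurable[OF regular_measurable]]])
    (rule regular_velocity_bound)

lemma regular_increment:
  assumes "0 \<le> r" "r \<le> t" "t \<le> T"
  shows "X t w = X r w + partial_integral N {r..t} (velocity X) w"
proof -
  have "X t w = \<phi> w + (primitive (velocity X) t w - primitive (velocity X) s w)"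
    "X r w = \<phi> w + (primitive (velocity X) r w - primitive (velocity X) s w)"
    using X assms by (auto simp: regular_solution_def ode_solution_def)
  moreover have "primitive (velocity X) t w = primitive (velocity X) r w + partial_integral N {r..t} (velocity X) w"
    unfolding primitive_def partial_integral_def
    by (rule integral_indicator_split[OF regular_slice_integrable]) (use assms in auto)
  ultimately show ?thesis by simp
qed

lemma regular_initial: "X s w = \<phi> w"
  using X s by (simp add: regular_solution_def ode_solution_def)

lemma regular_L2:
  assumes t: "t \<in> {0..T}" shows "X t \<in> L2 \<mu>"
proof (rule L2_bound)
  have "(\<lambda>w. growth_const *\<^sub>R (1::real) + growth_const *\<^sub>R norm (\<phi> w)) \<in> L2 \<mu>"
    by (intro L2_add L2_scaleR L2_const finite_\<mu> L2_norm_real \<phi>)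
  then show "(\<lambda>w. growth_const * (1 + norm (\<phi> w))) \<in> L2 \<mu>" by (simp add: algebra_simps)
  note [measurable] = regular_measurable
  have [measurable]: "t \<in> space N" using t by simp
  show "X t \<in> borel_measurable \<mu>" by measurable
  have "0 \<le> growth_const" using growth_const_ge_1 by simp
  then show "AE w in \<mu>. norm (X t w) \<le> norm (growth_const * (1 + norm (\<phi> w)))"
    using X t by (auto simp: regular_solution_def abs_mult)
qed

theorem regular_primitive_curve: "primitive_curve T \<mu> (velocity X) (L2norm \<mu> (velocity_bound_fun \<phi>)) X"
  unfolding primitive_curve_def
proof (intro conjI ballI allI impI)
  show "case_prod (velocity X) \<in> L2 (N \<Otimes>\<^sub>M \<mu>)" by (rule regular_velocity_L2)
  show "X t \<in> L2 \<mu>" if "t \<in> {0..T}" for t by (rule regular_L2[OF that])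
  fix r t :: real assume rt: "0 \<le> r \<and> r \<le> t \<and> t \<le> T"
  show "AE w in \<mu>. X t w = X r w + partial_integral N {r..t} (velocity X) w" using rt by (simp add: regular_increment)
  have sets: "{r..t} \<in> sets N" using rt by (auto simp: sets_restrict_space_iff)
  have "L2dist \<mu> (X t) (X r) = L2norm \<mu> (partial_integral N {r..t} (velocity X))"
    using regular_increment[of r t] rt by simp
  also have "\<dots> \<le> measure N {r..t} * L2norm \<mu> (velocity_bound_fun \<phi>)"
  proof (rule partial_integral_norm_le_bound[OF regular_velocity_L2 sets])
    show "AE \<sigma> in N. \<sigma> \<in> {r..t} \<longrightarrow> L2norm \<mu> (velocity X \<sigma>) \<le> L2norm \<mu> (velocity_bound_fun \<phi>)"
      using AE_slice_L2[OF regular_velocity_L2] AE_space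
    proof eventually_elim
      case (elim \<sigma>)
      have "norm (velocity X \<sigma> w) \<le> norm (velocity_bound_fun \<phi> w)" for w
        using regular_velocity_bound[of \<sigma> w] elim by simp
      then show ?case
        by (intro impI L2norm_mono[OF velocity_bound_fun_L2[OF \<phi>] L2_measurable[OF elim(1)]]) simp
    qed
  qed simp
  also have "measure N {r..t} = t - r" using rt by (intro measure_lebesgue_on_Icc) auto
  finally show "L2dist \<mu> (X t) (X r) \<le> L2norm \<mu> (velocity_bound_fun \<phi>) * (t - r)" by (simp add: mult.commute)
qed simp

end

lemma regular_solution_exists:
  assumes "s \<in> {0..T}" "\<phi> \<in> L2 \<mu>"
  shows "\<exists>X. regular_solution s \<phi> X"
  using ode_solution_exists[OF assms(1) L2_measurable[OF assms(2)]] unfolding regular_solution_def by blast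

end

section \<open>The controlled system\<close>

lemma compact_UNIV_dense_sequence:
  assumes "compact (UNIV :: 'w::metric_space set)"
  shows "\<exists>d :: nat \<Rightarrow> 'w. \<forall>w. \<forall>e>0. \<exists>n. dist w (d n) < e"
proof -
  have "\<exists>K. finite K \<and> UNIV \<subseteq> (\<Union>x\<in>K. ball (x::'w) (1 / real (Suc n)))" for n :: nat
  proof -
    obtain K where "finite K" "UNIV \<subseteq> (\<Union>x\<in>K. ball (x::'w) (1 / real (Suc n)))"
      by (rule compactE_image[OF assms, of UNIV "\<lambda>x. ball x (1 / real (Suc n))"]) auto
    then show ?thesis by (intro exI[of _ K] conjI)
  qed
  from choice[OF allI[OF this]] obtain K where "\<forall>n. finite (K n) \<and> UNIV \<subseteq> (\<Union>x\<in>K n. ball (x::'w) (1 / real (Suc n)))" ..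
  then have K: "\<And>n. finite (K n)" "\<And>n. UNIV \<subseteq> (\<Union>x\<in>K n. ball (x::'w) (1 / real (Suc n)))" by simp_all
  define D where "D = (\<Union>n. K n)"
  have "countable D" unfolding D_def using K(1) by (auto intro: countable_finite)
  have near: "\<exists>x\<in>D. dist w x < e" if "e > 0" for w e
  proof -
    obtain n where n: "1 / real (Suc n) < e" using \<open>e > 0\<close> nat_approx_posE by blast
    have "w \<in> (\<Union>x\<in>K n. ball x (1 / real (Suc n)))" by (rule subsetD[OF K(2)]) simp
    then obtain x where "x \<in> K n" "dist x w < 1 / real (Suc n)" by auto
    then show ?thesis using n unfolding D_def by (intro bexI[of _ x]) (auto simp: dist_commute)
  qed
  then have "D \<noteq> {}" using zero_less_one by blast
  show ?thesis
  proof (intro exI[of _ "from_nat_into D"] allI impI)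
    fix w :: 'w and e :: real assume "e > 0"
    then obtain x where "x \<in> D" "dist w x < e" using near by blast
    then show "\<exists>n. dist w (from_nat_into D n) < e"
      using from_nat_into_surj[OF \<open>countable D\<close>] by metis
  qed
qed

lemma closure_UNIV_of_dense: "(\<And>x e. e > 0 \<Longrightarrow> \<exists>y\<in>D. dist y x < e) \<Longrightarrow> closure D = (UNIV :: 'a::metric_space set)"
  by (auto simp: closure_approachable)

text \<open>The hypothesis allows the null set of times to depend on the states, the control and the
  parameter. A countable dense set of such arguments has one common null set, and continuity at
  fixed time extends the closed inequalities to all arguments.\<close>

lemma dynamics_hyp_null_set:
  fixes f :: "real \<Rightarrow> real^'n \<Rightarrow> real^'m \<Rightarrow> 'w::metric_space \<Rightarrow> real^'n"
  assumes cpt: "compact (UNIV :: 'w set)" and dyn: "dynamics_hyp T f"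
  shows "\<exists>Z c k. negligible Z \<and> 0 < c \<and> 0 < k \<and> (\<forall>t\<in>{0..T} - Z. \<forall>x x' u w.
    norm (f t x u w) \<le> c * (1 + norm x) \<and> norm (f t x u w - f t x' u w) \<le> k * norm (x - x'))"
proof -
  obtain c k where ck: "c > 0" "k > 0" "\<And>x x' u w. AE t in lebesgue_on {0<..<T}.
        norm (f t x u w) \<le> c * (1 + norm x) \<and> norm (f t x u w - f t x' u w) \<le> k * norm (x - x')"
    and cont: "\<And>t. t \<in> {0..T} \<Longrightarrow> continuous_on UNIV (\<lambda>(x, u, w). f t x u w)"
    using dyn unfolding dynamics_hyp_def by blast
  define P where "P t = (\<lambda>(x, x', u, w). norm (f t x u w) \<le> c * (1 + norm x) \<and> norm (f t x u w - f t x' u w) \<le> k * norm (x - x'))" for t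
  obtain D1 :: "(real^'n) set" where D1: "countable D1" "\<And>X. open X \<Longrightarrow> X \<noteq> {} \<Longrightarrow> \<exists>d\<in>D1. d \<in> X"
    by (erule countable_dense_setE)
  obtain D2 :: "(real^'m) set" where D2: "countable D2" "\<And>X. open X \<Longrightarrow> X \<noteq> {} \<Longrightarrow> \<exists>d\<in>D2. d \<in> X"
    by (erule countable_dense_setE)
  obtain d :: "nat \<Rightarrow> 'w" where d: "\<And>w e. e > 0 \<Longrightarrow> \<exists>n. dist w (d n) < e"
    using compact_UNIV_dense_sequence[OF cpt] by blast
  have "closure D1 = UNIV" "closure D2 = UNIV"
    using D1(2)[OF open_ball] D2(2)[OF open_ball] by (intro closure_UNIV_of_dense; force simp: dist_commute)+
  moreover have "closure (range d) = UNIV"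
    using d by (intro closure_UNIV_of_dense) (simp add: dist_commute)
  ultimately have dense: "closure (D1 \<times> D1 \<times> D2 \<times> range d) = UNIV" by (simp add: closure_Times)
  have "countable (D1 \<times> D1 \<times> D2 \<times> range d)" using D1(1) D2(1) by simp
  moreover have "AE t in lebesgue_on {0<..<T}. P t z" for z
    using ck(3) unfolding P_def by (cases z) auto
  ultimately have "AE t in lebesgue_on {0<..<T}. \<forall>z\<in>D1 \<times> D1 \<times> D2 \<times> range d. P t z"
    by (subst AE_ball_countable) auto
  then have n: "negligible {t\<in>{0<..<T}. \<not> (\<forall>z\<in>D1 \<times> D1 \<times> D2 \<times> range d. P t z)}"
    by (subst (asm) AE_lebesgue_on_iff_negligible) auto
  \<comment> \<open>The estimates are assumed on the open interval only, so both end points join the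
    null set.\<close>
  define Z where "Z = {t\<in>{0<..<T}. \<not> (\<forall>z\<in>D1 \<times> D1 \<times> D2 \<times> range d. P t z)} \<union> {0, T}"
  have "negligible Z" unfolding Z_def using n by (intro negligible_Un) auto
  moreover have "P t z" if t: "t \<in> {0..T} - Z" for t z
  proof -
    have t': "t \<in> {0..T}" "\<forall>z\<in>D1 \<times> D1 \<times> D2 \<times> range d. P t z" using t by (auto simp: Z_def)
    have c1: "continuous_on UNIV (\<lambda>p :: (real^'n) \<times> (real^'n) \<times> (real^'m) \<times> 'w. f t (fst p) (fst (snd (snd p))) (snd (snd (snd p))))"
    proof -
      have "continuous_on UNIV (\<lambda>p :: (real^'n) \<times> (real^'n) \<times> (real^'m) \<times> 'w. (fst p, fst (snd (snd p)), snd (snd (snd p))))"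
        by (intro continuous_intros)
      from continuous_on_compose2[OF cont[OF t'(1)] this subset_UNIV] show ?thesis by (simp only: prod.case)
    qed
    have c2: "continuous_on UNIV (\<lambda>p :: (real^'n) \<times> (real^'n) \<times> (real^'m) \<times> 'w. f t (fst (snd p)) (fst (snd (snd p))) (snd (snd (snd p))))"
    proof -
      have "continuous_on UNIV (\<lambda>p :: (real^'n) \<times> (real^'n) \<times> (real^'m) \<times> 'w. (fst (snd p), fst (snd (snd p)), snd (snd (snd p))))"
        by (intro continuous_intros)
      from continuous_on_compose2[OF cont[OF t'(1)] this subset_UNIV] show ?thesis by (simp only: prod.case)
    qed
    have "closed {p. P t p}"
      unfolding P_def case_prod_unfold
      by (intro closed_Collect_conj closed_Collect_le continuous_intros c1 c2)
    moreover have "D1 \<times> D1 \<times> D2 \<times> range d \<subseteq> {p. P t p}" using t'(2) by blast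
    ultimately have "closure (D1 \<times> D1 \<times> D2 \<times> range d) \<subseteq> {p. P t p}" by (rule closure_minimal[rotated])
    then show ?thesis unfolding dense by blast
  qed
  then have "\<forall>t\<in>{0..T} - Z. \<forall>x x' u w.
    norm (f t x u w) \<le> c * (1 + norm x) \<and> norm (f t x u w - f t x' u w) \<le> k * norm (x - x')"
    unfolding P_def by fastforce
  ultimately show ?thesis using ck(1,2) by blast
qed

text \<open>\<open>Z\<close>, \<open>c\<close> and \<open>k\<close> are those provided by
  \<open>dynamics_hyp_null_set\<close>; as parameters of the locale they are the same for all
  states, controls and points of the parameter space.\<close>

locale control_problem =
  fixes T :: real and \<mu> :: "'w::metric_space measure" and U :: "real \<Rightarrow> (real^'m) set"
    and f :: "real \<Rightarrow> real^'n \<Rightarrow> real^'m \<Rightarrow> 'w \<Rightarrow> real^'n" and Z :: "real set" and c k :: real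
  assumes T_pos: "0 < T" and compact_UNIV: "compact (UNIV :: 'w set)" and radon: "finite_radon_measure \<mu>"
    and U_hyp: "control_map_hyp T U" and f_hyp: "dynamics_hyp T f"
    and Z: "negligible Z" and c_pos: "0 < c" and k_pos: "0 < k"
    and f_growth: "\<And>t x u w. t \<in> {0..T} - Z \<Longrightarrow> norm (f t x u w) \<le> c * (1 + norm x)"
    and f_lipschitz: "\<And>t x x' u w. t \<in> {0..T} - Z \<Longrightarrow> norm (f t x u w - f t x' u w) \<le> k * norm (x - x')"

sublocale control_problem \<subseteq> pair_finite_measure "lebesgue_on {0..T}" \<mu>
  using radon by (intro pair_finite_measure_Icc) (simp add: finite_radon_measure_def)

context control_problem
begin

abbreviation "N \<equiv> lebesgue_on {0..T}"

lemma finite_\<mu>: "finite_measure \<mu>" and sets_\<mu>: "sets \<mu> = sets borel"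
  using radon by (auto simp: finite_radon_measure_def)

lemma space_\<mu>: "space \<mu> = UNIV"
  using sets_eq_imp_space_eq[OF sets_\<mu>] by simp

text \<open>The field is set to 0 on the exceptional times. Growth, Lipschitz bound and continuity
  then hold at every time, while the integrals over subintervals of \<open>{0..T}\<close> are those
  of \<open>f\<close>.\<close>

definition F :: "real \<Rightarrow> real^'n \<Rightarrow> real^'m \<Rightarrow> 'w \<Rightarrow> real^'n" where
  "F t x u w = (if t \<in> {0..T} - Z then f t x u w else 0)"

lemma F_growth: "norm (F t x u w) \<le> c * (1 + norm x)"
  using f_growth c_pos by (auto simp: F_def)

lemma F_lipschitz: "norm (F t x u w - F t x' u w) \<le> k * norm (x - x')"
  using f_lipschitz k_pos by (auto simp: F_def)

lemma F_continuous: "continuous_on UNIV (\<lambda>(x, u, w). F t x u w)"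
  using f_hyp by (cases "t \<in> {0..T} - Z") (auto simp: F_def dynamics_hyp_def case_prod_unfold cong: if_cong)

lemma F_tendsto:
  assumes "x \<longlonglongrightarrow> x'" "u \<longlonglongrightarrow> u'" "v \<longlonglongrightarrow> v'"
  shows "(\<lambda>i. F t (x i) (u i) (v i)) \<longlonglongrightarrow> F t x' u' v'"
proof -
  have "isCont (\<lambda>(x, u, w). F t x u w) (x', u', v')"
    using F_continuous by (simp add: continuous_on_eq_continuous_at)
  from isCont_tendsto_compose[OF this tendsto_Pair[OF assms(1) tendsto_Pair[OF assms(2,3)]]] show ?thesis by simp
qed

lemma measurable_F_time: "(\<lambda>t. F t x u w) \<in> borel_measurable N"
proof -
  have "Z \<in> sets lebesgue" using Z by (auto simp: negligible_iff_null_sets)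
  then have "{t \<in> space N. t \<in> {0..T} - Z} \<in> sets N" by (auto simp: sets_restrict_space image_iff intro!: bexI[of _ "{0..T} - Z"])
  moreover have "(\<lambda>t. f t x u w) \<in> borel_measurable N" using f_hyp by (simp add: dynamics_hyp_def)
  ultimately show ?thesis unfolding F_def by (intro measurable_If) auto
qed

text \<open>Superposition with a Caratheodory function: \<open>F\<close> is measurable in time and
  continuous in the rest, so the claim holds when state, control and parameter take countably many
  values, and it passes to the limit by continuity.\<close>

lemma measurable_F:
  assumes \<tau>: "\<tau> \<in> measurable S N" and X [measurable]: "X \<in> borel_measurable S" and v [measurable]: "v \<in> borel_measurable S"
    and q: "q \<in> measurable S borel"
  shows "(\<lambda>s. F (\<tau> s) (X s) (v s) (q s)) \<in> borel_measurable S"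
proof -
  obtain d :: "nat \<Rightarrow> 'w" where d: "\<And>w e. e > 0 \<Longrightarrow> \<exists>n. dist w (d n) < e"
    using compact_UNIV_dense_sequence[OF compact_UNIV] by blast
  have "(\<lambda>s. (X s, v s)) \<in> borel_measurable S" by measurable
  from borel_measurable_implies_sequence_metric[OF this, of 0] obtain H where
    H: "\<forall>i. simple_function S (H i)" "\<forall>s\<in>space S. (\<lambda>i. H i s) \<longlonglongrightarrow> (X s, v s)" by blast
  \<comment> \<open>Index of the first point of the dense sequence within
    \<open>1 / real (Suc i)\<close> of \<open>q s\<close>; taking the least index makes the choice
    measurable.\<close>
  define j where "j i s = (LEAST n. dist (q s) (d n) < 1 / real (Suc i))" for i s
  have j [measurable]: "j i \<in> measurable S (count_space UNIV)" for i
  proof -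
    have "(\<lambda>s. dist (q s) (d n) < 1 / real (Suc i)) \<in> measurable S (count_space UNIV)" for n
    proof -
      have "(\<lambda>w. dist w (d n)) \<in> borel_measurable borel"
        by (intro borel_measurable_continuous_onI continuous_intros)
      from measurable_compose[OF q this] show ?thesis by measurable
    qed
    then show ?thesis unfolding j_def by (rule measurable_Least)
  qed
  have jd: "dist (q s) (d (j i s)) < 1 / real (Suc i)" for i s
    unfolding j_def by (rule LeastI_ex) (rule d, simp)
  have "(\<lambda>s. F (\<tau> s) (fst (H i s)) (snd (H i s)) (d (j i s))) \<in> borel_measurable S" for i
  proof (rule measurable_compose_countable'[where I = "H i ` space S" and g = "H i" and
        f = "\<lambda>z s. F (\<tau> s) (fst z) (snd z) (d (j i s))"])
    have fin: "finite (H i ` space S)" "\<And>z. H i -` {z} \<inter> space S \<in> sets S" using H(1) by (auto simp: simple_functionD)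
    then show "H i \<in> measurable S (count_space (H i ` space S))"
      by (subst measurable_count_space_eq2) auto
    show "countable (H i ` space S)" using fin(1) by (rule countable_finite)
    fix z
    show "(\<lambda>s. F (\<tau> s) (fst z) (snd z) (d (j i s))) \<in> borel_measurable S"
      by (rule measurable_compose_countable'[where I = UNIV and g = "j i" and f = "\<lambda>n s. F (\<tau> s) (fst z) (snd z) (d n)"])
        (auto intro: measurable_compose[OF \<tau> measurable_F_time])
  qed
  then show ?thesis
  proof (rule borel_measurable_LIMSEQ_metric)
    fix s assume s: "s \<in> space S"
    have "(\<lambda>i. d (j i s)) \<longlonglongrightarrow> q s"
    proof (rule metric_LIMSEQ_I)
      fix e :: real assume "e > 0"
      then obtain n where n: "1 / real (Suc n) < e" using nat_approx_posE by blast
      have "dist (d (j i s)) (q s) < e" if "i \<ge> n" for i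
      proof -
        have "1 / real (Suc i) \<le> 1 / real (Suc n)" using that by (simp add: frac_le)
        then show ?thesis using jd[of s i] n by (simp add: dist_commute)
      qed
      then show "\<exists>n. \<forall>i\<ge>n. dist (d (j i s)) (q s) < e" by blast
    qed
    moreover have "(\<lambda>i. H i s) \<longlonglongrightarrow> (X s, v s)" using H(2) s by blast
    ultimately show "(\<lambda>i. F (\<tau> s) (fst (H i s)) (snd (H i s)) (d (j i s))) \<longlonglongrightarrow> F (\<tau> s) (X s) (v s) (q s)"
      using tendsto_fst[of "\<lambda>i. H i s" "(X s, v s)"] tendsto_snd[of "\<lambda>i. H i s" "(X s, v s)"] by (intro F_tendsto) auto
  qed
qed

lemma measurable_F_slice:
  assumes "\<psi> \<in> borel_measurable \<mu>"
  shows "(\<lambda>w. F t (\<psi> w) u w) \<in> borel_measurable \<mu>"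
proof (cases "t \<in> {0..T}")
  case True
  show ?thesis
    by (rule measurable_F[of "\<lambda>_. t"]) (use assms True in \<open>auto intro: measurable_ident_sets[OF sets_\<mu>]\<close>)
next
  case False
  then have "F t x u w = 0" for x w unfolding F_def by (intro if_not_P) blast
  then show ?thesis by simp
qed

lemma F_slice_L2:
  assumes "\<psi> \<in> L2 \<mu>" shows "(\<lambda>w. F t (\<psi> w) u w) \<in> L2 \<mu>"
proof (rule L2_bound)
  have "(\<lambda>w. c *\<^sub>R (1::real) + c *\<^sub>R norm (\<psi> w)) \<in> L2 \<mu>"
    by (intro L2_add L2_scaleR L2_const finite_\<mu> L2_norm_real assms)
  then show "(\<lambda>w. c * (1 + norm (\<psi> w))) \<in> L2 \<mu>" by (simp add: algebra_simps)
  show "(\<lambda>w. F t (\<psi> w) u w) \<in> borel_measurable \<mu>" by (rule measurable_F_slice[OF L2_measurable[OF assms]])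
  show "AE w in \<mu>. norm (F t (\<psi> w) u w) \<le> norm (c * (1 + norm (\<psi> w)))"
    using F_growth c_pos by (auto simp: abs_mult intro!: AE_I2 order_trans[OF F_growth])
qed

lemma AE_not_Z: "AE t in N. t \<notin> Z"
  using Z by (subst AE_lebesgue_on_iff_negligible) (auto intro: negligible_subset)

lemma AE_not_Z_sub: "AE t in lebesgue_on {a..b}. t \<notin> Z"
  using Z by (subst AE_lebesgue_on_iff_negligible) (auto intro: negligible_subset)

definition vel :: "(real \<Rightarrow> real^'m) \<Rightarrow> (real \<Rightarrow> 'w \<Rightarrow> real^'n) \<Rightarrow> real \<Rightarrow> 'w \<Rightarrow> real^'n" where
  "vel u X \<sigma> w = F \<sigma> (X \<sigma> w) (u \<sigma>) w"

lemma vel_measurable: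
  assumes u: "u \<in> borel_measurable N" and X: "case_prod X \<in> borel_measurable (N \<Otimes>\<^sub>M \<mu>)"
  shows "case_prod (vel u X) \<in> borel_measurable (N \<Otimes>\<^sub>M \<mu>)"
proof -
  have "snd \<in> measurable (N \<Otimes>\<^sub>M \<mu>) borel"
    using measurable_snd[of N \<mu>] measurable_cong_sets[OF refl sets_\<mu>] by blast
  then have "(\<lambda>z. F (fst z) (case_prod X z) (u (fst z)) (snd z)) \<in> borel_measurable (N \<Otimes>\<^sub>M \<mu>)"
    by (intro measurable_F measurable_fst X measurable_compose[OF measurable_fst u])
  then show ?thesis by (simp add: vel_def case_prod_unfold)
qed

lemma lipschitz_ode:
  assumes "u \<in> borel_measurable N"
  shows "lipschitz_ode T \<mu> (\<lambda>\<sigma> x w. F \<sigma> x (u \<sigma>) w) c k"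
proof
  show "case_prod (\<lambda>\<sigma> w. F \<sigma> (X \<sigma> w) (u \<sigma>) w) \<in> borel_measurable (N \<Otimes>\<^sub>M \<mu>)"
    if "case_prod X \<in> borel_measurable (N \<Otimes>\<^sub>M \<mu>)" for X
    using vel_measurable[OF assms that] unfolding vel_def .
qed (use T_pos c_pos k_pos finite_\<mu> space_\<mu> F_growth F_lipschitz in \<open>auto simp: finite_measure_def finite_measure_axioms_def\<close>)

text \<open>The representative used throughout: it lives on all of \<open>{0..T}\<close>, also to
  the left of \<open>s\<close>, satisfies the equation for every parameter and obeys the a priori
  bound. That \<open>u\<close> takes values in \<open>U\<close> is kept as a separate
  assumption.\<close>

definition trajectory :: "real \<Rightarrow> ('w \<Rightarrow> real^'n) \<Rightarrow> (real \<Rightarrow> real^'m) \<Rightarrow> (real \<Rightarrow> 'w \<Rightarrow> real^'n) \<Rightarrow> bool" where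
  "trajectory s \<phi> u X \<longleftrightarrow> u \<in> borel_measurable N \<and> s \<in> {0..T} \<and> \<phi> \<in> L2 \<mu> \<and>
    lipschitz_ode.regular_solution T \<mu> (\<lambda>\<sigma> x w. F \<sigma> x (u \<sigma>) w) c k s \<phi> X"

definition velocity_bound :: "('w \<Rightarrow> real^'n) \<Rightarrow> 'w \<Rightarrow> real" where
  "velocity_bound = lipschitz_ode.velocity_bound_fun T c k"

lemma velocity_eq: "u \<in> borel_measurable N \<Longrightarrow> lipschitz_ode.velocity (\<lambda>\<sigma> x w. F \<sigma> x (u \<sigma>) w) X = vel u X"
  using lipschitz_ode.velocity_def[OF lipschitz_ode] by (simp add: vel_def fun_eq_iff)

lemma trajectory_exists:
  assumes "u \<in> borel_measurable N" "s \<in> {0..T}" "\<phi> \<in> L2 \<mu>"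
  shows "\<exists>X. trajectory s \<phi> u X"
  using lipschitz_ode.regular_solution_exists[OF lipschitz_ode[OF assms(1)] assms(2,3)] assms
  unfolding trajectory_def by blast

context
  fixes s \<phi> u X
  assumes X: "trajectory s \<phi> u X"
begin

lemma trajectoryD: "u \<in> borel_measurable N" "s \<in> {0..T}" "\<phi> \<in> L2 \<mu>"
  and trajectory_regular: "lipschitz_ode.regular_solution T \<mu> (\<lambda>\<sigma> x w. F \<sigma> x (u \<sigma>) w) c k s \<phi> X"
  using X by (simp_all add: trajectory_def)

lemmas trajectory_ode = lipschitz_ode[OF trajectoryD(1)]

lemma trajectory_initial: "X s w = \<phi> w"
  by (rule lipschitz_ode.regular_initial[OF trajectory_ode trajectory_regular trajectoryD(2,3)])

lemma trajectory_primitive_curve: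
  "primitive_curve T \<mu> (vel u X) (L2norm \<mu> (velocity_bound \<phi>)) X"
  using lipschitz_ode.regular_primitive_curve[OF trajectory_ode trajectory_regular trajectoryD(2,3)]
  unfolding velocity_eq[OF trajectoryD(1)] velocity_bound_def .

lemma trajectory_velocity_bound: "\<sigma> \<in> {0..T} \<Longrightarrow> norm (vel u X \<sigma> w) \<le> velocity_bound \<phi> w"
  using lipschitz_ode.regular_velocity_bound[OF trajectory_ode trajectory_regular trajectoryD(2,3)]
  unfolding velocity_eq[OF trajectoryD(1)] velocity_bound_def .

lemma trajectory_increment:
  "0 \<le> r \<Longrightarrow> r \<le> t \<Longrightarrow> t \<le> T \<Longrightarrow> X t w = X r w + partial_integral N {r..t} (vel u X) w"
  using lipschitz_ode.regular_increment[OF trajectory_ode trajectory_regular trajectoryD(2,3)]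
  unfolding velocity_eq[OF trajectoryD(1)] .

end

lemma velocity_bound_eq:
  "velocity_bound \<phi> w = c * (1 + (1 + 2 * c * T * exp (2 * k * T)) * (1 + norm (\<phi> w)))"
  using lipschitz_ode.velocity_bound_fun_def[OF lipschitz_ode, of "\<lambda>_. 0"] lipschitz_ode.growth_const_def[OF lipschitz_ode, of "\<lambda>_. 0"]
  by (simp add: velocity_bound_def)

lemma velocity_bound_L2: "\<phi> \<in> L2 \<mu> \<Longrightarrow> velocity_bound \<phi> \<in> L2 \<mu>"
  using lipschitz_ode.velocity_bound_fun_L2[OF lipschitz_ode, of "\<lambda>_. 0"] by (simp add: velocity_bound_def)

lemma trajectory_state_solution:
  assumes X: "trajectory s \<phi> u X" and v: "\<And>t. t \<in> {s..T} \<Longrightarrow> v t = u t"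
  shows "state_solution \<mu> f s T \<phi> v X"
  unfolding state_solution_def
proof (intro conjI ballI)
  have s: "s \<in> {0..T}" using X by (simp add: trajectory_def)
  note P = trajectory_primitive_curve[OF X]
  show "continuous_L2_curve \<mu> s T X" using primitive_curve_continuous[OF finite_\<mu> P] s by simp
  fix t assume t: "t \<in> {s..T}"
  show "has_L2_integral \<mu> (\<lambda>\<sigma> w. f \<sigma> (X \<sigma> w) (v \<sigma>) w) {s..t} (\<lambda>w. X t w - \<phi> w)"
  proof (rule has_L2_integral_cong_AE)
    show "has_L2_integral \<mu> (vel u X) {s..t} (\<lambda>w. X t w - X s w)"
      using s t by (intro primitive_curve_has_L2_integral[OF finite_\<mu> P]) auto
    show "AE \<sigma> in lebesgue_on {s..t}. vel u X \<sigma> = (\<lambda>w. f \<sigma> (X \<sigma> w) (v \<sigma>) w)"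
      using AE_not_Z_sub[of s t] AE_space
    proof eventually_elim
      case (elim \<sigma>)
      then have "\<sigma> \<in> {0..T} - Z" "\<sigma> \<in> {s..T}" using s t by auto
      then show ?case unfolding vel_def F_def using v by (simp add: fun_eq_iff)
    qed
    show "(\<lambda>w. X t w - \<phi> w) \<in> L2 \<mu>"
      using X s t by (intro L2_diff primitive_curve_L2[OF finite_\<mu> P]) (auto simp: trajectory_def)
  qed (simp add: trajectory_initial[OF X])
qed

text \<open>The distance of two solutions satisfies the homogeneous Gronwall inequality with the
  Lipschitz constant \<open>k\<close>. The solutions are merely continuous curves, so this
  inequality is drawn from the comparison of Bochner integrals.\<close>

lemma state_solution_unique:
  assumes x: "state_solution \<mu> f s T \<phi> v x" and x': "state_solution \<mu> f s T \<phi> v x'" and s: "s \<in> {0..T}" and \<phi>: "\<phi> \<in> L2 \<mu>"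
    and t: "t \<in> {s..T}"
  shows "AE w in \<mu>. x t w = x' t w"
proof -
  have c: "continuous_L2_curve \<mu> s T x" "continuous_L2_curve \<mu> s T x'" using x x' by (auto simp: state_solution_def)
  then have L: "x r \<in> L2 \<mu>" "x' r \<in> L2 \<mu>" if "r \<in> {s..T}" for r using that by (auto simp: continuous_L2_curve_iff)
  define n where "n r = L2dist \<mu> (x r) (x' r)" for r
  have n_cont: "continuous_on {s..T} n"
    unfolding continuous_on_iff
  proof (intro ballI allI impI)
    fix r and e :: real assume r: "r \<in> {s..T}" and "e > 0"
    then have "e/2 > 0" by simp
    obtain d1 where d1: "d1 > 0" "\<And>q. q \<in> {s..T} \<Longrightarrow> \<bar>q - r\<bar> < d1 \<Longrightarrow> L2dist \<mu> (x q) (x r) < e/2"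
      using c(1) r \<open>e/2 > 0\<close> unfolding continuous_L2_curve_iff by meson
    obtain d2 where d2: "d2 > 0" "\<And>q. q \<in> {s..T} \<Longrightarrow> \<bar>q - r\<bar> < d2 \<Longrightarrow> L2dist \<mu> (x' q) (x' r) < e/2"
      using c(2) r \<open>e/2 > 0\<close> unfolding continuous_L2_curve_iff by meson
    show "\<exists>d>0. \<forall>q\<in>{s..T}. dist q r < d \<longrightarrow> dist (n q) (n r) < e"
    proof (intro exI[of _ "min d1 d2"] conjI ballI impI)
      fix q assume q: "q \<in> {s..T}" "dist q r < min d1 d2"
      have "\<bar>n q - n r\<bar> \<le> L2norm \<mu> (\<lambda>w. (x q w - x' q w) - (x r w - x' r w))"
        unfolding n_def by (intro L2norm_triangle_reverse L2_diff L q r)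
      also have "\<dots> = L2norm \<mu> (\<lambda>w. (x q w - x r w) - (x' q w - x' r w))" by (simp add: algebra_simps)
      also have "\<dots> \<le> L2dist \<mu> (x q) (x r) + L2dist \<mu> (x' q) (x' r)"
        by (intro L2norm_triangle_diff' L2_diff L q r)
      also have "\<dots> < e" using d1(2)[of q] d2(2)[of q] q by (simp add: dist_real_def)
      finally show "dist (n q) (n r) < e" by (simp add: dist_real_def)
    qed (use d1 d2 in simp)
  qed
  have "n t = 0"
  proof (rule Gronwall_zero[OF n_cont _ k_pos _ t])
    show "0 \<le> n r" for r by (simp add: n_def)
    fix r assume r: "r \<in> {s..T}"
    have sub: "{s..r} \<subseteq> {s..T}" using r by auto
    have kn: "continuous_on {s..r} (\<lambda>\<sigma>. k * n \<sigma>)" by (intro continuous_intros continuous_on_subset[OF n_cont sub])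
    then have i: "integrable (lebesgue_on {s..r}) (\<lambda>\<sigma>. k * n \<sigma>)" by (rule continuous_imp_integrable_real)
    have "ennreal (L2norm \<mu> (\<lambda>w. (x r w - \<phi> w) - (x' r w - \<phi> w))) \<le> (\<integral>\<^sup>+\<sigma>. ennreal (k * n \<sigma>) \<partial>lebesgue_on {s..r})"
    proof (rule has_L2_integral_diff_norm_le[OF finite_\<mu>])
      show "has_L2_integral \<mu> (\<lambda>\<sigma> w. f \<sigma> (x \<sigma> w) (v \<sigma>) w) {s..r} (\<lambda>w. x r w - \<phi> w)"
        "has_L2_integral \<mu> (\<lambda>\<sigma> w. f \<sigma> (x' \<sigma> w) (v \<sigma>) w) {s..r} (\<lambda>w. x' r w - \<phi> w)"
        using x x' r by (auto simp: state_solution_def)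
      show "(\<lambda>\<sigma>. k * n \<sigma>) \<in> borel_measurable (lebesgue_on {s..r})" by (rule borel_measurable_integrable[OF i])
      show "AE \<sigma> in lebesgue_on {s..r}. L2norm \<mu> (\<lambda>w. f \<sigma> (x \<sigma> w) (v \<sigma>) w - f \<sigma> (x' \<sigma> w) (v \<sigma>) w) \<le> k * n \<sigma>"
        using AE_not_Z_sub[of s r] AE_space
      proof eventually_elim
        case (elim \<sigma>)
        then have \<sigma>: "\<sigma> \<in> {0..T} - Z" "\<sigma> \<in> {s..T}" using s r by auto
        have eq: "f \<sigma> y z w = F \<sigma> y z w" for y z w using \<sigma> by (simp add: F_def)
        have "L2norm \<mu> (\<lambda>w. f \<sigma> (x \<sigma> w) (v \<sigma>) w - f \<sigma> (x' \<sigma> w) (v \<sigma>) w) \<le> L2norm \<mu> (\<lambda>w. k *\<^sub>R (x \<sigma> w - x' \<sigma> w))"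
          unfolding eq
        proof (rule L2norm_mono)
          show "(\<lambda>w. k *\<^sub>R (x \<sigma> w - x' \<sigma> w)) \<in> L2 \<mu>" by (intro L2_scaleR L2_diff L \<sigma>)
          show "(\<lambda>w. F \<sigma> (x \<sigma> w) (v \<sigma>) w - F \<sigma> (x' \<sigma> w) (v \<sigma>) w) \<in> borel_measurable \<mu>"
            by (intro borel_measurable_diff measurable_F_slice L2_measurable L \<sigma>)
          show "AE w in \<mu>. norm (F \<sigma> (x \<sigma> w) (v \<sigma>) w - F \<sigma> (x' \<sigma> w) (v \<sigma>) w) \<le> norm (k *\<^sub>R (x \<sigma> w - x' \<sigma> w))"
            using k_pos by (auto intro!: AE_I2 order_trans[OF F_lipschitz])
        qed
        also have "\<dots> = k * n \<sigma>" using k_pos by (simp add: L2norm_scaleR n_def)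
        finally show ?case .
      qed
    qed
    also have "(\<integral>\<^sup>+\<sigma>. ennreal (k * n \<sigma>) \<partial>lebesgue_on {s..r}) = ennreal (integral {s..r} (\<lambda>\<sigma>. k * n \<sigma>))"
      using nn_integral_eq_integral[OF i] k_pos lebesgue_integral_eq_integral[OF i] by (simp add: n_def)
    finally have "ennreal (n r) \<le> ennreal (integral {s..r} (\<lambda>\<sigma>. k * n \<sigma>))" by (simp add: n_def)
    moreover have "0 \<le> integral {s..r} (\<lambda>\<sigma>. k * n \<sigma>)"
      using k_pos by (intro integral_nonneg integrable_continuous_real kn) (simp add: n_def)
    ultimately show "n r \<le> integral {s..r} (\<lambda>\<sigma>. k * n \<sigma>)" by (simp add: ennreal_le_iff)
  qed
  then have "AE w in \<mu>. x t w - x' t w = 0"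
    unfolding n_def using L2norm_eq_0[OF L2_diff[OF L(1)[OF t] L(2)[OF t]]] by simp
  then show ?thesis by eventually_elim simp
qed

text \<open>Eliminates the choice operator in \<open>state\<close>: by uniqueness any explicitly
  constructed solution represents it up to null sets.\<close>

lemma state_eq:
  assumes x: "state_solution \<mu> f s T \<phi> v x" and s: "s \<in> {0..T}" and \<phi>: "\<phi> \<in> L2 \<mu>" and t: "t \<in> {s..T}"
  shows "AE w in \<mu>. state \<mu> f s T \<phi> v t w = x t w"
  by (rule state_solution_unique[OF _ x s \<phi> t]) (unfold state_def, rule someI[of "\<lambda>x. state_solution \<mu> f s T \<phi> v x", OF x])

end

section \<open>Measurable selection of controls\<close>

lemma L2norm_continuous_on:
  fixes x :: "real \<Rightarrow> 'w \<Rightarrow> 'b::euclidean_space"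
  assumes x: "continuous_L2_curve M a b x"
  shows "continuous_on {a..b} (\<lambda>r. L2norm M (x r))"
  unfolding continuous_on_iff
proof (intro ballI allI impI)
  have L: "x r \<in> L2 M" if "r \<in> {a..b}" for r using x that by (simp add: continuous_L2_curve_iff)
  fix r and e :: real assume r: "r \<in> {a..b}" and "e > 0"
  then obtain d where d: "d > 0" "\<And>q. q \<in> {a..b} \<Longrightarrow> \<bar>q - r\<bar> < d \<Longrightarrow> L2dist M (x q) (x r) < e"
    using x unfolding continuous_L2_curve_iff by meson
  show "\<exists>d>0. \<forall>q\<in>{a..b}. dist q r < d \<longrightarrow> dist (L2norm M (x q)) (L2norm M (x r)) < e"
    using d L2norm_triangle_reverse[OF L L[OF r]] by (intro exI[of _ d]) (force simp: dist_real_def)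
qed

lemma has_L2_integral_cong_AE_slice:
  fixes h h' :: "real \<Rightarrow> 'w \<Rightarrow> 'b::euclidean_space"
  assumes I: "AE \<sigma> in lebesgue_on I. h' \<sigma> \<in> L2 M \<and> (AE w in M. h \<sigma> w = h' \<sigma> w)" and h: "has_L2_integral M h I y"
  shows "has_L2_integral M h' I y"
proof -
  obtain H Y where H: "\<And>k. L2_simple M I (H k) (Y k)"
    "AE \<sigma> in lebesgue_on I. (\<lambda>k. L2dist M (h \<sigma>) (H k \<sigma>)) \<longlonglongrightarrow> 0"
    "(\<lambda>k. \<integral>\<^sup>+\<sigma>. ennreal (L2dist M (h \<sigma>) (H k \<sigma>)) \<partial>lebesgue_on I) \<longlonglongrightarrow> 0"
    "(\<lambda>k. L2dist M (Y k) y) \<longlonglongrightarrow> 0"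
    and yL: "y \<in> L2 M" and hL: "AE \<sigma> in lebesgue_on I. h \<sigma> \<in> L2 M"
    using h unfolding has_L2_integral_def by blast
  have HL: "H k \<sigma> \<in> L2 M" for k \<sigma>
    using H(1)[of k] unfolding L2_simple_def by (auto intro!: L2_sum L2_scaleR)
  have eq: "AE \<sigma> in lebesgue_on I. \<forall>k. L2dist M (h \<sigma>) (H k \<sigma>) = L2dist M (h' \<sigma>) (H k \<sigma>)"
    using I hL
  proof eventually_elim
    case (elim \<sigma>)
    show ?case
    proof
      fix k
      have "AE w in M. norm (h \<sigma> w - H k \<sigma> w) = norm (h' \<sigma> w - H k \<sigma> w)"
        using conjunct2[OF elim(1)] by eventually_elim simp
      then show "L2dist M (h \<sigma>) (H k \<sigma>) = L2dist M (h' \<sigma>) (H k \<sigma>)"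
        by (rule L2norm_cong_AE[OF L2_measurable[OF L2_diff[OF elim(2) HL]] L2_measurable[OF L2_diff[OF conjunct1[OF elim(1)] HL]]])
    qed
  qed
  have nn: "(\<integral>\<^sup>+\<sigma>. ennreal (L2dist M (h \<sigma>) (H k \<sigma>)) \<partial>lebesgue_on I) =
      (\<integral>\<^sup>+\<sigma>. ennreal (L2dist M (h' \<sigma>) (H k \<sigma>)) \<partial>lebesgue_on I)" for k
    by (rule nn_integral_cong_AE) (use eq in \<open>eventually_elim, simp\<close>)
  show ?thesis unfolding has_L2_integral_def
  proof (intro conjI exI[of _ H] exI[of _ Y] allI)
    show "AE \<sigma> in lebesgue_on I. h' \<sigma> \<in> L2 M" using I by eventually_elim simp
    show "AE \<sigma> in lebesgue_on I. (\<lambda>k. L2dist M (h' \<sigma>) (H k \<sigma>)) \<longlonglongrightarrow> 0"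
      using H(2) eq by eventually_elim simp
    show "(\<lambda>k. \<integral>\<^sup>+\<sigma>. ennreal (L2dist M (h' \<sigma>) (H k \<sigma>)) \<partial>lebesgue_on I) \<longlonglongrightarrow> 0"
      using H(3) unfolding nn .
  qed (fact yL H(1) H(4))+
qed

lemma sets_lebesgue_on_closedin:
  assumes "closedin (top_of_set {a..b::real}) A" "{a'..b'} \<subseteq> {a..b}"
  shows "{t \<in> space (lebesgue_on {a'..b'}). t \<in> A} \<in> sets (lebesgue_on {a'..b'})"
proof -
  have "closed A" using assms(1) closedin_closed_trans[of "{a..b}" A] by simp
  then have "A \<inter> {a'..b'} \<in> sets lebesgue" by simp
  moreover have "{t \<in> space (lebesgue_on {a'..b'}). t \<in> A} = A \<inter> {a'..b'}" by auto
  ultimately show ?thesis by (simp add: sets_restrict_space_iff)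
qed

text \<open>Approximate hitting condition: for a level \<open>\<psi> t\<close> that is continuous it says that the zero set
  of \<open>\<psi> t\<close> in the compact set \<open>U t\<close> meets \<open>C\<close>, but it only evaluates \<open>\<psi> t\<close> on a dense sequence.\<close>

definition hits :: "(nat \<Rightarrow> 'u::euclidean_space) \<Rightarrow> (real \<Rightarrow> 'u set) \<Rightarrow> (real \<Rightarrow> 'u \<Rightarrow> real) \<Rightarrow> 'u set \<Rightarrow> real \<Rightarrow> bool" where
  "hits q U \<psi> C t \<longleftrightarrow> (\<forall>N::nat. \<exists>n j. N \<le> n \<and> U t \<inter> (C \<inter> cball (q j) (1 / real (Suc n))) \<noteq> {} \<and> \<psi> t (q j) < 1 / real (Suc N))"

text \<open>Converts a condition with countable quantifiers into the existence of a genuine zero. By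
  continuity a zero in \<open>C\<close> is seen by nearby dense points; conversely, the points of
  \<open>U t \<inter> C\<close> close to the selected dense points accumulate by compactness, and
  their limit is a zero in the closed set \<open>C\<close>.\<close>

lemma hits_iff:
  fixes q :: "nat \<Rightarrow> 'u::euclidean_space"
  assumes q: "\<And>x e. e > 0 \<Longrightarrow> \<exists>j. dist x (q j) < e"
    and U: "compact (U t)" and C: "closed C" and \<psi>: "continuous_on UNIV (\<psi> t)" and \<psi>0: "\<And>x. 0 \<le> \<psi> t x"
  shows "hits q U \<psi> C t \<longleftrightarrow> (\<exists>p\<in>U t \<inter> C. \<psi> t p = (0::real))"
proof
  assume "\<exists>p\<in>U t \<inter> C. \<psi> t p = 0"
  then obtain p where p: "p \<in> U t" "p \<in> C" "\<psi> t p = 0" by auto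
  show "hits q U \<psi> C t" unfolding hits_def
  proof
    fix N :: nat
    have pos: "(0::real) < 1 / real (Suc N)" by simp
    obtain \<delta> where \<delta>: "\<delta> > 0" "\<And>y. dist y p < \<delta> \<Longrightarrow> dist (\<psi> t y) (\<psi> t p) < 1 / real (Suc N)"
      using \<psi>[unfolded continuous_on_iff, rule_format, OF UNIV_I pos, of p] by auto
    obtain n0 where n0: "1 / real (Suc n0) < \<delta>" using \<delta>(1) nat_approx_posE by blast
    define n where "n = max N n0"
    have "1 / real (Suc n) \<le> 1 / real (Suc n0)" by (simp add: n_def frac_le)
    then have n: "1 / real (Suc n) < \<delta>" using n0 by linarith
    obtain j where j: "dist p (q j) < 1 / real (Suc n)" using q[of "1 / real (Suc n)" p] by auto
    have "\<psi> t (q j) < 1 / real (Suc N)" using \<delta>(2)[of "q j"] j n p(3) by (simp add: dist_commute dist_real_def)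
    moreover have "p \<in> U t \<inter> (C \<inter> cball (q j) (1 / real (Suc n)))" using p j by (simp add: dist_commute)
    ultimately show "\<exists>n j. N \<le> n \<and> U t \<inter> (C \<inter> cball (q j) (1 / real (Suc n))) \<noteq> {} \<and> \<psi> t (q j) < 1 / real (Suc N)"
      by (intro exI[of _ n] exI[of _ j]) (auto simp: n_def)
  qed
next
  assume h: "hits q U \<psi> C t"
  have "\<exists>j y. y \<in> U t \<and> y \<in> C \<and> dist (q j) y \<le> 1 / real (Suc N) \<and> \<psi> t (q j) < 1 / real (Suc N)" for N
  proof -
    obtain n j y where *: "N \<le> n" "y \<in> U t" "y \<in> C" "dist (q j) y \<le> 1 / real (Suc n)" "\<psi> t (q j) < 1 / real (Suc N)"
      using h[unfolded hits_def, rule_format, of N] by auto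
    moreover have "1 / real (Suc n) \<le> 1 / real (Suc N)" using *(1) by (simp add: frac_le)
    ultimately show ?thesis by (intro exI[of _ j] exI[of _ y]) auto
  qed
  then obtain j y where jy: "\<And>N. y N \<in> U t" "\<And>N. y N \<in> C" "\<And>N. dist (q (j N)) (y N) \<le> 1 / real (Suc N)"
    "\<And>N. \<psi> t (q (j N)) < 1 / real (Suc N)" by metis
  obtain p r where p: "p \<in> U t" "strict_mono r" "(y \<circ> r) \<longlonglongrightarrow> p"
    using U[unfolded compact_def, rule_format, of y] jy(1) by auto
  have lim: "(\<lambda>N. 1 / real (Suc (r N))) \<longlonglongrightarrow> 0"
    using LIMSEQ_subseq_LIMSEQ[OF LIMSEQ_inverse_real_of_nat p(2)] by (simp add: o_def inverse_eq_divide)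
  have "p \<in> C" by (rule closed_sequentially[OF C _ p(3)]) (simp add: jy(2))
  have "(\<lambda>N. dist (q (j (r N))) (y (r N))) \<longlonglongrightarrow> 0"
    by (rule tendsto_sandwich[OF _ _ tendsto_const lim]) (use jy(3) in auto)
  then have "(\<lambda>N. q (j (r N)) - y (r N)) \<longlonglongrightarrow> 0" by (simp add: dist_norm tendsto_norm_zero_iff)
  from tendsto_add[OF this p(3)[unfolded o_def]] have ql: "(\<lambda>N. q (j (r N))) \<longlonglongrightarrow> p" by simp
  have "(\<lambda>N. \<psi> t (q (j (r N)))) \<longlonglongrightarrow> \<psi> t p"
    by (rule continuous_on_tendsto_compose[OF \<psi> ql]) auto
  then have "\<psi> t p \<le> 0" by (rule LIMSEQ_le[OF _ lim]) (use jy(4) less_imp_le in blast)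
  then show "\<exists>p\<in>U t \<inter> C. \<psi> t p = 0" using \<psi>0[of p] p(1) \<open>p \<in> C\<close> by (intro bexI[of _ p]) auto
qed

text \<open>A selection in the manner of Kuratowski and Ryll-Nardzewski. Upper semicontinuity makes
  the sets of times at which \<open>U t\<close> meets a closed set measurable, so the least index of
  a dense point with a zero within a given radius is a measurable function of \<open>t\<close>;
  halving the radius at each stage gives a Cauchy sequence of dense points.\<close>

theorem measurable_selection:
  fixes U :: "real \<Rightarrow> (real^'m) set" and \<psi> :: "real \<Rightarrow> real^'m \<Rightarrow> real"
  assumes U: "control_map_hyp T U" and sub: "{a..b} \<subseteq> {0..T}"
    and \<psi>m: "\<And>x. (\<lambda>t. \<psi> t x) \<in> borel_measurable (lebesgue_on {a..b})"
    and good: "\<And>t. t \<in> {a..b} - Z \<Longrightarrow> continuous_on UNIV (\<psi> t) \<and> (\<forall>x. 0 \<le> \<psi> t x) \<and> (\<exists>p\<in>U t. \<psi> t p = 0)"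
  shows "\<exists>u\<in>borel_measurable (lebesgue_on {a..b}). \<forall>t\<in>{a..b} - Z. u t \<in> U t \<and> \<psi> t (u t) = 0"
proof -
  let ?N = "lebesgue_on {a..b}"
  obtain D :: "(real^'m) set" where D: "countable D" "\<And>X. open X \<Longrightarrow> X \<noteq> {} \<Longrightarrow> \<exists>d\<in>D. d \<in> X"
    by (erule countable_dense_setE)
  define q where "q = from_nat_into D"
  have q: "\<exists>j. dist x (q j) < e" if e_pos: "e > 0" for x e
  proof -
    obtain d where "d \<in> D" "d \<in> ball x e" using D(2)[OF open_ball, of x e] e_pos centre_in_ball[of x e] by blast
    then show ?thesis using from_nat_into_surj[OF D(1)] unfolding q_def by force
  qed
  have Uc: "compact (U t)" if "t \<in> {a..b}" for t using U that sub by (auto simp: control_map_hyp_def)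
  have hm [measurable]: "Measurable.pred ?N (hits q U \<psi> C)" if C: "closed C" for C
  proof -
    have hit: "Measurable.pred ?N (\<lambda>t. U t \<inter> C' \<noteq> {})" if "closed C'" for C'
    proof -
      have "closedin (top_of_set {0..T}) {t \<in> {0..T}. U t \<inter> C' \<noteq> {}}"
        using U that by (auto simp: control_map_hyp_def upper_semicontinuous_setmap_def)
      from sets_lebesgue_on_closedin[OF this sub]
      have "{t \<in> space ?N. t \<in> {t \<in> {0..T}. U t \<inter> C' \<noteq> {}}} \<in> sets ?N" .
      moreover have "{t \<in> space ?N. t \<in> {t \<in> {0..T}. U t \<inter> C' \<noteq> {}}} = {t \<in> space ?N. U t \<inter> C' \<noteq> {}}" using sub by auto
      ultimately show ?thesis by (simp add: pred_def)
    qed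
    have 1: "Measurable.pred ?N (\<lambda>t. U t \<inter> (C \<inter> cball (q j) r) \<noteq> {})" for j r by (rule hit[OF closed_Int[OF C closed_cball]])
    note [measurable] = 1 \<psi>m
    show ?thesis unfolding hits_def by measurable
  qed
  have hi: "hits q U \<psi> C t \<longleftrightarrow> (\<exists>p\<in>U t \<inter> C. \<psi> t p = 0)" if "t \<in> {a..b} - Z" "closed C" for C t
    using good[OF that(1)] Uc that by (intro hits_iff q) auto
  \<comment> \<open>The next point has a zero within the halved radius and stays near the previous
    point; \<open>2 * (1/2)^n\<close> exceeds the sum of the radius \<open>(1/2)^n\<close> and the
    distance \<open>(1/2)^Suc n\<close> from that zero to a dense point.\<close>
  define next_index where "next_index n i t = (LEAST j. hits q U \<psi> (cball (q j) ((1/2)^Suc n)) t \<and> dist (q j) (q i) \<le> 2 * (1/2)^n)" for n i t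
  define J where "J = rec_nat (\<lambda>t. LEAST j. hits q U \<psi> (cball (q j) 1) t) (\<lambda>n Jn t. next_index n (Jn t) t)"
  have J: "J 0 t = (LEAST j. hits q U \<psi> (cball (q j) 1) t)" "J (Suc n) t = next_index n (J n t) t" for n t by (simp_all add: J_def)
  have Jm [measurable]: "J n \<in> measurable ?N (count_space UNIV)" for n
  proof (induction n)
    case 0
    have "J 0 = (\<lambda>t. LEAST j. hits q U \<psi> (cball (q j) 1) t)" by (rule ext) (rule J(1))
    then show ?case by (simp only:) (intro measurable_Least hm closed_cball)
  next
    case (Suc n)
    have ni: "next_index n i \<in> measurable ?N (count_space UNIV)" for i
      unfolding next_index_def by (intro measurable_Least pred_intros_logic hm closed_cball) auto
    have "(\<lambda>t. next_index n (J n t) t) \<in> measurable ?N (count_space UNIV)"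
      by (rule measurable_compose_countable'[where I = UNIV and f = "\<lambda>i t. next_index n i t"]) (use ni Suc in auto)
    moreover have "J (Suc n) = (\<lambda>t. next_index n (J n t) t)" by (rule ext) (rule J(2))
    ultimately show ?case by simp
  qed
  \<comment> \<open>At times in \<open>Z\<close> the sequence may diverge and the value of
    \<open>lim\<close> is unspecified, but \<open>u\<close> is measurable on the whole
    interval.\<close>
  define u where "u t = lim (\<lambda>n. q (J n t))" for t
  have "u \<in> borel_measurable ?N"
  proof -
    have "(\<lambda>t. q (J n t)) \<in> borel_measurable ?N" for n by (rule measurable_compose[OF Jm]) simp
    then show ?thesis unfolding u_def by measurable
  qed
  moreover have "u t \<in> U t \<and> \<psi> t (u t) = 0" if t: "t \<in> {a..b} - Z" for t
  proof -
    have step: "hits q U \<psi> (cball (q (J (Suc n) t)) ((1/2)^Suc n)) t \<and> dist (q (J (Suc n) t)) (q (J n t)) \<le> 2 * (1/2)^n"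
      if hit: "hits q U \<psi> (cball (q (J n t)) ((1/2)^n)) t" for n
    proof -
      obtain p where p: "p \<in> U t" "\<psi> t p = 0" "dist (q (J n t)) p \<le> (1/2)^n"
        using hit unfolding hi[OF t closed_cball] by auto
      obtain j where j: "dist p (q j) < (1/2)^Suc n" using q[of "(1/2)^Suc n" p] by auto
      have "hits q U \<psi> (cball (q j) ((1/2)^Suc n)) t"
        unfolding hi[OF t closed_cball] using p j by (intro bexI[of _ p]) (auto simp: dist_commute)
      moreover have "dist (q j) (q (J n t)) \<le> 2 * (1/2)^n"
      proof -
        have "dist (q j) (q (J n t)) \<le> dist p (q j) + dist (q (J n t)) p"
          using dist_triangle[of "q j" "q (J n t)" p] by (simp add: dist_commute)
        also have "\<dots> \<le> (1/2)^Suc n + (1/2)^n" by (rule add_mono[OF less_imp_le[OF j] p(3)])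
        also have "\<dots> \<le> 2 * (1/2)^n" by simp
        finally show ?thesis .
      qed
      ultimately show ?thesis unfolding J(2) next_index_def
        using LeastI[of "\<lambda>j. hits q U \<psi> (cball (q j) ((1/2)^Suc n)) t \<and> dist (q j) (q (J n t)) \<le> 2 * (1/2)^n" j] by blast
    qed
    have inv: "hits q U \<psi> (cball (q (J n t)) ((1/2)^n)) t" for n
    proof (induction n)
      case 0
      obtain p where p: "p \<in> U t" "\<psi> t p = 0" using good[OF t] by blast
      obtain j where "dist p (q j) < 1" using q[of 1 p] by auto
      then have "hits q U \<psi> (cball (q j) 1) t" unfolding hi[OF t closed_cball] using p by (intro bexI[of _ p]) (auto simp: dist_commute)
      then show ?case unfolding J by simp (rule LeastI)
    next
      case (Suc n)
      then show ?case using step by blast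
    qed
    have close: "norm (q (J (Suc n) t) - q (J n t)) \<le> 2 * (1/2)^n" for n
      using step[OF inv] by (simp add: dist_norm)
    have conv: "(\<lambda>n. q (J n t)) \<longlonglongrightarrow> u t"
      using geometric_increments_convergent(1)[of "\<lambda>n. q (J n t)" 2, OF close] unfolding u_def convergent_LIMSEQ_iff by simp
    have "\<exists>p. p \<in> U t \<and> \<psi> t p = 0 \<and> dist (q (J n t)) p \<le> (1/2)^n" for n
      using inv[of n] unfolding hi[OF t closed_cball] by auto
    then obtain p where p: "\<And>n. p n \<in> U t" "\<And>n. \<psi> t (p n) = 0" "\<And>n. dist (q (J n t)) (p n) \<le> (1/2)^n" by metis
    have half: "(\<lambda>n. (1/2::real)^n) \<longlonglongrightarrow> 0" by (rule LIMSEQ_realpow_zero) auto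
    have "(\<lambda>n. dist (q (J n t)) (p n)) \<longlonglongrightarrow> 0"
      by (rule tendsto_sandwich[OF _ _ tendsto_const half]) (use p(3) in auto)
    then have "(\<lambda>n. q (J n t) - p n) \<longlonglongrightarrow> 0" by (simp add: dist_norm tendsto_norm_zero_iff)
    from tendsto_diff[OF conv this] have pl: "p \<longlonglongrightarrow> u t" by simp
    have "u t \<in> U t" using compact_imp_closed[OF Uc] pl p(1) t by (auto simp: closed_sequential_limits)
    moreover have "(\<lambda>n. \<psi> t (p n)) \<longlonglongrightarrow> \<psi> t (u t)"
      by (rule continuous_on_tendsto_compose[OF _ pl]) (use good[OF t] in auto)
    then have "\<psi> t (u t) = 0" unfolding p(2) by (simp add: LIMSEQ_const_iff)
    ultimately show ?thesis by simp
  qed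
  ultimately show ?thesis by blast
qed

lemma (in pair_finite_measure) product_L2_bounded_slices:
  assumes [measurable]: "case_prod h \<in> borel_measurable (N \<Otimes>\<^sub>M M)"
    and bd: "\<And>\<sigma>. \<sigma> \<in> space N \<Longrightarrow> h \<sigma> \<in> L2 M \<and> L2norm M (h \<sigma>) \<le> B"
  shows "case_prod h \<in> L2 (N \<Otimes>\<^sub>M M)"
proof -
  have "(\<integral>\<^sup>+z. ennreal ((norm (case_prod h z))\<^sup>2) \<partial>(N \<Otimes>\<^sub>M M)) = (\<integral>\<^sup>+\<sigma>. \<integral>\<^sup>+w. ennreal ((norm (h \<sigma> w))\<^sup>2) \<partial>M \<partial>N)"
    by (subst M2.nn_integral_fst[symmetric]) auto
  also have "\<dots> \<le> (\<integral>\<^sup>+\<sigma>. ennreal (B\<^sup>2) \<partial>N)"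
  proof (rule nn_integral_mono)
    fix \<sigma> assume "\<sigma> \<in> space N"
    then show "(\<integral>\<^sup>+w. ennreal ((norm (h \<sigma> w))\<^sup>2) \<partial>M) \<le> ennreal (B\<^sup>2)"
      using nn_integral_norm_square[of "h \<sigma>" M] bd[of \<sigma>] by (auto intro!: ennreal_leI power_mono)
  qed
  also have "\<dots> < \<infinity>" using M1.emeasure_finite[of "space N"] by (simp add: ennreal_mult_eq_top_iff less_top[symmetric])
  finally show ?thesis by (auto simp: L2_def intro!: integrableI_bounded)
qed

section \<open>Filippov's lemma: solutions of the inclusion are controlled states\<close>

context control_problem
begin

lemma U_bounded: "\<exists>B. \<forall>t\<in>{0..T}. \<forall>u\<in>U t. norm u \<le> B"
proof -
  obtain UU where "compact UU" "\<forall>t\<in>{0..T}. U t \<subseteq> UU" using U_hyp by (auto simp: control_map_hyp_def)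
  then show ?thesis using compact_imp_bounded[of UU] by (auto simp: bounded_iff subset_eq)
qed

lemma admissibleI:
  assumes u: "u \<in> borel_measurable (lebesgue_on {s..T})" and s: "0 \<le> s" and AE: "AE t in lebesgue_on {s..T}. u t \<in> U t"
  shows "u \<in> admissible_controls U s T"
proof -
  obtain B where B: "\<forall>t\<in>{0..T}. \<forall>u\<in>U t. norm u \<le> B" using U_bounded by blast
  have "AE t in lebesgue_on {s..T}. norm (u t) \<le> B"
    using AE AE_space by eventually_elim (use B s in auto)
  then show ?thesis using u AE by (auto simp: admissible_controls_def)
qed

lemma id_measurable_N: "0 \<le> s \<Longrightarrow> (\<lambda>\<sigma>. \<sigma>) \<in> measurable (lebesgue_on {s..T}) N"
  by (rule measurable_restrict_space2) (auto intro: measurable_restrict_space1)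

lemma F_control_tendsto:
  assumes \<psi>: "\<psi> \<in> L2 \<mu>" and p: "p \<longlonglongrightarrow> p'"
  shows "(\<lambda>n. L2norm \<mu> (\<lambda>w. F t (\<psi> w) (p n) w - F t (\<psi> w) p' w)) \<longlonglongrightarrow> 0"
proof (rule L2_dominated_convergence)
  have "(\<lambda>w. c *\<^sub>R (1::real) + c *\<^sub>R norm (\<psi> w)) \<in> L2 \<mu>"
    by (intro L2_add L2_scaleR L2_const finite_\<mu> L2_norm_real \<psi>)
  then show "(\<lambda>w. c * (1 + norm (\<psi> w))) \<in> L2 \<mu>" by (simp add: algebra_simps)
  show "(\<lambda>w. F t (\<psi> w) (p n) w) \<in> borel_measurable \<mu>" "(\<lambda>w. F t (\<psi> w) p' w) \<in> borel_measurable \<mu>" for n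
    by (rule measurable_F_slice[OF L2_measurable[OF \<psi>]])+
qed (use F_growth F_tendsto p in auto)

text \<open>Filippov's argument. At each time the velocity comes from an existential statement, so
  its measurable dependence on time has to be built: difference quotients along
  \<open>1 / real (Suc n)\<close> make the distance from \<open>F t (x t w) p w\<close> to the
  derivative, in L2, measurable in \<open>t\<close>, and a measurable zero of this distance is the
  control.\<close>

lemma inclusion_solution_control:
  assumes s: "s \<in> {0..T}" and \<phi>: "\<phi> \<in> L2 \<mu>" and x: "x \<in> inclusion_solutions \<mu> U f s T \<phi>"
  shows "\<exists>u\<in>admissible_controls U s T. state_solution \<mu> f s T \<phi> u x"
proof -
  let ?N = "lebesgue_on {s..T}"
  interpret S: pair_finite_measure ?N \<mu> by (rule pair_finite_measure_Icc[OF finite_\<mu>])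
  have cx: "continuous_L2_curve \<mu> s T x" and ac: "L2_absolutely_continuous_on \<mu> s T x" and x0: "AE w in \<mu>. x s w = \<phi> w"
    and der: "AE t in ?N. \<exists>\<psi>\<in>setF \<mu> U f t (x t). has_L2_derivative \<mu> x \<psi> t {s..T}"
    using x by (auto simp: inclusion_solutions_def)
  have xL: "x t \<in> L2 \<mu>" if "t \<in> {s..T}" for t using cx that by (simp add: continuous_L2_curve_iff)
  obtain X where Xm: "case_prod X \<in> borel_measurable (?N \<Otimes>\<^sub>M \<mu>)" and Xx: "\<And>t. t \<in> {s..T} \<Longrightarrow> AE w in \<mu>. X t w = x t w"
    using continuous_L2_curve_version[OF cx] by blast
  \<comment> \<open>Forward translates, stopped at \<open>T\<close> so as to remain in the interval.
    For \<open>t < T\<close> they give the difference quotient with step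
    \<open>1 / real (Suc n)\<close> once \<open>n\<close> is large.\<close>
  define y where "y n t = x (min (t + 1 / real (Suc n)) T)" for n :: nat and t
  have cy: "continuous_L2_curve \<mu> s T (y n)" for n
    unfolding continuous_L2_curve_iff
  proof (intro conjI ballI allI impI)
    fix \<sigma> assume \<sigma>: "\<sigma> \<in> {s..T}"
    then have \<sigma>': "min (\<sigma> + 1 / real (Suc n)) T \<in> {s..T}" by (auto simp: min_def intro: add_increasing2)
    then show "y n \<sigma> \<in> L2 \<mu>" unfolding y_def by (rule xL)
    fix e :: real assume "e > 0"
    then obtain d where d: "d > 0" "\<And>r. r \<in> {s..T} \<Longrightarrow> \<bar>r - min (\<sigma> + 1 / real (Suc n)) T\<bar> < d \<Longrightarrow>
        L2norm \<mu> (\<lambda>w. x r w - x (min (\<sigma> + 1 / real (Suc n)) T) w) < e"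
      using cx \<sigma>' unfolding continuous_L2_curve_iff by meson
    show "\<exists>d>0. \<forall>r\<in>{s..T}. \<bar>r - \<sigma>\<bar> < d \<longrightarrow> L2dist \<mu> (y n r) (y n \<sigma>) < e"
    proof (intro exI[of _ d] conjI ballI impI d(1))
      fix r assume r: "r \<in> {s..T}" "\<bar>r - \<sigma>\<bar> < d"
      have "min (r + 1 / real (Suc n)) T \<in> {s..T}" using r(1) by (auto simp: min_def intro: add_increasing2)
      moreover have "\<bar>min (r + 1 / real (Suc n)) T - min (\<sigma> + 1 / real (Suc n)) T\<bar> < d" using r(2) by linarith
      ultimately show "L2dist \<mu> (y n r) (y n \<sigma>) < e" unfolding y_def by (rule d(2))
    qed
  qed
  have "\<exists>Y. case_prod Y \<in> borel_measurable (?N \<Otimes>\<^sub>M \<mu>) \<and> (\<forall>t\<in>{s..T}. AE w in \<mu>. Y t w = y n t w)" for n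
    by (rule continuous_L2_curve_version[OF cy])
  then have "\<exists>Y. \<forall>n. case_prod (Y n) \<in> borel_measurable (?N \<Otimes>\<^sub>M \<mu>) \<and> (\<forall>t\<in>{s..T}. AE w in \<mu>. Y n t w = y n t w)"
    by (intro choice allI)
  then obtain Y where Y: "\<forall>n. case_prod (Y n) \<in> borel_measurable (?N \<Otimes>\<^sub>M \<mu>) \<and> (\<forall>t\<in>{s..T}. AE w in \<mu>. Y n t w = y n t w)" ..
  have Fm: "(\<lambda>z. F (fst z) (case_prod X z) (v (fst z)) (snd z)) \<in> borel_measurable (?N \<Otimes>\<^sub>M \<mu>)" if "v \<in> borel_measurable ?N" for v
  proof (rule measurable_F)
    show "fst \<in> measurable (?N \<Otimes>\<^sub>M \<mu>) N"
      using s by (intro measurable_compose[OF measurable_fst id_measurable_N]) auto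
    show "(\<lambda>z. v (fst z)) \<in> borel_measurable (?N \<Otimes>\<^sub>M \<mu>)" by (rule measurable_compose[OF measurable_fst that])
    show "snd \<in> measurable (?N \<Otimes>\<^sub>M \<mu>) borel"
      using measurable_snd[of ?N \<mu>] measurable_cong_sets[OF refl sets_\<mu>] by blast
  qed (rule Xm)
  define q where "q n t p = L2norm \<mu> (\<lambda>w. F t (X t w) p w - real (Suc n) *\<^sub>R (Y n t w - X t w))" for n t p
  have qm: "(\<lambda>t. q n t p) \<in> borel_measurable ?N" for n p
    unfolding q_def
  proof (rule S.measurable_slice_norm)
    have "(\<lambda>z. F (fst z) (case_prod X z) p (snd z) - real (Suc n) *\<^sub>R (case_prod (Y n) z - case_prod X z)) \<in> borel_measurable (?N \<Otimes>\<^sub>M \<mu>)"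
      using Y by (intro borel_measurable_diff borel_measurable_scaleR borel_measurable_const Fm Xm) auto
    then show "case_prod (\<lambda>t w. F t (X t w) p w - real (Suc n) *\<^sub>R (Y n t w - X t w)) \<in> borel_measurable (?N \<Otimes>\<^sub>M \<mu>)"
      by (simp add: case_prod_unfold)
  qed
  \<comment> \<open>At good times this is the distance between the velocity produced by the control
    value \<open>p\<close> and the derivative, obtained as a limit of measurable functions of
    \<open>t\<close> without selecting the derivative measurably.\<close>
  define \<psi> where "\<psi> t p = lim (\<lambda>n. q n t p)" for t p
  \<comment> \<open>The end point \<open>T\<close> is excluded because the forward quotients
    degenerate there.\<close>
  define good where "good t \<longleftrightarrow> t \<notin> Z \<and> t \<noteq> T \<and> (\<exists>l\<in>setF \<mu> U f t (x t). has_L2_derivative \<mu> x l t {s..T})" for t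
  have good_AE: "AE t in ?N. good t"
    using der AE_not_Z_sub[of s T] AE_lebesgue_on_neq[of T s T] by eventually_elim (simp add: good_def)
  define Z' where "Z' = {t\<in>{s..T}. \<not> good t}"
  have Z': "negligible Z'" unfolding Z'_def using good_AE by (subst (asm) AE_lebesgue_on_iff_negligible) auto
  have at_good: "\<exists>l\<in>L2 \<mu>. has_L2_derivative \<mu> x l t {s..T} \<and> (\<forall>p. \<psi> t p = L2norm \<mu> (\<lambda>w. F t (x t w) p w - l w)) \<and>
      (\<exists>p\<in>U t. AE w in \<mu>. l w = F t (x t w) p w)" if t: "t \<in> {s..T}" "good t" for t
  proof -
    obtain l where l: "l \<in> setF \<mu> U f t (x t)" "has_L2_derivative \<mu> x l t {s..T}" using t by (auto simp: good_def)
    then have wL: "l \<in> L2 \<mu>" by (simp add: setF_def)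
    have t': "t \<in> {0..T} - Z" "t < T" using t s by (auto simp: good_def)
    have FL: "(\<lambda>w. F t (x t w) p w) \<in> L2 \<mu>" for p by (rule F_slice_L2[OF xL[OF t(1)]])
    have "\<psi> t p = L2norm \<mu> (\<lambda>w. F t (x t w) p w - l w)" for p
    proof -
      define r where "r n = t + 1 / real (Suc n)" for n
      have "(\<lambda>n. t + 1 / real (Suc n)) \<longlonglongrightarrow> t + 0"
        by (intro tendsto_add tendsto_const LIMSEQ_Suc[OF lim_1_over_n])
      then have r: "r \<longlonglongrightarrow> t" by (simp add: r_def[abs_def])
      then have "\<forall>\<^sub>F n in sequentially. r n < T" by (rule order_tendstoD(2)) (fact t'(2))
      then have ev: "\<forall>\<^sub>F n in sequentially. r n \<in> {s..T}" by eventually_elim (use t in \<open>auto simp: r_def intro: add_increasing2\<close>)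
      have "filterlim r (at t within {s..T}) sequentially"
        unfolding filterlim_at using r ev by (auto simp: r_def elim!: eventually_mono)
      from filterlim_compose[OF l(2)[unfolded has_L2_derivative_def] this]
      have d0: "(\<lambda>n. L2norm \<mu> (\<lambda>w. (x (r n) w - x t w) /\<^sub>R (r n - t) - l w)) \<longlonglongrightarrow> 0" .
      have "\<forall>\<^sub>F n in sequentially. norm (q n t p - L2norm \<mu> (\<lambda>w. F t (x t w) p w - l w)) \<le> L2norm \<mu> (\<lambda>w. (x (r n) w - x t w) /\<^sub>R (r n - t) - l w)"
        using ev
      proof eventually_elim
        case (elim n)
        have yr: "y n t = x (r n)" using elim by (simp add: y_def r_def)
        let ?d = "\<lambda>w. (x (r n) w - x t w) /\<^sub>R (r n - t)"
        have dL: "?d \<in> L2 \<mu>" by (intro L2_scaleR L2_diff xL elim t(1))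
        have "q n t p = L2norm \<mu> (\<lambda>w. F t (x t w) p w - ?d w)"
          unfolding q_def
        proof (rule L2norm_cong_AE)
          have sl: "X t \<in> borel_measurable \<mu>" "Y n t \<in> borel_measurable \<mu>"
            using measurable_Pair2[of "case_prod X" ?N \<mu> borel t] measurable_Pair2[of "case_prod (Y n)" ?N \<mu> borel t] Xm Y t(1) by auto
          then show "(\<lambda>w. F t (X t w) p w - real (Suc n) *\<^sub>R (Y n t w - X t w)) \<in> borel_measurable \<mu>"
            by (intro borel_measurable_diff borel_measurable_scaleR borel_measurable_const measurable_F_slice)
          show "(\<lambda>w. F t (x t w) p w - ?d w) \<in> borel_measurable \<mu>" by (rule L2_measurable[OF L2_diff[OF FL dL]])
          have "AE w in \<mu>. Y n t w = x (r n) w" using Y t(1) yr by metis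
          with Xx[OF t(1)] show "AE w in \<mu>. norm (F t (X t w) p w - real (Suc n) *\<^sub>R (Y n t w - X t w)) = norm (F t (x t w) p w - ?d w)"
            by eventually_elim (simp add: r_def)
        qed
        then have "\<bar>q n t p - L2norm \<mu> (\<lambda>w. F t (x t w) p w - l w)\<bar> \<le> L2norm \<mu> (\<lambda>w. (F t (x t w) p w - ?d w) - (F t (x t w) p w - l w))"
          using L2norm_triangle_reverse[OF L2_diff[OF FL dL] L2_diff[OF FL wL], of p p] by simp
        also have "\<dots> = L2norm \<mu> (\<lambda>w. ?d w - l w)" using L2norm_minus_commute[of \<mu> l ?d] by simp
        finally show ?case by simp
      qed
      from Lim_null_comparison[OF this d0] have "(\<lambda>n. q n t p) \<longlonglongrightarrow> L2norm \<mu> (\<lambda>w. F t (x t w) p w - l w)"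
        by (simp add: LIM_zero_iff)
      then show ?thesis unfolding \<psi>_def by (rule limI)
    qed
    moreover have "\<exists>p\<in>U t. AE w in \<mu>. l w = F t (x t w) p w" using l(1) t'(1) by (auto simp: setF_def F_def)
    ultimately show ?thesis using wL l(2) by blast
  qed
  have "\<exists>u\<in>borel_measurable ?N. \<forall>t\<in>{s..T} - Z'. u t \<in> U t \<and> \<psi> t (u t) = 0"
  proof (rule measurable_selection[OF U_hyp])
    show "{s..T} \<subseteq> {0..T}" using s by auto
    show "(\<lambda>t. \<psi> t p) \<in> borel_measurable ?N" for p unfolding \<psi>_def using qm by measurable
    fix t assume "t \<in> {s..T} - Z'"
    then have t: "t \<in> {s..T}" "good t" by (auto simp: Z'_def)
    obtain l p where l: "l \<in> L2 \<mu>" "\<And>p. \<psi> t p = L2norm \<mu> (\<lambda>w. F t (x t w) p w - l w)" and p: "p \<in> U t" "AE w in \<mu>. l w = F t (x t w) p w"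
      using at_good[OF t] by blast
    have FL: "(\<lambda>w. F t (x t w) p w) \<in> L2 \<mu>" for p by (rule F_slice_L2[OF xL[OF t(1)]])
    have "\<psi> t p = 0" unfolding l(2) L2norm_eq_0[OF L2_diff[OF FL l(1)]] using p(2) by eventually_elim simp
    moreover have "continuous_on UNIV (\<psi> t)"
    proof (rule continuous_on_sequentiallyI)
      fix v :: "nat \<Rightarrow> real^'m" and a assume v: "v \<longlonglongrightarrow> a"
      have "norm (\<psi> t (v n) - \<psi> t a) \<le> L2norm \<mu> (\<lambda>w. F t (x t w) (v n) w - F t (x t w) a w)" for n
        unfolding l(2) using L2norm_triangle_reverse[OF L2_diff[OF FL l(1)] L2_diff[OF FL l(1)], of "v n" a] by simp
      then have "(\<lambda>n. \<psi> t (v n) - \<psi> t a) \<longlonglongrightarrow> 0"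
        by (intro Lim_null_comparison[OF always_eventually F_control_tendsto[OF xL[OF t(1)] v, of t]]) simp
      then show "(\<lambda>n. \<psi> t (v n)) \<longlonglongrightarrow> \<psi> t a" by (simp add: LIM_zero_iff)
    qed
    ultimately show "continuous_on UNIV (\<psi> t) \<and> (\<forall>p. 0 \<le> \<psi> t p) \<and> (\<exists>p\<in>U t. \<psi> t p = 0)"
      using p(1) by (auto simp: l(2))
  qed
  then obtain u where um: "u \<in> borel_measurable ?N" and u: "\<And>t. t \<in> {s..T} - Z' \<Longrightarrow> u t \<in> U t \<and> \<psi> t (u t) = 0" by blast
  have notZ': "AE t in ?N. t \<notin> Z'" using good_AE by eventually_elim (simp add: Z'_def)
  have adm: "u \<in> admissible_controls U s T"
  proof (rule admissibleI[OF um])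
    show "AE t in ?N. u t \<in> U t" using notZ' AE_space by eventually_elim (use u in auto)
  qed (use s in simp)
  \<comment> \<open>The version \<open>X\<close> and the measurable control make this velocity
    jointly measurable, which was not known of the family of derivatives.\<close>
  define D where "D t w = F t (X t w) (u t) w" for t w
  have Dm: "case_prod D \<in> borel_measurable (?N \<Otimes>\<^sub>M \<mu>)" using Fm[OF um] by (simp add: D_def case_prod_unfold)
  have XL: "X t \<in> L2 \<mu>" if "t \<in> {s..T}" for t
  proof (rule L2_bound[OF xL[OF that]])
    show "X t \<in> borel_measurable \<mu>" using measurable_Pair2[of "case_prod X" ?N \<mu> borel t] Xm that by auto
    show "AE w in \<mu>. norm (X t w) \<le> norm (x t w)" using Xx[OF that] by eventually_elim simp
  qed
  have XP: "case_prod X \<in> L2 (?N \<Otimes>\<^sub>M \<mu>)"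
  proof -
    have "compact ((\<lambda>r. L2norm \<mu> (x r)) ` {s..T})" by (rule compact_continuous_image[OF L2norm_continuous_on[OF cx]]) simp
    from compact_imp_bounded[OF this] obtain B where "\<forall>y\<in>(\<lambda>r. L2norm \<mu> (x r)) ` {s..T}. norm y \<le> B"
      unfolding bounded_iff ..
    then have B: "\<And>r. r \<in> {s..T} \<Longrightarrow> L2norm \<mu> (x r) \<le> B" by simp
    have "L2norm \<mu> (X t) \<le> B" if "t \<in> {s..T}" for t
    proof -
      have "L2norm \<mu> (X t) = L2norm \<mu> (x t)"
        by (rule L2norm_cong_AE[OF L2_measurable[OF XL[OF that]] L2_measurable[OF xL[OF that]]])
          (use Xx[OF that] in \<open>auto elim!: eventually_mono\<close>)
      then show ?thesis using B[OF that] by simp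
    qed
    then show ?thesis using XL by (intro S.product_L2_bounded_slices[OF Xm, of B]) auto
  qed
  have DP: "case_prod D \<in> L2 (?N \<Otimes>\<^sub>M \<mu>)"
  proof (rule L2_bound[OF _ Dm])
    have "(\<lambda>z. c *\<^sub>R (1::real) + c *\<^sub>R norm (case_prod X z)) \<in> L2 (?N \<Otimes>\<^sub>M \<mu>)"
      by (intro L2_add L2_scaleR L2_const S.P.finite_measure_axioms L2_norm_real XP)
    then show "(\<lambda>z. c * (1 + norm (case_prod X z))) \<in> L2 (?N \<Otimes>\<^sub>M \<mu>)" by (simp add: algebra_simps)
    show "AE z in ?N \<Otimes>\<^sub>M \<mu>. norm (case_prod D z) \<le> norm (c * (1 + norm (case_prod X z)))"
      using c_pos by (auto simp: D_def abs_mult intro!: AE_I2 F_growth)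
  qed
  have Dx: "AE w in \<mu>. D t w = F t (x t w) (u t) w" if "t \<in> {s..T}" for t
    using Xx[OF that] by eventually_elim (simp add: D_def)
  have DL: "D t \<in> L2 \<mu>" if "t \<in> {s..T}" for t unfolding D_def by (rule F_slice_L2[OF XL[OF that]])
  have derD: "AE t in ?N. has_L2_derivative \<mu> x (D t) t {s..T}"
    using notZ' AE_space
  proof eventually_elim
    case (elim t)
    then have t: "t \<in> {s..T}" "t \<in> {s..T} - Z'" "good t" by (auto simp: Z'_def)
    obtain l where l: "l \<in> L2 \<mu>" "has_L2_derivative \<mu> x l t {s..T}" "\<And>p. \<psi> t p = L2norm \<mu> (\<lambda>w. F t (x t w) p w - l w)"
      using at_good[OF t(1,3)] by blast
    have "L2norm \<mu> (\<lambda>w. F t (x t w) (u t) w - l w) = 0" using u[OF t(2)] l(3) by simp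
    then have "AE w in \<mu>. F t (x t w) (u t) w - l w = 0"
      using L2norm_eq_0[OF L2_diff[OF F_slice_L2[OF xL[OF t(1)]] l(1)]] by simp
    with Dx[OF t(1)] have "AE w in \<mu>. l w = D t w" by eventually_elim simp
    then show ?case
      using has_L2_derivative_cong[of "{s..T}" x \<mu> x l "D t" t] xL l(1,2) DL[OF t(1)] t(1) by auto
  qed
  have int: "AE w in \<mu>. x \<tau> w = x s w + partial_integral ?N {s..\<tau>} D w" if "\<tau> \<in> {s..T}" for \<tau>
    by (rule L2_absolutely_continuous_imp_integral[OF finite_\<mu> xL ac DP derD that])
  have "state_solution \<mu> f s T \<phi> u x" unfolding state_solution_def
  proof (intro conjI ballI cx)
    fix \<tau> assume \<tau>: "\<tau> \<in> {s..T}"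
    have "has_L2_integral \<mu> D {s..\<tau>} (\<lambda>w. x \<tau> w - \<phi> w)"
    proof (rule has_L2_integral_cong_AE)
      show "has_L2_integral \<mu> D {s..\<tau>} (partial_integral (lebesgue_on {s..\<tau>}) {s..\<tau>} D)"
        by (rule has_L2_integral_partial_integral[OF finite_\<mu> L2_lebesgue_on_subinterval[OF finite_\<mu> DP]]) (use \<tau> in auto)
      show "(\<lambda>w. x \<tau> w - \<phi> w) \<in> L2 \<mu>" by (intro L2_diff xL \<tau> \<phi>)
      have "partial_integral (lebesgue_on {s..\<tau>}) {s..\<tau>} D = partial_integral ?N {s..\<tau>} D"
        by (rule partial_integral_sub) (use \<tau> in auto)
      then show "AE w in \<mu>. partial_integral (lebesgue_on {s..\<tau>}) {s..\<tau>} D w = x \<tau> w - \<phi> w"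
        using int[OF \<tau>] x0 by (auto elim!: eventually_elim2)
    qed simp
    then show "has_L2_integral \<mu> (\<lambda>\<sigma> w. f \<sigma> (x \<sigma> w) (u \<sigma>) w) {s..\<tau>} (\<lambda>w. x \<tau> w - \<phi> w)"
    proof (rule has_L2_integral_cong_AE_slice[rotated])
      show "AE \<sigma> in lebesgue_on {s..\<tau>}. (\<lambda>w. f \<sigma> (x \<sigma> w) (u \<sigma>) w) \<in> L2 \<mu> \<and> (AE w in \<mu>. D \<sigma> w = f \<sigma> (x \<sigma> w) (u \<sigma>) w)"
        using AE_not_Z_sub[of s \<tau>] AE_space
      proof eventually_elim
        case (elim \<sigma>)
        then have \<sigma>: "\<sigma> \<in> {0..T} - Z" "\<sigma> \<in> {s..T}" using s \<tau> by auto
        have eq: "f \<sigma> y l w = F \<sigma> y l w" for y l w using \<sigma> by (simp add: F_def)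
        show ?case unfolding eq using F_slice_L2[OF xL[OF \<sigma>(2)]] Dx[OF \<sigma>(2)] by simp
      qed
    qed
  qed
  then show ?thesis using adm by blast
qed

text \<open>With a level function that vanishes identically the selection theorem yields a
  measurable selection of \<open>U\<close>.\<close>

lemma admissible_exists: "\<exists>u. u \<in> borel_measurable N \<and> (\<forall>t\<in>{0..T}. u t \<in> U t)"
proof -
  have "\<exists>u\<in>borel_measurable N. \<forall>t\<in>{0..T} - {}. u t \<in> U t \<and> (\<lambda>t x. 0::real) t (u t) = 0"
    by (rule measurable_selection[OF U_hyp]) (use U_hyp in \<open>auto simp: control_map_hyp_def\<close>)
  then show ?thesis by auto
qed

text \<open>Controls on different intervals \<open>{s..T}\<close> are extended to the common
  interval \<open>{0..T}\<close>, on which trajectories with different initial times can be compared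
  uniformly.\<close>

lemma admissible_extension:
  assumes u: "u \<in> admissible_controls U s T" and s: "s \<in> {0..T}"
  shows "\<exists>v\<in>admissible_controls U 0 T. \<forall>t\<in>{s..T}. v t = u t"
proof -
  obtain u0 where u0: "u0 \<in> borel_measurable N" "\<forall>t\<in>{0..T}. u0 t \<in> U t" using admissible_exists by blast
  define v where "v t = (if t \<in> {s..T} then u t else u0 t)" for t
  have "(\<lambda>t. if t \<in> {s..T} then u t else 0) \<in> borel_measurable lebesgue"
    using u by (subst measurable_restrict_space_iff[symmetric]) (auto simp: admissible_controls_def)
  then have 1: "(\<lambda>t. if t \<in> {s..T} then u t else 0) \<in> borel_measurable N" by (rule measurable_restrict_space1)
  have 2: "{t \<in> space N. t \<in> {s..T}} \<in> sets N"
  proof -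
    have "{t \<in> space N. t \<in> {s..T}} = {s..T}" using s by auto
    then show ?thesis using s by (simp add: sets_restrict_space_iff)
  qed
  have "(\<lambda>t. if t \<in> {s..T} then (if t \<in> {s..T} then u t else 0) else u0 t) \<in> borel_measurable N"
    by (rule measurable_If[OF 1 u0(1) 2])
  then have vm: "v \<in> borel_measurable N" by (simp add: v_def[abs_def] if_distrib cong: if_cong)
  have "AE t in lebesgue_on {s..T}. u t \<in> U t" using u by (simp add: admissible_controls_def)
  then have "negligible {t\<in>{s..T}. u t \<notin> U t}" by (subst (asm) AE_lebesgue_on_iff_negligible) auto
  moreover have "{t\<in>{0..T}. v t \<notin> U t} \<subseteq> {t\<in>{s..T}. u t \<notin> U t}" using u0(2) by (auto simp: v_def)
  ultimately have "AE t in N. v t \<in> U t" by (subst AE_lebesgue_on_iff_negligible) (auto intro: negligible_subset)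
  then have "v \<in> admissible_controls U 0 T" by (intro admissibleI vm) auto
  then show ?thesis by (intro bexI[of _ v]) (auto simp: v_def)
qed

end

section \<open>Compactness of primitives\<close>

text \<open>The diagonal argument in combinatorial form: at stage \<open>i\<close> some cell of a
  finite partition contains infinitely many terms of the current subsequence, and the diagonal
  sequence satisfies the relation of every stage from some index on.\<close>

lemma finite_partition_subseq:
  fixes R :: "nat \<Rightarrow> nat \<Rightarrow> nat \<Rightarrow> bool"
  assumes part: "\<And>i. \<exists>\<A>. finite \<A> \<and> \<Union>\<A> = UNIV \<and> (\<forall>S\<in>\<A>. \<forall>m\<in>S. \<forall>n\<in>S. R i m n)"
  shows "\<exists>r. strict_mono r \<and> (\<forall>i m n. i \<le> m \<longrightarrow> i \<le> n \<longrightarrow> R i (r m) (r n))"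
proof -
  define P where "P i s \<longleftrightarrow> (\<forall>m n. R i (s m) (s n))" for i and s :: "nat \<Rightarrow> nat"
  interpret subseqs P
  proof
    fix i and s :: "nat \<Rightarrow> nat" assume "strict_mono s"
    from part[of i] obtain \<A> where \<A>: "finite \<A>" "\<Union>\<A> = UNIV" "\<forall>S\<in>\<A>. \<forall>m\<in>S. \<forall>n\<in>S. R i m n" by (elim exE conjE)
    have "(\<Union>S\<in>\<A>. s -` S) = UNIV" unfolding vimage_Union[symmetric] \<A>(2) by simp
    then have "infinite (\<Union>S\<in>\<A>. s -` S)" by simp
    then obtain S where S: "S \<in> \<A>" "infinite (s -` S)" unfolding finite_UN[OF \<A>(1)] by blast
    have "strict_mono (enumerate (s -` S))" by (rule strict_mono_enumerate[OF S(2)])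
    moreover have "P i (s \<circ> enumerate (s -` S))"
      unfolding P_def using \<A>(3) S enumerate_in_set[OF S(2)] by auto
    ultimately show "\<exists>r'. strict_mono r' \<and> P i (s \<circ> r')" by blast
  qed
  have "P k (diagseq \<circ> ((+) (Suc k)))" for k
    by (rule diagseq_holds) (simp add: P_def)
  then have R: "R k (diagseq (Suc (k + m))) (diagseq (Suc (k + n)))" for k m n by (simp add: P_def)
  \<comment> \<open>The relation of stage \<open>i\<close> is guaranteed from entry
    \<open>Suc i\<close> of the diagonal sequence on, hence the shift by one.\<close>
  have "strict_mono (\<lambda>i. diagseq (Suc i))" using subseq_diagseq by (simp add: strict_mono_Suc_iff)
  moreover have "R i (diagseq (Suc m)) (diagseq (Suc n))" if "i \<le> m" "i \<le> n" for i m n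
    using R[of i "m - i" "n - i"] that by simp
  ultimately show ?thesis by blast
qed

text \<open>Total boundedness of a bounded part of a finite-dimensional span. Coefficients rather
  than vectors are rounded, so linear dependence of the \<open>p i\<close> is harmless.\<close>

lemma finite_span_net:
  assumes J: "finite J" and p: "\<And>i. i \<in> J \<Longrightarrow> p i \<in> L2 M" and "0 < e"
  shows "\<exists>Q. finite Q \<and> Q \<subseteq> L2 M \<and> (\<forall>\<beta>. (\<forall>i\<in>J. \<bar>\<beta> i\<bar> \<le> R) \<longrightarrow> (\<exists>q\<in>Q. L2norm M (\<lambda>w. (\<Sum>i\<in>J. \<beta> i *\<^sub>R p i w) - q w) \<le> e))"
proof -
  \<comment> \<open>The summand 1 makes \<open>C\<close> positive. Rounding every coefficient down
    to a multiple of \<open>e / C\<close> costs at most \<open>e\<close> in total.\<close>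
  define C where "C = (\<Sum>i\<in>J. L2norm M (p i)) + 1"
  have C: "C > 0" unfolding C_def by (intro add_nonneg_pos sum_nonneg) auto
  define \<delta> where "\<delta> = e / C"
  have \<delta>: "\<delta> > 0" using C \<open>0 < e\<close> by (simp add: \<delta>_def)
  define K where "K = {\<lfloor>- R / \<delta>\<rfloor>..\<lfloor>R / \<delta>\<rfloor>}"
  define Q where "Q = (\<lambda>\<kappa> w. \<Sum>i\<in>J. (\<delta> * real_of_int (\<kappa> i)) *\<^sub>R p i w) ` (J \<rightarrow>\<^sub>E K)"
  have "finite Q" unfolding Q_def K_def by (intro finite_imageI finite_PiE J) simp
  moreover have "Q \<subseteq> L2 M" unfolding Q_def using p by (auto intro!: L2_sum L2_scaleR)
  moreover have "\<exists>q\<in>Q. L2norm M (\<lambda>w. (\<Sum>i\<in>J. \<beta> i *\<^sub>R p i w) - q w) \<le> e" if \<beta>: "\<forall>i\<in>J. \<bar>\<beta> i\<bar> \<le> R" for \<beta>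
  proof -
    define \<kappa> where "\<kappa> = restrict (\<lambda>i. \<lfloor>\<beta> i / \<delta>\<rfloor>) J"
    define q where "q = (\<lambda>w. \<Sum>i\<in>J. (\<delta> * real_of_int (\<kappa> i)) *\<^sub>R p i w)"
    have "\<kappa> \<in> J \<rightarrow>\<^sub>E K"
    proof (rule PiE_I)
      fix i assume i: "i \<in> J"
      then have "- R \<le> \<beta> i" "\<beta> i \<le> R" using \<beta> by force+
      then have "- R / \<delta> \<le> \<beta> i / \<delta>" "\<beta> i / \<delta> \<le> R / \<delta>"
        using divide_right_mono[of "- R" "\<beta> i" \<delta>] divide_right_mono[of "\<beta> i" R \<delta>] \<delta> by auto
      then show "\<kappa> i \<in> K" using i unfolding \<kappa>_def K_def by (auto intro: floor_mono)
    qed (simp add: \<kappa>_def)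
    then have "q \<in> Q" unfolding Q_def q_def by blast
    moreover have "L2norm M (\<lambda>w. (\<Sum>i\<in>J. \<beta> i *\<^sub>R p i w) - q w) \<le> e"
    proof -
      have "L2norm M (\<lambda>w. (\<Sum>i\<in>J. \<beta> i *\<^sub>R p i w) - q w) = L2norm M (\<lambda>w. \<Sum>i\<in>J. (\<beta> i - \<delta> * real_of_int (\<kappa> i)) *\<^sub>R p i w)"
        unfolding q_def by (simp add: sum_subtractf[symmetric] scaleR_diff_left)
      also have "\<dots> \<le> (\<Sum>i\<in>J. L2norm M (\<lambda>w. (\<beta> i - \<delta> * real_of_int (\<kappa> i)) *\<^sub>R p i w))"
        using p by (intro L2norm_sum_le L2_scaleR) auto
      also have "\<dots> \<le> (\<Sum>i\<in>J. \<delta> * L2norm M (p i))"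
      proof (rule sum_mono)
        fix i assume i: "i \<in> J"
        have "real_of_int \<lfloor>\<beta> i / \<delta>\<rfloor> \<le> \<beta> i / \<delta>" "\<beta> i / \<delta> < real_of_int \<lfloor>\<beta> i / \<delta>\<rfloor> + 1" by linarith+
        then have "\<delta> * real_of_int \<lfloor>\<beta> i / \<delta>\<rfloor> \<le> \<beta> i" "\<beta> i < \<delta> * real_of_int \<lfloor>\<beta> i / \<delta>\<rfloor> + \<delta>"
          using \<delta> by (simp_all only: pos_le_divide_eq pos_divide_less_eq mult.commute[of \<delta>] distrib_right mult_1_left)
        then have "\<bar>\<beta> i - \<delta> * real_of_int (\<kappa> i)\<bar> \<le> \<delta>" using i by (simp add: \<kappa>_def)
        then show "L2norm M (\<lambda>w. (\<beta> i - \<delta> * real_of_int (\<kappa> i)) *\<^sub>R p i w) \<le> \<delta> * L2norm M (p i)"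
          unfolding L2norm_scaleR by (rule mult_right_mono) simp
      qed
      also have "\<dots> = \<delta> * (C - 1)" by (simp add: C_def sum_distrib_left)
      also have "\<dots> \<le> e" using C \<open>0 < e\<close> by (simp add: \<delta>_def field_simps)
      finally show ?thesis .
    qed
    ultimately show ?thesis by blast
  qed
  ultimately show ?thesis by blast
qed

text \<open>Arzela--Ascoli: total boundedness of the values at the points of a finite grid gives a finite
  partition of the index set, and the common Lipschitz constant controls the times in between.\<close>

lemma uniformly_Cauchy_subseq:
  fixes y :: "nat \<Rightarrow> real \<Rightarrow> 'w \<Rightarrow> 'b::euclidean_space"
  assumes T: "0 < T" and yL: "\<And>n t. t \<in> {0..T} \<Longrightarrow> y n t \<in> L2 M"
    and lip: "\<And>n t r. t \<in> {0..T} \<Longrightarrow> r \<in> {0..T} \<Longrightarrow> L2dist M (y n t) (y n r) \<le> B * \<bar>t - r\<bar>" and "0 \<le> B"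
    and net: "\<And>e. 0 < e \<Longrightarrow> \<exists>Q. finite Q \<and> Q \<subseteq> L2 M \<and> (\<forall>n. \<forall>t\<in>{0..T}. \<exists>q\<in>Q. L2dist M (y n t) q \<le> e)"
  shows "\<exists>r. strict_mono r \<and> (\<forall>i m n. i \<le> m \<longrightarrow> i \<le> n \<longrightarrow> (\<forall>t\<in>{0..T}. L2dist M (y (r m) t) (y (r n) t) \<le> (1/2)^i))"
proof (rule finite_partition_subseq)
  fix i :: nat
  \<comment> \<open>The final triangle inequality has four terms: two for moving \<open>t\<close> to
    a grid point and two for passing through the common net point.\<close>
  define e where "e = (1/2::real)^i / 4"
  have "e > 0" by (simp add: e_def)
  then obtain Q where Q: "finite Q" "Q \<subseteq> L2 M" "\<And>n t. t \<in> {0..T} \<Longrightarrow> \<exists>q\<in>Q. L2dist M (y n t) q \<le> e"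
    using net by meson
  obtain K :: nat where K: "B * T / e < real K" using reals_Archimedean2 by blast
  have "0 \<le> B * T / e" using T \<open>0 \<le> B\<close> \<open>e > 0\<close> by simp
  then have "K > 0" using K by linarith
  define \<tau> where "\<tau> j = real j * (T / real K)" for j :: nat
  have \<tau>: "\<tau> j \<in> {0..T}" if "j \<le> K" for j
  proof -
    have "real j * T \<le> real K * T" using that T by simp
    then show ?thesis using T \<open>K > 0\<close> by (simp add: \<tau>_def field_simps)
  qed
  have near: "\<exists>j\<le>K. \<bar>t - \<tau> j\<bar> \<le> T / real K" if t: "t \<in> {0..T}" for t
  proof (intro exI conjI)
    define j where "j = nat \<lfloor>t / (T / real K)\<rfloor>"
    have pos: "T / real K > 0" using T \<open>K > 0\<close> by simp
    have "0 \<le> t / (T / real K)" using t pos by (meson atLeastAtMost_iff divide_nonneg_pos)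
    then have j: "real j \<le> t / (T / real K)" "t / (T / real K) < real j + 1" unfolding j_def by linarith+
    then have j': "real j * (T / real K) \<le> t" "t < (real j + 1) * (T / real K)"
      using pos by (simp_all only: pos_le_divide_eq pos_divide_less_eq)
    have "t / (T / real K) \<le> real K" using t T \<open>K > 0\<close> by (simp add: field_simps)
    then show "j \<le> K" using j(1) by linarith
    have "(real j + 1) * (T / real K) = real j * (T / real K) + T / real K" by (simp only: distrib_right mult_1_left)
    then show "\<bar>t - \<tau> j\<bar> \<le> T / real K" using j' pos unfolding \<tau>_def abs_le_iff by (intro conjI) linarith+
  qed
  \<comment> \<open>Records the net points near \<open>y n\<close> on the grid. The restriction to
    \<open>{..K}\<close> makes each record an element of a finite function space, so that only
    finitely many classes arise.\<close>
  define c where "c n = restrict (\<lambda>j. SOME q. q \<in> Q \<and> L2dist M (y n (\<tau> j)) q \<le> e) {..K}" for n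
  have c: "c n j \<in> Q \<and> L2dist M (y n (\<tau> j)) (c n j) \<le> e" if j: "j \<le> K" for n j
  proof -
    have "\<exists>q. q \<in> Q \<and> L2dist M (y n (\<tau> j)) q \<le> e" using Q(3)[OF \<tau>[OF j], of n] by blast
    from someI_ex[OF this] show ?thesis using j by (simp add: c_def)
  qed
  have "range c \<subseteq> {..K} \<rightarrow>\<^sub>E Q"
  proof
    fix g assume "g \<in> range c"
    then obtain n where g: "g = c n" by blast
    show "g \<in> {..K} \<rightarrow>\<^sub>E Q" unfolding g by (rule PiE_I) (use c in blast, simp add: c_def)
  qed
  then have fin: "finite (range c)" by (rule finite_subset) (intro finite_PiE Q(1), simp)
  show "\<exists>\<A>. finite \<A> \<and> \<Union>\<A> = UNIV \<and> (\<forall>S\<in>\<A>. \<forall>m\<in>S. \<forall>n\<in>S. \<forall>t\<in>{0..T}. L2dist M (y m t) (y n t) \<le> (1/2)^i)"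
  proof (intro exI[of _ "(\<lambda>g. c -` {g}) ` range c"] conjI ballI)
    show "finite ((\<lambda>g. c -` {g}) ` range c)" using fin by simp
    show "\<Union>((\<lambda>g. c -` {g}) ` range c) = UNIV" by auto
    fix S m n t assume "S \<in> (\<lambda>g. c -` {g}) ` range c" "m \<in> S" "n \<in> S" and t: "t \<in> {0..T}"
    then have mn: "c m = c n" by auto
    obtain j where j: "j \<le> K" "\<bar>t - \<tau> j\<bar> \<le> T / real K" using near[OF t] by blast
    have cL: "c n j \<in> L2 M" using c[OF j(1)] Q(2) by blast
    have l: "L2dist M (y n t) (y n (\<tau> j)) \<le> e" for n
    proof -
      have "L2dist M (y n t) (y n (\<tau> j)) \<le> B * \<bar>t - \<tau> j\<bar>" by (rule lip[OF t \<tau>[OF j(1)]])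
      also have "\<dots> \<le> B * (T / real K)" using j(2) \<open>0 \<le> B\<close> by (rule mult_left_mono)
      also have "\<dots> \<le> e" using K \<open>e > 0\<close> \<open>K > 0\<close> by (simp add: field_simps)
      finally show ?thesis .
    qed
    have "L2dist M (y m t) (y n t) \<le> L2dist M (y m t) (y m (\<tau> j)) + L2dist M (y m (\<tau> j)) (c n j)
        + L2dist M (c n j) (y n (\<tau> j)) + L2dist M (y n (\<tau> j)) (y n t)"
      using L2norm_triangle_diff[OF yL[OF t, of m] yL[OF \<tau>[OF j(1)], of m] yL[OF t, of n]]
        L2norm_triangle_diff[OF yL[OF \<tau>[OF j(1)], of m] cL yL[OF t, of n]]
        L2norm_triangle_diff[OF cL yL[OF \<tau>[OF j(1)], of n] yL[OF t, of n]] by linarith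
    also have "\<dots> \<le> e + e + e + e"
      using l[of m] l[of n] c[OF j(1), of m] c[OF j(1), of n] mn L2norm_minus_commute[of M "c n j" "y n (\<tau> j)"]
        L2norm_minus_commute[of M "y n (\<tau> j)" "y n t"] by (intro add_mono) auto
    also have "\<dots> = (1/2)^i" by (simp add: e_def)
    finally show "L2dist M (y m t) (y n t) \<le> (1/2)^i" .
  qed
qed

text \<open>The velocity is replaced by the first net point within \<open>\<epsilon>\<close>. The
  primitive of this step map is a combination of net points whose coefficients are measures of sets
  of times, hence bounded by \<open>T\<close>; it ranges over a bounded part of a finite-dimensional
  span that is the same for all \<open>h\<close> and \<open>t\<close>.\<close>

lemma compact_range_primitive_net:
  fixes K :: "('w \<Rightarrow> 'b::euclidean_space) set" and T :: real
  assumes M: "finite_measure M" and T: "0 < T" and K: "compactin (L2_topology M) K" and "0 < e"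
  shows "\<exists>Q. finite Q \<and> Q \<subseteq> L2 M \<and> (\<forall>h. case_prod h \<in> L2 (lebesgue_on {0..T} \<Otimes>\<^sub>M M) \<longrightarrow> (AE \<sigma> in lebesgue_on {0..T}. h \<sigma> \<in> K) \<longrightarrow>
    (\<forall>t\<in>{0..T}. \<exists>q\<in>Q. L2norm M (\<lambda>w. partial_integral (lebesgue_on {0..T}) {0..t} h w - q w) \<le> e))"
proof -
  let ?N = "lebesgue_on {0..T}"
  interpret pair_finite_measure ?N M by (rule pair_finite_measure_Icc) fact
  \<comment> \<open>Half of \<open>e\<close> is spent on replacing the velocity over a time at most
    \<open>T\<close>, the other half on rounding the coefficients.\<close>
  define \<epsilon> where "\<epsilon> = e / (2 * T)"
  have "\<epsilon> > 0" using \<open>0 < e\<close> T by (simp add: \<epsilon>_def)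
  obtain P where P: "finite P" "P \<subseteq> L2 M" "\<And>\<psi>. \<psi> \<in> K \<Longrightarrow> \<exists>q\<in>P. L2dist M \<psi> q < \<epsilon>"
    using compactin_L2_finite_net[OF K \<open>\<epsilon> > 0\<close>] by blast
  obtain p where p: "bij_betw p {..<card P} P"
    using ex_bij_betw_nat_finite[OF P(1)] by (auto simp: atLeast0LessThan)
  define n where "n = card P"
  have pL: "p i \<in> L2 M" if "i < n" for i using p P(2) that by (auto simp: bij_betw_def n_def)
  have "0 < e / 2" using \<open>0 < e\<close> by simp
  obtain Q where Q: "finite Q" "Q \<subseteq> L2 M"
    "\<And>\<beta>. (\<forall>i\<in>{..<n}. \<bar>\<beta> i\<bar> \<le> T) \<Longrightarrow> \<exists>q\<in>Q. L2norm M (\<lambda>w. (\<Sum>i<n. \<beta> i *\<^sub>R p i w) - q w) \<le> e / 2"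
    using finite_span_net[of "{..<n}" p M "e/2" T] pL \<open>0 < e / 2\<close> by auto
  have "\<exists>q\<in>Q. L2norm M (\<lambda>w. partial_integral ?N {0..t} h w - q w) \<le> e"
    if h: "case_prod h \<in> L2 (?N \<Otimes>\<^sub>M M)" and hK: "AE \<sigma> in ?N. h \<sigma> \<in> K" and t: "t \<in> {0..T}" for h t
  proof -
    define near where "near i \<sigma> \<longleftrightarrow> L2dist M (h \<sigma>) (p i) < \<epsilon>" for i \<sigma>
    \<comment> \<open>Taking the first index makes the sets disjoint, so that \<open>g\<close> takes
      a single value \<open>p i\<close> at almost every time.\<close>
    define A where "A i = {\<sigma> \<in> space ?N. near i \<sigma> \<and> (\<forall>j<i. \<not> near j \<sigma>)}" for i
    have const: "case_prod (\<lambda>\<sigma> w. p i w) \<in> L2 (?N \<Otimes>\<^sub>M M)" if "i < n" for i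
      using L2_measurable[OF pL[OF that]] by (intro product_L2I[of _ "\<lambda>w. norm (p i w)"]) (auto intro: L2_norm_real pL that)
    have nm: "{\<sigma> \<in> space ?N. near i \<sigma>} \<in> sets ?N" if "i < n" for i
    proof -
      have "case_prod (\<lambda>\<sigma> w. h \<sigma> w - p i w) \<in> borel_measurable (?N \<Otimes>\<^sub>M M)"
        using L2_measurable[OF L2_diff[OF h const[OF that]]] by (simp add: case_prod_unfold)
      from measurable_slice_norm[OF this] show ?thesis unfolding near_def by measurable
    qed
    have As: "A i \<in> sets ?N" if "i < n" for i
    proof -
      have "A i = {\<sigma> \<in> space ?N. near i \<sigma>} - (\<Union>j<i. {\<sigma> \<in> space ?N. near j \<sigma>})" unfolding A_def by auto
      then show ?thesis using nm that by (auto intro!: sets.Diff sets.finite_UN)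
    qed
    define g where "g \<sigma> w = (\<Sum>i<n. indicator (A i) \<sigma> *\<^sub>R p i w)" for \<sigma> w
    have gR: "case_prod g \<in> rect_simple ?N M"
    proof -
      have "case_prod g = (\<lambda>z. \<Sum>i<n. indicator (A i) (fst z) *\<^sub>R p i (snd z))" by (auto simp: g_def fun_eq_iff)
      then show ?thesis unfolding rect_simple_def using As pL by blast
    qed
    have gL: "case_prod g \<in> L2 (?N \<Otimes>\<^sub>M M)" by (rule rect_simple_L2[OF gR])
    have st: "{0..t} \<in> sets ?N" using t by (auto simp: sets_restrict_space_iff)
    have D: "case_prod (\<lambda>\<sigma> w. h \<sigma> w - g \<sigma> w) \<in> L2 (?N \<Otimes>\<^sub>M M)"
      using L2_diff[OF h gL] by (simp add: case_prod_unfold)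
    have "L2norm M (partial_integral ?N {0..t} (\<lambda>\<sigma> w. h \<sigma> w - g \<sigma> w)) \<le> measure ?N {0..t} * \<epsilon>"
    proof (rule partial_integral_norm_le_bound[OF D st])
      show "AE \<sigma> in ?N. \<sigma> \<in> {0..t} \<longrightarrow> L2dist M (h \<sigma>) (g \<sigma>) \<le> \<epsilon>"
        using hK AE_space
      proof eventually_elim
        case (elim \<sigma>)
        obtain q where q: "q \<in> P" "L2dist M (h \<sigma>) q < \<epsilon>" using P(3)[OF elim(1)] by blast
        have "q \<in> p ` {..<n}" using q(1) p by (simp add: bij_betw_def n_def)
        then obtain j where j0: "q = p j" "j \<in> {..<n}" by (rule imageE)
        then have j: "j < n" "near j \<sigma>" using q(2) by (simp_all add: near_def)
        define i where "i = (LEAST j. near j \<sigma>)"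
        have "near i \<sigma>" unfolding i_def by (rule LeastI[of "\<lambda>j. near j \<sigma>", OF j(2)])
        moreover have "i < n" using Least_le[of "\<lambda>j. near j \<sigma>", OF j(2)] j(1) unfolding i_def by (rule le_less_trans)
        moreover have "\<not> near j \<sigma>" if "j < i" for j
          by (rule not_less_Least[of _ "\<lambda>j. near j \<sigma>"]) (use \<open>j < i\<close> in \<open>simp add: i_def\<close>)
        ultimately have i: "near i \<sigma>" "i < n" "\<And>j. j < i \<Longrightarrow> \<not> near j \<sigma>" by blast+
        have "\<sigma> \<in> A l \<longleftrightarrow> l = i" for l
        proof
          assume l: "\<sigma> \<in> A l"
          then have "\<not> l < i" "\<not> i < l" using i(1,3) unfolding A_def by auto
          then show "l = i" by simp
        next
          assume "l = i"
          then show "\<sigma> \<in> A l" using i(1,3) elim(2) unfolding A_def by auto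
        qed
        then have "indicator (A l) \<sigma> *\<^sub>R p l w = (if l = i then p l w else 0)" for l w by simp
        then have "g \<sigma> = (\<lambda>w. \<Sum>l<n. if l = i then p l w else 0)"
          unfolding g_def by (simp only:)
        also have "\<dots> = p i" using i(2) by (simp add: fun_eq_iff)
        finally show ?case using i(1) by (simp add: near_def)
      qed
    qed (use \<open>\<epsilon> > 0\<close> in simp)
    also have "measure ?N {0..t} * \<epsilon> \<le> e / 2"
    proof -
      have "measure ?N {0..t} = t" using t measure_lebesgue_on_Icc[of 0 0 t T] by simp
      moreover have "t * \<epsilon> \<le> T * \<epsilon>" using t \<open>\<epsilon> > 0\<close> by (intro mult_right_mono) auto
      ultimately show ?thesis using T by (simp add: \<epsilon>_def)
    qed
    finally have 1: "L2norm M (partial_integral ?N {0..t} (\<lambda>\<sigma> w. h \<sigma> w - g \<sigma> w)) \<le> e / 2" .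
    define \<beta> where "\<beta> i = measure ?N (A i \<inter> {0..t})" for i
    have g\<beta>: "partial_integral ?N {0..t} g = (\<lambda>w. \<Sum>i<n. \<beta> i *\<^sub>R p i w)"
    proof -
      have "partial_integral ?N {0..t} g = partial_integral ?N (space ?N) (\<lambda>\<sigma> w. \<Sum>i<n. indicator (A i \<inter> {0..t}) \<sigma> *\<^sub>R p i w)"
        unfolding partial_integral_def g_def
        by (intro ext Bochner_Integration.integral_cong refl) (auto simp: indicator_def intro!: sum.neutral sum.cong)
      also have "\<dots> = (\<lambda>w. \<Sum>i<n. \<beta> i *\<^sub>R p i w)"
        unfolding \<beta>_def by (rule partial_integral_sum_indicator[OF M1.finite_measure_axioms]) (use As st in auto)
      finally show ?thesis .
    qed
    have "\<bar>\<beta> i\<bar> \<le> T" if "i < n" for i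
    proof -
      have "\<beta> i \<le> measure ?N (space ?N)" unfolding \<beta>_def by (rule M1.bounded_measure)
      also have "\<dots> = T" using T measure_lebesgue_on_Icc[of 0 0 T T] by simp
      finally show ?thesis by (simp add: \<beta>_def)
    qed
    then obtain q where q: "q \<in> Q" "L2norm M (\<lambda>w. (\<Sum>i<n. \<beta> i *\<^sub>R p i w) - q w) \<le> e / 2" using Q(3)[of \<beta>] by auto
    note PL = partial_integral_L2(1)[OF h st] partial_integral_L2(1)[OF gL st] partial_integral_L2(1)[OF D st]
    have "L2norm M (\<lambda>w. partial_integral ?N {0..t} h w - partial_integral ?N {0..t} g w) = L2norm M (partial_integral ?N {0..t} (\<lambda>\<sigma> w. h \<sigma> w - g \<sigma> w))"
      using partial_integral_diff[OF h gL st]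
      by (intro L2norm_cong_AE L2_measurable L2_diff PL) (auto elim!: eventually_mono)
    then have "L2norm M (\<lambda>w. partial_integral ?N {0..t} h w - q w) \<le> e / 2 + e / 2"
      using L2norm_triangle_diff[OF PL(1,2), of q] q Q(2) 1 g\<beta> by auto
    then show ?thesis using q(1) by auto
  qed
  then show ?thesis by (intro exI[of _ Q] conjI allI impI ballI Q(1,2))
qed

text \<open>The compact parameter space is cut into finitely many cells of small balls. An
  equicontinuous map is uniformly within \<open>\<epsilon>\<close> of the map equal on each cell to
  its value at the centre, and the latter is a combination of indicators times basis vectors with
  coefficients bounded by \<open>R\<close>.\<close>

lemma equicontinuous_net:
  fixes M :: "'w::metric_space measure"
  assumes M: "finite_measure M" and sets: "sets M = sets borel" and cpt: "compact (UNIV :: 'w set)"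
    and \<theta>: "(\<theta> \<longlongrightarrow> 0) (at_right (0::real))" and "\<theta> 0 = 0" and mono: "mono_on {0..} \<theta>" and "0 < e"
  shows "\<exists>Q. finite Q \<and> Q \<subseteq> L2 M \<and> (\<forall>y::'w \<Rightarrow> 'b::euclidean_space. y \<in> borel_measurable M \<longrightarrow>
    (\<forall>w w'. norm (y w - y w') \<le> \<theta> (dist w w')) \<longrightarrow> (\<forall>w. norm (y w) \<le> R) \<longrightarrow> (\<exists>q\<in>Q. L2dist M y q \<le> e))"
proof -
  interpret finite_measure M by fact
  have space: "space M = UNIV" using sets_eq_imp_space_eq[OF sets] by simp
  define S where "S = sqrt (measure M UNIV) + 1"
  have "S > 0" unfolding S_def by (simp add: add_nonneg_pos)
  define \<epsilon> where "\<epsilon> = e / (2 * S)"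
  have "\<epsilon> > 0" using \<open>0 < e\<close> \<open>S > 0\<close> by (simp add: \<epsilon>_def)
  obtain \<delta> where \<delta>: "\<delta> > 0" "\<And>r. 0 < r \<Longrightarrow> r < \<delta> \<Longrightarrow> \<theta> r < \<epsilon>"
    using order_tendstoD(2)[OF \<theta> \<open>\<epsilon> > 0\<close>] unfolding eventually_at_right_field by auto
  \<comment> \<open>\<open>\<theta> 0 = 0\<close> covers the points that coincide with their centre,
    since the one-sided limit speaks of \<open>r > 0\<close> only.\<close>
  have \<theta>\<delta>: "\<theta> r \<le> \<epsilon>" if "0 \<le> r" "r < \<delta>" for r
    using \<delta>(2)[of r] that \<open>\<theta> 0 = 0\<close> \<open>\<epsilon> > 0\<close> by (cases "r = 0") auto
  obtain P where P: "finite P" "UNIV \<subseteq> (\<Union>x\<in>P. ball (x::'w) \<delta>)"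
    by (rule compactE_image[OF cpt, of UNIV "\<lambda>x. ball x \<delta>"]) (use \<delta>(1) in auto)
  define n where "n = card P"
  obtain v where v: "bij_betw v {..<n} P"
    using ex_bij_betw_nat_finite[OF P(1)] by (auto simp: atLeast0LessThan n_def)
  define A where "A i = ball (v i) \<delta> - (\<Union>j<i. ball (v j) \<delta>)" for i
  have As: "A i \<in> sets M" for i unfolding A_def sets by auto
  define p where "p = (\<lambda>(i, b) w. indicator (A i) w *\<^sub>R (b :: 'b))"
  have pL: "p z \<in> L2 M" for z
    unfolding p_def by (cases z) (auto intro!: L2_indicator L2_const M As)
  have "0 < e / 2" using \<open>0 < e\<close> by simp
  obtain Q where Q: "finite Q" "Q \<subseteq> L2 M"
    "\<And>\<beta>. (\<forall>z\<in>{..<n} \<times> Basis. \<bar>\<beta> z\<bar> \<le> R) \<Longrightarrow> \<exists>q\<in>Q. L2norm M (\<lambda>w. (\<Sum>z\<in>{..<n} \<times> Basis. \<beta> z *\<^sub>R p z w) - q w) \<le> e / 2"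
    using finite_span_net[of "{..<n} \<times> (Basis :: 'b set)" p M "e/2" R] pL \<open>0 < e / 2\<close> by auto
  have "\<exists>q\<in>Q. L2dist M y q \<le> e"
    if ym: "y \<in> borel_measurable M" and y: "\<forall>w w'. norm (y w - y w') \<le> \<theta> (dist w w')" and yR: "\<forall>w. norm (y w) \<le> R" for y :: "'w \<Rightarrow> 'b"
  proof -
    define \<beta> where "\<beta> = (\<lambda>(i, b). y (v i) \<bullet> b)"
    have "\<forall>z\<in>{..<n} \<times> Basis. \<bar>\<beta> z\<bar> \<le> R"
    proof clarify
      fix i and b :: 'b assume "b \<in> Basis"
      then have "\<bar>y (v i) \<bullet> b\<bar> \<le> norm (y (v i))" by (rule Basis_le_norm)
      then show "\<bar>\<beta> (i, b)\<bar> \<le> R" using yR order_trans unfolding \<beta>_def by auto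
    qed
    then obtain q where q: "q \<in> Q" "L2norm M (\<lambda>w. (\<Sum>z\<in>{..<n} \<times> Basis. \<beta> z *\<^sub>R p z w) - q w) \<le> e / 2" using Q(3) by blast
    define g where "g w = (\<Sum>z\<in>{..<n} \<times> Basis. \<beta> z *\<^sub>R p z w)" for w
    have gL: "g \<in> L2 M" unfolding g_def by (intro L2_sum L2_scaleR pL)
    have g: "g w = (\<Sum>i<n. indicator (A i) w *\<^sub>R y (v i))" for w
    proof -
      have "g w = (\<Sum>(i, b)\<in>{..<n} \<times> Basis. (y (v i) \<bullet> b) *\<^sub>R (indicator (A i) w *\<^sub>R b))"
        unfolding g_def by (intro sum.cong) (auto simp: \<beta>_def p_def)
      also have "\<dots> = (\<Sum>i<n. \<Sum>b\<in>Basis. (y (v i) \<bullet> b) *\<^sub>R (indicator (A i) w *\<^sub>R b))"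
        by (rule sum.cartesian_product[symmetric])
      also have "\<dots> = (\<Sum>i<n. indicator (A i) w *\<^sub>R (\<Sum>b\<in>Basis. (y (v i) \<bullet> b) *\<^sub>R b))"
        by (simp add: scaleR_sum_right mult.commute)
      finally show ?thesis by (simp add: euclidean_representation)
    qed
    have close: "norm (y w - g w) \<le> \<epsilon>" for w
    proof -
      have "w \<in> (\<Union>x\<in>P. ball x \<delta>)" by (rule subsetD[OF P(2)]) simp
      then obtain j where j: "j < n" "w \<in> ball (v j) \<delta>" using v unfolding bij_betw_def by auto
      define i where "i = (LEAST j. w \<in> ball (v j) \<delta>)"
      have "w \<in> ball (v i) \<delta>" unfolding i_def by (rule LeastI[of "\<lambda>j. w \<in> ball (v j) \<delta>", OF j(2)])
      moreover have "i < n" using Least_le[of "\<lambda>j. w \<in> ball (v j) \<delta>", OF j(2)] j(1) unfolding i_def by (rule le_less_trans)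
      moreover have "w \<notin> ball (v j) \<delta>" if "j < i" for j
        by (rule not_less_Least[of _ "\<lambda>j. w \<in> ball (v j) \<delta>"]) (use \<open>j < i\<close> in \<open>simp add: i_def\<close>)
      ultimately have i: "w \<in> ball (v i) \<delta>" "i < n" "\<And>j. j < i \<Longrightarrow> w \<notin> ball (v j) \<delta>" by blast+
      have "w \<in> A l \<longleftrightarrow> l = i" for l
      proof
        assume l: "w \<in> A l"
        then have "\<not> l < i" "\<not> i < l" using i(1,3) unfolding A_def by auto
        then show "l = i" by simp
      next
        assume "l = i"
        then show "w \<in> A l" using i(1,3) unfolding A_def by auto
      qed
      then have "g w = (\<Sum>l<n. if l = i then y (v l) else 0)"
        unfolding g by (intro sum.cong) (auto simp: indicator_def)
      then have "g w = y (v i)" using i(2) by simp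
      then have "norm (y w - g w) \<le> \<theta> (dist w (v i))" using y by simp
      also have "\<dots> \<le> \<epsilon>" using i(1) by (intro \<theta>\<delta>) (auto simp: dist_commute)
      finally show ?thesis .
    qed
    have "L2dist M y g \<le> L2norm M (\<lambda>w. \<epsilon>)"
      using close \<open>\<epsilon> > 0\<close> L2_measurable[OF gL] ym by (intro L2norm_mono L2_const M) auto
    also have "\<dots> = \<epsilon> * sqrt (measure M UNIV)"
      using \<open>\<epsilon> > 0\<close> space by (simp add: L2norm_def real_sqrt_mult)
    also have "\<dots> \<le> \<epsilon> * S" using \<open>\<epsilon> > 0\<close> by (simp add: S_def)
    also have "\<dots> = e / 2" using \<open>S > 0\<close> by (simp add: \<epsilon>_def)
    finally have 1: "L2dist M y g \<le> e / 2" .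
    have yL: "y \<in> L2 M" by (rule L2_bound[OF L2_const[OF M, of R] ym]) (rule AE_I2, use yR abs_ge_self[of R] order_trans in \<open>simp, blast\<close>)
    have "L2dist M y q \<le> e / 2 + e / 2"
      using L2norm_triangle_diff[OF yL gL, of q] q Q(2) 1 unfolding g_def by auto
    then show ?thesis using q(1) by auto
  qed
  then show ?thesis by (intro exI[of _ Q] conjI allI impI ballI Q(1,2))
qed

section \<open>Total boundedness of the primitives under either alternative hypothesis\<close>

context control_problem
begin

lemma setF_vel:
  assumes "\<sigma> \<in> {0..T} - Z" "u \<sigma> \<in> U \<sigma>" "X \<sigma> \<in> L2 \<mu>"
  shows "vel u X \<sigma> \<in> setF \<mu> U f \<sigma> (X \<sigma>)"
  using F_slice_L2[OF assms(3), of \<sigma> "u \<sigma>"] assms unfolding setF_def vel_def by (auto simp: F_def)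

text \<open>One net serves all trajectories at once: it is uniform in \<open>s\<close>,
  \<open>\<phi>\<close> and \<open>u\<close>, so that initial data may vary along a
  sequence.\<close>

theorem primitive_net:
  assumes alt: "measure_modulus_hyp \<mu> T U f \<or> compact_range_hyp \<mu> T U f" and "0 < e"
  shows "\<exists>Q. finite Q \<and> Q \<subseteq> L2 \<mu> \<and> (\<forall>s \<phi> u X. trajectory s \<phi> u X \<longrightarrow> u \<in> admissible_controls U 0 T \<longrightarrow>
    (\<forall>t\<in>{0..T}. \<exists>q\<in>Q. L2norm \<mu> (\<lambda>w. partial_integral N {0..t} (vel u X) w - q w) \<le> e))"
  using alt
proof
  assume "compact_range_hyp \<mu> T U f"
  then obtain K where K: "compactin (L2_topology \<mu>) K" "\<And>t \<phi>. t \<in> {0..T} \<Longrightarrow> \<phi> \<in> L2 \<mu> \<Longrightarrow> setF \<mu> U f t \<phi> \<subseteq> K"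
    unfolding compact_range_hyp_def by blast
  obtain Q where Q: "finite Q" "Q \<subseteq> L2 \<mu>" "\<And>h t. case_prod h \<in> L2 (N \<Otimes>\<^sub>M \<mu>) \<Longrightarrow> (AE \<sigma> in N. h \<sigma> \<in> K) \<Longrightarrow> t \<in> {0..T} \<Longrightarrow>
      \<exists>q\<in>Q. L2norm \<mu> (\<lambda>w. partial_integral N {0..t} h w - q w) \<le> e"
    using compact_range_primitive_net[OF finite_\<mu> T_pos K(1) \<open>0 < e\<close>] by blast
  have "\<exists>q\<in>Q. L2norm \<mu> (\<lambda>w. partial_integral N {0..t} (vel u X) w - q w) \<le> e"
    if X: "trajectory s \<phi> u X" and u: "u \<in> admissible_controls U 0 T" and t: "t \<in> {0..T}" for s \<phi> u X t
  proof (rule Q(3)[OF _ _ t])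
    note P = trajectory_primitive_curve[OF X]
    show "case_prod (vel u X) \<in> L2 (N \<Otimes>\<^sub>M \<mu>)" using P by (simp add: primitive_curve_def)
    have "AE \<sigma> in N. u \<sigma> \<in> U \<sigma>" using u by (simp add: admissible_controls_def)
    with AE_not_Z AE_space show "AE \<sigma> in N. vel u X \<sigma> \<in> K"
    proof eventually_elim
      case (elim \<sigma>)
      have "X \<sigma> \<in> L2 \<mu>" using elim(2) by (intro primitive_curve_L2[OF finite_\<mu> P]) simp
      then show ?case using setF_vel[of \<sigma> u X] K(2)[of \<sigma> "X \<sigma>"] elim by auto
    qed
  qed
  then show ?thesis by (intro exI[of _ Q] conjI allI impI ballI Q(1,2))
next
  assume mm: "measure_modulus_hyp \<mu> T U f"
  then obtain \<theta> where \<theta>: "modulus_of_continuity \<theta>" and \<theta>b: "\<And>w1 w2. (\<integral>\<^sup>+t. (SUP (u, x, y) \<in> U t \<times> UNIV \<times> UNIV. ennreal (norm (f t x u w1 - f t y u w2)))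
           \<partial>N) \<le> ennreal (\<theta> (dist w1 w2))"
    unfolding measure_modulus_hyp_def by blast
  have \<theta>0: "\<theta> 0 = 0"
  proof (rule antisym)
    show "0 \<le> \<theta> 0" using \<theta> by (simp add: modulus_of_continuity_def)
    have "\<forall>\<^sub>F r in at_right 0. \<theta> 0 \<le> \<theta> r"
      using \<theta> unfolding modulus_of_continuity_def eventually_at_right_field
      by (intro exI[of _ 1]) (auto simp: mono_on_def)
    then show "\<theta> 0 \<le> 0" using \<theta> by (intro tendsto_lowerbound[of \<theta> 0 "at_right 0"]) (auto simp: modulus_of_continuity_def)
  qed
  obtain Q where Q: "finite Q" "Q \<subseteq> L2 \<mu>" "\<And>y :: 'w \<Rightarrow> real^'n. y \<in> borel_measurable \<mu> \<Longrightarrow>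
    (\<forall>w w'. norm (y w - y w') \<le> \<theta> (dist w w')) \<Longrightarrow> (\<forall>w. norm (y w) \<le> c * T) \<Longrightarrow> (\<exists>q\<in>Q. L2dist \<mu> y q \<le> e)"
  proof -
    have th: "(\<theta> \<longlongrightarrow> 0) (at_right 0)" "mono_on {0..} \<theta>" using \<theta> by (simp_all add: modulus_of_continuity_def)
    from equicontinuous_net[where R = "c * T" and 'b = "real^'n", OF finite_\<mu> sets_\<mu> compact_UNIV th(1) \<theta>0 th(2) \<open>0 < e\<close>]
    show thesis by (elim exE conjE) (rule that, assumption, assumption, blast)
  qed
  have "\<exists>q\<in>Q. L2norm \<mu> (\<lambda>w. partial_integral N {0..t} (vel u X) w - q w) \<le> e"
    if X: "trajectory s \<phi> u X" and u: "u \<in> admissible_controls U 0 T" and t: "t \<in> {0..T}" for s \<phi> u X t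
  proof (rule Q(3))
    note P = trajectory_primitive_curve[OF X]
    have vm: "case_prod (vel u X) \<in> borel_measurable (N \<Otimes>\<^sub>M \<mu>)"
      using P L2_measurable by (auto simp: primitive_curve_def)
    have st: "{0..t} \<in> sets N" using t by (auto simp: sets_restrict_space_iff)
    show "partial_integral N {0..t} (vel u X) \<in> borel_measurable \<mu>" by (rule measurable_partial_integral[OF vm st])
    have uU: "AE \<sigma> in N. u \<sigma> \<in> U \<sigma>" using u by (simp add: admissible_controls_def)
    have um: "u \<in> borel_measurable N" by (rule trajectoryD(1)[OF X])
    \<comment> \<open>The state functions \<open>a\<close> and \<open>b\<close> are arbitrary: the
      trajectory at two parameters gives equicontinuity, the trajectory against the state 0 at one
      parameter gives the uniform bound.\<close>
    have key: "norm (\<integral>\<sigma>. indicator {0..t} \<sigma> *\<^sub>R F \<sigma> (a \<sigma>) (u \<sigma>) w1 \<partial>N - \<integral>\<sigma>. indicator {0..t} \<sigma> *\<^sub>R F \<sigma> (b \<sigma>) (u \<sigma>) w2 \<partial>N) \<le> \<theta> (dist w1 w2)"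
      if a: "integrable N (\<lambda>\<sigma>. F \<sigma> (a \<sigma>) (u \<sigma>) w1)" and b: "integrable N (\<lambda>\<sigma>. F \<sigma> (b \<sigma>) (u \<sigma>) w2)" for a b w1 w2
    proof -
      let ?d = "\<lambda>\<sigma>. indicator {0..t} \<sigma> *\<^sub>R F \<sigma> (a \<sigma>) (u \<sigma>) w1 - indicator {0..t} \<sigma> *\<^sub>R F \<sigma> (b \<sigma>) (u \<sigma>) w2"
      note i = integrable_mult_indicator[OF st a] integrable_mult_indicator[OF st b]
      have "ennreal (norm (\<integral>\<sigma>. ?d \<sigma> \<partial>N)) \<le> (\<integral>\<^sup>+\<sigma>. ennreal (norm (?d \<sigma>)) \<partial>N)"
        by (rule integral_norm_bound_ennreal[OF Bochner_Integration.integrable_diff[OF i]])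
      also have "\<dots> \<le> (\<integral>\<^sup>+\<sigma>. (SUP (u, x, y) \<in> U \<sigma> \<times> UNIV \<times> UNIV. ennreal (norm (f \<sigma> x u w1 - f \<sigma> y u w2))) \<partial>N)"
      proof (rule nn_integral_mono_AE)
        show "AE \<sigma> in N. ennreal (norm (?d \<sigma>)) \<le> (SUP (u, x, y) \<in> U \<sigma> \<times> UNIV \<times> UNIV. ennreal (norm (f \<sigma> x u w1 - f \<sigma> y u w2)))"
          using uU AE_not_Z AE_space
        proof eventually_elim
          case (elim \<sigma>)
          have "norm (?d \<sigma>) \<le> norm (f \<sigma> (a \<sigma>) (u \<sigma>) w1 - f \<sigma> (b \<sigma>) (u \<sigma>) w2)"
            using elim by (auto simp: indicator_def F_def)
          then have "ennreal (norm (?d \<sigma>)) \<le> ennreal (norm (f \<sigma> (a \<sigma>) (u \<sigma>) w1 - f \<sigma> (b \<sigma>) (u \<sigma>) w2))" by (rule ennreal_leI)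
          also have "\<dots> \<le> (SUP (u, x, y) \<in> U \<sigma> \<times> UNIV \<times> UNIV. ennreal (norm (f \<sigma> x u w1 - f \<sigma> y u w2)))"
            by (rule SUP_upper2[of "(u \<sigma>, a \<sigma>, b \<sigma>)"]) (use elim(1) in auto)
          finally show ?case .
        qed
      qed
      also have "\<dots> \<le> ennreal (\<theta> (dist w1 w2))" by (rule \<theta>b)
      finally have "norm (\<integral>\<sigma>. ?d \<sigma> \<partial>N) \<le> \<theta> (dist w1 w2)"
        using \<theta> by (subst (asm) ennreal_le_iff) (auto simp: modulus_of_continuity_def)
      then show ?thesis by (subst Bochner_Integration.integral_diff[OF i, symmetric])
    qed
    have vi: "integrable N (\<lambda>\<sigma>. F \<sigma> (X \<sigma> w) (u \<sigma>) w)" for w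
    proof (rule bounded_integrable_lebesgue_on)
      have [measurable]: "w \<in> space \<mu>" by (simp add: space_\<mu>)
      have "(\<lambda>\<sigma>. vel u X \<sigma> w) \<in> borel_measurable N" using vm by measurable
      then show "(\<lambda>\<sigma>. F \<sigma> (X \<sigma> w) (u \<sigma>) w) \<in> borel_measurable N" by (simp add: vel_def)
      show "norm (F \<sigma> (X \<sigma> w) (u \<sigma>) w) \<le> velocity_bound \<phi> w" if "\<sigma> \<in> {0..T}" for \<sigma>
        using trajectory_velocity_bound[OF X that, of w] by (simp add: vel_def)
    qed
    have zi: "integrable N (\<lambda>\<sigma>. F \<sigma> 0 (u \<sigma>) w)" for w
    proof (rule bounded_integrable_lebesgue_on)
      show "(\<lambda>\<sigma>. F \<sigma> 0 (u \<sigma>) w) \<in> borel_measurable N"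
        by (rule measurable_F[of "\<lambda>\<sigma>. \<sigma>" N "\<lambda>_. 0" u "\<lambda>_. w"]) (use um in auto)
      show "norm (F \<sigma> 0 (u \<sigma>) w) \<le> c" for \<sigma> using F_growth[of \<sigma> 0 "u \<sigma>" w] by simp
    qed
    have PI: "partial_integral N {0..t} (vel u X) w = (\<integral>\<sigma>. indicator {0..t} \<sigma> *\<^sub>R F \<sigma> (X \<sigma> w) (u \<sigma>) w \<partial>N)" for w
      by (simp add: partial_integral_def vel_def)
    show "\<forall>w w'. norm (partial_integral N {0..t} (vel u X) w - partial_integral N {0..t} (vel u X) w') \<le> \<theta> (dist w w')"
      unfolding PI by (intro allI key vi)
    \<comment> \<open>Comparison with the zero state at the same parameter, where the modulus
      vanishes. Linear growth at \<open>x = 0\<close> then gives a bound free of the initial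
      value.\<close>
    show "\<forall>w. norm (partial_integral N {0..t} (vel u X) w) \<le> c * T"
    proof
      fix w
      have "norm (partial_integral N {0..t} (vel u X) w - (\<integral>\<sigma>. indicator {0..t} \<sigma> *\<^sub>R F \<sigma> 0 (u \<sigma>) w \<partial>N)) \<le> \<theta> (dist w w)"
        unfolding PI by (rule key[OF vi zi])
      then have "partial_integral N {0..t} (vel u X) w = (\<integral>\<sigma>. indicator {0..t} \<sigma> *\<^sub>R F \<sigma> 0 (u \<sigma>) w \<partial>N)" using \<theta>0 by simp
      also have "norm \<dots> \<le> (\<integral>\<sigma>. c \<partial>N)"
      proof (rule Bochner_Integration.integral_norm_bound_integral[OF integrable_mult_indicator[OF st zi]])
        show "norm (indicator {0..t} \<sigma> *\<^sub>R F \<sigma> 0 (u \<sigma>) w) \<le> c" for \<sigma>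
          using F_growth[of \<sigma> 0 "u \<sigma>" w] c_pos by (auto simp: indicator_def)
      qed simp
      also have "\<dots> = c * T" using T_pos measure_lebesgue_on_Icc[of 0 0 T T] by (simp add: mult.commute)
      finally show "norm (partial_integral N {0..t} (vel u X) w) \<le> c * T" .
    qed
  qed
  then show ?thesis by (intro exI[of _ Q] conjI allI impI ballI Q(1,2))
qed

end

text \<open>The minimal-norm trick: midpoint convexity and the parallelogram law replace Mazur's lemma.\<close>

lemma midpoint_decreasing_convergent:
  fixes C :: "nat \<Rightarrow> ('w \<Rightarrow> 'b::euclidean_space) set"
  assumes L: "\<And>m. C m \<subseteq> L2 M" and ne: "\<And>m. C m \<noteq> {}" and dec: "\<And>m. C (Suc m) \<subseteq> C m"
    and mid: "\<And>m g h. g \<in> C m \<Longrightarrow> h \<in> C m \<Longrightarrow> (\<lambda>z. (1/2) *\<^sub>R (g z + h z)) \<in> C m"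
    and bd: "\<And>g. g \<in> C 0 \<Longrightarrow> L2norm M g \<le> B"
  shows "\<exists>g. \<exists>G\<in>L2 M. (\<forall>m. g m \<in> C m) \<and> (\<lambda>m. L2dist M (g m) G) \<longlonglongrightarrow> 0"
proof -
  have anti: "C n \<subseteq> C m" if "m \<le> n" for m n
    by (rule lift_Suc_antimono_le[of C, OF dec that])
  have bddb: "bdd_below ((\<lambda>g. (L2norm M g)\<^sup>2) ` C m)" for m by (rule bdd_belowI[of _ 0]) auto
  \<comment> \<open>Infima of the squared norms; they increase because the sets shrink and are
    bounded by \<open>B\<^sup>2\<close>, hence converge.\<close>
  define d where "d m = (INF g\<in>C m. (L2norm M g)\<^sup>2)" for m
  have lower: "d m \<le> (L2norm M g)\<^sup>2" if "g \<in> C m" for g m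
    unfolding d_def by (rule cINF_lower[OF bddb that])
  have "\<exists>g. g \<in> C m \<and> (L2norm M g)\<^sup>2 < d m + 1 / real (Suc m)" for m
  proof -
    have "(INF g\<in>C m. (L2norm M g)\<^sup>2) < d m + 1 / real (Suc m)" by (simp add: d_def)
    then show ?thesis using cINF_less_iff[OF ne bddb] by blast
  qed
  then have "\<exists>g. \<forall>m. g m \<in> C m \<and> (L2norm M (g m))\<^sup>2 < d m + 1 / real (Suc m)" by (intro choice allI)
  then obtain g where g: "\<And>m. g m \<in> C m" "\<And>m. (L2norm M (g m))\<^sup>2 < d m + 1 / real (Suc m)" by blast
  have gL: "g m \<in> L2 M" for m using g(1) L by blast
  have d_mono: "d m \<le> d n" if "m \<le> n" for m n
    unfolding d_def by (rule cINF_superset_mono[OF ne bddb anti[OF that]]) simp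
  have "d m \<le> B\<^sup>2" for m
    using lower[OF g(1), of m] bd[of "g m"] g(1)[of m] anti[of 0 m] power_mono[of "L2norm M (g m)" B 2] by auto
  moreover have "incseq d" using d_mono by (simp add: incseq_def)
  ultimately obtain L where "d \<longlonglongrightarrow> L" using incseq_convergent[of d "B\<^sup>2"] by blast
  then have "Cauchy d" by (rule LIMSEQ_imp_Cauchy)
  \<comment> \<open>For \<open>m \<le> n\<close> both elements lie in \<open>C m\<close>, and so
    does their midpoint, whose squared norm is at least \<open>d m\<close>. The parallelogram law
    turns this into a bound on the distance.\<close>
  have par: "(L2dist M (g m) (g n))\<^sup>2 \<le> 2 * (d n - d m) + 4 * (1 / real (Suc m))" if "m \<le> n" for m n
  proof -
    have "(\<lambda>z. (1/2) *\<^sub>R (g m z + g n z)) \<in> C m" using g(1)[of n] anti[OF that] by (intro mid g(1)) blast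
    then have "d m \<le> (L2norm M (\<lambda>z. (1/2) *\<^sub>R (g m z + g n z)))\<^sup>2" by (rule lower)
    then have 1: "4 * d m \<le> (L2norm M (\<lambda>z. g m z + g n z))\<^sup>2" by (simp add: L2norm_scaleR power_divide)
    have "1 / real (Suc n) \<le> 1 / real (Suc m)" using that by (simp add: frac_le)
    then show ?thesis
      using L2norm_add_power2[OF gL[of m] gL[of n], of 1] L2norm_add_power2[OF gL[of m] gL[of n], of "-1"] 1 g(2)[of m] g(2)[of n]
      by simp
  qed
  have "\<exists>N. \<forall>m\<ge>N. \<forall>n\<ge>N. L2dist M (g m) (g n) < e" if "e > 0" for e
  proof -
    have e2: "0 < e\<^sup>2 / 8" using that by simp
    obtain N1 where N1: "\<And>m n. m \<ge> N1 \<Longrightarrow> n \<ge> N1 \<Longrightarrow> \<bar>d m - d n\<bar> < e\<^sup>2 / 8"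
      using \<open>Cauchy d\<close> e2 unfolding Cauchy_def dist_real_def by meson
    obtain N2 where N2: "inverse (real (Suc N2)) < e\<^sup>2 / 8" using reals_Archimedean[OF e2] by blast
    have lt: "L2dist M (g m) (g n) < e" if mn: "max N1 N2 \<le> m" "m \<le> n" for m n
    proof -
      have "1 / real (Suc m) \<le> inverse (real (Suc N2))" using mn by (simp add: inverse_eq_divide frac_le)
      then have 1: "1 / real (Suc m) < e\<^sup>2 / 8" using N2 by (rule le_less_trans)
      have 2: "d n - d m < e\<^sup>2 / 8"
        using mn by (intro order.strict_trans1[OF abs_ge_self N1]) auto
      note par[OF mn(2)]
      also have "2 * (d n - d m) + 4 * (1 / real (Suc m)) < 2 * (e\<^sup>2 / 8) + 4 * (e\<^sup>2 / 8)"
        by (rule add_strict_mono[OF mult_strict_left_mono[OF 2] mult_strict_left_mono[OF 1]]) simp_all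
      also have "\<dots> \<le> e\<^sup>2" by simp
      finally have "(L2dist M (g m) (g n))\<^sup>2 < e\<^sup>2" .
      then show ?thesis using \<open>e > 0\<close> by (simp add: power_less_imp_less_base)
    qed
    show ?thesis
    proof (intro exI[of _ "max N1 N2"] allI impI)
      fix m n assume "max N1 N2 \<le> m" "max N1 N2 \<le> n"
      then show "L2dist M (g m) (g n) < e"
        using lt[of m n] lt[of n m] L2norm_minus_commute[of M "g m" "g n"] by (cases "m \<le> n") auto
    qed
  qed
  from L2_complete[of g, OF gL this] g(1) show ?thesis by blast
qed

lemma L2_uniformly_convergent:
  fixes X :: "nat \<Rightarrow> 'i \<Rightarrow> 'w \<Rightarrow> 'b::euclidean_space"
  assumes X: "\<And>n t. t \<in> I \<Longrightarrow> X n t \<in> L2 M"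
    and C: "\<And>e. e > 0 \<Longrightarrow> \<exists>K. \<forall>m\<ge>K. \<forall>n\<ge>K. \<forall>t\<in>I. L2dist M (X m t) (X n t) < e"
  shows "\<exists>x. (\<forall>t\<in>I. x t \<in> L2 M) \<and> (\<forall>e>0. \<exists>K. \<forall>n\<ge>K. \<forall>t\<in>I. L2dist M (X n t) (x t) \<le> e)"
proof -
  have "\<forall>t\<in>I. \<exists>G. G \<in> L2 M \<and> (\<lambda>n. L2dist M (X n t) G) \<longlonglongrightarrow> 0"
  proof
    fix t assume t: "t \<in> I"
    have "\<exists>K. \<forall>m\<ge>K. \<forall>n\<ge>K. L2dist M (X m t) (X n t) < e" if "e > 0" for e
      using C[OF that] t by meson
    from L2_complete[of "\<lambda>n. X n t", OF X[OF t] this] show "\<exists>G. G \<in> L2 M \<and> (\<lambda>n. L2dist M (X n t) G) \<longlonglongrightarrow> 0" by blast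
  qed
  from bchoice[OF this] obtain x where x0: "\<forall>t\<in>I. x t \<in> L2 M \<and> (\<lambda>n. L2dist M (X n t) (x t)) \<longlonglongrightarrow> 0"
    by (rule exE)
  then have x: "\<And>t. t \<in> I \<Longrightarrow> x t \<in> L2 M" "\<And>t. t \<in> I \<Longrightarrow> (\<lambda>n. L2dist M (X n t) (x t)) \<longlonglongrightarrow> 0"
    by simp_all
  have "\<exists>K. \<forall>n\<ge>K. \<forall>t\<in>I. L2dist M (X n t) (x t) \<le> e" if e: "e > 0" for e
  proof -
    obtain K where K: "\<And>m n t. m \<ge> K \<Longrightarrow> n \<ge> K \<Longrightarrow> t \<in> I \<Longrightarrow> L2dist M (X m t) (X n t) < e" using C[OF e] by meson
    have "L2dist M (X n t) (x t) \<le> e" if n: "n \<ge> K" and t: "t \<in> I" for n t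
    proof (rule LIMSEQ_le_const)
      show "(\<lambda>m. e + L2dist M (X m t) (x t)) \<longlonglongrightarrow> e" using tendsto_add[OF tendsto_const x(2)[OF t], of e] by simp
      show "\<exists>N. \<forall>m\<ge>N. L2dist M (X n t) (x t) \<le> e + L2dist M (X m t) (x t)"
      proof (intro exI[of _ K] allI impI)
        fix m assume "m \<ge> K"
        then show "L2dist M (X n t) (x t) \<le> e + L2dist M (X m t) (x t)"
          using L2norm_triangle_diff[OF X[OF t, of n] X[OF t, of m] x(1)[OF t]] K[OF n _ t, of m] by linarith
      qed
    qed
    then show ?thesis by blast
  qed
  then show ?thesis using x(1) by blast
qed

section \<open>Closure of the differential inclusion under uniform limits\<close>

context control_problem
begin

lemma setF_cong:
  assumes "AE w in \<mu>. \<psi> w = \<psi>' w" shows "setF \<mu> U f t \<psi> = setF \<mu> U f t \<psi>'"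
proof -
  have "setF \<mu> U f t \<psi> \<subseteq> setF \<mu> U f t \<psi>'" if AE: "AE w in \<mu>. \<psi> w = \<psi>' w" for \<psi> \<psi>'
  proof
    fix \<zeta> assume "\<zeta> \<in> setF \<mu> U f t \<psi>"
    then obtain u where u: "\<zeta> \<in> L2 \<mu>" "u \<in> U t" "AE w in \<mu>. \<zeta> w = f t (\<psi> w) u w" unfolding setF_def by blast
    have "AE w in \<mu>. \<zeta> w = f t (\<psi>' w) u w" using u(3) AE by eventually_elim simp
    then show "\<zeta> \<in> setF \<mu> U f t \<psi>'" using u(1,2) unfolding setF_def by blast
  qed
  from this[OF assms] this[of \<psi>' \<psi>] assms show ?thesis by (auto simp: eq_commute)
qed

text \<open>Controls realizing the \<open>g j\<close> have a convergent subsequence in the compact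
  set \<open>U t\<close>. By dominated convergence the corresponding velocities converge in L2 to
  the velocity of the limit control, which must agree with \<open>G\<close> up to a null
  set.\<close>

lemma setF_closed:
  assumes t: "t \<in> {0..T} - Z" and \<psi>: "\<psi> \<in> L2 \<mu>" and g: "\<And>j. g j \<in> setF \<mu> U f t \<psi>" and G: "G \<in> L2 \<mu>"
    and lim: "(\<lambda>j. L2dist \<mu> (g j) G) \<longlonglongrightarrow> 0"
  shows "G \<in> setF \<mu> U f t \<psi>"
proof -
  have Ff: "F t x v w = f t x v w" for x v w using t by (simp add: F_def)
  have gL: "g j \<in> L2 \<mu>" for j using g[of j] by (simp add: setF_def)
  have "\<forall>j. \<exists>u. u \<in> U t \<and> (AE w in \<mu>. g j w = F t (\<psi> w) u w)"
    using g unfolding setF_def Ff by blast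
  from choice[OF this] obtain u where u: "\<And>j. u j \<in> U t" "\<And>j. AE w in \<mu>. g j w = F t (\<psi> w) (u j) w" by blast
  have "compact (U t)" using U_hyp t by (simp add: control_map_hyp_def)
  then obtain p r where p: "p \<in> U t" "strict_mono (r :: nat \<Rightarrow> nat)" "(u \<circ> r) \<longlonglongrightarrow> p"
    using u(1) unfolding compact_def by meson
  have pL: "(\<lambda>w. F t (\<psi> w) v w) \<in> L2 \<mu>" for v by (rule F_slice_L2[OF \<psi>])
  have "AE w in \<mu>. G w = F t (\<psi> w) p w"
  proof (rule L2_limit_unique[OF gL[of "r _"] G pL[of p] LIMSEQ_subseq_LIMSEQ[OF lim p(2), unfolded comp_def]])
    have "L2norm \<mu> (\<lambda>w. g (r n) w - F t (\<psi> w) p w) = L2norm \<mu> (\<lambda>w. F t (\<psi> w) (u (r n)) w - F t (\<psi> w) p w)" for n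
    proof (rule L2norm_cong_AE)
      show "AE w in \<mu>. norm (g (r n) w - F t (\<psi> w) p w) = norm (F t (\<psi> w) (u (r n)) w - F t (\<psi> w) p w)"
        using u(2)[of "r n"] by eventually_elim simp
    qed (intro L2_measurable L2_diff gL pL)+
    then show "(\<lambda>n. L2norm \<mu> (\<lambda>w. g (r n) w - F t (\<psi> w) p w)) \<longlonglongrightarrow> 0"
      using F_control_tendsto[OF \<psi> p(3)[unfolded comp_def], of t] by simp
  qed
  then show ?thesis using G p(1) unfolding setF_def Ff by blast
qed

definition slice_bound :: "('w \<Rightarrow> real^'n) \<Rightarrow> real" where
  "slice_bound \<psi> = c * (L2norm \<mu> (\<lambda>w. 1 :: real) + L2norm \<mu> \<psi>)"

lemma F_slice_norm_le:
  assumes "\<psi> \<in> L2 \<mu>" shows "L2norm \<mu> (\<lambda>w. F t (\<psi> w) v w) \<le> slice_bound \<psi>"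
proof -
  have 1: "(\<lambda>w. 1 + norm (\<psi> w)) \<in> L2 \<mu>" by (rule L2_add[OF L2_const[OF finite_\<mu>] L2_norm_real[OF assms]])
  have "L2norm \<mu> (\<lambda>w. F t (\<psi> w) v w) \<le> L2norm \<mu> (\<lambda>w. c *\<^sub>R (1 + norm (\<psi> w)))"
    using F_growth c_pos by (intro L2norm_mono[OF L2_scaleR[OF 1] L2_measurable[OF F_slice_L2[OF assms]]]) (auto simp: abs_mult)
  also have "\<dots> = c * L2norm \<mu> (\<lambda>w. 1 + norm (\<psi> w))" using c_pos by (simp only: L2norm_scaleR)
  also have "\<dots> \<le> slice_bound \<psi>"
    using L2norm_triangle[OF L2_const[OF finite_\<mu>, of "1::real"] L2_norm_real[OF assms]] c_pos
    unfolding slice_bound_def L2norm_norm by (simp add: mult_left_mono)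
  finally show ?thesis .
qed

lemma setF_norm_le:
  assumes t: "t \<in> {0..T} - Z" and \<psi>: "\<psi> \<in> L2 \<mu>" and g: "g \<in> setF \<mu> U f t \<psi>"
  shows "L2norm \<mu> g \<le> slice_bound \<psi>"
proof -
  obtain v where v: "g \<in> L2 \<mu>" "AE w in \<mu>. g w = f t (\<psi> w) v w" using g unfolding setF_def by blast
  have "L2norm \<mu> g = L2norm \<mu> (\<lambda>w. F t (\<psi> w) v w)"
    by (rule L2norm_cong_AE[OF L2_measurable[OF v(1)] L2_measurable[OF F_slice_L2[OF \<psi>]]])
      (use v(2) t in \<open>auto simp: F_def elim: eventually_mono\<close>)
  then show ?thesis using F_slice_norm_le[OF \<psi>, of t v] by simp
qed

lemma primitive_curve_inclusion:
  assumes s: "s \<in> {0..T}" and P: "primitive_curve T \<mu> h B x" and h: "AE \<sigma> in N. h \<sigma> \<in> setF \<mu> U f \<sigma> (x \<sigma>)"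
    and x: "AE w in \<mu>. x s w = \<phi> w"
  shows "x \<in> inclusion_solutions \<mu> U f s T \<phi>"
proof -
  have s0: "0 \<le> s" "s \<le> T" using s by auto
  have "AE \<sigma> in lebesgue_on {s..T}. h \<sigma> \<in> setF \<mu> U f \<sigma> (x \<sigma>)"
    using h s0 by (subst (asm) AE_restrict_space_iff, simp, subst AE_restrict_space_iff) (auto elim!: eventually_mono)
  then have "AE t in lebesgue_on {s..T}. \<exists>\<psi>\<in>setF \<mu> U f t (x t). has_L2_derivative \<mu> x \<psi> t {s..T}"
    using primitive_curve_derivative[OF finite_\<mu> P s0(1) order_refl] by eventually_elim blast
  then show ?thesis
    using primitive_curve_continuous[OF finite_\<mu> P s0(1) order_refl] primitive_curve_absolutely_continuous[OF finite_\<mu> P s0(1) order_refl] x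
    unfolding inclusion_solutions_def by simp
qed

text \<open>The starting time \<open>t\<close> is arbitrary and may precede \<open>s\<close>: a
  trajectory prescribed at \<open>T\<close> is thus a solution of the inclusion from every earlier
  time.\<close>

lemma trajectory_inclusion:
  assumes X: "trajectory s \<phi> u X" and u: "u \<in> admissible_controls U 0 T" and t: "t \<in> {0..T}"
  shows "X \<in> inclusion_solutions \<mu> U f t T (X t)"
proof (rule primitive_curve_inclusion[OF t trajectory_primitive_curve[OF X]])
  have "AE \<sigma> in N. u \<sigma> \<in> U \<sigma>" using u by (simp add: admissible_controls_def)
  with AE_not_Z AE_space show "AE \<sigma> in N. vel u X \<sigma> \<in> setF \<mu> U f \<sigma> (X \<sigma>)"
  proof eventually_elim
    case (elim \<sigma>)
    then show ?case using primitive_curve_L2[OF finite_\<mu> trajectory_primitive_curve[OF X], of \<sigma>] by (intro setF_vel) auto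
  qed
qed simp

text \<open>Inserting the controls \<open>u n\<close> into the limit curve gives velocity fields
  with values in sets that do not depend on \<open>n\<close>. They reproduce the increments of
  \<open>x\<close> with a small error. Nearly minimal-norm elements among such fields converge
  strongly, and closedness of the sets at almost every time makes the limit an admissible velocity
  of \<open>x\<close>.\<close>

theorem trajectories_limit_primitive_curve:
  assumes conv: "convexity_hyp \<mu> T U f"
    and X: "\<And>n. trajectory (s n) (\<phi> n) (u n) (X n)" and u: "\<And>n. u n \<in> admissible_controls U 0 T"
    and B: "\<And>n. L2norm \<mu> (velocity_bound (\<phi> n)) \<le> B" and xL: "\<And>t. t \<in> {0..T} \<Longrightarrow> x t \<in> L2 \<mu>"
    and unif: "\<And>e. 0 < e \<Longrightarrow> \<exists>n::nat. \<forall>t\<in>{0..T}. L2dist \<mu> (X n t) (x t) \<le> e"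
  shows "\<exists>h. primitive_curve T \<mu> h B x \<and> (AE \<sigma> in N. h \<sigma> \<in> setF \<mu> U f \<sigma> (x \<sigma>))"
proof -
  note P = trajectory_primitive_curve[OF X]
  note XL = primitive_curve_L2[OF finite_\<mu> P]
  have "0 \<le> B" using B[of 0] L2norm_nonneg[of \<mu> "velocity_bound (\<phi> 0)"] by linarith
  have lip: "L2dist \<mu> (x t) (x r) \<le> B * \<bar>t - r\<bar>" if t: "t \<in> {0..T}" and r: "r \<in> {0..T}" for t r
  proof (rule field_le_epsilon)
    fix e :: real assume "0 < e"
    then obtain n where n: "\<forall>t\<in>{0..T}. L2dist \<mu> (X n t) (x t) \<le> e / 2" using unif[of "e / 2"] by auto
    have "L2dist \<mu> (X n t) (X n r) \<le> B * \<bar>t - r\<bar>"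
      using primitive_curve_Lipschitz[OF finite_\<mu> P t r, of n] mult_right_mono[OF B, of "\<bar>t - r\<bar>" n] by simp
    moreover have "L2dist \<mu> (x t) (X n t) \<le> e / 2" using n t L2norm_minus_commute[of \<mu> "x t" "X n t"] by simp
    moreover have "L2dist \<mu> (X n r) (x r) \<le> e / 2" using n r by simp
    ultimately show "L2dist \<mu> (x t) (x r) \<le> B * \<bar>t - r\<bar> + e"
      using L2norm_triangle_diff[OF xL[OF t] XL[OF t, of n] xL[OF r]] L2norm_triangle_diff[OF XL[OF t, of n] XL[OF r, of n] xL[OF r]]
      by linarith
  qed
  have "continuous_L2_curve \<mu> 0 T x"
    unfolding continuous_L2_curve_iff
  proof (intro conjI ballI allI impI xL)
    fix \<sigma> e :: real assume \<sigma>: "\<sigma> \<in> {0..T}" and "0 < e"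
    show "\<exists>d>0. \<forall>r\<in>{0..T}. \<bar>r - \<sigma>\<bar> < d \<longrightarrow> L2dist \<mu> (x r) (x \<sigma>) < e"
    proof (intro exI[of _ "e / (B + 1)"] conjI ballI impI)
      show "0 < e / (B + 1)" using \<open>0 < e\<close> \<open>0 \<le> B\<close> by simp
      fix r assume r: "r \<in> {0..T}" and d: "\<bar>r - \<sigma>\<bar> < e / (B + 1)"
      have "B * \<bar>r - \<sigma>\<bar> \<le> (B + 1) * \<bar>r - \<sigma>\<bar>" by (simp add: mult_right_mono)
      also have "\<dots> < e" using d \<open>0 \<le> B\<close> by (simp add: pos_less_divide_eq mult.commute)
      finally show "L2dist \<mu> (x r) (x \<sigma>) < e" using lip[OF r \<sigma>] by linarith
    qed
  qed
  \<comment> \<open>The limit \<open>x\<close> is determined only slice by slice; a jointly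
    measurable version is what makes \<open>vel (u n) Y\<close> an element of L2 of the
    product.\<close>
  from continuous_L2_curve_version[OF this] obtain Y where Y: "case_prod Y \<in> borel_measurable (N \<Otimes>\<^sub>M \<mu>)"
    "\<forall>\<sigma>\<in>{0..T}. AE w in \<mu>. Y \<sigma> w = x \<sigma> w" by blast
  have YL: "Y \<sigma> \<in> L2 \<mu>" if \<sigma>: "\<sigma> \<in> {0..T}" for \<sigma>
  proof (rule L2_bound[OF xL[OF \<sigma>]])
    have [measurable]: "\<sigma> \<in> space N" using \<sigma> by simp
    show "Y \<sigma> \<in> borel_measurable \<mu>" using Y(1) by measurable
    show "AE w in \<mu>. norm (Y \<sigma> w) \<le> norm (x \<sigma> w)" using Y(2) \<sigma> by (auto elim!: ballE eventually_mono)
  qed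
  have XY: "L2dist \<mu> (X n \<sigma>) (Y \<sigma>) = L2dist \<mu> (X n \<sigma>) (x \<sigma>)" if \<sigma>: "\<sigma> \<in> {0..T}" for n \<sigma>
    using Y(2) \<sigma> by (intro L2norm_cong_AE L2_measurable[OF L2_diff] XL[OF \<sigma>] YL[OF \<sigma>] xL[OF \<sigma>]) (auto elim!: ballE eventually_mono)
  \<comment> \<open>A bound for all velocities along \<open>Y\<close>: linear growth, together with
    the fact that \<open>x\<close> moves by at most \<open>B * T\<close> from its value at
    0.\<close>
  define D where "D = slice_bound (x 0) + c * (B * T)"
  have D: "slice_bound (Y \<sigma>) \<le> D" if \<sigma>: "\<sigma> \<in> {0..T}" for \<sigma>
  proof -
    have z: "0 \<in> {0..T}" using T_pos by simp
    have "L2norm \<mu> (Y \<sigma>) = L2norm \<mu> (x \<sigma>)"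
      using Y(2) \<sigma> by (intro L2norm_cong_AE L2_measurable YL xL) (auto elim!: ballE eventually_mono)
    also have "\<dots> \<le> L2norm \<mu> (x 0) + B * \<bar>\<sigma> - 0\<bar>"
      using L2norm_triangle_reverse[OF xL[OF \<sigma>] xL[OF z]] lip[OF \<sigma> z] by linarith
    also have "\<dots> \<le> L2norm \<mu> (x 0) + B * T" using \<sigma> \<open>0 \<le> B\<close> by (simp add: mult_left_mono)
    finally have "c * L2norm \<mu> (Y \<sigma>) \<le> c * (L2norm \<mu> (x 0) + B * T)" using c_pos by (intro mult_left_mono) auto
    then show ?thesis by (simp add: D_def slice_bound_def distrib_left)
  qed
  have "0 \<le> slice_bound (x 0)" unfolding slice_bound_def using c_pos by (intro mult_nonneg_nonneg add_nonneg_nonneg) auto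
  then have "0 \<le> D" unfolding D_def using c_pos T_pos \<open>0 \<le> B\<close> by simp
  have hL: "case_prod (vel (u n) Y) \<in> L2 (N \<Otimes>\<^sub>M \<mu>)" for n
  proof (rule product_L2_bounded_slices[OF vel_measurable[OF trajectoryD(1)[OF X] Y(1)]])
    fix \<sigma> assume "\<sigma> \<in> space N"
    then have \<sigma>: "\<sigma> \<in> {0..T}" by simp
    show "vel (u n) Y \<sigma> \<in> L2 \<mu> \<and> L2norm \<mu> (vel (u n) Y \<sigma>) \<le> D"
      using F_slice_L2[OF YL[OF \<sigma>], of \<sigma> "u n \<sigma>"] F_slice_norm_le[OF YL[OF \<sigma>], of \<sigma> "u n \<sigma>"] D[OF \<sigma>]
      unfolding vel_def by auto
  qed
  let ?PI = "\<lambda>r t g. partial_integral N {r..t} (\<lambda>\<sigma> w. g (\<sigma>, w))"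
  define defect where "defect r t g = L2norm \<mu> (\<lambda>w. x t w - x r w - ?PI r t g w)" for r t g
  \<comment> \<open>Admissible velocity fields along the limit curve that reproduce all increments
    of \<open>x\<close> up to \<open>(1/2)^m\<close>. This condition stands in for weak convergence:
    it is stable under midpoints and passes to norm limits.\<close>
  define C where "C m = {g \<in> L2 (N \<Otimes>\<^sub>M \<mu>). (AE \<sigma> in N. (\<lambda>w. g (\<sigma>, w)) \<in> setF \<mu> U f \<sigma> (Y \<sigma>)) \<and>
     (\<forall>r t. 0 \<le> r \<longrightarrow> r \<le> t \<longrightarrow> t \<le> T \<longrightarrow> defect r t g \<le> (1/2)^m)}" for m :: nat
  \<comment> \<open>Origin of \<open>2 + T * k\<close>: replacing \<open>X n\<close> by
    \<open>x\<close> at the two end points costs \<open>e\<close> each, replacing it inside the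
    vector field costs \<open>k * e\<close> over a time at most \<open>T\<close>.\<close>
  have CI: "case_prod (vel (u n) Y) \<in> C m" if n: "\<forall>t\<in>{0..T}. L2dist \<mu> (X n t) (x t) \<le> e" and e: "0 \<le> e" "(2 + T * k) * e \<le> (1/2)^m" for n m e
  proof -
    have "AE \<sigma> in N. u n \<sigma> \<in> U \<sigma>" using u by (simp add: admissible_controls_def)
    with AE_not_Z AE_space have 1: "AE \<sigma> in N. vel (u n) Y \<sigma> \<in> setF \<mu> U f \<sigma> (Y \<sigma>)"
    proof eventually_elim
      case (elim \<sigma>)
      then show ?case using YL[of \<sigma>] by (intro setF_vel) auto
    qed
    have 2: "defect r t (case_prod (vel (u n) Y)) \<le> (1/2)^m" if rt: "0 \<le> r" "r \<le> t" "t \<le> T" for r t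
    proof -
      have t: "t \<in> {0..T}" and r: "r \<in> {0..T}" using rt by auto
      have st: "{r..t} \<in> sets N" using rt by (auto simp: sets_restrict_space_iff)
      let ?v = "\<lambda>\<sigma> w. vel (u n) (X n) \<sigma> w - vel (u n) Y \<sigma> w"
      have vL: "case_prod (vel (u n) (X n)) \<in> L2 (N \<Otimes>\<^sub>M \<mu>)" using P[of n] by (simp add: primitive_curve_def)
      have dL: "case_prod ?v \<in> L2 (N \<Otimes>\<^sub>M \<mu>)" using L2_diff[OF vL hL[of n]] by (simp add: case_prod_unfold)
      have "L2norm \<mu> (partial_integral N {r..t} ?v) \<le> measure N {r..t} * (k * e)"
      proof (rule partial_integral_norm_le_bound[OF dL st])
        show "AE \<sigma> in N. \<sigma> \<in> {r..t} \<longrightarrow> L2norm \<mu> (?v \<sigma>) \<le> k * e"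
          using AE_space
        proof eventually_elim
          case (elim \<sigma>)
          then have \<sigma>: "\<sigma> \<in> {0..T}" by simp
          have "L2norm \<mu> (?v \<sigma>) \<le> L2norm \<mu> (\<lambda>w. k *\<^sub>R (X n \<sigma> w - Y \<sigma> w))"
            unfolding vel_def using F_lipschitz k_pos
            by (intro L2norm_mono L2_scaleR L2_diff L2_measurable[OF L2_diff] F_slice_L2 XL[OF \<sigma>] YL[OF \<sigma>]) auto
          also have "\<dots> \<le> k * e" using XY[OF \<sigma>, of n] n \<sigma> k_pos by (simp add: L2norm_scaleR)
          finally show ?case by simp
        qed
      qed (use k_pos e in simp)
      also have "\<dots> \<le> T * (k * e)" using measure_lebesgue_on_Icc[OF rt] rt k_pos e by (intro mult_right_mono) auto
      finally have b: "L2norm \<mu> (partial_integral N {r..t} ?v) \<le> T * (k * e)" .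
      let ?a = "\<lambda>w. x t w - X n t w" and ?b = "\<lambda>w. X n r w - x r w"
      have aL: "?a \<in> L2 \<mu>" "?b \<in> L2 \<mu>" by (intro L2_diff xL XL t r)+
      have pL: "partial_integral N {r..t} ?v \<in> L2 \<mu>" by (rule partial_integral_L2(1)[OF dL st])
      have "defect r t (case_prod (vel (u n) Y)) = L2norm \<mu> (\<lambda>w. (?a w + ?b w) + partial_integral N {r..t} ?v w)"
        unfolding defect_def
      proof (rule L2norm_cong_AE)
        have "AE w in \<mu>. partial_integral N {r..t} ?v w = partial_integral N {r..t} (vel (u n) (X n)) w - partial_integral N {r..t} (vel (u n) Y) w"
          by (rule partial_integral_diff[OF vL hL st])
        then show "AE w in \<mu>. norm (x t w - x r w - ?PI r t (case_prod (vel (u n) Y)) w) = norm ((?a w + ?b w) + partial_integral N {r..t} ?v w)"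
        proof eventually_elim
          case (elim w)
          show ?case by (simp only: elim trajectory_increment[OF X rt, of n w] prod.case) (simp add: algebra_simps)
        qed
        show "(\<lambda>w. x t w - x r w - ?PI r t (case_prod (vel (u n) Y)) w) \<in> borel_measurable \<mu>"
          using partial_integral_L2(1)[OF hL st, of n] by (intro L2_measurable L2_diff xL t r) simp
        show "(\<lambda>w. (?a w + ?b w) + partial_integral N {r..t} ?v w) \<in> borel_measurable \<mu>"
          by (intro L2_measurable L2_add aL pL)
      qed
      also have "\<dots> \<le> L2norm \<mu> ?a + L2norm \<mu> ?b + L2norm \<mu> (partial_integral N {r..t} ?v)"
        using L2norm_triangle[OF L2_add[OF aL] pL] L2norm_triangle[OF aL] by linarith
      also have "\<dots> \<le> e + e + T * (k * e)"
        using n t r b L2norm_minus_commute[of \<mu> "x t" "X n t"] by (intro add_mono) auto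
      also have "\<dots> \<le> (1/2)^m" using e(2) by (simp add: algebra_simps)
      finally show ?thesis .
    qed
    show ?thesis unfolding C_def using hL[of n] 1 2 by simp
  qed
  have pos: "0 < 2 + T * k" using T_pos k_pos by (simp add: add_pos_pos)
  have CL: "C m \<subseteq> L2 (N \<Otimes>\<^sub>M \<mu>)" for m by (auto simp: C_def)
  have "\<exists>g. \<exists>G\<in>L2 (N \<Otimes>\<^sub>M \<mu>). (\<forall>m. g m \<in> C m) \<and> (\<lambda>m. L2dist (N \<Otimes>\<^sub>M \<mu>) (g m) G) \<longlonglongrightarrow> 0"
  proof (rule midpoint_decreasing_convergent[OF CL])
    fix m
    have "0 < (1/2)^m / (2 + T * k)" using pos by simp
    from unif[OF this] obtain n where "\<forall>t\<in>{0..T}. L2dist \<mu> (X n t) (x t) \<le> (1/2)^m / (2 + T * k)" by (rule exE)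
    from CI[OF this] show "C m \<noteq> {}" using pos by force
    have "(1/2::real) ^ Suc m \<le> (1/2)^m" by simp
    then show "C (Suc m) \<subseteq> C m" unfolding C_def using order_trans by blast
    fix g h assume g: "g \<in> C m" and h: "h \<in> C m"
    have gL: "g \<in> L2 (N \<Otimes>\<^sub>M \<mu>)" "h \<in> L2 (N \<Otimes>\<^sub>M \<mu>)" using g h by (simp_all add: C_def)
    have gL': "case_prod (\<lambda>\<sigma> w. g (\<sigma>, w)) \<in> L2 (N \<Otimes>\<^sub>M \<mu>)" "case_prod (\<lambda>\<sigma> w. h (\<sigma>, w)) \<in> L2 (N \<Otimes>\<^sub>M \<mu>)"
      using gL by (simp_all add: case_prod_unfold)
    have "AE \<sigma> in N. (\<lambda>w. g (\<sigma>, w)) \<in> setF \<mu> U f \<sigma> (Y \<sigma>)" "AE \<sigma> in N. (\<lambda>w. h (\<sigma>, w)) \<in> setF \<mu> U f \<sigma> (Y \<sigma>)"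
      using g h by (simp_all add: C_def)
    with AE_space have 1: "AE \<sigma> in N. (\<lambda>w. (1/2) *\<^sub>R (g (\<sigma>, w) + h (\<sigma>, w))) \<in> setF \<mu> U f \<sigma> (Y \<sigma>)"
    proof eventually_elim
      case (elim \<sigma>)
      have \<sigma>: "\<sigma> \<in> {0..T}" using elim(1) by simp
      have half: "1/2 \<in> {0..1::real}" by simp
      from conv[unfolded convexity_hyp_def, rule_format, OF \<sigma> YL[OF \<sigma>] elim(2,3) half] show ?case by (simp add: scaleR_add_right)
    qed
    have 2: "defect r t (\<lambda>z. (1/2) *\<^sub>R (g z + h z)) \<le> (1/2)^m" if rt: "0 \<le> r" "r \<le> t" "t \<le> T" for r t
    proof -
      have t: "t \<in> {0..T}" and r: "r \<in> {0..T}" using rt by auto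
      have st: "{r..t} \<in> sets N" using rt by (auto simp: sets_restrict_space_iff)
      let ?a = "\<lambda>w. (1/2) *\<^sub>R (x t w - x r w - ?PI r t g w)" and ?b = "\<lambda>w. (1/2) *\<^sub>R (x t w - x r w - ?PI r t h w)"
      have gh: "(\<lambda>z. (1/2) *\<^sub>R (g z + h z)) \<in> L2 (N \<Otimes>\<^sub>M \<mu>)" by (intro L2_scaleR L2_add gL)
      have ghL: "case_prod (\<lambda>\<sigma> w. (1/2) *\<^sub>R (g (\<sigma>, w) + h (\<sigma>, w))) \<in> L2 (N \<Otimes>\<^sub>M \<mu>)" using gh by (simp add: case_prod_unfold)
      have aL: "?a \<in> L2 \<mu>" "?b \<in> L2 \<mu>"
        by (intro L2_scaleR L2_diff xL t r partial_integral_L2(1)[OF gL'(1) st] partial_integral_L2(1)[OF gL'(2) st])+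
      have "defect r t (\<lambda>z. (1/2) *\<^sub>R (g z + h z)) = L2norm \<mu> (\<lambda>w. ?a w + ?b w)"
        unfolding defect_def
      proof (rule L2norm_cong_AE)
        show "AE w in \<mu>. norm (x t w - x r w - ?PI r t (\<lambda>z. (1/2) *\<^sub>R (g z + h z)) w) = norm (?a w + ?b w)"
          using partial_integral_add[OF gL' st]
        proof eventually_elim
          case (elim w)
          have "?PI r t (\<lambda>z. (1/2) *\<^sub>R (g z + h z)) w = (1/2) *\<^sub>R (?PI r t g w + ?PI r t h w)"
            unfolding partial_integral_scaleR elim ..
          moreover have "v - (1/2) *\<^sub>R (p + q) = (1/2) *\<^sub>R (v - p) + (1/2) *\<^sub>R (v - q)" for v p q :: "real^'n"
            by (simp add: scaleR_add_right scaleR_diff_right)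
          ultimately show ?case by simp
        qed
        show "(\<lambda>w. x t w - x r w - ?PI r t (\<lambda>z. (1/2) *\<^sub>R (g z + h z)) w) \<in> borel_measurable \<mu>"
          using partial_integral_L2(1)[OF ghL st] by (intro L2_measurable L2_diff xL t r) simp
        show "(\<lambda>w. ?a w + ?b w) \<in> borel_measurable \<mu>" by (intro L2_measurable L2_add aL)
      qed
      also have "\<dots> \<le> (1/2) * defect r t g + (1/2) * defect r t h"
        using L2norm_triangle[OF aL] unfolding L2norm_scaleR defect_def by simp
      also have "\<dots> \<le> (1/2)^m"
      proof -
        have "defect r t g \<le> (1/2)^m" "defect r t h \<le> (1/2)^m" using g h rt by (simp_all add: C_def)
        then show ?thesis by simp
      qed
      finally show ?thesis .
    qed
    show "(\<lambda>z. (1/2) *\<^sub>R (g z + h z)) \<in> C m"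
      unfolding C_def using L2_scaleR[OF L2_add[OF gL], of "1/2"] 1 2 by simp
  next
    fix g assume g: "g \<in> C 0"
    have gL: "case_prod (\<lambda>\<sigma> w. g (\<sigma>, w)) \<in> L2 (N \<Otimes>\<^sub>M \<mu>)" using g by (simp add: C_def case_prod_unfold)
    have "L2norm (N \<Otimes>\<^sub>M \<mu>) g = L2norm N (\<lambda>\<sigma>. L2norm \<mu> (\<lambda>w. g (\<sigma>, w)))"
      using slice_norm_L2(2)[OF gL] by (simp add: case_prod_unfold)
    also have "\<dots> \<le> L2norm N (\<lambda>\<sigma>. D)"
    proof (rule L2norm_mono[OF L2_const L2_measurable[OF slice_norm_L2(1)[OF gL]]])
      have "AE \<sigma> in N. (\<lambda>w. g (\<sigma>, w)) \<in> setF \<mu> U f \<sigma> (Y \<sigma>)" using g by (simp add: C_def)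
      with AE_space AE_not_Z show "AE \<sigma> in N. norm (L2norm \<mu> (\<lambda>w. g (\<sigma>, w))) \<le> norm D"
      proof eventually_elim
        case (elim \<sigma>)
        then have \<sigma>: "\<sigma> \<in> {0..T} - Z" by simp
        have "L2norm \<mu> (\<lambda>w. g (\<sigma>, w)) \<le> slice_bound (Y \<sigma>)" using setF_norm_le[OF \<sigma> YL elim(3)] \<sigma> by simp
        then show ?case using D[of \<sigma>] \<sigma> by simp
      qed
    qed (rule M1.finite_measure_axioms)
    finally show "L2norm (N \<Otimes>\<^sub>M \<mu>) g \<le> L2norm N (\<lambda>\<sigma>. D)" .
  qed
  then obtain g G where gC: "\<And>m. g m \<in> C m" and G: "G \<in> L2 (N \<Otimes>\<^sub>M \<mu>)"
    and lim: "(\<lambda>m. L2dist (N \<Otimes>\<^sub>M \<mu>) (g m) G) \<longlonglongrightarrow> 0" by blast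
  define h where "h \<sigma> w = G (\<sigma>, w)" for \<sigma> w
  have hG: "case_prod h = G" by (simp add: h_def fun_eq_iff)
  have gL: "case_prod (\<lambda>\<sigma> w. g m (\<sigma>, w)) \<in> L2 (N \<Otimes>\<^sub>M \<mu>)" for m using gC[of m] by (simp add: C_def case_prod_unfold)
  have dL: "case_prod (\<lambda>\<sigma> w. g m (\<sigma>, w) - h \<sigma> w) \<in> L2 (N \<Otimes>\<^sub>M \<mu>)" for m
    using L2_diff[OF gL[of m] G] by (simp add: h_def case_prod_unfold)
  have dn: "L2norm (N \<Otimes>\<^sub>M \<mu>) (case_prod (\<lambda>\<sigma> w. g m (\<sigma>, w) - h \<sigma> w)) = L2dist (N \<Otimes>\<^sub>M \<mu>) (g m) G" for m
    by (simp add: h_def case_prod_unfold)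
  define \<delta> where "\<delta> m \<sigma> = L2norm \<mu> (\<lambda>w. g m (\<sigma>, w) - h \<sigma> w)" for m \<sigma>
  have \<delta>L: "\<delta> m \<in> L2 N" for m unfolding \<delta>_def by (rule slice_norm_L2(1)[OF dL])
  have "(\<lambda>m. L2norm N (\<lambda>\<sigma>. \<delta> m \<sigma> - 0)) \<longlonglongrightarrow> 0"
    using lim slice_norm_L2(2)[OF dL] unfolding dn \<delta>_def by simp
  \<comment> \<open>Norm convergence in the product gives convergence of the slices along a
    subsequence, which suffices to use the closedness of the sets at almost every time.\<close>
  from L2_tendsto_AE_subseq[OF \<delta>L L2_zero this] obtain \<rho> :: "nat \<Rightarrow> nat" where \<rho>: "AE \<sigma> in N. (\<lambda>m. \<delta> (\<rho> m) \<sigma>) \<longlonglongrightarrow> 0" by blast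
  have "AE \<sigma> in N. \<forall>m. (\<lambda>w. g m (\<sigma>, w)) \<in> setF \<mu> U f \<sigma> (Y \<sigma>)"
    using gC unfolding AE_all_countable by (simp add: C_def)
  with \<rho> AE_slice_L2[of h, unfolded hG, OF G] AE_space AE_not_Z have hF: "AE \<sigma> in N. h \<sigma> \<in> setF \<mu> U f \<sigma> (x \<sigma>)"
  proof eventually_elim
    case (elim \<sigma>)
    then have \<sigma>: "\<sigma> \<in> {0..T} - Z" "\<sigma> \<in> {0..T}" by simp_all
    have "h \<sigma> \<in> setF \<mu> U f \<sigma> (Y \<sigma>)"
      by (rule setF_closed[OF \<sigma>(1) YL[OF \<sigma>(2)] elim(5)[rule_format] elim(2) elim(1)[unfolded \<delta>_def]])
    then show ?case using setF_cong[of "Y \<sigma>" "x \<sigma>"] Y(2) \<sigma>(2) by simp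
  qed
  have "AE w in \<mu>. x t w = x r w + partial_integral N {r..t} h w" if rt: "0 \<le> r" "r \<le> t" "t \<le> T" for r t
  proof -
    have t: "t \<in> {0..T}" and r: "r \<in> {0..T}" using rt by auto
    have st: "{r..t} \<in> sets N" using rt by (auto simp: sets_restrict_space_iff)
    have hL: "case_prod h \<in> L2 (N \<Otimes>\<^sub>M \<mu>)" using G hG by simp
    have pL: "partial_integral N {r..t} h \<in> L2 \<mu>" by (rule partial_integral_L2(1)[OF hL st])
    let ?d = "\<lambda>w. (x t w - x r w) - partial_integral N {r..t} h w"
    have xd: "(\<lambda>w. x t w - x r w) \<in> L2 \<mu>" by (intro L2_diff xL t r)
    have ub: "L2norm \<mu> ?d \<le> (1/2)^m + sqrt (measure N {r..t}) * L2dist (N \<Otimes>\<^sub>M \<mu>) (g m) G" for m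
    proof -
      have gp: "?PI r t (g m) \<in> L2 \<mu>" by (rule partial_integral_L2(1)[OF gL st])
      have 1: "L2norm \<mu> (\<lambda>w. (x t w - x r w) - ?PI r t (g m) w) \<le> (1/2)^m"
        using gC[of m] rt by (simp add: C_def defect_def)
      have "L2norm \<mu> (\<lambda>w. ?PI r t (g m) w - partial_integral N {r..t} h w) = L2norm \<mu> (partial_integral N {r..t} (\<lambda>\<sigma> w. g m (\<sigma>, w) - h \<sigma> w))"
        using partial_integral_diff[OF gL hL st, of m]
        by (intro L2norm_cong_AE L2_measurable L2_diff gp pL partial_integral_L2(1)[OF dL st]) (auto elim: eventually_mono)
      also have "\<dots> \<le> sqrt (measure N {r..t}) * L2dist (N \<Otimes>\<^sub>M \<mu>) (g m) G"
        using partial_integral_norm_le[OF dL st, of m] unfolding dn .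
      finally show ?thesis using L2norm_triangle_diff[OF xd gp pL] 1 by linarith
    qed
    have "(\<lambda>m. (1/2)^m + sqrt (measure N {r..t}) * L2dist (N \<Otimes>\<^sub>M \<mu>) (g m) G) \<longlonglongrightarrow> 0 + sqrt (measure N {r..t}) * 0"
      by (intro tendsto_intros lim LIMSEQ_realpow_zero) auto
    from LIMSEQ_le_const[OF this, of "L2norm \<mu> ?d"] ub have "L2norm \<mu> ?d \<le> 0" by auto
    then have "L2norm \<mu> ?d = 0" using L2norm_nonneg[of \<mu> ?d] by simp
    then have "AE w in \<mu>. ?d w = 0" using L2norm_eq_0[OF L2_diff[OF xd pL]] by simp
    then show ?thesis by eventually_elim (simp add: algebra_simps)
  qed
  moreover have "L2dist \<mu> (x t) (x r) \<le> B * (t - r)" if "0 \<le> r" "r \<le> t" "t \<le> T" for r t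
    using lip[of t r] that by simp
  ultimately have "primitive_curve T \<mu> h B x"
    unfolding primitive_curve_def hG using G \<open>0 \<le> B\<close> xL by blast
  with hF show ?thesis by blast
qed

text \<open>The bound is affine in \<open>norm (\<phi> w)\<close>, hence Lipschitz in
  \<open>\<phi>\<close>; one constant therefore serves a convergent sequence of initial
  values.\<close>

lemma velocity_bound_norm_le:
  assumes \<phi>: "\<phi> \<in> L2 \<mu>" "\<phi>' \<in> L2 \<mu>"
  shows "L2norm \<mu> (velocity_bound \<phi>) \<le> L2norm \<mu> (velocity_bound \<phi>') +
    c * (1 + 2 * c * T * exp (2 * k * T)) * L2dist \<mu> \<phi> \<phi>'"
proof -
  define A where "A = c * (1 + 2 * c * T * exp (2 * k * T))"
  have "A \<ge> 0" unfolding A_def using c_pos T_pos by simp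
  note V = velocity_bound_L2[OF \<phi>(1)] velocity_bound_L2[OF \<phi>(2)]
  have "norm (velocity_bound \<phi> w - velocity_bound \<phi>' w) \<le> norm (A *\<^sub>R (\<phi> w - \<phi>' w))" for w
  proof -
    have "velocity_bound \<phi> w - velocity_bound \<phi>' w = A * (norm (\<phi> w) - norm (\<phi>' w))"
      unfolding velocity_bound_eq A_def by (simp add: algebra_simps)
    also have "norm \<dots> \<le> A * norm (\<phi> w - \<phi>' w)"
      using \<open>A \<ge> 0\<close> norm_triangle_ineq3[of "\<phi> w" "\<phi>' w"] by (simp add: abs_mult mult_left_mono)
    finally show ?thesis using \<open>A \<ge> 0\<close> by simp
  qed
  then have "L2dist \<mu> (velocity_bound \<phi>) (velocity_bound \<phi>') \<le> L2norm \<mu> (\<lambda>w. A *\<^sub>R (\<phi> w - \<phi>' w))"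
    by (intro L2norm_mono L2_scaleR L2_diff \<phi> L2_measurable[OF L2_diff] V) auto
  then show ?thesis
    using L2norm_triangle_reverse[OF V] \<open>A \<ge> 0\<close> unfolding L2norm_scaleR A_def[symmetric] by linarith
qed

text \<open>Compactness is available for the primitives, while convergence of the initial data is
  known at the moving times \<open>s n\<close>. The uniform Lipschitz constant transfers the latter
  to a common time, so that uniform convergence of primitives becomes uniform convergence of
  trajectories.\<close>

theorem trajectories_convergent_subseq:
  assumes conv: "convexity_hyp \<mu> T U f" and alt: "measure_modulus_hyp \<mu> T U f \<or> compact_range_hyp \<mu> T U f"
    and X: "\<And>n. trajectory (s n) (\<phi> n) (u n) (X n)" and u: "\<And>n. u n \<in> admissible_controls U 0 T"
    and s: "s \<longlonglongrightarrow> s'" and \<phi>: "\<phi>' \<in> L2 \<mu>" "(\<lambda>n. L2dist \<mu> (\<phi> n) \<phi>') \<longlonglongrightarrow> 0"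
  shows "\<exists>r x. strict_mono r \<and> x \<in> inclusion_solutions \<mu> U f s' T \<phi>' \<and>
    (\<forall>n. X (r n) T \<in> L2 \<mu>) \<and> x T \<in> L2 \<mu> \<and> (\<lambda>n. L2dist \<mu> (X (r n) T) (x T)) \<longlonglongrightarrow> 0"
proof -
  note P = trajectory_primitive_curve[OF X]
  note XL = primitive_curve_L2[OF finite_\<mu> P]
  have sn: "s n \<in> {0..T}" and \<phi>L: "\<phi> n \<in> L2 \<mu>" for n using trajectoryD(2,3)[OF X] by auto
  have s': "s' \<in> {0..T}" using closed_sequentially[OF closed_atLeastAtMost _ s] sn by blast
  have z: "0 \<in> {0..T}" and TT: "T \<in> {0..T}" using T_pos by auto
  define A where "A = c * (1 + 2 * c * T * exp (2 * k * T))"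
  have "A \<ge> 0" unfolding A_def using c_pos T_pos by simp
  obtain K where K: "\<And>n. norm (L2dist \<mu> (\<phi> n) \<phi>') \<le> K"
    using convergentI[OF \<phi>(2), THEN convergent_imp_Bseq] unfolding Bseq_def by blast
  define B where "B = L2norm \<mu> (velocity_bound \<phi>') + A * K"
  have B: "L2norm \<mu> (velocity_bound (\<phi> n)) \<le> B" for n
  proof -
    have "A * L2dist \<mu> (\<phi> n) \<phi>' \<le> A * K" using K[of n] \<open>A \<ge> 0\<close> by (intro mult_left_mono) auto
    then show ?thesis using velocity_bound_norm_le[OF \<phi>L \<phi>(1), of n] unfolding B_def A_def by linarith
  qed
  have "0 \<le> B" using B[of 0] L2norm_nonneg[of \<mu> "velocity_bound (\<phi> 0)"] by linarith
  have lipX: "L2dist \<mu> (X n t) (X n r) \<le> B * \<bar>t - r\<bar>" if t: "t \<in> {0..T}" and r: "r \<in> {0..T}" for t r n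
    using primitive_curve_Lipschitz[OF finite_\<mu> P t r, of n] mult_right_mono[OF B, of "\<bar>t - r\<bar>" n] by simp
  \<comment> \<open>Primitives based at 0, for which the finite nets are available; the values
    \<open>X n 0\<close> themselves are not controlled directly.\<close>
  define y where "y n t w = X n t w - X n 0 w" for n t w
  have yL: "y n t \<in> L2 \<mu>" if "t \<in> {0..T}" for n t unfolding y_def by (intro L2_diff XL that z)
  have lipy: "L2dist \<mu> (y n t) (y n r) \<le> B * \<bar>t - r\<bar>" if "t \<in> {0..T}" "r \<in> {0..T}" for t r n
    using lipX[OF that, of n] by (simp add: y_def)
  have "\<exists>r. strict_mono r \<and> (\<forall>i m n. i \<le> m \<longrightarrow> i \<le> n \<longrightarrow> (\<forall>t\<in>{0..T}. L2dist \<mu> (y (r m) t) (y (r n) t) \<le> (1/2)^i))"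
  proof (rule uniformly_Cauchy_subseq[OF T_pos yL lipy \<open>0 \<le> B\<close>])
    fix e :: real assume "0 < e"
    from primitive_net[OF alt this] obtain Q where Q: "finite Q" "Q \<subseteq> L2 \<mu>"
      "\<forall>s \<phi> u X. trajectory s \<phi> u X \<longrightarrow> u \<in> admissible_controls U 0 T \<longrightarrow>
        (\<forall>t\<in>{0..T}. \<exists>q\<in>Q. L2norm \<mu> (\<lambda>w. partial_integral N {0..t} (vel u X) w - q w) \<le> e)"
      by (elim exE conjE)
    have "\<exists>q\<in>Q. L2dist \<mu> (y n t) q \<le> e" if t: "t \<in> {0..T}" for n t
    proof -
      have "partial_integral N {0..t} (vel (u n) (X n)) w = y n t w" for w
        using trajectory_increment[OF X, of 0 t n w] t by (simp add: y_def)
      then show ?thesis using Q(3)[rule_format, OF X u t, of n] by simp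
    qed
    then show "\<exists>Q. finite Q \<and> Q \<subseteq> L2 \<mu> \<and> (\<forall>n. \<forall>t\<in>{0..T}. \<exists>q\<in>Q. L2dist \<mu> (y n t) q \<le> e)"
      by (intro exI[of _ Q] conjI allI ballI Q(1,2))
  qed
  then obtain r where r: "strict_mono r" and yC: "\<And>i m n t. i \<le> m \<Longrightarrow> i \<le> n \<Longrightarrow> t \<in> {0..T} \<Longrightarrow> L2dist \<mu> (y (r m) t) (y (r n) t) \<le> (1/2)^i"
    by (elim exE conjE) (use atLeastAtMost_iff in blast)
  have rn: "n \<le> r n" for n by (rule seq_suble[OF r])
  \<comment> \<open>\<open>X n\<close> is recovered from \<open>y n\<close> by its value
    \<open>\<phi> n\<close> at its own initial time \<open>s n\<close>; the mismatch of the initial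
    times costs the Lipschitz term.\<close>
  have tri: "L2dist \<mu> (X m t) (X n t) \<le> L2dist \<mu> (y m t) (y n t) + L2dist \<mu> (\<phi> m) (\<phi> n)
      + L2dist \<mu> (y m (s m)) (y n (s m)) + B * \<bar>s m - s n\<bar>" if t: "t \<in> {0..T}" for m n t
  proof -
    have i: "X n (s n) w = \<phi> n w" for n w by (rule trajectory_initial[OF X])
    have a: "(\<lambda>w. y m t w - y n t w) \<in> L2 \<mu>" "(\<lambda>w. \<phi> m w - \<phi> n w) \<in> L2 \<mu>" "(\<lambda>w. y n (s n) w - y m (s m) w) \<in> L2 \<mu>"
      by (intro L2_diff yL \<phi>L t sn)+
    have "L2dist \<mu> (X m t) (X n t) = L2norm \<mu> (\<lambda>w. ((y m t w - y n t w) + (\<phi> m w - \<phi> n w)) + (y n (s n) w - y m (s m) w))"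
      by (simp add: y_def i algebra_simps)
    also have "\<dots> \<le> L2dist \<mu> (y m t) (y n t) + L2dist \<mu> (\<phi> m) (\<phi> n) + L2dist \<mu> (y n (s n)) (y m (s m))"
      using L2norm_triangle[OF L2_add[OF a(1,2)] a(3)] L2norm_triangle[OF a(1,2)] by linarith
    finally show ?thesis
      using L2norm_triangle_diff[OF yL[OF sn[of n], of n] yL[OF sn[of m], of n] yL[OF sn[of m], of m]] lipy[OF sn sn, of n n m]
        L2norm_minus_commute[of \<mu> "y n (s m)" "y m (s m)"] abs_minus_commute[of "s m" "s n"] by simp
  qed
  have unifC: "\<exists>K. \<forall>m\<ge>K. \<forall>n\<ge>K. \<forall>t\<in>{0..T}. L2dist \<mu> (X (r m) t) (X (r n) t) < e" if e: "e > 0" for e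
  proof -
    \<comment> \<open>The estimate \<open>tri\<close> has four contributions, a quarter of
      \<open>e\<close> for each; \<open>B + 1\<close> avoids a division by zero.\<close>
    have e4: "e / 4 > 0" "e / (4 * (B + 1)) > 0" using e \<open>0 \<le> B\<close> by simp_all
    obtain i where i: "(1/2::real)^i < e / 4" using real_arch_pow_inv[OF e4(1), of "1/2"] by auto
    from L2_convergent_imp_Cauchy[OF \<phi>L \<phi> e4(1)] obtain N1 where N1: "\<forall>m\<ge>N1. \<forall>n\<ge>N1. L2dist \<mu> (\<phi> m) (\<phi> n) < e / 4" by (rule exE)
    from LIMSEQ_imp_Cauchy[OF s] e4(2) obtain N2 where N2: "\<And>m n. m \<ge> N2 \<Longrightarrow> n \<ge> N2 \<Longrightarrow> \<bar>s m - s n\<bar> < e / (4 * (B + 1))"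
      unfolding Cauchy_def dist_real_def by meson
    show ?thesis
    proof (intro exI[of _ "max i (max N1 N2)"] allI impI ballI)
      fix m n t assume m: "max i (max N1 N2) \<le> m" and n: "max i (max N1 N2) \<le> n" and t: "t \<in> {0..T}"
      have ge: "i \<le> m" "i \<le> n" "N1 \<le> r m" "N1 \<le> r n" "N2 \<le> r m" "N2 \<le> r n" using m n rn[of m] rn[of n] by auto
      have "B * \<bar>s (r m) - s (r n)\<bar> \<le> B * (e / (4 * (B + 1)))" using N2[OF ge(5,6)] \<open>0 \<le> B\<close> by (intro mult_left_mono) auto
      also have "\<dots> \<le> (B + 1) * (e / (4 * (B + 1)))" using e4(2) by (intro mult_right_mono) auto
      also have "\<dots> = e / 4" using \<open>0 \<le> B\<close> by (simp add: field_simps)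
      finally have "B * \<bar>s (r m) - s (r n)\<bar> \<le> e / 4" .
      moreover have "L2dist \<mu> (\<phi> (r m)) (\<phi> (r n)) < e / 4" using N1 ge by blast
      ultimately show "L2dist \<mu> (X (r m) t) (X (r n) t) < e"
        using tri[OF t, of "r m" "r n"] yC[OF ge(1,2) t] yC[OF ge(1,2) sn, of "r m"] i by linarith
    qed
  qed
  have "\<exists>x. (\<forall>t\<in>{0..T}. x t \<in> L2 \<mu>) \<and> (\<forall>e>0. \<exists>K. \<forall>n\<ge>K. \<forall>t\<in>{0..T}. L2dist \<mu> (X (r n) t) (x t) \<le> e)"
  proof (rule L2_uniformly_convergent[of "{0..T}" "\<lambda>n. X (r n)"])
    show "X (r n) t \<in> L2 \<mu>" if "t \<in> {0..T}" for n t by (rule XL[OF that])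
  qed (rule unifC)
  then obtain x where x: "\<forall>t\<in>{0..T}. x t \<in> L2 \<mu>" and
    unif: "\<forall>e>0. \<exists>K. \<forall>n\<ge>K. \<forall>t\<in>{0..T}. L2dist \<mu> (X (r n) t) (x t) \<le> e" by (elim exE conjE)
  have lim: "(\<lambda>n. L2dist \<mu> (X (r n) t) (x t)) \<longlonglongrightarrow> 0" if t: "t \<in> {0..T}" for t
  proof (rule LIMSEQ_I)
    fix e :: real assume "0 < e"
    then obtain K where "\<forall>n\<ge>K. \<forall>t\<in>{0..T}. L2dist \<mu> (X (r n) t) (x t) \<le> e / 2" using unif[rule_format, of "e / 2"] by auto
    then show "\<exists>K. \<forall>n\<ge>K. norm (L2dist \<mu> (X (r n) t) (x t) - 0) < e"
      using t \<open>0 < e\<close> by (intro exI[of _ K]) force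
  qed
  have "\<exists>h. primitive_curve T \<mu> h B x \<and> (AE \<sigma> in N. h \<sigma> \<in> setF \<mu> U f \<sigma> (x \<sigma>))"
  proof (rule trajectories_limit_primitive_curve[OF conv X u B])
    show "x t \<in> L2 \<mu>" if "t \<in> {0..T}" for t using x that by blast
    show "\<exists>n. \<forall>t\<in>{0..T}. L2dist \<mu> (X (r n) t) (x t) \<le> e" if "0 < e" for e
      using unif[rule_format, OF that] by blast
  qed
  then obtain h where h: "primitive_curve T \<mu> h B x" "AE \<sigma> in N. h \<sigma> \<in> setF \<mu> U f \<sigma> (x \<sigma>)" by (elim exE conjE)
  have xs: "x s' \<in> L2 \<mu>" using x s' by blast
  \<comment> \<open>The comparison of \<open>x s'\<close> with \<open>\<phi>'\<close> passes through
    \<open>X (r n) s'\<close> and through the exact initial value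
    \<open>X (r n) (s (r n)) = \<phi> (r n)\<close>.\<close>
  let ?e = "\<lambda>n. L2dist \<mu> (X (r n) s') (x s') + B * \<bar>s' - s (r n)\<bar> + L2dist \<mu> (\<phi> (r n)) \<phi>'"
  have "L2dist \<mu> (x s') \<phi>' \<le> ?e n" for n
    using L2norm_triangle_diff[OF xs XL[OF s', of "r n"] \<phi>(1)] L2norm_triangle_diff[OF XL[OF s', of "r n"] \<phi>L[of "r n"] \<phi>(1)]
      lipX[OF s' sn, of "r n" "r n"] L2norm_minus_commute[of \<mu> "X (r n) s'" "x s'"] by (simp add: trajectory_initial[OF X])
  moreover have "?e \<longlonglongrightarrow> 0 + B * \<bar>s' - s'\<bar> + 0"
    by (intro tendsto_intros lim[OF s'] LIMSEQ_subseq_LIMSEQ[OF s r, unfolded comp_def] LIMSEQ_subseq_LIMSEQ[OF \<phi>(2) r, unfolded comp_def])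
  ultimately have "L2dist \<mu> (x s') \<phi>' \<le> 0" using LIMSEQ_le_const[of ?e 0] by auto
  then have "L2dist \<mu> (x s') \<phi>' = 0" using L2norm_nonneg[of \<mu> "\<lambda>w. x s' w - \<phi>' w"] by linarith
  then have "AE w in \<mu>. x s' w = \<phi>' w" using L2norm_eq_0[OF L2_diff[OF xs \<phi>(1)]] by simp
  from primitive_curve_inclusion[OF s' h this] show ?thesis
    using r lim[OF TT] x TT XL[OF TT] by (intro exI[of _ r] exI[of _ x] conjI allI) auto
qed

end

section \<open>Lower semicontinuity of the cost\<close>

lemma ext_integral_eq_integral: "integrable M v \<Longrightarrow> ext_integral M v = ereal (\<integral>w. v w \<partial>M)"
  using upper_integral_eq_lebesgue_integral[of M v] upper_integral_eq_ext_integral[of v M]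
  by (simp add: measurable_completion)

lemma cost_cong_AE:
  assumes "AE w in M. \<phi> w = \<phi>' w"
  shows "cost M g \<phi> = cost M g \<phi>'"
proof -
  have "(AE w in M. g (\<phi> w) w \<le> v w) \<longleftrightarrow> (AE w in M. g (\<phi>' w) w \<le> v w)" for v
  proof
    assume "AE w in M. g (\<phi> w) w \<le> v w"
    with assms show "AE w in M. g (\<phi>' w) w \<le> v w" by eventually_elim simp
  next
    assume "AE w in M. g (\<phi>' w) w \<le> v w"
    with assms show "AE w in M. g (\<phi> w) w \<le> v w" by eventually_elim simp
  qed
  then show ?thesis unfolding cost_def upper_integral_def by simp
qed

text \<open>Fatou's lemma adapted to the upper integral. The integrand need not be measurable, so it
  is replaced by measurable majorants \<open>v n\<close> with integrals below the level. The limit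
  inferior of \<open>v n + q\<close> is measurable and, by lower semicontinuity of \<open>g\<close>,
  dominates \<open>g (\<psi> w) w + q w\<close> almost everywhere; it thus provides a majorant for
  the cost of \<open>\<psi>\<close>.\<close>

theorem cost_le_limit:
  fixes \<psi> :: "'w \<Rightarrow> real^'n"
  assumes g: "cost_hyp M g" and \<phi>: "\<And>n. \<phi> n \<in> L2 M" and \<psi>: "\<psi> \<in> L2 M"
    and lim: "(\<lambda>n. L2dist M (\<phi> n) \<psi>) \<longlonglongrightarrow> 0" and le: "\<And>n. cost M g (\<phi> n) \<le> d"
  shows "cost M g \<psi> \<le> d"
\<comment> \<open>Room above \<open>d\<close> is needed because the upper integral is an infimum:
  majorants with integral below \<open>d'\<close> exist for every \<open>d' > d\<close>, but the
  level \<open>d\<close> itself may not be attained.\<close>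
proof (rule dense_ge)
  fix d' assume d': "d < d'"
  show "cost M g \<psi> \<le> d'"
  proof (cases d')
    case PInf then show ?thesis by simp
  next
    case MInf then show ?thesis using d' by simp
  next
    case (real \<delta>)
    obtain a b where a: "integrable (completion M) a" and "0 \<le> b" and ab: "\<And>x w. a w - b * (norm x)\<^sup>2 \<le> g x w"
      and lsc: "\<And>w. lower_semicontinuous euclidean (\<lambda>x. g x w)"
      using g unfolding cost_hyp_def by blast
    \<comment> \<open>\<open>a\<close> is integrable with respect to the completion; a version
      measurable for \<open>M\<close> itself can be combined with the other integrands.\<close>
    obtain a' where a'm: "a' \<in> borel_measurable M" and a'e: "AE w in M. a w = a' w"
      using completion_ex_borel_measurable_real[of a M] a by blast
    have "integrable (completion M) a'"
      using a AE_completion[OF a'e] by (subst integrable_cong_AE[of _ _ a]) (auto simp: a'm measurable_completion elim: eventually_mono)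
    then have a': "integrable M a'" using a'm by (simp add: integrable_completion)
    from L2_tendsto_AE_subseq[OF \<phi> \<psi> lim] obtain r m where m: "m \<in> L2 M"
      and conv: "AE w in M. (\<lambda>n. \<phi> (r n) w) \<longlonglongrightarrow> \<psi> w" and bd: "AE w in M. \<forall>n. norm (\<phi> (r n) w) \<le> (m w :: real)" by (elim exE conjE)
    \<comment> \<open>\<open>- q\<close> is an integrable minorant of the integrands along the
      subsequence, so that Fatou's lemma applies to \<open>v n + q\<close>.\<close>
    define q where "q w = b * (norm (m w))\<^sup>2 - a' w" for w
    have q: "integrable M q" unfolding q_def using L2_integrable_square[OF m] a' by simp
    have [measurable]: "q \<in> borel_measurable M" using q by simp
    have low: "AE w in M. - q w \<le> g (\<phi> (r n) w) w" for n
      using bd a'e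
    proof eventually_elim
      case (elim w)
      have "(norm (\<phi> (r n) w))\<^sup>2 \<le> (norm (m w))\<^sup>2"
        using elim(1)[rule_format, of n] abs_ge_self[of "m w"] by (intro power_mono) auto
      then have "b * (norm (\<phi> (r n) w))\<^sup>2 \<le> b * (norm (m w))\<^sup>2" using \<open>0 \<le> b\<close> by (rule mult_left_mono)
      then show ?case using ab[of w "\<phi> (r n) w"] elim(2) unfolding q_def by linarith
    qed
    have "\<forall>n. \<exists>v. v \<in> borel_measurable M \<and> (AE w in M. g (\<phi> (r n) w) w \<le> v w) \<and> ext_integral M v < ereal \<delta>"
    proof
      fix n
      have "cost M g (\<phi> (r n)) < ereal \<delta>" using le[of "r n"] d' real by simp
      then show "\<exists>v. v \<in> borel_measurable M \<and> (AE w in M. g (\<phi> (r n) w) w \<le> v w) \<and> ext_integral M v < ereal \<delta>"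
        unfolding cost_def upper_integral_def INF_less_iff by (elim bexE) auto
    qed
    from choice[OF this] obtain v where v0: "\<forall>n. v n \<in> borel_measurable M \<and> (AE w in M. g (\<phi> (r n) w) w \<le> v n w) \<and> ext_integral M (v n) < ereal \<delta>"
      by (rule exE)
    then have vm[measurable]: "\<And>n. v n \<in> borel_measurable M" and vg: "\<And>n. AE w in M. g (\<phi> (r n) w) w \<le> v n w" and vi: "\<And>n. ext_integral M (v n) < ereal \<delta>"
      by simp_all
    have vq: "AE w in M. 0 \<le> v n w + q w" for n using low[of n] vg[of n] by eventually_elim linarith
    \<comment> \<open>The minorant controls the negative part; the finite level
      \<open>\<delta>\<close> then rules out an infinite positive part in the difference of extended
      reals.\<close>
    have vint: "integrable M (v n)" for n
    proof -
      have "(\<integral>\<^sup>+w. ennreal (- v n w) \<partial>M) \<le> (\<integral>\<^sup>+w. ennreal (q w) \<partial>M)"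
        using vq[of n] by (intro nn_integral_mono_AE) (auto elim!: eventually_mono intro!: ennreal_leI)
      then have 1: "(\<integral>\<^sup>+w. ennreal (- v n w) \<partial>M) \<noteq> \<infinity>" using q unfolding real_integrable_def by (auto simp: top_unique)
      have "(\<integral>\<^sup>+w. ennreal (v n w) \<partial>M) \<noteq> \<infinity>"
      proof
        assume "(\<integral>\<^sup>+w. ennreal (v n w) \<partial>M) = \<infinity>"
        then have "ext_integral M (v n) = \<infinity> - enn2ereal (\<integral>\<^sup>+w. ennreal (- v n w) \<partial>M)" by (simp add: ext_integral_def)
        then show False using vi[of n] 1 by (cases "\<integral>\<^sup>+w. ennreal (- v n w) \<partial>M") (auto simp: enn2ereal_ennreal)
      qed
      with 1 show ?thesis unfolding real_integrable_def by simp
    qed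
    define L where "L w = liminf (\<lambda>n. ennreal (v n w + q w))" for w
    have [measurable]: "L \<in> borel_measurable M" unfolding L_def by measurable
    have vI: "(\<integral>\<^sup>+w. ennreal (v n w + q w) \<partial>M) \<le> ennreal (\<delta> + (\<integral>w. q w \<partial>M))" for n
    proof -
      have "(\<integral>\<^sup>+w. ennreal (v n w + q w) \<partial>M) = ennreal (\<integral>w. v n w + q w \<partial>M)"
        by (rule nn_integral_eq_integral[OF Bochner_Integration.integrable_add[OF vint q] vq])
      also have "\<dots> \<le> ennreal (\<delta> + (\<integral>w. q w \<partial>M))"
        using vi[of n] unfolding ext_integral_eq_integral[OF vint] Bochner_Integration.integral_add[OF vint q]
        by (intro ennreal_leI) simp
      finally show ?thesis .
    qed
    have "(\<integral>\<^sup>+w. L w \<partial>M) \<le> liminf (\<lambda>n. \<integral>\<^sup>+w. ennreal (v n w + q w) \<partial>M)"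
      unfolding L_def by (rule nn_integral_liminf) measurable
    also have "\<dots> \<le> ennreal (\<delta> + (\<integral>w. q w \<partial>M))"
      using vI by (intro Liminf_le) (auto intro: always_eventually)
    finally have LI: "(\<integral>\<^sup>+w. L w \<partial>M) \<le> ennreal (\<delta> + (\<integral>w. q w \<partial>M))" .
    then have "(\<integral>\<^sup>+w. L w \<partial>M) \<noteq> \<infinity>" by (auto simp: top_unique)
    then have Lfin: "AE w in M. L w \<noteq> \<infinity>" by (intro nn_integral_PInf_AE) auto
    define \<l> where "\<l> w = enn2real (L w)" for w
    have \<l>L: "AE w in M. ennreal (\<l> w) = L w" using Lfin unfolding \<l>_def by eventually_elim (simp add: less_top)
    have \<l>0: "0 \<le> \<l> w" for w by (simp add: \<l>_def)
    have \<l>m[measurable]: "\<l> \<in> borel_measurable M" unfolding \<l>_def by measurable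
    have \<l>nn: "(\<integral>\<^sup>+w. ennreal (\<l> w) \<partial>M) = (\<integral>\<^sup>+w. L w \<partial>M)" by (rule nn_integral_cong_AE[OF \<l>L])
    have \<l>i: "integrable M \<l>"
      using \<l>m \<l>0 LI unfolding \<l>nn[symmetric] by (intro integrableI_nonneg) (auto simp: le_less_trans less_top[symmetric] top_unique)
    have dq: "0 \<le> \<delta> + (\<integral>w. q w \<partial>M)"
    proof -
      have "0 \<le> (\<integral>w. v 0 w + q w \<partial>M)" using vq[of 0] by (rule integral_nonneg_AE)
      then show ?thesis using vi[of 0] unfolding ext_integral_eq_integral[OF vint] Bochner_Integration.integral_add[OF vint q] by simp
    qed
    have "ennreal (\<integral>w. \<l> w \<partial>M) \<le> ennreal (\<delta> + (\<integral>w. q w \<partial>M))"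
      using LI nn_integral_eq_integral[OF \<l>i] \<l>0 unfolding \<l>nn by simp
    then have \<l>le: "(\<integral>w. \<l> w \<partial>M) \<le> \<delta> + (\<integral>w. q w \<partial>M)" using dq by (simp add: ennreal_le_iff)
    have "AE w in M. \<forall>n. g (\<phi> (r n) w) w \<le> v n w" using vg by (simp add: AE_all_countable)
    with conv \<l>L have gw: "AE w in M. g (\<psi> w) w \<le> \<l> w - q w"
    proof eventually_elim
      case (elim w)
      show ?case
      proof (rule field_le_epsilon)
        fix e :: real assume "0 < e"
        have "open {x. g (\<psi> w) w - e < g x w}" using lsc[of w] by (simp add: lower_semicontinuous_def)
        from topological_tendstoD[OF elim(1) this] \<open>0 < e\<close> have "\<forall>\<^sub>F n in sequentially. g (\<psi> w) w - e < g (\<phi> (r n) w) w" by simp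
        then have "\<forall>\<^sub>F n in sequentially. ennreal (g (\<psi> w) w - e + q w) \<le> ennreal (v n w + q w)"
        proof eventually_elim
          case (elim n)
          then show ?case using \<open>\<forall>n. g (\<phi> (r n) w) w \<le> v n w\<close>[rule_format, of n] by (intro ennreal_leI) linarith
        qed
        then have "ennreal (g (\<psi> w) w - e + q w) \<le> L w" unfolding L_def by (rule Liminf_bounded)
        \<comment> \<open>A negative left side is truncated to 0 by \<open>ennreal\<close>; this is
          harmless because \<open>\<l> w\<close> is nonnegative.\<close>
        then have "g (\<psi> w) w - e + q w \<le> \<l> w" using elim(2) \<l>0[of w] by (metis ennreal_le_iff)
        then show "g (\<psi> w) w \<le> \<l> w - q w + e" by linarith
      qed
    qed
    have "cost M g \<psi> \<le> ext_integral M (\<lambda>w. \<l> w - q w)"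
      unfolding cost_def upper_integral_def using gw by (intro INF_lower) simp
    also have "\<dots> \<le> ereal \<delta>"
      using \<l>le unfolding ext_integral_eq_integral[OF Bochner_Integration.integrable_diff[OF \<l>i q]] Bochner_Integration.integral_diff[OF \<l>i q] by simp
    finally show ?thesis using real by simp
  qed
qed

text \<open>Together with \<open>value_le\<close> this is the dynamic programming inequality: at any
  later point of a solution the value does not exceed the final cost of that solution.\<close>

lemma inclusion_solutions_restrict:
  fixes f :: "real \<Rightarrow> real^'n \<Rightarrow> real^'m \<Rightarrow> 'w \<Rightarrow> real^'n"
  assumes x: "x \<in> inclusion_solutions M U f s T \<phi>" and r: "s \<le> r"
  shows "x \<in> inclusion_solutions M U f r T (x r)"
proof -
  have c: "continuous_L2_curve M s T x" and a: "L2_absolutely_continuous_on M s T x"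
    and d: "AE t in lebesgue_on {s..T}. \<exists>\<psi>\<in>setF M U f t (x t). has_L2_derivative M x \<psi> t {s..T}"
    using x unfolding inclusion_solutions_def by blast+
  have sub: "{r..T} \<subseteq> {s..T}" using r by auto
  have "continuous_L2_curve M r T x"
    using c sub unfolding continuous_L2_curve_def by (rule continuous_map_from_subtopology_mono)
  moreover have "L2_absolutely_continuous_on M r T x"
    unfolding L2_absolutely_continuous_on_def
  proof (intro allI impI)
    fix \<epsilon> :: real assume "0 < \<epsilon>"
    from a[unfolded L2_absolutely_continuous_on_def, rule_format, OF this] obtain \<delta> where \<delta>: "\<delta> > 0"
      "\<forall>(K::nat) a b. (\<forall>i<K. s \<le> a i \<and> a i \<le> b i \<and> b i \<le> T) \<and> disjoint_family_on (\<lambda>i. {a i<..<b i}) {..<K} \<and> (\<Sum>i<K. b i - a i) < \<delta>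
        \<longrightarrow> (\<Sum>i<K. L2dist M (x (b i)) (x (a i))) < \<epsilon>" by (elim exE conjE)
    show "\<exists>\<delta>>0. \<forall>(K::nat) a b. (\<forall>i<K. r \<le> a i \<and> a i \<le> b i \<and> b i \<le> T) \<and> disjoint_family_on (\<lambda>i. {a i<..<b i}) {..<K} \<and> (\<Sum>i<K. b i - a i) < \<delta>
        \<longrightarrow> (\<Sum>i<K. L2dist M (x (b i)) (x (a i))) < \<epsilon>"
    proof (intro exI[of _ \<delta>] conjI allI impI \<delta>(1), elim conjE)
      fix K :: nat and a b :: "nat \<Rightarrow> real"
      assume K: "\<forall>i<K. r \<le> a i \<and> a i \<le> b i \<and> b i \<le> T" "disjoint_family_on (\<lambda>i. {a i<..<b i}) {..<K}" "(\<Sum>i<K. b i - a i) < \<delta>"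
      have "\<forall>i<K. s \<le> a i \<and> a i \<le> b i \<and> b i \<le> T" using K(1) order_trans[OF r] by blast
      then show "(\<Sum>i<K. L2dist M (x (b i)) (x (a i))) < \<epsilon>"
        using K(2,3) by (intro \<delta>(2)[THEN spec, THEN spec, THEN spec, THEN mp] conjI)
    qed
  qed
  moreover have "AE t in lebesgue_on {r..T}. \<exists>\<psi>\<in>setF M U f t (x t). has_L2_derivative M x \<psi> t {r..T}"
  proof -
    have imp: "has_L2_derivative M x \<psi> t {r..T}" if "has_L2_derivative M x \<psi> t {s..T}" for \<psi> t
      using that sub unfolding has_L2_derivative_def by (rule tendsto_within_subset)
    have "AE t in lebesgue. t \<in> {s..T} \<longrightarrow> (\<exists>\<psi>\<in>setF M U f t (x t). has_L2_derivative M x \<psi> t {s..T})"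
      using d by (subst (asm) AE_restrict_space_iff) auto
    then have "AE t in lebesgue. t \<in> {r..T} \<longrightarrow> (\<exists>\<psi>\<in>setF M U f t (x t). has_L2_derivative M x \<psi> t {r..T})"
    proof eventually_elim
      case (elim t)
      then show ?case using sub imp by blast
    qed
    then show ?thesis by (subst AE_restrict_space_iff) auto
  qed
  ultimately show ?thesis unfolding inclusion_solutions_def by simp
qed

section \<open>The value function: attainment, semicontinuity and the two limits\<close>

context control_problem
begin

text \<open>Measurable selection provides a control for which \<open>x\<close> solves the state
  equation; by uniqueness the chosen \<open>state\<close> agrees with \<open>x\<close> at time
  \<open>T\<close> up to a null set, which the cost does not see.\<close>

lemma value_le:
  assumes s: "s \<in> {0..T}" and \<phi>: "\<phi> \<in> L2 \<mu>" and x: "x \<in> inclusion_solutions \<mu> U f s T \<phi>"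
  shows "value_function \<mu> T U f g s \<phi> \<le> cost \<mu> g (x T)"
proof -
  from inclusion_solution_control[OF assms] obtain u where u: "u \<in> admissible_controls U s T" "state_solution \<mu> f s T \<phi> u x" by blast
  have "cost \<mu> g (state \<mu> f s T \<phi> u T) = cost \<mu> g (x T)"
    using s by (intro cost_cong_AE state_eq[OF u(2) s \<phi>]) simp
  then show ?thesis unfolding value_function_def using u(1) by (metis INF_lower)
qed

text \<open>A nearly optimal control on \<open>{s..T}\<close> and its chosen state are replaced by a
  control and a trajectory on all of \<open>{0..T}\<close>, the form in which compactness
  applies.\<close>

lemma value_less_trajectory:
  assumes s: "s \<in> {0..T}" and \<phi>: "\<phi> \<in> L2 \<mu>" and less: "value_function \<mu> T U f g s \<phi> < d"
  shows "\<exists>u X. u \<in> admissible_controls U 0 T \<and> trajectory s \<phi> u X \<and> cost \<mu> g (X T) < d"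
proof -
  obtain u where u: "u \<in> admissible_controls U s T" "cost \<mu> g (state \<mu> f s T \<phi> u T) < d"
    using less unfolding value_function_def INF_less_iff by blast
  from admissible_extension[OF u(1) s] obtain v where v: "v \<in> admissible_controls U 0 T" "\<forall>t\<in>{s..T}. v t = u t" by blast
  then have "v \<in> borel_measurable N" by (simp add: admissible_controls_def)
  from trajectory_exists[OF this s \<phi>] obtain X where X: "trajectory s \<phi> v X" by (rule exE)
  have "state_solution \<mu> f s T \<phi> u X" using v(2) by (intro trajectory_state_solution[OF X]) simp
  then have "cost \<mu> g (state \<mu> f s T \<phi> u T) = cost \<mu> g (X T)"
    using s by (intro cost_cong_AE state_eq[OF _ s \<phi>]) simp_all
  then show ?thesis using v(1) X u(2) by auto
qed

text \<open>The common core of attainment and of lower semicontinuity: strict levels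
  \<open>d n\<close> above the values provide near-minimizers even where the infimum is not known to
  be attained, and the limit solution has cost at most the limit level.\<close>

lemma value_limit:
  assumes conv: "convexity_hyp \<mu> T U f" and alt: "measure_modulus_hyp \<mu> T U f \<or> compact_range_hyp \<mu> T U f"
    and g: "cost_hyp \<mu> g"
    and s: "\<And>n. s n \<in> {0..T}" "s \<longlonglongrightarrow> s'" and \<phi>: "\<And>n. \<phi> n \<in> L2 \<mu>" "\<phi>' \<in> L2 \<mu>" "(\<lambda>n. L2dist \<mu> (\<phi> n) \<phi>') \<longlonglongrightarrow> 0"
    and less: "\<And>n. value_function \<mu> T U f g (s n) (\<phi> n) < d n" and d: "d \<longlonglongrightarrow> d'"
  shows "\<exists>x\<in>inclusion_solutions \<mu> U f s' T \<phi>'. cost \<mu> g (x T) \<le> d'"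
proof -
  have "\<forall>n. \<exists>p. fst p \<in> admissible_controls U 0 T \<and> trajectory (s n) (\<phi> n) (fst p) (snd p) \<and> cost \<mu> g (snd p T) < d n"
    using value_less_trajectory[OF s(1) \<phi>(1) less] by (metis fst_conv snd_conv)
  from choice[OF this] obtain p where p: "\<forall>n. fst (p n) \<in> admissible_controls U 0 T \<and> trajectory (s n) (\<phi> n) (fst (p n)) (snd (p n)) \<and> cost \<mu> g (snd (p n) T) < d n"
    by (rule exE)
  define X where "X n = snd (p n)" for n
  have X: "trajectory (s n) (\<phi> n) (fst (p n)) (X n)" and u: "fst (p n) \<in> admissible_controls U 0 T" and cd: "cost \<mu> g (X n T) < d n" for n
    using p by (simp_all add: X_def)
  from trajectories_convergent_subseq[OF conv alt X u s(2) \<phi>(2,3)]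
  obtain r x where r: "strict_mono r" and x: "x \<in> inclusion_solutions \<mu> U f s' T \<phi>'"
    and XT: "\<forall>n. X (r n) T \<in> L2 \<mu>" and xT: "x T \<in> L2 \<mu>" and lim: "(\<lambda>n. L2dist \<mu> (X (r n) T) (x T)) \<longlonglongrightarrow> 0"
    by (elim exE conjE)
  have "cost \<mu> g (x T) \<le> d'"
  proof (rule dense_ge)
    fix c assume "d' < c"
    from order_tendstoD(2)[OF d this] obtain K where K: "\<And>n. n \<ge> K \<Longrightarrow> d n < c" unfolding eventually_sequentially by blast
    \<comment> \<open>The levels fall below \<open>c\<close> only eventually, while
      \<open>cost_le_limit\<close> wants a bound for all terms; hence the tail.\<close>
    have "cost \<mu> g (X (r (n + K)) T) \<le> c" for n
      using cd[of "r (n + K)"] K[of "r (n + K)"] seq_suble[OF r, of "n + K"] by (meson le_add2 le_trans less_imp_le less_le_trans)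
    with XT xT show "cost \<mu> g (x T) \<le> c"
      by (intro cost_le_limit[where \<phi> = "\<lambda>n. X (r (n + K)) T", OF g _ xT LIMSEQ_ignore_initial_segment[OF lim, of K]]) auto
  qed
  with x show ?thesis by blast
qed

context
  fixes g :: "real^'n \<Rightarrow> 'w \<Rightarrow> real"
  assumes conv: "convexity_hyp \<mu> T U f" and alt: "measure_modulus_hyp \<mu> T U f \<or> compact_range_hyp \<mu> T U f"
    and g: "cost_hyp \<mu> g"
begin

abbreviation "V \<equiv> value_function \<mu> T U f g"

text \<open>Constant sequences in \<open>value_limit\<close>, with levels tending to the value from
  above. An infinite value leaves no room for such levels, but then every solution is optimal, and
  one exists.\<close>

lemma value_attained:
  assumes s: "s \<in> {0..T}" and \<phi>: "\<phi> \<in> L2 \<mu>"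
  shows "\<exists>x\<in>inclusion_solutions \<mu> U f s T \<phi>. V s \<phi> = cost \<mu> g (x T)"
proof (cases "V s \<phi> = \<infinity>")
  case True
  obtain u where u: "u \<in> borel_measurable N" "\<forall>t\<in>{0..T}. u t \<in> U t" using admissible_exists by blast
  have ua: "u \<in> admissible_controls U 0 T" using u by (intro admissibleI) (auto intro!: AE_I2)
  from trajectory_exists[OF u(1) s \<phi>] obtain X where X: "trajectory s \<phi> u X" by (rule exE)
  have "X s = \<phi>" using trajectory_initial[OF X] by (simp add: fun_eq_iff)
  then have x: "X \<in> inclusion_solutions \<mu> U f s T \<phi>" using trajectory_inclusion[OF X ua s] by simp
  have "cost \<mu> g (X T) = V s \<phi>" using value_le[OF s \<phi> x, of g] True by simp
  then show ?thesis by (intro bexI[OF _ x]) simp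
next
  case False
  then have "V s \<phi> < \<infinity>" by simp
  from approx_from_above_dense_linorder[OF this] obtain d where d: "\<And>n. V s \<phi> < d n" "d \<longlonglongrightarrow> V s \<phi>" by blast
  from value_limit[OF conv alt g s tendsto_const \<phi> \<phi> _ d] obtain x where x: "x \<in> inclusion_solutions \<mu> U f s T \<phi>" "cost \<mu> g (x T) \<le> V s \<phi>"
    by auto
  then show ?thesis using value_le[OF s \<phi> x(1), of g] by (intro bexI[OF _ x(1)]) simp
qed

text \<open>Otherwise some sequence of pairs approaches \<open>(s', \<phi>')\<close> with values at
  most \<open>a\<close>. Levels tending to \<open>a\<close> from above then yield a solution from
  the limit point with cost at most \<open>a\<close>, which bounds its value.\<close>

lemma value_lower_bound_near:
  assumes s': "s' \<in> {0..T}" and \<phi>': "\<phi>' \<in> L2 \<mu>" and a: "a < V s' \<phi>'"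
  shows "\<exists>e>0. \<forall>s\<in>{0..T}. \<forall>\<phi>\<in>L2 \<mu>. \<bar>s - s'\<bar> < e \<longrightarrow> L2dist \<mu> \<phi> \<phi>' < e \<longrightarrow> a < V s \<phi>"
proof (rule ccontr)
  assume neg: "\<not> ?thesis"
  have "\<forall>n::nat. \<exists>p. fst p \<in> {0..T} \<and> snd p \<in> L2 \<mu> \<and> \<bar>fst p - s'\<bar> < 1 / real (Suc n) \<and>
      L2dist \<mu> (snd p) \<phi>' < 1 / real (Suc n) \<and> \<not> a < V (fst p) (snd p)"
  proof
    fix n :: nat
    have "(0::real) < 1 / real (Suc n)" by simp
    with neg obtain s \<phi> where "s \<in> {0..T}" "\<phi> \<in> L2 \<mu>" "\<bar>s - s'\<bar> < 1 / real (Suc n)" "L2dist \<mu> \<phi> \<phi>' < 1 / real (Suc n)" "\<not> a < V s \<phi>"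
      by blast
    then show "\<exists>p. fst p \<in> {0..T} \<and> snd p \<in> L2 \<mu> \<and> \<bar>fst p - s'\<bar> < 1 / real (Suc n) \<and>
      L2dist \<mu> (snd p) \<phi>' < 1 / real (Suc n) \<and> \<not> a < V (fst p) (snd p)" by (intro exI[of _ "(s, \<phi>)"]) simp
  qed
  from choice[OF this] obtain p where p: "\<forall>n::nat. fst (p n) \<in> {0..T} \<and> snd (p n) \<in> L2 \<mu> \<and> \<bar>fst (p n) - s'\<bar> < 1 / real (Suc n) \<and>
      L2dist \<mu> (snd (p n)) \<phi>' < 1 / real (Suc n) \<and> \<not> a < V (fst (p n)) (snd (p n))" by (rule exE)
  have z: "(\<lambda>n. 1 / real (Suc n)) \<longlonglongrightarrow> 0" using LIMSEQ_inverse_real_of_nat by (simp add: inverse_eq_divide)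
  have s: "fst (p n) \<in> {0..T}" and \<phi>: "snd (p n) \<in> L2 \<mu>" for n using p by simp_all
  have "(\<lambda>n. fst (p n) - s') \<longlonglongrightarrow> 0"
    by (rule Lim_null_comparison[OF _ z]) (use p in \<open>auto intro!: always_eventually less_imp_le\<close>)
  then have sl: "(\<lambda>n. fst (p n)) \<longlonglongrightarrow> s'" by (simp only: LIM_zero_iff)
  have \<phi>l: "(\<lambda>n. L2dist \<mu> (snd (p n)) \<phi>') \<longlonglongrightarrow> 0"
    by (rule Lim_null_comparison[OF _ z]) (use p in \<open>auto intro!: always_eventually less_imp_le\<close>)
  from approx_from_above_dense_linorder[OF a] obtain d where d: "\<And>n. a < d n" "d \<longlonglongrightarrow> a" by blast
  have "V (fst (p n)) (snd (p n)) < d n" for n using p d(1)[of n] by (meson not_less le_less_trans)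
  from value_limit[OF conv alt g s sl \<phi> \<phi>' \<phi>l this d(2)] obtain x where x: "x \<in> inclusion_solutions \<mu> U f s' T \<phi>'" "cost \<mu> g (x T) \<le> a"
    by blast
  then show False using value_le[OF s' \<phi>' x(1), of g] a by simp
qed

theorem value_lower_semicontinuous:
  "lower_semicontinuous (prod_topology (top_of_set {0..T}) (L2_topology \<mu>)) (\<lambda>(s, \<phi>). V s \<phi>)"
  unfolding lower_semicontinuous_def openin_prod_topology_alt
proof (intro allI impI)
  fix a s' \<phi>'
  assume "(s', \<phi>') \<in> {z \<in> topspace (prod_topology (top_of_set {0..T}) (L2_topology \<mu>)). a < (case z of (s, \<phi>) \<Rightarrow> V s \<phi>)}"
  then have s': "s' \<in> {0..T}" and \<phi>': "\<phi>' \<in> L2 \<mu>" and "a < V s' \<phi>'" by auto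
  from value_lower_bound_near[OF this] obtain e where e: "e > 0"
    "\<forall>s\<in>{0..T}. \<forall>\<phi>\<in>L2 \<mu>. \<bar>s - s'\<bar> < e \<longrightarrow> L2dist \<mu> \<phi> \<phi>' < e \<longrightarrow> a < V s \<phi>" by (elim exE conjE)
  show "\<exists>A B. openin (top_of_set {0..T}) A \<and> openin (L2_topology \<mu>) B \<and> s' \<in> A \<and> \<phi>' \<in> B \<and>
      A \<times> B \<subseteq> {z \<in> topspace (prod_topology (top_of_set {0..T}) (L2_topology \<mu>)). a < (case z of (s, \<phi>) \<Rightarrow> V s \<phi>)}"
  proof (intro exI conjI)
    show "openin (top_of_set {0..T}) ({0..T} \<inter> ball s' e)" by (rule openin_open_Int) simp
    show "openin (L2_topology \<mu>) {\<phi> \<in> L2 \<mu>. L2dist \<mu> \<phi> \<phi>' < e}" by (rule openin_L2_ball[OF \<phi>'])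
    show "s' \<in> {0..T} \<inter> ball s' e" "\<phi>' \<in> {\<phi> \<in> L2 \<mu>. L2dist \<mu> \<phi> \<phi>' < e}" using s' \<phi>' e(1) by simp_all
    show "({0..T} \<inter> ball s' e) \<times> {\<phi> \<in> L2 \<mu>. L2dist \<mu> \<phi> \<phi>' < e}
      \<subseteq> {z \<in> topspace (prod_topology (top_of_set {0..T}) (L2_topology \<mu>)). a < (case z of (s, \<phi>) \<Rightarrow> V s \<phi>)}"
      using e(2) by (auto simp: dist_real_def abs_minus_commute)
  qed
qed

text \<open>Lower semicontinuity gives one inequality; the other is obtained along a solution \<open>x\<close> ending or starting at
  \<open>\<phi>'\<close>, on which the value function does not exceed its value at \<open>(s', \<phi>')\<close>.\<close>

lemma value_Liminf:
  assumes s': "s' \<in> {0..T}" and \<phi>': "\<phi>' \<in> L2 \<mu>" and G: "G \<noteq> bot" "G \<le> nhds s'" "eventually (\<lambda>s. s \<in> {0..T}) G"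
    and x: "\<And>s. s \<in> {0..T} \<Longrightarrow> x s \<in> L2 \<mu>" "\<And>s. s \<in> {0..T} \<Longrightarrow> V s (x s) \<le> V s' \<phi>'"
    and lim: "((\<lambda>s. L2dist \<mu> (x s) \<phi>') \<longlongrightarrow> 0) G"
  shows "V s' \<phi>' = Liminf (G \<times>\<^sub>F nhdsin (L2_topology \<mu>) \<phi>') (\<lambda>(s, \<phi>). V s \<phi>)"
proof (rule antisym)
  show "V s' \<phi>' \<le> Liminf (G \<times>\<^sub>F nhdsin (L2_topology \<mu>) \<phi>') (\<lambda>(s, \<phi>). V s \<phi>)"
    unfolding le_Liminf_iff
  proof (intro allI impI)
    fix a assume "a < V s' \<phi>'"
    from value_lower_bound_near[OF s' \<phi>' this] obtain e where e: "e > 0"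
      "\<forall>s\<in>{0..T}. \<forall>\<phi>\<in>L2 \<mu>. \<bar>s - s'\<bar> < e \<longrightarrow> L2dist \<mu> \<phi> \<phi>' < e \<longrightarrow> a < V s \<phi>" by (elim exE conjE)
    have 1: "eventually (\<lambda>s. s \<in> {0..T} \<and> \<bar>s - s'\<bar> < e) G"
    proof (rule eventually_conj[OF G(3)])
      have "eventually (\<lambda>s. dist s s' < e) (nhds s')" using e(1) unfolding eventually_nhds_metric by blast
      then show "eventually (\<lambda>s. \<bar>s - s'\<bar> < e) G" using G(2) unfolding dist_real_def by (rule filter_leD[rotated])
    qed
    have 2: "eventually (\<lambda>\<phi>. \<phi> \<in> L2 \<mu> \<and> L2dist \<mu> \<phi> \<phi>' < e) (nhdsin (L2_topology \<mu>) \<phi>')"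
      unfolding eventually_nhdsin_L2[OF \<phi>'] using e(1) by blast
    show "\<forall>\<^sub>F z in G \<times>\<^sub>F nhdsin (L2_topology \<mu>) \<phi>'. a < (case z of (s, \<phi>) \<Rightarrow> V s \<phi>)"
      unfolding eventually_prod_filter by (intro exI conjI allI impI, rule 1, rule 2) (use e(2) in simp)
  qed
  show "Liminf (G \<times>\<^sub>F nhdsin (L2_topology \<mu>) \<phi>') (\<lambda>(s, \<phi>). V s \<phi>) \<le> V s' \<phi>'"
  proof (rule ccontr)
    assume "\<not> ?thesis"
    then have "V s' \<phi>' < Liminf (G \<times>\<^sub>F nhdsin (L2_topology \<mu>) \<phi>') (\<lambda>(s, \<phi>). V s \<phi>)" by simp
    \<comment> \<open>If the limit inferior were larger, \<open>V\<close> would exceed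
      \<open>V s' \<phi>'\<close> on a product neighbourhood, and \<open>(s, x s)\<close> lies in it
      eventually.\<close>
    from less_LiminfD[OF this] obtain P Q where P: "eventually P G" and Q: "eventually Q (nhdsin (L2_topology \<mu>) \<phi>')"
      and PQ: "\<forall>s \<phi>. P s \<longrightarrow> Q \<phi> \<longrightarrow> V s' \<phi>' < V s \<phi>" unfolding eventually_prod_filter by (auto simp del: not_less)
    from Q obtain e where e: "e > 0" "\<forall>\<psi>\<in>L2 \<mu>. L2dist \<mu> \<psi> \<phi>' < e \<longrightarrow> Q \<psi>"
      unfolding eventually_nhdsin_L2[OF \<phi>'] by blast
    have "eventually (\<lambda>s. False) G"
      using P G(3) order_tendstoD(2)[OF lim e(1)]
    proof eventually_elim
      case (elim s)
      then have "V s' \<phi>' < V s (x s)" using PQ e(2) x(1) by blast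
      then show ?case using x(2)[OF elim(2)] by simp
    qed
    then show False using G(1) by simp
  qed
qed

text \<open>On the degenerate interval a solution is determined by its initial value up to a null
  set, so attainment evaluates the infimum.\<close>

lemma value_terminal:
  assumes "\<phi> \<in> L2 \<mu>"
  shows "V T \<phi> = cost \<mu> g \<phi>"
proof -
  have T: "T \<in> {0..T}" using T_pos by simp
  from value_attained[OF T assms] obtain x where x: "x \<in> inclusion_solutions \<mu> U f T T \<phi>" "V T \<phi> = cost \<mu> g (x T)" by blast
  have "AE w in \<mu>. x T w = \<phi> w" using x(1) by (simp add: inclusion_solutions_def)
  from cost_cong_AE[OF this] x(2) show ?thesis by simp
qed

text \<open>The curve fed into \<open>value_Liminf\<close> is a trajectory with initial time
  \<open>T\<close>, run backward under an arbitrary measurable selection of \<open>U\<close>. It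
  equals \<open>\<phi>'\<close> at \<open>T\<close>, so its final cost is that of
  \<open>\<phi>'\<close>.\<close>

theorem cost_eq_Liminf_value:
  assumes \<phi>': "\<phi>' \<in> L2 \<mu>"
  shows "cost \<mu> g \<phi>' = Liminf (at_left T \<times>\<^sub>F nhdsin (L2_topology \<mu>) \<phi>') (\<lambda>(s, \<phi>). V s \<phi>)"
proof -
  have T: "T \<in> {0..T}" using T_pos by simp
  obtain u where u: "u \<in> borel_measurable N" "\<forall>t\<in>{0..T}. u t \<in> U t" using admissible_exists by blast
  have ua: "u \<in> admissible_controls U 0 T" using u by (intro admissibleI) (auto intro!: AE_I2)
  from trajectory_exists[OF u(1) T \<phi>'] obtain X where X: "trajectory T \<phi>' u X" by (rule exE)
  note P = trajectory_primitive_curve[OF X]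
  have XT: "X T = \<phi>'" using trajectory_initial[OF X] by (simp add: fun_eq_iff)
  have "V T \<phi>' = Liminf (at_left T \<times>\<^sub>F nhdsin (L2_topology \<mu>) \<phi>') (\<lambda>(s, \<phi>). V s \<phi>)"
  proof (rule value_Liminf[OF T \<phi>', where x = X])
    show "X s \<in> L2 \<mu>" if "s \<in> {0..T}" for s by (rule primitive_curve_L2[OF finite_\<mu> P that])
    show "V s (X s) \<le> V T \<phi>'" if s: "s \<in> {0..T}" for s
      using value_le[OF s primitive_curve_L2[OF finite_\<mu> P s] trajectory_inclusion[OF X ua s], of g] value_terminal[OF \<phi>'] XT by simp
    show ev: "eventually (\<lambda>s. s \<in> {0..T}) (at_left T)"
      using T_pos unfolding eventually_at_left_field by (intro exI[of _ 0]) auto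
    show "((\<lambda>s. L2dist \<mu> (X s) \<phi>') \<longlongrightarrow> 0) (at_left T)"
    proof (rule Lim_null_comparison)
      show "\<forall>\<^sub>F s in at_left T. norm (L2dist \<mu> (X s) \<phi>') \<le> L2norm \<mu> (velocity_bound \<phi>') * \<bar>s - T\<bar>"
        using ev
      proof eventually_elim
        case (elim s)
        then show ?case using primitive_curve_Lipschitz[OF finite_\<mu> P elim T] XT by simp
      qed
      show "((\<lambda>s. L2norm \<mu> (velocity_bound \<phi>') * \<bar>s - T\<bar>) \<longlongrightarrow> 0) (at_left T)"
        by (rule tendsto_eq_intros | simp)+
    qed
  qed (simp_all add: at_within_le_nhds)
  then show ?thesis using value_terminal[OF \<phi>'] by simp
qed

theorem value_eq_Liminf_value:
  assumes \<phi>': "\<phi>' \<in> L2 \<mu>"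
  shows "V 0 \<phi>' = Liminf (at_right 0 \<times>\<^sub>F nhdsin (L2_topology \<mu>) \<phi>') (\<lambda>(s, \<phi>). V s \<phi>)"
proof -
  have z: "0 \<in> {0..T}" using T_pos by simp
  from value_attained[OF z \<phi>'] obtain x where x: "x \<in> inclusion_solutions \<mu> U f 0 T \<phi>'" "V 0 \<phi>' = cost \<mu> g (x T)" by blast
  have c: "continuous_L2_curve \<mu> 0 T x" and x0: "AE w in \<mu>. x 0 w = \<phi>' w" using x(1) by (simp_all add: inclusion_solutions_def)
  have xL: "x s \<in> L2 \<mu>" if "s \<in> {0..T}" for s using c that by (simp add: continuous_L2_curve_iff)
  show ?thesis
  proof (rule value_Liminf[OF z \<phi>' _ _ _ xL])
    show "V s (x s) \<le> V 0 \<phi>'" if s: "s \<in> {0..T}" for s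
      using value_le[OF s xL[OF s] inclusion_solutions_restrict[OF x(1)], of g] x(2) s by simp
    show ev: "eventually (\<lambda>s. s \<in> {0..T}) (at_right 0)"
      using T_pos unfolding eventually_at_right_field by (intro exI[of _ T]) auto
    show "((\<lambda>s. L2dist \<mu> (x s) \<phi>') \<longlongrightarrow> 0) (at_right 0)"
    proof (rule tendstoI)
      fix e :: real assume "0 < e"
      then obtain d where d: "d > 0" "\<forall>r\<in>{0..T}. \<bar>r - 0\<bar> < d \<longrightarrow> L2dist \<mu> (x r) (x 0) < e"
        using c z unfolding continuous_L2_curve_iff by blast
      have "eventually (\<lambda>s. \<bar>s\<bar> < d) (at_right 0)" using d(1) unfolding eventually_at_right_field by (intro exI[of _ d]) auto
      with ev show "\<forall>\<^sub>F s in at_right 0. dist (L2dist \<mu> (x s) \<phi>') 0 < e"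
      proof eventually_elim
        case (elim s)
        \<comment> \<open>A solution of the inclusion meets its initial value only up to a null set,
          whereas its continuity refers to \<open>x 0\<close>.\<close>
        have "L2dist \<mu> (x s) \<phi>' = L2dist \<mu> (x s) (x 0)"
          using x0 by (intro L2norm_cong_AE L2_measurable L2_diff xL[OF elim(1)] xL[OF z] \<phi>') (auto elim: eventually_mono)
        then show ?case using d(2) elim by simp
      qed
    qed
  qed (simp_all add: at_within_le_nhds)
qed

end

end

theorem theorem3p8:
  fixes T :: real
    and \<mu> :: "'w::metric_space measure"
    and U :: "real \<Rightarrow> (real^'m) set"
    and f :: "real \<Rightarrow> real^'n \<Rightarrow> real^'m \<Rightarrow> 'w \<Rightarrow> real^'n"
    and g :: "real^'n \<Rightarrow> 'w \<Rightarrow> real"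
  assumes "0 < T"
    and "compact (UNIV :: 'w set)"
    and "finite_radon_measure \<mu>"
    and "control_map_hyp T U"
    and "dynamics_hyp T f"
    and "cost_hyp \<mu> g"
    and "convexity_hyp \<mu> T U f"
    and "measure_modulus_hyp \<mu> T U f \<or> compact_range_hyp \<mu> T U f"
  shows "lower_semicontinuous (prod_topology (top_of_set {0..T}) (L2_topology \<mu>))
           (\<lambda>(s, \<phi>). value_function \<mu> T U f g s \<phi>) \<and>
         (\<forall>s\<in>{0..T}. \<forall>\<phi>\<in>L2 \<mu>.
           (\<exists>x\<in>inclusion_solutions \<mu> U f s T \<phi>. value_function \<mu> T U f g s \<phi> = cost \<mu> g (x T)) \<and>
           (\<forall>x\<in>inclusion_solutions \<mu> U f s T \<phi>. value_function \<mu> T U f g s \<phi> \<le> cost \<mu> g (x T))) \<and>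
         (\<forall>\<phi>'\<in>L2 \<mu>.
           cost \<mu> g \<phi>' = Liminf (at_left T \<times>\<^sub>F nhdsin (L2_topology \<mu>) \<phi>')
             (\<lambda>(s, \<phi>). value_function \<mu> T U f g s \<phi>) \<and>
           value_function \<mu> T U f g 0 \<phi>' = Liminf (at_right 0 \<times>\<^sub>F nhdsin (L2_topology \<mu>) \<phi>')
             (\<lambda>(s, \<phi>). value_function \<mu> T U f g s \<phi>))"
proof -
  note alt = assms(8)
  \<comment> \<open>The common null set and the constants become parameters of the locale, in which
    \<open>F\<close> takes the place of \<open>f\<close>.\<close>
  from dynamics_hyp_null_set[OF assms(2,5)] obtain Z c k where Z: "negligible Z" "0 < c" "0 < k"
    and bounds: "\<forall>t\<in>{0..T} - Z. \<forall>x x' u \<omega>. norm (f t x u \<omega>) \<le> c * (1 + norm x) \<and>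
      norm (f t x u \<omega> - f t x' u \<omega>) \<le> k * norm (x - x')" by (elim exE conjE)
  interpret control_problem T \<mu> U f Z c k
    using assms(1-5) Z bounds by unfold_locales blast+
  show ?thesis
    using value_lower_semicontinuous[OF assms(7) alt assms(6)] value_attained[OF assms(7) alt assms(6)] value_le
      cost_eq_Liminf_value[OF assms(7) alt assms(6)] value_eq_Liminf_value[OF assms(7) alt assms(6)]
    by (intro conjI ballI)
qed


end
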